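(* Let $0<\alpha\le 1$, $1<\alpha+\beta\le 2$, $c>0$, $D>0$, and let $\eta$, $F$, $G$, $Z_{lm}$, $H$ be as described in the context. Assume that for every $t\ge 0$ $$\int_0^{\infty}\mu^{2}\,|H(\mu,t)|^{2}\,G(d\mu)<\infty.$$ Then the spherical fractional hyperbolic diffusion random field $$T_H(x,t)=\sum_{l=0}^{\infty}\sum_{m=-l}^{l}Y_{lm}(\theta,\varphi)\,a_{lm}^{H}(t),\qquad a_{lm}^{H}(t)=\pi\sqrt{2}\int_0^{\infty}\frac{J_{l+1/2}(\mu)}{\mu^{1/2}}H(\mu,t)\,Z_{lm}(d\mu),$$ where $x\in\mathbf{S}^2$ has spherical angles $(\theta,\varphi)$ and $t\ge 0$, is an isotropic random field on $\mathbf{S}^2$ with angular power spectrum $$C_l(t,t')=\mathrm{E}\,a_{lm}^{H}(t)\overline{a_{lm}^{H}(t')}=2\pi^{2}\int_0^{\infty}\frac{J_{l+1/2}^{2}(\mu)}{\mu}H(\mu,t)H(\mu,t')\,G(d\mu),\qquad l=0,1,2,\ldots,$$ where $$H(\mu,t)=1+\sum_{n=0}^{\infty}\left(-\mu^{2}c^{2}t^{\alpha+\beta}\right)^{n+1}\mathrm{E}_{\beta,(\alpha+\beta)(n+1)+1}^{\,n+1}\left(-\frac{c^{2}}{D}t^{\beta}\right)$$ $$=1-\mu^{2}c^{2}t^{\alpha+\beta}\sum_{m=0}^{\infty}\sum_{n=0}^{\infty}\binom{m}{n}\frac{\left(-\frac{c^{2}}{D}t^{\beta}\right)^{m}(\mu^{2}Dt^{\alpha})^{n}}{\Gamma(\beta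 m+\alpha n+\alpha+\beta+1)}.$$
   Context: The equation: $$\frac{1}{c^{2}}\frac{\partial^{\alpha+\beta}}{\partial t^{\alpha+\beta}}q(x,t)+\frac{1}{D}\frac{\partial^{\alpha}}{\partial t^{\alpha}}q(x,t)=\Delta q(x,t),\quad x\in\mathbb{R}^3,$$ where $\Delta$ is the Laplacian in $x$ and, for $n-1<\gamma<n$, $n\in\mathbb{N}$, $\frac{\partial^{\gamma}}{\partial t^{\gamma}}q(x,t)=\frac{1}{\Gamma(n-\gamma)}\int_0^t\frac{q^{(n)}(x,\tau)}{(t-\tau)^{\gamma+1-n}}d\tau$ is the Caputo derivative ($q^{(n)}$ is the $n$-th time derivative; for integer $\gamma$ it is the ordinary derivative). The function $H$: $Q(x,t)$ is the fundamental solution of this equation, with $q(x,0)=\delta(x)$ and $\frac{\partial}{\partial t}q(x,t)|_{t=0}=0$ (in general in the sense of distributions in $x$); $H(\kappa,t)=\int_{\mathbb{R}^3}e^{\mathrm{i}\langle\kappa,x\rangle}Q(x,t)dx$. It is radial in $\kappa$ and one writes $H(\mu,t)$ with $\mu=\|\kappa\|$. The initial field: $\eta(x)$, $x\in\mathbb{R}^3$, is a measurable, mean-square continuous, wide-sense homogeneous and isotropic zero-mean random field on a complete probability space, with covariance $$B(\|x-y\|)=\int_{\mathbb{R}^3}\cos(\langle\lambda,x-y\rangle)F(d\lambda)=\int_0^{\infty}\frac{\sin(\mu\|x-y\|)}{\mu\|x-y\|}G(d\mu),$$ for bounded non-negative measures $F$ on $\mathbb{R}^3$, $G$ on $[0,\infty)$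 with $G([0,\mu))=F(\{\|\lambda\|<\mu\})$. In spherical coordinates $(r,\theta,\varphi)$ of $x$, $$\eta(x)=\pi\sqrt{2}\sum_{l=0}^{\infty}\sum_{m=-l}^{l}Y_{lm}(\theta,\varphi)\int_0^{\infty}\frac{J_{l+1/2}(\mu r)}{(\mu r)^{1/2}}Z_{lm}(d\mu),$$ where $Z_{lm}$ are complex-valued random measures on $[0,\infty)$ with $\mathrm{E}[Z_{lm}(A_1)\overline{Z_{l'm'}(A_2)}]=\delta_{ll'}\delta_{mm'}G(A_1\cap A_2)$ for Borel $A_1,A_2$. Stochastic integrals are $L_2(\Omega)$ integrals with structural measure $G$, and the series converge in mean square. $T_H$ is the restriction to the unit sphere $\mathbf{S}^2=\{x\in\mathbb{R}^3:\|x\|=1\}$ of the homogeneous and isotropic (in $x$) field $$q(r,\theta,\varphi,t)=\pi\sqrt2\sum_{l=0}^{\infty}\sum_{m=-l}^{l}Y_{lm}(\theta,\varphi)\int_0^\infty\frac{J_{l+1/2}(\mu r)}{(\mu r)^{1/2}}H(\mu,t)Z_{lm}(d\mu),$$ which is the solution of the equation with random initial conditions $q(x,0)=\eta(x)$, $\frac{\partial}{\partial t}q(x,t)|_{t=0}=0$. Special functions: $Y_{lm}(\theta,\varphi)=(-1)^m\left[\frac{(2l+1)(l-m)!}{4\pi(l+m)!}\right]^{1/2}e^{\mathrm{i}m\varphi}P_l^m(\cos\theta)$ are the complex spherical harmonics ($P_l^m$ associated Legendre polynomials; the $Y_{lm}$ are orthonormal in $L_2(\mathbf{S}^2)$); $J_\nu$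 is the Bessel function of the first kind; $\mathrm{E}_{a,b}^{\zeta}(z)=\sum_{k=0}^{\infty}\frac{(\zeta)_kz^k}{k!\,\Gamma(ak+b)}$ with $(\zeta)_k=\Gamma(\zeta+k)/\Gamma(\zeta)$; $\binom{m}{n}=0$ for $n>m$, so that for each $m$ the inner sum (over $n$) is finite. Isotropy and angular power spectrum: a zero-mean, finite-variance, mean-square continuous real-valued field $T(x,t)$ on $\mathbf{S}^2\times[0,\infty)$ is (second-order) isotropic if $\mathrm{E}[T(x,t)T(y,t')]=\mathrm{E}[T(\mathbf{g}x,t)T(\mathbf{g}y,t')]$ for all $\mathbf{g}\in SO(3)$, $x,y\in\mathbf{S}^2$ and $t,t'\ge 0$. Its Laplace series coefficients $g_{lm}(t)=\int_0^{\pi}\int_0^{2\pi}T(\theta,\varphi,t)\overline{Y_{lm}(\theta,\varphi)}\sin\theta\,d\varphi\,d\theta$ satisfy $\mathrm{E}\,g_{lm}(t)\overline{g_{l'm'}(t')}=\delta_{ll'}\delta_{mm'}C_l(t,t')$, and $\{C_l(t,t'),\ l=0,1,2,\ldots\}$ is called the angular (time-dependent) power spectrum of $T$. *)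

theory Defs
  imports "HOL-Probability.Probability"
begin

text \<open>
  The functions of time live on \<open>[0,\<infinity>)\<close>, so the derivative at \<open>0\<close> is one-sided.
\<close>

definition tderiv :: "(real \<Rightarrow> complex) \<Rightarrow> real \<Rightarrow> complex" where
  "tderiv u t = vector_derivative u (at t within {0..})"

definition caputo :: "real \<Rightarrow> (real \<Rightarrow> complex) \<Rightarrow> real \<Rightarrow> complex" where
  "caputo \<gamma> u t =
     (let n = nat \<lceil>\<gamma>\<rceil> in
      if \<gamma> = real n then (tderiv ^^ n) u t
      else of_real (1 / Gamma (real n - \<gamma>)) *
           (LINT \<tau>:{0<..<t}|lborel.
              (tderiv ^^ n) u \<tau> / of_real ((t - \<tau>) powr (\<gamma> + 1 - real n))))"

text \<open>
  Regularity under which Caputo derivatives of all orders \<open>\<gamma> \<le> n\<close> make sense at every \<open>t > 0\<close>: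
  \<open>u\<close> is \<open>n - 1\<close> times continuously differentiable on \<open>[0,\<infinity>)\<close>, and its \<open>n\<close>-th derivative
  is continuous on \<open>(0,\<infinity>)\<close> and integrable at \<open>0\<close>.  Nothing more can be asked at \<open>0\<close>: the second
  derivative of a solution behaves there like \<open>t powr (\<alpha> + \<beta> - 2)\<close>.
\<close>

definition caputo_regular :: "nat \<Rightarrow> (real \<Rightarrow> complex) \<Rightarrow> bool" where
  "caputo_regular n u \<longleftrightarrow>
     (\<forall>k<n. continuous_on {0..} ((tderiv ^^ k) u)) \<and>
     (\<forall>k. Suc k < n \<longrightarrow> (tderiv ^^ k) u differentiable_on {0..}) \<and>
     (\<forall>k<n. (tderiv ^^ k) u differentiable_on {0<..}) \<and>
     continuous_on {0<..} ((tderiv ^^ n) u) \<and>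
     (\<forall>T>0. set_integrable lborel {0<..<T} ((tderiv ^^ n) u))"

definition partial_deriv :: "3 \<Rightarrow> (real^3 \<Rightarrow> complex) \<Rightarrow> real^3 \<Rightarrow> complex" where
  "partial_deriv i f x = frechet_derivative f (at x) (axis i 1)"

definition laplacian :: "(real^3 \<Rightarrow> complex) \<Rightarrow> real^3 \<Rightarrow> complex" where
  "laplacian f x = (\<Sum>i\<in>UNIV. partial_deriv i (partial_deriv i f) x)"

abbreviation multi_deriv :: "3 list \<Rightarrow> (real^3 \<Rightarrow> complex) \<Rightarrow> real^3 \<Rightarrow> complex" where
  "multi_deriv is f \<equiv> foldr partial_deriv is f"

text \<open>
  The Fourier transform \<open>\<integral> exp (\<i> \<langle>\<kappa>, x\<rangle>) Q(x) dx\<close> of a distribution \<open>Q\<close> is the value of \<open>Q\<close> at the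
  exponential, which is not compactly supported.  The distributions for which this is meaningful
  for every \<open>\<kappa>\<close> are Schwartz's integrable distributions.  They act on the smooth functions all of
  whose derivatives are bounded, and are continuous for sequences that have uniformly bounded
  derivatives and converge to \<open>0\<close> locally uniformly together with all derivatives.  This continuity
  makes them determined by their values on compactly supported test functions.
\<close>

definition bounded_smooth :: "(real^3 \<Rightarrow> complex) set" where
  "bounded_smooth =
     {\<phi>. \<forall>is. multi_deriv is \<phi> differentiable_on UNIV \<and> bounded (range (multi_deriv is \<phi>))}"

definition test_null_seq :: "(nat \<Rightarrow> real^3 \<Rightarrow> complex) \<Rightarrow> bool" where
  "test_null_seq \<phi> \<longleftrightarrow>
     (\<forall>n. \<phi> n \<in> bounded_smooth) \<and>
     (\<forall>is. (\<exists>C. \<forall>n x. norm (multi_deriv is (\<phi> n) x) \<le> C) \<and>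
           (\<forall>K. compact K \<longrightarrow>
              uniform_limit K (\<lambda>n. multi_deriv is (\<phi> n)) (\<lambda>_. 0) sequentially))"

definition integrable_distribution :: "((real^3 \<Rightarrow> complex) \<Rightarrow> complex) \<Rightarrow> bool" where
  "integrable_distribution T \<longleftrightarrow>
     (\<forall>\<phi>\<in>bounded_smooth. \<forall>\<psi>\<in>bounded_smooth. T (\<lambda>x. \<phi> x + \<psi> x) = T \<phi> + T \<psi>) \<and>
     (\<forall>\<phi>\<in>bounded_smooth. \<forall>a. T (\<lambda>x. a * \<phi> x) = a * T \<phi>) \<and>
     (\<forall>\<phi>. test_null_seq \<phi> \<longrightarrow> (\<lambda>n. T (\<phi> n)) \<longlonglongrightarrow> 0)"

definition fourier_distribution ::
    "((real^3 \<Rightarrow> complex) \<Rightarrow> complex) \<Rightarrow> real^3 \<Rightarrow> complex" where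
  "fourier_distribution T \<kappa> = T (\<lambda>x. exp (\<i> * of_real (\<kappa> \<bullet> x)))"

text \<open>
  \<open>Q t \<phi>\<close> is the value \<open>\<integral> Q(x,t) \<phi>(x) dx\<close> of the distribution \<open>Q(\<cdot>,t)\<close> at the test function \<open>\<phi>\<close>.
  The time derivatives are taken weakly in \<open>x\<close>, for each \<open>\<phi>\<close>, and the Laplacian is moved to \<open>\<phi>\<close>.
  As \<open>1 < \<alpha> + \<beta> \<le> 2\<close>, the highest time derivative that occurs is the second one.
\<close>

definition fundamental_solution ::
    "real \<Rightarrow> real \<Rightarrow> real \<Rightarrow> real \<Rightarrow> (real \<Rightarrow> (real^3 \<Rightarrow> complex) \<Rightarrow> complex) \<Rightarrow> bool" where
  "fundamental_solution \<alpha> \<beta> c D Q \<longleftrightarrow>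
     (\<forall>t\<ge>0. integrable_distribution (Q t)) \<and>
     (\<forall>\<phi>\<in>bounded_smooth.
        caputo_regular 2 (\<lambda>t. Q t \<phi>) \<and>
        (\<forall>t>0. of_real (1 / c\<^sup>2) * caputo (\<alpha> + \<beta>) (\<lambda>t. Q t \<phi>) t
             + of_real (1 / D) * caputo \<alpha> (\<lambda>t. Q t \<phi>) t
             = Q t (laplacian \<phi>)) \<and>
        Q 0 \<phi> = \<phi> 0 \<and>
        tderiv (\<lambda>t. Q t \<phi>) 0 = 0)"

text \<open>Meant for \<open>z > 0\<close>; see \<open>bessel_quot\<close> for the value at \<open>0\<close>.\<close>

definition bessel_J :: "real \<Rightarrow> real \<Rightarrow> real" where
  "bessel_J \<nu> z =
     (\<Sum>k. (-1) ^ k / (fact k * Gamma (\<nu> + real k + 1)) * (z / 2) powr (2 * real k + \<nu>))"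

text \<open>
  The quotient \<open>J\<^bsub>l+1/2\<^esub>(z) / z\<^sup>1\<^sup>/\<^sup>2\<close>, extended continuously to \<open>z = 0\<close>.  The value at \<open>0\<close>
  (non-zero for \<open>l = 0\<close>) matters at the origin and when the spectral measure has an atom at \<open>0\<close>.
\<close>

definition bessel_quot :: "nat \<Rightarrow> real \<Rightarrow> real" where
  "bessel_quot l z =
     (if z = 0 then Lim (at_right 0) (\<lambda>w. bessel_J (real l + 1 / 2) w / sqrt w)
      else bessel_J (real l + 1 / 2) z / sqrt z)"

text \<open>
  Associated Legendre functions by Rodrigues' formula, for \<open>-l \<le> m \<le> l\<close> and \<open>-1 \<le> x \<le> 1\<close>, without
  the factor \<open>(-1)\<^sup>m\<close>, which is part of \<open>sph_harm\<close>.  In the integer power, \<open>0 powi 0 = 1\<close>, and for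
  \<open>m < 0\<close> it gives the correct value \<open>0\<close> at \<open>x = \<plusminus>1\<close>, because \<open>0 powi m = 0\<close>.
\<close>

definition assoc_legendre :: "nat \<Rightarrow> int \<Rightarrow> real \<Rightarrow> real" where
  "assoc_legendre l m x =
     1 / (2 ^ l * fact l) * sqrt (1 - x\<^sup>2) powi m *
     poly ((pderiv ^^ nat (int l + m)) ([:-1, 0, 1:] ^ l)) x"

definition sph_harm :: "nat \<Rightarrow> int \<Rightarrow> real \<Rightarrow> real \<Rightarrow> complex" where
  "sph_harm l m \<theta> \<phi> =
     (-1) powi m *
     of_real (sqrt ((2 * real l + 1) * fact (nat (int l - m)) / (4 * pi * fact (nat (int l + m))))) *
     exp (\<i> * of_int m * of_real \<phi>) * of_real (assoc_legendre l m (cos \<theta>))"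

text \<open>
  The numerator \<open>\<Gamma>(\<zeta> + k) / \<Gamma>(\<zeta>)\<close> is \<open>pochhammer \<zeta> k\<close> whenever \<open>\<zeta>\<close> is not a pole of the Gamma function;
  only positive integers \<open>\<zeta>\<close> are used.
\<close>

definition mittag_leffler3 :: "real \<Rightarrow> real \<Rightarrow> real \<Rightarrow> real \<Rightarrow> real" where
  "mittag_leffler3 \<zeta> a b z =
     (\<Sum>k. pochhammer \<zeta> k * z ^ k / (fact k * Gamma (a * real k + b)))"

definition sph_point :: "real \<Rightarrow> real \<Rightarrow> real^3" where
  "sph_point \<theta> \<phi> = vector [sin \<theta> * cos \<phi>, sin \<theta> * sin \<phi>, cos \<theta>]"

definition sq_integrable ::
    "'a measure \<Rightarrow> ('a \<Rightarrow> 'b::{banach, second_countable_topology}) \<Rightarrow> bool" where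
  "sq_integrable M X \<longleftrightarrow> X \<in> borel_measurable M \<and> integrable M (\<lambda>\<omega>. (norm (X \<omega>))\<^sup>2)"

definition ms_tendsto ::
    "'a measure \<Rightarrow> (nat \<Rightarrow> 'a \<Rightarrow> complex) \<Rightarrow> ('a \<Rightarrow> complex) \<Rightarrow> bool" where
  "ms_tendsto M X Y \<longleftrightarrow>
     (\<forall>n. sq_integrable M (X n)) \<and> sq_integrable M Y \<and>
     (\<lambda>n. LINT \<omega>|M. (norm (X n \<omega> - Y \<omega>))\<^sup>2) \<longlonglongrightarrow> 0"

definition simple_stoch_integral ::
    "real measure \<Rightarrow> (real set \<Rightarrow> 'w \<Rightarrow> complex) \<Rightarrow> (real \<Rightarrow> complex) \<Rightarrow> 'w \<Rightarrow> complex" where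
  "simple_stoch_integral G Z s \<omega> = (\<Sum>y\<in>s ` space G. y * Z (s -` {y} \<inter> space G) \<omega>)"

definition has_stoch_integral ::
    "'w measure \<Rightarrow> real measure \<Rightarrow> (real set \<Rightarrow> 'w \<Rightarrow> complex) \<Rightarrow> (real \<Rightarrow> complex) \<Rightarrow>
     ('w \<Rightarrow> complex) \<Rightarrow> bool" where
  "has_stoch_integral M G Z f X \<longleftrightarrow>
     (\<exists>s. (\<forall>n. simple_function G (s n)) \<and> ms_tendsto G s f \<and>
          ms_tendsto M (\<lambda>n. simple_stoch_integral G Z (s n)) X)"

text \<open>The stochastic integral is determined only almost surely; a representative is chosen.\<close>

definition stoch_integral ::
    "'w measure \<Rightarrow> real measure \<Rightarrow> (real set \<Rightarrow> 'w \<Rightarrow> complex) \<Rightarrow> (real \<Rightarrow> complex) \<Rightarrow>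
     'w \<Rightarrow> complex" where
  "stoch_integral M G Z f = (SOME X. has_stoch_integral M G Z f X)"

definition orthogonal_random_measures ::
    "'w measure \<Rightarrow> real measure \<Rightarrow> (nat \<Rightarrow> int \<Rightarrow> real set \<Rightarrow> 'w \<Rightarrow> complex) \<Rightarrow> bool" where
  "orthogonal_random_measures M G Z \<longleftrightarrow>
     (\<forall>l m. \<bar>m\<bar> \<le> int l \<longrightarrow>
        (\<forall>A\<in>sets G. sq_integrable M (Z l m A)) \<and>
        (\<forall>A::nat \<Rightarrow> real set. range A \<subseteq> sets G \<and> disjoint_family A \<longrightarrow>
           ms_tendsto M (\<lambda>n \<omega>. \<Sum>i<n. Z l m (A i) \<omega>) (Z l m (\<Union>i. A i)))) \<and>
     (\<forall>l m l' m'. \<bar>m\<bar> \<le> int l \<longrightarrow> \<bar>m'\<bar> \<le> int l' \<longrightarrow>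
        (\<forall>A\<in>sets G. \<forall>A'\<in>sets G.
           (LINT \<omega>|M. Z l m A \<omega> * cnj (Z l' m' A' \<omega>)) =
           (if l = l' \<and> m = m' then of_real (measure G (A \<inter> A')) else 0)))"

definition homogeneous_isotropic_field ::
    "'w measure \<Rightarrow> (real^3 \<Rightarrow> 'w \<Rightarrow> real) \<Rightarrow> (real \<Rightarrow> real) \<Rightarrow> bool" where
  "homogeneous_isotropic_field M \<eta> B \<longleftrightarrow>
     (\<lambda>(x, \<omega>). \<eta> x \<omega>) \<in> borel_measurable (borel \<Otimes>\<^sub>M M) \<and>
     (\<forall>x. sq_integrable M (\<eta> x) \<and> (LINT \<omega>|M. \<eta> x \<omega>) = 0) \<and>
     (\<forall>x. ((\<lambda>y. LINT \<omega>|M. (\<eta> y \<omega> - \<eta> x \<omega>)\<^sup>2) \<longlongrightarrow> 0) (at x)) \<and>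
     (\<forall>x y. (LINT \<omega>|M. \<eta> x \<omega> * \<eta> y \<omega>) = B (norm (x - y)))"

text \<open>
  For the field \<open>\<pi> \<surd>2 \<Sum>l m. Y\<^sub>l\<^sub>m(\<theta>,\<phi>) \<integral> J\<^bsub>l+1/2\<^esub>(\<mu>r) / (\<mu>r)\<^sup>1\<^sup>/\<^sup>2 h(\<mu>) Z\<^sub>l\<^sub>m(d\<mu>)\<close>, the
  coefficient of \<open>Y\<^sub>l\<^sub>m(\<theta>,\<phi>)\<close> on the sphere of radius \<open>r\<close>.
\<close>

definition spectral_coeff ::
    "'w measure \<Rightarrow> real measure \<Rightarrow> (nat \<Rightarrow> int \<Rightarrow> real set \<Rightarrow> 'w \<Rightarrow> complex) \<Rightarrow>
     (real \<Rightarrow> complex) \<Rightarrow> real \<Rightarrow> nat \<Rightarrow> int \<Rightarrow> 'w \<Rightarrow> complex" where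
  "spectral_coeff M G Z h r l m \<omega> =
     of_real (pi * sqrt 2) *
     stoch_integral M G (Z l m) (\<lambda>\<mu>. of_real (bessel_quot l (\<mu> * r)) * h \<mu>) \<omega>"

definition laplace_partial_sum ::
    "(nat \<Rightarrow> int \<Rightarrow> 'w \<Rightarrow> complex) \<Rightarrow> real \<Rightarrow> real \<Rightarrow> nat \<Rightarrow> 'w \<Rightarrow> complex" where
  "laplace_partial_sum a \<theta> \<phi> L \<omega> = (\<Sum>l\<le>L. \<Sum>m=-int l..int l. sph_harm l m \<theta> \<phi> * a l m \<omega>)"

text \<open>
  The mean square sum of a Laplace series is determined only almost surely at each point.  The
  predicate below describes its real-valued versions that are measurable on the sphere, as is needed
  to integrate sample paths over the sphere.
\<close>

definition laplace_series_field ::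
    "'w measure \<Rightarrow> (nat \<Rightarrow> int \<Rightarrow> real \<Rightarrow> 'w \<Rightarrow> complex) \<Rightarrow> (real^3 \<Rightarrow> real \<Rightarrow> 'w \<Rightarrow> real) \<Rightarrow> bool" where
  "laplace_series_field M a T \<longleftrightarrow>
     (\<forall>t\<ge>0.
        (\<lambda>(x, \<omega>). T x t \<omega>) \<in> borel_measurable (restrict_space borel (sphere 0 1) \<Otimes>\<^sub>M M) \<and>
        (\<forall>\<theta>\<in>{0..pi}. \<forall>\<phi>\<in>{0..<2 * pi}.
           ms_tendsto M (laplace_partial_sum (\<lambda>l m. a l m t) \<theta> \<phi>)
             (\<lambda>\<omega>. of_real (T (sph_point \<theta> \<phi>) t \<omega>))))"

definition isotropic_sphere_field ::
    "'w measure \<Rightarrow> (real^3 \<Rightarrow> real \<Rightarrow> 'w \<Rightarrow> real) \<Rightarrow> bool" where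
  "isotropic_sphere_field M T \<longleftrightarrow>
     (\<forall>x\<in>sphere 0 1. \<forall>t\<ge>0. sq_integrable M (T x t) \<and> (LINT \<omega>|M. T x t \<omega>) = 0) \<and>
     (\<forall>x\<in>sphere 0 1. \<forall>t\<ge>0.
        ((\<lambda>(y, s). LINT \<omega>|M. (T y s \<omega> - T x t \<omega>)\<^sup>2) \<longlongrightarrow> 0)
          (at (x, t) within sphere 0 1 \<times> {0..})) \<and>
     (\<forall>g x y t t'. rotation_matrix g \<longrightarrow> x \<in> sphere 0 1 \<longrightarrow> y \<in> sphere 0 1 \<longrightarrow> t \<ge> 0 \<longrightarrow> t' \<ge> 0 \<longrightarrow>
        (LINT \<omega>|M. T x t \<omega> * T y t' \<omega>) = (LINT \<omega>|M. T (g *v x) t \<omega> * T (g *v y) t' \<omega>))"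

definition laplace_coeff ::
    "(real^3 \<Rightarrow> real \<Rightarrow> 'w \<Rightarrow> real) \<Rightarrow> nat \<Rightarrow> int \<Rightarrow> real \<Rightarrow> 'w \<Rightarrow> complex" where
  "laplace_coeff T l m t \<omega> =
     (LINT \<theta>:{0..pi}|lborel. LINT \<phi>:{0..2 * pi}|lborel.
        of_real (T (sph_point \<theta> \<phi>) t \<omega>) * cnj (sph_harm l m \<theta> \<phi>) * of_real (sin \<theta>))"

text \<open>The values of \<open>C\<close> are complex because they are expectations of complex variables.\<close>

definition angular_power_spectrum ::
    "'w measure \<Rightarrow> (real^3 \<Rightarrow> real \<Rightarrow> 'w \<Rightarrow> real) \<Rightarrow> (nat \<Rightarrow> real \<Rightarrow> real \<Rightarrow> complex) \<Rightarrow> bool" where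
  "angular_power_spectrum M T C \<longleftrightarrow>
     (\<forall>l m t. \<bar>m\<bar> \<le> int l \<longrightarrow> t \<ge> 0 \<longrightarrow> sq_integrable M (laplace_coeff T l m t)) \<and>
     (\<forall>l m l' m' t t'. \<bar>m\<bar> \<le> int l \<longrightarrow> \<bar>m'\<bar> \<le> int l' \<longrightarrow> t \<ge> 0 \<longrightarrow> t' \<ge> 0 \<longrightarrow>
        (LINT \<omega>|M. laplace_coeff T l m t \<omega> * cnj (laplace_coeff T l' m' t' \<omega>)) =
        (if l = l' \<and> m = m' then C l t t' else 0))"

end

theory Submission
  imports Defs
begin

text \<open>
  The exponentials \<open>exp (\<i> \<langle>\<kappa>, x\<rangle>)\<close> are admissible test functions and eigenfunctions of the
  Laplacian, so \<open>t \<mapsto> H(\<mu>,t)\<close> solves a fractional ordinary differential equation.  In integrated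
  form this is a Volterra equation, whose Neumann series is the series for \<open>H\<close>; it also makes \<open>H\<close>
  real and continuous in both variables.  Multiplying the equation by \<open>\<partial>H/\<partial>t\<close> and using that the
  kernels \<open>\<tau> powr (b - 1)\<close>, \<open>0 < b < 1\<close>, are of positive type gives \<open>\<bar>H\<bar> \<le> 1\<close>.

  With \<open>\<bar>H\<bar> \<le> 1\<close> the spectrum \<open>C\<^sub>l(t,t')\<close> is dominated by the spectrum of \<open>\<eta>\<close> on the unit sphere, whose
  Laplace series converges.  Hence the covariance of \<open>T\<^sub>H\<close> is a dominated series of
  \<open>C\<^sub>l(t,t') \<Sum>\<^sub>m Y\<^sub>l\<^sub>m(x) cnj (Y\<^sub>l\<^sub>m(y))\<close>, and by the addition theorem it depends on \<open>x\<close> and \<open>y\<close> through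
  \<open>\<langle>x, y\<rangle>\<close> only.

  That \<open>T\<^sub>H\<close> is real and centred is not immediate, since nothing of the kind is assumed of the random
  measures \<open>Z\<^sub>l\<^sub>m\<close>.  Projecting the real and centred field \<open>\<eta>\<close> to the spheres of all radii \<open>r\<close> yields
  both properties for the stochastic integrals of the densities \<open>\<mu> \<mapsto> J\<^bsub>l+1/2\<^esub>(\<mu>r) / (\<mu>r)\<^sup>1\<^sup>/\<^sup>2\<close>.
  These densities are total, so the properties extend to all densities that occur.
\<close>

section \<open>Riemann-Liouville integrals\<close>

text \<open>Stochastic integrals and mean square sums are fixed only up to null sets, which depend
  on the density, the point and the time. Identities between them are therefore deduced from the
  isometry, as vanishing L2 norms. Pathwise integration over the sphere asks for more: a version
  measurable in point and sample jointly. It is a pointwise limit along one subsequence that serves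
  all points and times, which is possible because the tails of the Laplace series have bounds
  uniform in both.

  Mean square continuity in time is derived from a bound on H uniform in t. The series for H hides
  such a bound behind cancellation, hence the energy argument. There the second derivative may be
  unbounded at 0, so the fundamental theorem of calculus is applied with derivatives on open
  intervals and continuity up to the end points.

  The harmonics are treated through a generating Laurent polynomial: its coefficients obey a
  three-term recursion on which rotations about two axes act explicitly, and these suffice to bring
  any pair of unit vectors into a standard position.\<close>

lemma nonneg_has_integral_lborel:
  fixes f :: "real \<Rightarrow> real"
  assumes "(f has_integral r) S" "\<And>x. x \<in> S \<Longrightarrow> 0 \<le> f x" "(\<lambda>x. indicator S x * f x) \<in> borel_measurable borel"
  shows "set_integrable lborel S f" "(LINT x:S|lborel. f x) = r"
proof -
  let ?g = "\<lambda>x. indicator S x * f x"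
  have g0: "0 \<le> ?g x" for x using assms(2) by (auto simp: indicator_def)
  have r: "r \<ge> 0" using assms(1,2) by (rule has_integral_nonneg)
  have "((\<lambda>x. if x \<in> S then f x else 0) has_integral r) UNIV" using assms(1) by simp
  also have "(\<lambda>x. if x \<in> S then f x else 0) = ?g" by (auto simp: indicator_def)
  finally have "integral\<^sup>N lborel ?g = r" by (rule nn_integral_has_integral_lborel[OF assms(3) g0])
  then have "has_bochner_integral lborel ?g r"
    using assms(3) g0 r by (intro has_bochner_integral_nn_integral) auto
  then show "set_integrable lborel S f" "(LINT x:S|lborel. f x) = r"
    by (auto simp: set_integrable_def set_lebesgue_integral_def has_bochner_integral_iff)
qed

text \<open>Only the part of the Gamma integral over [A, A + 1] is kept. The parameter A is free, so
  Gamma outgrows every geometric sequence; this makes the series below converge at every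
  time.\<close>

lemma Gamma_lower_bound:
  assumes "A > 0" "x \<ge> 0"
  shows "A powr x \<le> exp (A + 1) * Gamma (x + 1 :: real)"
proof -
  have G: "((\<lambda>t. t powr x / exp t) has_integral Gamma (x + 1)) {0..}"
    using Gamma_integral_real[of "x + 1"] assms by simp
  have c: "continuous_on {A..A+1} (\<lambda>t. t powr x / exp t)"
    using assms by (intro continuous_intros) auto
  then have i: "((\<lambda>t. t powr x / exp t) has_integral integral {A..A+1} (\<lambda>t. t powr x / exp t)) {A..A+1}"
    by (intro integrable_integral integrable_continuous_interval)
  have "integral {A..A+1} (\<lambda>t. A powr x / exp (A + 1)) \<le> integral {A..A+1} (\<lambda>t. t powr x / exp t)"
    using assms by (intro integral_le integrable_continuous_interval c continuous_intros frac_le powr_mono2) auto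
  also have "\<dots> \<le> Gamma (x + 1)"
    by (rule has_integral_subset_le[OF _ i G]) (use assms in auto)
  finally show ?thesis using assms by (simp add: field_simps)
qed

text \<open>Euler's Beta integral after the affine substitution s = r + (t - r) x. It is the inner
  integral when two fractional kernels are composed.\<close>

lemma beta_integral_shift:
  fixes a b r t :: real
  assumes "a > 0" "b > 0" "r < t"
  shows "set_integrable lborel {r<..<t} (\<lambda>s. (t - s) powr (a - 1) * (s - r) powr (b - 1))"
    and "(LINT s:{r<..<t}|lborel. (t - s) powr (a - 1) * (s - r) powr (b - 1)) = (t - r) powr (a + b - 1) * Beta a b"
proof -
  define f where "f s = indicator {r<..<t} s *\<^sub>R ((t - s) powr (a - 1) * (s - r) powr (b - 1))" for s
  have B: "set_integrable lborel {0<..<1} (\<lambda>x. x powr (b - 1) * (1 - x) powr (a - 1))"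
    "(LINT x:{0<..<1}|lborel. x powr (b - 1) * (1 - x) powr (a - 1)) = Beta b a"
    using nonneg_has_integral_lborel[of "\<lambda>x. x powr (b - 1) * (1 - x) powr (a - 1)" "Beta b a" "{0<..<1}"]
      has_integral_Beta_real[OF assms(2,1)] by (auto simp: has_integral_Icc_iff_Ioo)
  have eq: "f (r + (t - r) * x) = (t - r) powr (a + b - 2) * (indicator {0<..<1} x *\<^sub>R (x powr (b - 1) * (1 - x) powr (a - 1)))" for x
  proof (cases "x \<in> {0<..<1}")
    case True
    have e: "t - (r + (t - r) * x) = (t - r) * (1 - x)" "r + (t - r) * x - r = (t - r) * x" by (auto simp: algebra_simps)
    have "r + (t - r) * x \<in> {r<..<t}"
    proof -
      have "(t - r) * x < (t - r) * 1" using True assms by (intro mult_strict_left_mono) auto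
      from add_strict_left_mono[OF this, of r] have "r + (t - r) * x < t" by simp
      moreover have "0 < (t - r) * x" using True assms by simp
      ultimately show ?thesis by simp
    qed
    moreover have "(t - r) powr (a - 1) * (t - r) powr (b - 1) = (t - r) powr (a + b - 2)"
      by (simp flip: powr_add add: algebra_simps)
    ultimately show ?thesis unfolding f_def e using True assms by (simp add: powr_mult)
  next
    case False
    have "r + (t - r) * x \<notin> {r<..<t}"
    proof
      assume "r + (t - r) * x \<in> {r<..<t}"
      then have "0 < (t - r) * x" "0 < (t - r) * (1 - x)" by (auto simp: algebra_simps)
      then show False using False assms by (auto simp: zero_less_mult_iff)
    qed
    then show ?thesis using False by (simp add: f_def)
  qed
  have "integrable lborel (\<lambda>x. f (r + (t - r) * x))"
    unfolding eq using B(1) unfolding set_integrable_def by (rule integrable_mult_right)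
  then have "integrable lborel f" using assms lborel_integrable_real_affine_iff[of "t - r" f r] by simp
  then show "set_integrable lborel {r<..<t} (\<lambda>s. (t - s) powr (a - 1) * (s - r) powr (b - 1))"
    by (simp add: set_integrable_def f_def[abs_def])
  have "(LINT s|lborel. f s) = \<bar>t - r\<bar> *\<^sub>R (LINT x|lborel. f (r + (t - r) * x))"
    using assms by (intro lborel_integral_real_affine) auto
  also have "(LINT x|lborel. f (r + (t - r) * x)) = (t - r) powr (a + b - 2) * Beta b a"
    unfolding eq by (simp only: Bochner_Integration.integral_mult_right_zero) (use B(2) in \<open>simp add: set_lebesgue_integral_def\<close>)
  also have "\<bar>t - r\<bar> *\<^sub>R ((t - r) powr (a + b - 2) * Beta b a) = (t - r) powr (a + b - 1) * Beta a b"
  proof -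
    have "(t - r) powr (a + b - 1) = (t - r) powr (1 + (a + b - 2))" by simp
    also have "\<dots> = (t - r) * (t - r) powr (a + b - 2)" using assms by (subst powr_add) simp
    finally show ?thesis using assms by (simp add: Beta_commute)
  qed
  finally show "(LINT s:{r<..<t}|lborel. (t - s) powr (a - 1) * (s - r) powr (b - 1)) = (t - r) powr (a + b - 1) * Beta a b"
    by (simp add: set_lebesgue_integral_def f_def[abs_def])
qed

text \<open>The fractional integral is based at 0. Order 0, where the kernel degenerates to a point
  mass, is treated separately by \<open>RLz\<close>.\<close>

definition RL :: "real \<Rightarrow> (real \<Rightarrow> real) \<Rightarrow> real \<Rightarrow> real" where
  "RL b f t = (LINT s:{0<..<t}|lborel. (t - s) powr (b - 1) * f s) / Gamma b"

text \<open>With the normalisation by \<open>Gamma (p + 1)\<close> the Beta factor cancels, so that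
  a power is merely shifted by the order of the integral.\<close>

lemma RL_power:
  assumes "b > 0" "p \<ge> 0" "t > 0"
  shows "set_integrable lborel {0<..<t} (\<lambda>s. (t - s) powr (b - 1) * (s powr p / Gamma (p + 1)))"
    and "RL b (\<lambda>s. s powr p / Gamma (p + 1)) t = t powr (p + b) / Gamma (p + b + 1)"
proof -
  have p: "p + 1 > 0" "Gamma (p + 1) > 0" "Gamma b > 0" using assms by (auto intro!: Gamma_real_pos)
  note B = beta_integral_shift[OF assms(1) p(1) assms(3), simplified]
  show "set_integrable lborel {0<..<t} (\<lambda>s. (t - s) powr (b - 1) * (s powr p / Gamma (p + 1)))"
    using set_integrable_divide[OF B(1), of "Gamma (p + 1)"] by simp
  have "RL b (\<lambda>s. s powr p / Gamma (p + 1)) t = (LINT s:{0<..<t}|lborel. (t - s) powr (b - 1) * s powr p) / Gamma (p + 1) / Gamma b"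
    unfolding RL_def by simp
  also have "\<dots> = t powr (b + p) * Beta b (p + 1) / Gamma (p + 1) / Gamma b"
    using B(2) by simp
  also have "\<dots> = t powr (p + b) / Gamma (p + b + 1)"
  proof -
    have "Gamma (1 + p) \<noteq> 0" "Gamma b \<noteq> 0" using p(2,3) by (auto simp: add.commute)
    then show ?thesis by (simp add: Beta_def add_ac)
  qed
  finally show "RL b (\<lambda>s. s powr p / Gamma (p + 1)) t = t powr (p + b) / Gamma (p + b + 1)" .
qed

lemma pair_if_measurable [measurable]:
  "(\<lambda>(r, s). indicator {r<..<t} s :: real) \<in> borel_measurable (borel \<Otimes>\<^sub>M borel)" for t :: real
proof -
  have "(\<lambda>(r, s). indicator {r<..<t} s :: real) = (\<lambda>p. if fst p < snd p \<and> snd p < t then 1 else 0)"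
    by (auto simp: fun_eq_iff indicator_def)
  then show ?thesis by simp
qed

text \<open>Semigroup law: Fubini on the triangle r < s < t, with a Beta integral as the inner one.
  The condition a + b \<ge> 1 keeps the composed kernel bounded, so integrability of
  \<open>f\<close> is enough to have the law at the single time t rather than almost
  everywhere.\<close>

lemma RL_RL:
  assumes ab: "a > 0" "b > 0" "a + b \<ge> 1" and t: "t > 0" and f: "set_integrable lborel {0<..<t} f"
  shows "set_integrable lborel {0<..<t} (\<lambda>s. (t - s) powr (a - 1) * RL b f s)"
    and "RL a (RL b f) t = RL (a + b) f t"
proof -
  define g where "g r = indicator {0<..<t} r *\<^sub>R f r" for r
  have g: "integrable lborel g" using f by (simp add: set_integrable_def g_def[abs_def])
  have gm [measurable]: "g \<in> borel_measurable borel" using g by auto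
  define k where "k p = indicator {fst p<..<t} (snd p) * ((t - snd p) powr (a - 1) * (snd p - fst p) powr (b - 1)) * g (fst p)" for p
  have km: "k \<in> borel_measurable (lborel \<Otimes>\<^sub>M lborel)"
    using pair_if_measurable[of t] unfolding k_def[abs_def] split_beta' by measurable
  have ki: "integrable lborel (\<lambda>s. k (r, s))" and kI: "(LINT s|lborel. k (r, s)) = (t - r) powr (a + b - 1) * Beta a b * g r"
    and kN: "(LINT s|lborel. norm (k (r, s))) = (t - r) powr (a + b - 1) * Beta a b * \<bar>g r\<bar>" for r
  proof -
    have "integrable lborel (\<lambda>s. k (r, s)) \<and> (LINT s|lborel. k (r, s)) = (t - r) powr (a + b - 1) * Beta a b * g r
       \<and> (LINT s|lborel. norm (k (r, s))) = (t - r) powr (a + b - 1) * Beta a b * \<bar>g r\<bar>"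
    proof (cases "r < t")
      case True
      note B = beta_integral_shift[OF ab(1,2) True]
      have 1: "k (r, s) = (indicator {r<..<t} s *\<^sub>R ((t - s) powr (a - 1) * (s - r) powr (b - 1))) * g r" for s
        by (simp add: k_def)
      have 2: "norm (k (r, s)) = (indicator {r<..<t} s *\<^sub>R ((t - s) powr (a - 1) * (s - r) powr (b - 1))) * \<bar>g r\<bar>" for s
        unfolding 1 by (auto simp: abs_mult indicator_def)
      show ?thesis unfolding 2 unfolding 1
        using B(1) B(2) unfolding set_integrable_def set_lebesgue_integral_def by simp
    next
      case False
      then have "g r = 0" by (auto simp: g_def)
      then show ?thesis by (simp add: k_def)
    qed
    then show "integrable lborel (\<lambda>s. k (r, s))" "(LINT s|lborel. k (r, s)) = (t - r) powr (a + b - 1) * Beta a b * g r"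
      "(LINT s|lborel. norm (k (r, s))) = (t - r) powr (a + b - 1) * Beta a b * \<bar>g r\<bar>" by auto
  qed
  have nz: "Gamma a \<noteq> 0" "Gamma b \<noteq> 0" "Gamma (a + b) \<noteq> 0"
    using Gamma_real_pos[of a] Gamma_real_pos[of b] Gamma_real_pos[of "a + b"] ab by linarith+
  have Bpos: "Beta a b > 0" using ab by (simp add: Beta_def Gamma_real_pos)
  have "integrable lborel (\<lambda>r. (t - r) powr (a + b - 1) * Beta a b * \<bar>g r\<bar>)"
  proof (rule Bochner_Integration.integrable_bound)
    show "integrable lborel (\<lambda>r. t powr (a + b - 1) * Beta a b * \<bar>g r\<bar>)" using g by simp
    show "AE r in lborel. norm ((t - r) powr (a + b - 1) * Beta a b * \<bar>g r\<bar>) \<le> norm (t powr (a + b - 1) * Beta a b * \<bar>g r\<bar>)"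
    proof (rule AE_I2)
      fix r
      show "norm ((t - r) powr (a + b - 1) * Beta a b * \<bar>g r\<bar>) \<le> norm (t powr (a + b - 1) * Beta a b * \<bar>g r\<bar>)"
      proof (cases "r \<in> {0<..<t}")
        case True
        then have "(t - r) powr (a + b - 1) \<le> t powr (a + b - 1)" using ab by (intro powr_mono2) auto
        then show ?thesis using Bpos by (auto simp: abs_mult intro!: mult_right_mono)
      qed (simp add: g_def)
    qed
  qed measurable
  then have K: "integrable (lborel \<Otimes>\<^sub>M lborel) k"
    by (intro lborel_pair.Fubini_integrable km) (auto simp: kN[unfolded real_norm_def] ki)
  have kr: "(LINT r|lborel. k (r, s)) = indicator {0<..<t} s *\<^sub>R ((t - s) powr (a - 1) * (Gamma b * RL b f s))" for s
  proof (cases "s \<in> {0<..<t}")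
    case True
    have "k (r, s) = (t - s) powr (a - 1) * (indicator {0<..<s} r *\<^sub>R ((s - r) powr (b - 1) * f r))" for r
      using True by (auto simp: k_def g_def indicator_def)
    then have "(LINT r|lborel. k (r, s)) = (t - s) powr (a - 1) * (LINT r:{0<..<s}|lborel. (s - r) powr (b - 1) * f r)"
      by (simp add: set_lebesgue_integral_def)
    then show ?thesis using True Gamma_real_pos[OF ab(2)] by (simp add: RL_def)
  next
    case False
    then have "k (r, s) = 0" for r by (auto simp: k_def g_def indicator_def)
    then show ?thesis using False by simp
  qed
  have "integrable lborel (\<lambda>s. LINT r|lborel. k (r, s))"
    using lborel_pair.integrable_snd[of "\<lambda>r s. k (r, s)"] K by simp
  then have "integrable lborel (\<lambda>s. (1 / Gamma b) * (LINT r|lborel. k (r, s)))" by (rule integrable_mult_right)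
  also have "(\<lambda>s. (1 / Gamma b) * (LINT r|lborel. k (r, s))) = (\<lambda>s. indicator {0<..<t} s *\<^sub>R ((t - s) powr (a - 1) * RL b f s))"
    unfolding kr using Gamma_real_pos[OF ab(2)] by (auto simp: fun_eq_iff)
  finally show "set_integrable lborel {0<..<t} (\<lambda>s. (t - s) powr (a - 1) * RL b f s)" by (simp add: set_integrable_def)
  have "(LINT s|lborel. LINT r|lborel. k (r, s)) = (LINT r|lborel. LINT s|lborel. k (r, s))"
    using lborel_pair.Fubini_integral[of "\<lambda>r s. k (r, s)"] K by simp
  also have "(LINT r|lborel. LINT s|lborel. k (r, s)) = Beta a b * (LINT r:{0<..<t}|lborel. (t - r) powr (a + b - 1) * f r)"
    unfolding kI set_lebesgue_integral_def Bochner_Integration.integral_mult_right_zero[symmetric]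
    by (intro Bochner_Integration.integral_cong) (auto simp: g_def)
  also have "(LINT s|lborel. LINT r|lborel. k (r, s)) = Gamma b * (LINT s:{0<..<t}|lborel. (t - s) powr (a - 1) * RL b f s)"
    unfolding kr set_lebesgue_integral_def Bochner_Integration.integral_mult_right_zero[symmetric]
    by (intro Bochner_Integration.integral_cong) (auto simp: algebra_simps)
  finally have "Gamma b * (Gamma a * RL a (RL b f) t) = Beta a b * (Gamma (a + b) * RL (a + b) f t)"
    using nz by (simp add: RL_def)
  then show "RL a (RL b f) t = RL (a + b) f t"
    using nz by (simp add: Beta_def)
qed

section \<open>Positive type of the fractional kernels\<close>

lemma gamma_kernel:
  fixes b \<tau> :: real
  assumes "b < 1" "\<tau> > 0"
  shows "set_integrable lborel {0<..} (\<lambda>x. x powr (- b) * exp (- x * \<tau>))"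
    and "(LINT x:{0<..}|lborel. x powr (- b) * exp (- x * \<tau>)) = Gamma (1 - b) * \<tau> powr (b - 1)"
proof -
  define f where "f x = indicator {0<..} x *\<^sub>R (x powr (- b) * exp (- x))" for x :: real
  have "((\<lambda>t. t powr (- b) * exp (- t)) has_integral Gamma (1 - b)) {0..}"
    using Gamma_integral_real[of "1 - b"] assms by (simp add: exp_minus field_simps)
  then have h: "((\<lambda>t. t powr (- b) * exp (- t)) has_integral Gamma (1 - b)) {0<..}"
    by (subst has_integral_spike_set_eq[of "{0<..}" "{0..}"]) (auto intro: negligible_subset[of "{0}"])
  have F: "integrable lborel f" "(LINT x|lborel. f x) = Gamma (1 - b)"
    using nonneg_has_integral_lborel[OF h] by (auto simp: f_def[abs_def] set_integrable_def set_lebesgue_integral_def)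
  have eq: "f (0 + \<tau> * x) = \<tau> powr (- b) * (indicator {0<..} x *\<^sub>R (x powr (- b) * exp (- x * \<tau>)))" for x
    using assms by (auto simp: f_def indicator_def powr_mult zero_less_mult_iff mult_ac)
  have "integrable lborel (\<lambda>x. f (0 + \<tau> * x))"
    using F(1) assms lborel_integrable_real_affine_iff[of \<tau> f 0] by simp
  then have "integrable lborel (\<lambda>x. \<tau> powr b * f (0 + \<tau> * x))" by simp
  also have "(\<lambda>x. \<tau> powr b * f (0 + \<tau> * x)) = (\<lambda>x. indicator {0<..} x *\<^sub>R (x powr (- b) * exp (- x * \<tau>)))"
    unfolding eq using assms by (auto simp: fun_eq_iff powr_minus)
  finally show "set_integrable lborel {0<..} (\<lambda>x. x powr (- b) * exp (- x * \<tau>))" by (simp add: set_integrable_def)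
  have "(LINT x|lborel. f x) = \<bar>\<tau>\<bar> *\<^sub>R (LINT x|lborel. f (0 + \<tau> * x))"
    using assms by (intro lborel_integral_real_affine) auto
  then have "Gamma (1 - b) = \<tau> * (\<tau> powr (- b) * (LINT x:{0<..}|lborel. x powr (- b) * exp (- x * \<tau>)))"
    unfolding eq F(2) using assms by (simp add: set_lebesgue_integral_def)
  then have G: "\<tau> powr (b - 1) * Gamma (1 - b) = \<tau> powr (b - 1) * \<tau> powr 1 * \<tau> powr (- b) * (LINT x:{0<..}|lborel. x powr (- b) * exp (- x * \<tau>))"
    using assms by simp
  have "\<tau> powr (b - 1) * \<tau> powr 1 * \<tau> powr (- b) = \<tau> powr ((b - 1) + 1 + (- b))"
    by (simp only: powr_add)
  also have "\<dots> = 1" using assms by simp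
  finally have "\<tau> powr (b - 1) * \<tau> powr 1 * \<tau> powr (- b) = 1" .
  then show "(LINT x:{0<..}|lborel. x powr (- b) * exp (- x * \<tau>)) = Gamma (1 - b) * \<tau> powr (b - 1)"
    using G by (simp add: mult.commute)
qed

lemma continuous_set_integrable_Ioo:
  fixes f :: "real \<Rightarrow> real"
  assumes "continuous_on {a..b} f"
  shows "set_integrable lborel {a<..<b} f"
  by (rule set_integrable_subset[OF borel_integrable_atLeastAtMost'[OF assms]]) auto

lemma LINT_Ioo_eq:
  fixes f :: "real \<Rightarrow> real"
  assumes "(f has_integral I) {a..b}" "set_integrable lborel {a<..<b} f"
  shows "(LINT x:{a<..<b}|lborel. f x) = I"
  using set_borel_integral_eq_integral(2)[OF assms(2)] assms(1) integral_open_interval_real[of a b f]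
  by (simp add: integral_unique)

lemma set_integrable_mult_bounded:
  fixes f g :: "real \<Rightarrow> real"
  assumes f: "set_integrable lborel {0<..<T} f" and g: "continuous_on {0..T} g"
  shows "set_integrable lborel {0<..<T} (\<lambda>s. f s * g s)"
proof -
  have "bounded (g ` {0..T})" by (intro compact_imp_bounded compact_continuous_image g) simp
  then obtain W where "\<forall>y\<in>g ` {0..T}. norm y \<le> W" unfolding bounded_iff by blast
  then have W: "\<And>s. s \<in> {0..T} \<Longrightarrow> \<bar>g s\<bar> \<le> W" by auto
  have gi: "integrable lborel (\<lambda>s. indicator {0<..<T} s *\<^sub>R g s)"
    using continuous_set_integrable_Ioo[OF g] by (simp add: set_integrable_def)
  have fi: "integrable lborel (\<lambda>s. indicator {0<..<T} s *\<^sub>R f s)" using f by (simp add: set_integrable_def)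
  have "integrable lborel (\<lambda>s. (indicator {0<..<T} s *\<^sub>R f s) * (indicator {0<..<T} s *\<^sub>R g s))"
  proof (rule Bochner_Integration.integrable_bound)
    show "integrable lborel (\<lambda>s. W * (indicator {0<..<T} s *\<^sub>R f s))" using fi by (rule integrable_mult_right)
    show "(\<lambda>s. (indicator {0<..<T} s *\<^sub>R f s) * (indicator {0<..<T} s *\<^sub>R g s)) \<in> borel_measurable lborel"
      by (intro borel_measurable_times borel_measurable_integrable[OF gi] borel_measurable_integrable[OF fi])
    show "AE s in lborel. norm ((indicator {0<..<T} s *\<^sub>R f s) * (indicator {0<..<T} s *\<^sub>R g s)) \<le> norm (W * (indicator {0<..<T} s *\<^sub>R f s))"
    proof (rule AE_I2)
      fix s
      show "norm ((indicator {0<..<T} s *\<^sub>R f s) * (indicator {0<..<T} s *\<^sub>R g s)) \<le> norm (W * (indicator {0<..<T} s *\<^sub>R f s))"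
      proof (cases "s \<in> {0<..<T}")
        case True
        then have "\<bar>g s\<bar> \<le> \<bar>W\<bar>" using W[of s] by auto
        then show ?thesis using True mult_left_mono[of "\<bar>g s\<bar>" "\<bar>W\<bar>" "\<bar>f s\<bar>"] by (simp add: abs_mult mult.commute)
      qed simp
    qed
  qed
  also have "(\<lambda>s. (indicator {0<..<T} s *\<^sub>R f s) * (indicator {0<..<T} s *\<^sub>R g s)) = (\<lambda>s. indicator {0<..<T} s *\<^sub>R (f s * g s))"
    by (auto simp: indicator_def)
  finally show ?thesis by (simp add: set_integrable_def)
qed

text \<open>The kernel \<open>\<tau> powr (b - 1)\<close> is a mixture of exponentials \<open>exp (- x \<tau>)\<close>, so its positivity
  reduces to that of the exponential kernels.\<close>

lemma RL_positive_of_exponential: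
  fixes f w :: "real \<Rightarrow> real"
  assumes b: "0 < b" "b < 1" and T: "T > 0"
    and f: "set_integrable lborel {0<..<T} f" and w: "continuous_on {0..T} w"
    and pos: "\<And>x. x > 0 \<Longrightarrow> 0 \<le> (LINT t:{0<..<T}|lborel. (LINT s:{0<..<t}|lborel. exp (- x * (t - s)) * f s) * w t)"
  shows "set_integrable lborel {0<..<T} (\<lambda>t. RL b f t * w t)"
    and "0 \<le> (LINT t:{0<..<T}|lborel. RL b f t * w t)"
proof -
  define g where "g r = indicator {0<..<T} r *\<^sub>R f r" for r
  have g: "integrable lborel g" using f by (simp add: set_integrable_def g_def[abs_def])
  then have gm [measurable]: "g \<in> borel_measurable borel" by auto
  define v where "v r = indicator {0<..<T} r *\<^sub>R w r" for r
  have "integrable lborel v" using continuous_set_integrable_Ioo[OF w] by (simp add: set_integrable_def v_def[abs_def])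
  then have vm [measurable]: "v \<in> borel_measurable borel" by auto
  have "bounded (w ` {0..T})" by (intro compact_imp_bounded compact_continuous_image w) simp
  then obtain W where "\<forall>y\<in>w ` {0..T}. norm y \<le> W" unfolding bounded_iff by blast
  then have W: "\<And>s. s \<in> {0..T} \<Longrightarrow> \<bar>w s\<bar> \<le> W" by auto
  have W0: "W \<ge> 0" using W[of 0] T by auto
  have vW: "\<bar>v s\<bar> \<le> W" for s using W[of s] W0 by (auto simp: v_def indicator_def)
  define k where "k p = (if fst p < snd p then (snd p - fst p) powr (b - 1) * g (fst p) * v (snd p) else 0)" for p
  have km [measurable]: "k \<in> borel_measurable (lborel \<Otimes>\<^sub>M lborel)" unfolding k_def[abs_def] by measurable
  have b1: "b - 1 > -1" "b > 0" using b by auto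
  have kb: "integrable lborel (\<lambda>t. k (s, t)) \<and> (LINT t|lborel. norm (k (s, t))) \<le> (W * T powr b * Beta b 1) * \<bar>g s\<bar>" for s
  proof (cases "s \<in> {0<..<T}")
    case False
    then have "g s = 0" by (simp add: g_def)
    then have "k (s, t) = 0" for t by (simp add: k_def)
    then show ?thesis using \<open>g s = 0\<close> by simp
  next
    case True
    then have "s < T" by simp
    \<comment> \<open>For t < T the factor \<open>(T - t) powr (1 - 1)\<close> equals 1; it makes
      the integral a Beta integral with first parameter 1.\<close>
    have B: "integrable lborel (\<lambda>t. indicator {s<..<T} t *\<^sub>R ((T - t) powr (1 - 1) * (t - s) powr (b - 1)))"
      "(LINT t|lborel. indicator {s<..<T} t *\<^sub>R ((T - t) powr (1 - 1) * (t - s) powr (b - 1))) = (T - s) powr b * Beta 1 b"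
      using beta_integral_shift[of 1 b s T] b \<open>s < T\<close> by (auto simp: set_integrable_def set_lebesgue_integral_def simp del: diff_self diff_numeral_special)
    let ?B = "\<lambda>t. (W * \<bar>g s\<bar>) * (indicator {s<..<T} t *\<^sub>R ((T - t) powr (1 - 1) * (t - s) powr (b - 1)))"
    have iB: "integrable lborel ?B" using B(1) by (rule integrable_mult_right)
    have le: "norm (k (s, t)) \<le> ?B t" for t
    proof (cases "t \<in> {s<..<T}")
      case t: True
      then have "norm (k (s, t)) = (t - s) powr (b - 1) * \<bar>g s\<bar> * \<bar>v t\<bar>" by (simp add: k_def abs_mult)
      also have "\<dots> \<le> (t - s) powr (b - 1) * \<bar>g s\<bar> * W" by (intro mult_left_mono vW) auto
      finally show ?thesis using t by (simp add: mult_ac)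
    next
      case False
      then have "k (s, t) = 0" by (auto simp: k_def v_def)
      then show ?thesis using False by simp
    qed
    have ki: "integrable lborel (\<lambda>t. k (s, t))"
    proof (rule Bochner_Integration.integrable_bound[OF iB])
      show "AE t in lborel. norm (k (s, t)) \<le> norm (?B t)"
        by (rule AE_I2) (metis le abs_ge_self order_trans real_norm_def)
    qed measurable
    have "(LINT t|lborel. norm (k (s, t))) \<le> (LINT t|lborel. ?B t)"
      by (intro integral_mono iB integrable_norm ki le)
    also have "\<dots> = (W * \<bar>g s\<bar>) * ((T - s) powr b * Beta 1 b)" unfolding B(2)[symmetric] by (rule Bochner_Integration.integral_mult_right_zero)
    also have "\<dots> \<le> (W * \<bar>g s\<bar>) * (T powr b * Beta 1 b)"
    proof -
      have "Beta 1 b \<ge> 0" using b by (simp add: Beta_def Gamma_real_pos less_imp_le)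
      then show ?thesis using True b W0 by (intro mult_left_mono mult_right_mono powr_mono2) auto
    qed
    finally show ?thesis using ki by (simp add: mult_ac Beta_commute)
  qed
  have K: "integrable (lborel \<Otimes>\<^sub>M lborel) k"
  proof (intro lborel_pair.Fubini_integrable km)
    show "AE x in lborel. integrable lborel (\<lambda>y. k (x, y))" using kb by simp
    show "integrable lborel (\<lambda>x. LINT y|lborel. norm (k (x, y)))"
    proof (rule Bochner_Integration.integrable_bound)
      show "integrable lborel (\<lambda>s. (W * T powr b * Beta b 1) * \<bar>g s\<bar>)" using g by simp
      have "norm (LINT y|lborel. norm (k (x, y))) \<le> norm ((W * T powr b * Beta b 1) * \<bar>g x\<bar>)" for x
      proof -
        have "0 \<le> (LINT y|lborel. norm (k (x, y)))" by simp
        then show ?thesis using kb[of x] unfolding real_norm_def by linarith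
      qed
      then show "AE x in lborel. norm (LINT y|lborel. norm (k (x, y))) \<le> norm ((W * T powr b * Beta b 1) * \<bar>g x\<bar>)" by simp
    qed measurable
  qed
  have G0: "Gamma b > 0" "Gamma (1 - b) > 0" using b by (auto intro!: Gamma_real_pos)
  have ks: "(LINT s|lborel. k (s, t)) = Gamma b * (indicator {0<..<T} t *\<^sub>R (RL b f t * w t))" for t
  proof (cases "t \<in> {0<..<T}")
    case True
    have "k (s, t) = (indicator {0<..<t} s *\<^sub>R ((t - s) powr (b - 1) * f s)) * w t" for s
      using True by (auto simp: k_def g_def v_def indicator_def)
    then have "(LINT s|lborel. k (s, t)) = (LINT s:{0<..<t}|lborel. (t - s) powr (b - 1) * f s) * w t"
      by (simp add: set_lebesgue_integral_def)
    then show ?thesis using True G0 by (simp add: RL_def)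
  next
    case False
    then have "k (s, t) = 0" for s by (auto simp: k_def v_def)
    then show ?thesis using False by simp
  qed
  have "integrable lborel (\<lambda>t. LINT s|lborel. k (s, t))"
    using lborel_pair.integrable_snd[of "\<lambda>r s. k (r, s)"] K by simp
  then have "integrable lborel (\<lambda>t. (1 / Gamma b) * (LINT s|lborel. k (s, t)))" by (rule integrable_mult_right)
  then show int: "set_integrable lborel {0<..<T} (\<lambda>t. RL b f t * w t)"
    unfolding ks set_integrable_def using G0 by simp
  have kk: "(LINT p|(lborel \<Otimes>\<^sub>M lborel). k p) = Gamma b * (LINT t:{0<..<T}|lborel. RL b f t * w t)"
  proof -
    have "(LINT p|(lborel \<Otimes>\<^sub>M lborel). k p) = (LINT t|lborel. LINT s|lborel. k (s, t))"
      using lborel_pair.integral_snd[of "\<lambda>r s. k (r, s)"] K by simp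
    then show ?thesis unfolding ks set_lebesgue_integral_def by simp
  qed
  \<comment> \<open>Here the kernel in \<open>k\<close> is replaced by its representation as a
    mixture of exponentials, up to the factor \<open>Gamma (1 - b)\<close>. Integrating out the
    mixing variable x first gives back \<open>k\<close>; integrating it out last exposes the
    exponential kernels.\<close>
  define h where "h q = (if snd q > 0 \<and> fst (fst q) < snd (fst q) then
      snd q powr (- b) * exp (- snd q * (snd (fst q) - fst (fst q))) * (g (fst (fst q)) * v (snd (fst q))) else 0)" for q :: "(real \<times> real) \<times> real"
  have hm: "h \<in> borel_measurable ((lborel \<Otimes>\<^sub>M lborel) \<Otimes>\<^sub>M lborel)" unfolding h_def[abs_def] by measurable
  interpret P: pair_sigma_finite "lborel \<Otimes>\<^sub>M lborel :: (real \<times> real) measure" "lborel :: real measure"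
    by (simp add: pair_sigma_finite_def lborel_prod lborel.sigma_finite_measure_axioms)
  have hx: "integrable lborel (\<lambda>x. h (p, x))" and hI: "(LINT x|lborel. h (p, x)) = Gamma (1 - b) * k p"
    and hN: "(LINT x|lborel. norm (h (p, x))) = Gamma (1 - b) * \<bar>k p\<bar>" for p
  proof -
    have "integrable lborel (\<lambda>x. h (p, x)) \<and> (LINT x|lborel. h (p, x)) = Gamma (1 - b) * k p \<and> (LINT x|lborel. norm (h (p, x))) = Gamma (1 - b) * \<bar>k p\<bar>"
    proof (cases "fst p < snd p")
      case True
      then have "snd p - fst p > 0" by simp
      note E = gamma_kernel[OF b(2) this]
      have 1: "h (p, x) = (g (fst p) * v (snd p)) * (indicator {0<..} x *\<^sub>R (x powr (- b) * exp (- x * (snd p - fst p))))" for x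
        using True by (auto simp: h_def indicator_def)
      have 2: "norm (h (p, x)) = \<bar>g (fst p) * v (snd p)\<bar> * (indicator {0<..} x *\<^sub>R (x powr (- b) * exp (- x * (snd p - fst p))))" for x
        using True by (auto simp: h_def indicator_def abs_mult)
      have 3: "integrable lborel (\<lambda>x. indicator {0<..} x *\<^sub>R (x powr (- b) * exp (- x * (snd p - fst p))))"
        using E(1) by (simp only: set_integrable_def)
      have 4: "(LINT x|lborel. c * (indicator {0<..} x *\<^sub>R (x powr (- b) * exp (- x * (snd p - fst p))))) = c * (Gamma (1 - b) * (snd p - fst p) powr (b - 1))" for c
        unfolding E(2)[symmetric] set_lebesgue_integral_def by (rule Bochner_Integration.integral_mult_right_zero)
      show ?thesis unfolding 2 unfolding 1 unfolding 4
        by (intro conjI integrable_mult_right 3) (use True in \<open>simp_all add: k_def abs_mult\<close>)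
    next
      case False
      then have "h (p, x) = 0" for x by (simp add: h_def)
      then show ?thesis using False by (simp add: k_def)
    qed
    then show "integrable lborel (\<lambda>x. h (p, x))" "(LINT x|lborel. h (p, x)) = Gamma (1 - b) * k p"
      "(LINT x|lborel. norm (h (p, x))) = Gamma (1 - b) * \<bar>k p\<bar>" by auto
  qed
  have H: "integrable ((lborel \<Otimes>\<^sub>M lborel) \<Otimes>\<^sub>M lborel) h"
  proof (intro P.Fubini_integrable hm)
    show "integrable (lborel \<Otimes>\<^sub>M lborel) (\<lambda>p. LINT x|lborel. norm (h (p, x)))" unfolding hN using K by simp
  qed (use hx in simp)
  have "(LINT x|lborel. LINT p|(lborel \<Otimes>\<^sub>M lborel). h (p, x)) = (LINT p|(lborel \<Otimes>\<^sub>M lborel). LINT x|lborel. h (p, x))"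
    using P.Fubini_integral[of "\<lambda>p x. h (p, x)"] H by simp
  also have "\<dots> = Gamma (1 - b) * (Gamma b * (LINT t:{0<..<T}|lborel. RL b f t * w t))"
    unfolding hI kk[symmetric] by (rule Bochner_Integration.integral_mult_right_zero)
  finally have eq: "(LINT x|lborel. LINT p|(lborel \<Otimes>\<^sub>M lborel). h (p, x)) = Gamma (1 - b) * (Gamma b * (LINT t:{0<..<T}|lborel. RL b f t * w t))" .
  \<comment> \<open>Fubini provides integrable sections for almost every x only, and positivity of
    the sections almost everywhere is enough for the outer integral.\<close>
  have "AE x in lborel. integrable (lborel \<Otimes>\<^sub>M lborel) (\<lambda>p. h (p, x))"
    using P.AE_integrable_snd[of "\<lambda>p x. h (p, x)"] H by simp
  then have "AE x in lborel. 0 \<le> (LINT p|(lborel \<Otimes>\<^sub>M lborel). h (p, x))"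
  proof eventually_elim
    case (elim x)
    show ?case
    proof (cases "x > 0")
      case x: True
      have "(LINT s|lborel. h ((s, t), x)) = x powr (- b) * (indicator {0<..<T} t *\<^sub>R ((LINT s:{0<..<t}|lborel. exp (- x * (t - s)) * f s) * w t))" for t
      proof (cases "t \<in> {0<..<T}")
        case True
        have "h ((s, t), x) = (x powr (- b) * w t) * (indicator {0<..<t} s *\<^sub>R (exp (- x * (t - s)) * f s))" for s
          using True x by (auto simp: h_def g_def v_def indicator_def)
        then have "(LINT s|lborel. h ((s, t), x)) = (x powr (- b) * w t) * (LINT s:{0<..<t}|lborel. exp (- x * (t - s)) * f s)"
          unfolding set_lebesgue_integral_def by (simp only: Bochner_Integration.integral_mult_right_zero)
        then show ?thesis using True by simp
      next
        case False
        then have "h ((s, t), x) = 0" for s by (auto simp: h_def v_def)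
        then show ?thesis using False by simp
      qed
      then have "(LINT p|(lborel \<Otimes>\<^sub>M lborel). h (p, x)) = (LINT t|lborel. x powr (- b) * (indicator {0<..<T} t *\<^sub>R ((LINT s:{0<..<t}|lborel. exp (- x * (t - s)) * f s) * w t)))"
        using lborel_pair.integral_snd[of "\<lambda>s t. h ((s, t), x)"] elim by (simp add: case_prod_beta')
      also have "\<dots> = x powr (- b) * (LINT t:{0<..<T}|lborel. (LINT s:{0<..<t}|lborel. exp (- x * (t - s)) * f s) * w t)"
        unfolding set_lebesgue_integral_def by (rule Bochner_Integration.integral_mult_right_zero)
      also have "\<dots> \<ge> 0" using pos[OF x] by simp
      finally show ?thesis .
    next
      case False
      then have "h (p, x) = 0" for p by (simp add: h_def)
      then show ?thesis by simp
    qed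
  qed
  then have "0 \<le> (LINT x|lborel. LINT p|(lborel \<Otimes>\<^sub>M lborel). h (p, x))" by (rule integral_nonneg_AE)
  then show "0 \<le> (LINT t:{0<..<T}|lborel. RL b f t * w t)"
    unfolding eq using G0 by (simp add: zero_le_mult_iff)
qed

text \<open>Convolution with an exponential kernel solves the linear equation z' = w - x z with z 0
  = 0. This trades the double integral of the quadratic form for integrals of z z' and of
  squares.\<close>

lemma exponential_kernel:
  fixes w :: "real \<Rightarrow> real"
  assumes w: "continuous_on {0..T} w" and T: "T > 0"
  obtains z where "\<And>t. t \<in> {0..T} \<Longrightarrow> (z has_real_derivative (w t - x * z t)) (at t within {0..T})" "z 0 = 0"
    "\<And>t. t \<in> {0<..<T} \<Longrightarrow> (LINT s:{0<..<t}|lborel. exp (- x * (t - s)) * w s) = z t"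
proof -
  have c: "continuous_on {0..T} (\<lambda>s. exp (x * s) * w s)" by (intro continuous_intros w)
  define z where "z t = exp (- x * t) * integral {0..t} (\<lambda>s. exp (x * s) * w s)" for t
  have "(z has_real_derivative (w t - x * z t)) (at t within {0..T})" if "t \<in> {0..T}" for t
  proof -
    have "(z has_real_derivative exp (- x * t) * (exp (x * t) * w t) + (exp (- x * t) * (- x)) * integral {0..t} (\<lambda>s. exp (x * s) * w s)) (at t within {0..T})"
      unfolding z_def by (rule DERIV_mult'[OF _ integral_has_real_derivative[OF c that]]) (auto intro!: derivative_eq_intros)
    also have "exp (- x * t) * (exp (x * t) * w t) = w t"
      by (simp add: mult.assoc[symmetric] flip: exp_add)
    finally show ?thesis by (simp add: z_def[abs_def] algebra_simps)
  qed
  moreover have "z 0 = 0" by (simp add: z_def)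
  moreover have "(LINT s:{0<..<t}|lborel. exp (- x * (t - s)) * w s) = z t" if "t \<in> {0<..<T}" for t
  proof (rule LINT_Ioo_eq)
    have ct: "continuous_on {0..t} (\<lambda>s. exp (x * s) * w s)" by (rule continuous_on_subset[OF c]) (use that in auto)
    have eq: "exp (- x * (t - s)) * w s = exp (- x * t) * (exp (x * s) * w s)" for s
    proof -
      have "- x * (t - s) = - x * t + x * s" by (simp add: algebra_simps)
      then show ?thesis by (simp only: exp_add mult.assoc)
    qed
    show "((\<lambda>s. exp (- x * (t - s)) * w s) has_integral z t) {0..t}"
      unfolding eq z_def by (intro has_integral_mult_right integrable_integral integrable_continuous_interval ct)
    show "set_integrable lborel {0<..<t} (\<lambda>s. exp (- x * (t - s)) * w s)"
      unfolding eq by (intro continuous_set_integrable_Ioo continuous_intros continuous_on_subset[OF w]) (use that in auto)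
  qed
  ultimately show ?thesis using that by blast
qed

text \<open>For an exponential kernel w = z' + x z, hence z w = (z^2 / 2)' + x z^2, and both parts
  have a nonnegative integral because z vanishes at 0.\<close>

lemma RL_positive:
  fixes w :: "real \<Rightarrow> real"
  assumes b: "0 < b" "b < 1" and T: "T > 0" and w: "continuous_on {0..T} w"
  shows "set_integrable lborel {0<..<T} (\<lambda>t. RL b w t * w t)"
    and "0 \<le> (LINT t:{0<..<T}|lborel. RL b w t * w t)"
proof -
  have pos: "0 \<le> (LINT t:{0<..<T}|lborel. (LINT s:{0<..<t}|lborel. exp (- x * (t - s)) * w s) * w t)" if x: "x > 0" for x
  proof -
    obtain z where z: "\<And>t. t \<in> {0..T} \<Longrightarrow> (z has_real_derivative (w t - x * z t)) (at t within {0..T})" "z 0 = 0"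
      "\<And>t. t \<in> {0<..<T} \<Longrightarrow> (LINT s:{0<..<t}|lborel. exp (- x * (t - s)) * w s) = z t"
      using exponential_kernel[OF w T] by metis
    have zc: "continuous_on {0..T} z" by (rule DERIV_continuous_on[OF z(1)])
    have "((\<lambda>t. (w t - x * z t) * z t) has_integral ((z T)\<^sup>2 / 2 - (z 0)\<^sup>2 / 2)) {0..T}"
      by (rule fundamental_theorem_of_calculus)
         (use T in \<open>auto intro!: derivative_eq_intros z(1) simp: has_real_derivative_iff_has_vector_derivative[symmetric]\<close>)
    moreover have "((\<lambda>t. x * (z t)\<^sup>2) has_integral integral {0..T} (\<lambda>t. x * (z t)\<^sup>2)) {0..T}"
      by (intro integrable_integral integrable_continuous_interval continuous_intros zc)
    ultimately have "((\<lambda>t. (w t - x * z t) * z t + x * (z t)\<^sup>2) has_integral ((z T)\<^sup>2 / 2 - (z 0)\<^sup>2 / 2) + integral {0..T} (\<lambda>t. x * (z t)\<^sup>2)) {0..T}"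
      by (rule has_integral_add)
    also have "(\<lambda>t. (w t - x * z t) * z t + x * (z t)\<^sup>2) = (\<lambda>t. z t * w t)" by (auto simp: algebra_simps power2_eq_square)
    finally have "(LINT t:{0<..<T}|lborel. z t * w t) = ((z T)\<^sup>2 / 2 - (z 0)\<^sup>2 / 2) + integral {0..T} (\<lambda>t. x * (z t)\<^sup>2)"
      by (rule LINT_Ioo_eq) (intro continuous_set_integrable_Ioo continuous_intros zc w)
    moreover have "0 \<le> integral {0..T} (\<lambda>t. x * (z t)\<^sup>2)"
      using x by (intro integral_nonneg integrable_continuous_interval continuous_intros zc) auto
    moreover have "(LINT t:{0<..<T}|lborel. (LINT s:{0<..<t}|lborel. exp (- x * (t - s)) * w s) * w t) = (LINT t:{0<..<T}|lborel. z t * w t)"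
      by (rule set_lebesgue_integral_cong, simp, intro allI impI, subst z(3)) auto
    ultimately show ?thesis using z(2) by simp
  qed
  show "set_integrable lborel {0<..<T} (\<lambda>t. RL b w t * w t)" "0 \<le> (LINT t:{0<..<T}|lborel. RL b w t * w t)"
    using RL_positive_of_exponential[OF b T continuous_set_integrable_Ioo[OF w] w pos] by auto
qed

text \<open>Since w vanishes at 0, integration by parts turns the exponential convolution of w' into
  w - x z = z'. Then z' w = x z z' + (z')^2, again with nonnegative integral. Only integrability of
  w' near 0 is available, because the second derivative of a solution may blow up there.\<close>

lemma RL_derivative_positive:
  fixes w w' :: "real \<Rightarrow> real"
  assumes b: "0 < b" "b < 1" and T: "T > 0" and w: "continuous_on {0..T} w" and w0: "w 0 = 0"
    and d: "\<And>t. t \<in> {0<..<T} \<Longrightarrow> (w has_real_derivative w' t) (at t)" and int: "set_integrable lborel {0<..<T} w'"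
  shows "set_integrable lborel {0<..<T} (\<lambda>t. RL b w' t * w t)"
    and "0 \<le> (LINT t:{0<..<T}|lborel. RL b w' t * w t)"
proof -
  have pos: "0 \<le> (LINT t:{0<..<T}|lborel. (LINT s:{0<..<t}|lborel. exp (- x * (t - s)) * w' s) * w t)" if x: "x > 0" for x
  proof -
    obtain z where z: "\<And>t. t \<in> {0..T} \<Longrightarrow> (z has_real_derivative (w t - x * z t)) (at t within {0..T})" "z 0 = 0"
      "\<And>t. t \<in> {0<..<T} \<Longrightarrow> (LINT s:{0<..<t}|lborel. exp (- x * (t - s)) * w s) = z t"
      using exponential_kernel[OF w T] by metis
    have zc: "continuous_on {0..T} z" by (rule DERIV_continuous_on[OF z(1)])
    have y: "(LINT s:{0<..<t}|lborel. exp (- x * (t - s)) * w' s) = w t - x * z t" if t: "t \<in> {0<..<T}" for t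
    proof -
      have wt: "continuous_on {0..t} w" by (rule continuous_on_subset[OF w]) (use t in auto)
      have i1: "set_integrable lborel {0<..<t} (\<lambda>s. w' s * exp (- x * (t - s)))"
        by (rule set_integrable_mult_bounded) (use t in \<open>auto intro!: continuous_intros set_integrable_subset[OF int]\<close>)
      have i2: "set_integrable lborel {0<..<t} (\<lambda>s. x * (exp (- x * (t - s)) * w s))"
        by (intro continuous_set_integrable_Ioo continuous_intros wt)
      have "((\<lambda>s. w' s * exp (- x * (t - s)) + x * (exp (- x * (t - s)) * w s)) has_integral (exp (- x * (t - t)) * w t - exp (- x * (t - 0)) * w 0)) {0..t}"
      proof (rule fundamental_theorem_of_calculus_interior)
        fix s assume s: "s \<in> {0<..<t}"
        show "((\<lambda>s. exp (- x * (t - s)) * w s) has_vector_derivative w' s * exp (- x * (t - s)) + x * (exp (- x * (t - s)) * w s)) (at s)"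
          unfolding has_real_derivative_iff_has_vector_derivative[symmetric]
          by (rule derivative_eq_intros d refl | use s t in \<open>simp add: algebra_simps\<close>)+
      qed (use t in \<open>auto intro!: continuous_intros wt\<close>)
      then have "(LINT s:{0<..<t}|lborel. w' s * exp (- x * (t - s)) + x * (exp (- x * (t - s)) * w s)) = w t"
        using LINT_Ioo_eq set_integral_add(1)[OF i1 i2] w0 by fastforce
      then have "(LINT s:{0<..<t}|lborel. w' s * exp (- x * (t - s))) + (LINT s:{0<..<t}|lborel. x * (exp (- x * (t - s)) * w s)) = w t"
        unfolding set_integral_add(2)[OF i1 i2] .
      then show ?thesis using z(3)[OF t] by (simp add: mult.commute)
    qed
    have "((\<lambda>t. x * ((w t - x * z t) * z t)) has_integral x * ((z T)\<^sup>2 / 2 - (z 0)\<^sup>2 / 2)) {0..T}"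
      by (rule has_integral_mult_right, rule fundamental_theorem_of_calculus)
         (use T in \<open>auto intro!: derivative_eq_intros z(1) simp: has_real_derivative_iff_has_vector_derivative[symmetric]\<close>)
    moreover have "((\<lambda>t. (w t - x * z t)\<^sup>2) has_integral integral {0..T} (\<lambda>t. (w t - x * z t)\<^sup>2)) {0..T}"
      by (intro integrable_integral integrable_continuous_interval continuous_intros zc w)
    ultimately have "((\<lambda>t. x * ((w t - x * z t) * z t) + (w t - x * z t)\<^sup>2) has_integral x * ((z T)\<^sup>2 / 2 - (z 0)\<^sup>2 / 2) + integral {0..T} (\<lambda>t. (w t - x * z t)\<^sup>2)) {0..T}"
      by (rule has_integral_add)
    also have "(\<lambda>t. x * ((w t - x * z t) * z t) + (w t - x * z t)\<^sup>2) = (\<lambda>t. (w t - x * z t) * w t)" by (auto simp: algebra_simps power2_eq_square)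
    finally have "(LINT t:{0<..<T}|lborel. (w t - x * z t) * w t) = x * ((z T)\<^sup>2 / 2 - (z 0)\<^sup>2 / 2) + integral {0..T} (\<lambda>t. (w t - x * z t)\<^sup>2)"
      by (rule LINT_Ioo_eq) (intro continuous_set_integrable_Ioo continuous_intros zc w)
    moreover have "0 \<le> integral {0..T} (\<lambda>t. (w t - x * z t)\<^sup>2)"
      by (intro integral_nonneg integrable_continuous_interval continuous_intros zc w) auto
    moreover have "(LINT t:{0<..<T}|lborel. (LINT s:{0<..<t}|lborel. exp (- x * (t - s)) * w' s) * w t) = (LINT t:{0<..<T}|lborel. (w t - x * z t) * w t)"
      by (rule set_lebesgue_integral_cong, simp, intro allI impI, subst y) auto
    ultimately show ?thesis using z(2) x by simp
  qed
  show "set_integrable lborel {0<..<T} (\<lambda>t. RL b w' t * w t)" "0 \<le> (LINT t:{0<..<T}|lborel. RL b w' t * w t)"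
    using RL_positive_of_exponential[OF b T int w pos] by auto
qed

section \<open>The fractional oscillator equation\<close>

text \<open>The integral behind \<open>RL\<close> is 0 by convention when it does not exist, so
  linearity and monotonicity are stated under this condition.\<close>

definition RLi :: "real \<Rightarrow> (real \<Rightarrow> real) \<Rightarrow> real \<Rightarrow> bool" where
  "RLi b f t \<longleftrightarrow> set_integrable lborel {0<..<t} (\<lambda>s. (t - s) powr (b - 1) * f s)"

lemma RL_cong: "(\<And>s. s \<in> {0<..<t} \<Longrightarrow> f s = g s) \<Longrightarrow> RL b f t = RL b g t"
  unfolding RL_def by (intro arg_cong[where f="\<lambda>x. x / Gamma b"] set_lebesgue_integral_cong) auto

lemma RL_lincomb:
  assumes "RLi b f t" "RLi b g t"
  shows "RLi b (\<lambda>s. x * f s + y * g s) t" "RL b (\<lambda>s. x * f s + y * g s) t = x * RL b f t + y * RL b g t"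
proof -
  have i: "set_integrable lborel {0<..<t} (\<lambda>s. x * ((t - s) powr (b - 1) * f s))" "set_integrable lborel {0<..<t} (\<lambda>s. y * ((t - s) powr (b - 1) * g s))"
    using assms unfolding RLi_def by (auto intro!: set_integrable_mult_right)
  have eq: "(t - s) powr (b - 1) * (x * f s + y * g s) = x * ((t - s) powr (b - 1) * f s) + y * ((t - s) powr (b - 1) * g s)" for s
    by (simp add: algebra_simps)
  show "RLi b (\<lambda>s. x * f s + y * g s) t" unfolding RLi_def eq by (rule set_integral_add(1)[OF i])
  show "RL b (\<lambda>s. x * f s + y * g s) t = x * RL b f t + y * RL b g t"
    unfolding RL_def eq set_integral_add(2)[OF i] set_integral_mult_right by (simp add: add_divide_distrib)
qed

lemma RL_sum:
  assumes "finite I" "\<And>i. i \<in> I \<Longrightarrow> RLi b (f i) t"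
  shows "RLi b (\<lambda>s. \<Sum>i\<in>I. c i * f i s) t \<and> RL b (\<lambda>s. \<Sum>i\<in>I. c i * f i s) t = (\<Sum>i\<in>I. c i * RL b (f i) t)"
  using assms
proof (induction I rule: finite_induct)
  case (insert i I)
  then show ?case using RL_lincomb[of b "f i" t "\<lambda>s. \<Sum>i\<in>I. c i * f i s" "c i" 1] by simp
qed (simp add: RLi_def RL_def set_integrable_def set_lebesgue_integral_def)

lemma RL_mono:
  assumes "b > 0" "RLi b f t" "RLi b g t" "\<And>s. s \<in> {0<..<t} \<Longrightarrow> \<bar>f s\<bar> \<le> g s"
  shows "\<bar>RL b f t\<bar> \<le> RL b g t"
proof -
  have le: "RL b f t \<le> RL b g t" if "RLi b f t" "\<And>s. s \<in> {0<..<t} \<Longrightarrow> f s \<le> g s" for f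
    unfolding RL_def
    using that assms by (intro divide_right_mono set_integral_mono) (auto simp: RLi_def Gamma_real_pos less_imp_le intro!: mult_left_mono)
  have "RL b f t \<le> RL b g t" by (rule le[OF assms(2)]) (use assms(4) in \<open>auto simp: abs_le_iff\<close>)
  moreover have "RLi b (\<lambda>s. (-1) * f s + 0 * f s) t" "RL b (\<lambda>s. (-1) * f s + 0 * f s) t = (-1) * RL b f t + 0 * RL b f t"
    by (rule RL_lincomb[OF assms(2,2)])+
  then have "- RL b f t \<le> RL b g t"
    using le[of "\<lambda>s. (-1) * f s + 0 * f s"] assms(4) by (auto simp: abs_le_iff)
  ultimately show ?thesis by (simp add: abs_le_iff)
qed

lemma RLi_continuous:
  assumes "b > 0" "t > 0" "continuous_on {0..t} f"
  shows "RLi b f t"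
proof -
  have "set_integrable lborel {0<..<t} (\<lambda>s. (t - s) powr (b - 1) * (s - 0) powr (1 - 1))"
    by (rule beta_integral_shift) (use assms in auto)
  also have "?this \<longleftrightarrow> set_integrable lborel {0<..<t} (\<lambda>s. (t - s) powr (b - 1))"
    by (rule set_integrable_cong) auto
  finally show ?thesis unfolding RLi_def by (rule set_integrable_mult_bounded[OF _ assms(3)])
qed

section \<open>Iterated fractional integrals of normalised powers\<close>

definition gpow :: "real \<Rightarrow> real \<Rightarrow> real" where
  "gpow p t = t powr p / Gamma (p + 1)"

lemma RL_gpow:
  assumes "b > 0" "p \<ge> 0" "t > 0"
  shows "RLi b (gpow p) t" "RL b (gpow p) t = gpow (p + b) t"
  using RL_power[OF assms] by (auto simp: RLi_def gpow_def[abs_def] add_ac)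

text \<open>
  With \<open>I\<^sup>b\<close> the Riemann-Liouville integral \<open>RL b\<close>, \<open>mlE \<beta> \<gamma> A B p k\<close> is \<open>(A I\<^sup>\<beta> + B I\<^sup>\<gamma>)\<^sup>k\<close> applied to
  \<open>gpow p\<close>.
\<close>

definition mlE :: "real \<Rightarrow> real \<Rightarrow> real \<Rightarrow> real \<Rightarrow> real \<Rightarrow> nat \<Rightarrow> real \<Rightarrow> real" where
  "mlE \<beta> \<gamma> A B p k t = (\<Sum>n\<le>k. (real (k choose n) * A ^ (k - n) * B ^ n) * gpow (\<beta> * real (k - n) + \<gamma> * real n + p) t)"

text \<open>Pascal's rule summed against F. The arguments of F count the applications of two
  commuting operators, and the two sums on the left come from applying the first or the second one
  once more.\<close>

lemma pascal_sum:
  fixes F :: "nat \<Rightarrow> nat \<Rightarrow> real"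
  shows "(\<Sum>n\<le>k. real (k choose n) * F (Suc (k - n)) n) + (\<Sum>n\<le>k. real (k choose n) * F (k - n) (Suc n)) =
    (\<Sum>n\<le>Suc k. real (Suc k choose n) * F (Suc k - n) n)"
proof -
  have "(\<Sum>n\<le>Suc k. real (Suc k choose n) * F (Suc k - n) n) =
    F (Suc k) 0 + (\<Sum>n\<le>k. real (k choose n) * F (k - n) (Suc n)) + (\<Sum>n\<le>k. real (k choose Suc n) * F (k - n) (Suc n))"
    by (subst sum.atMost_Suc_shift) (simp add: sum.distrib algebra_simps)
  moreover have "(\<Sum>n\<le>k. real (k choose n) * F (Suc (k - n)) n) = (\<Sum>n\<le>Suc k. real (k choose n) * F (Suc k - n) n)"
    by (simp add: Suc_diff_le)
  moreover have "\<dots> = F (Suc k) 0 + (\<Sum>n\<le>k. real (k choose Suc n) * F (k - n) (Suc n))"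
    by (subst sum.atMost_Suc_shift) simp
  ultimately show ?thesis by simp
qed

lemma RL_mlE:
  assumes "\<beta> > 0" "\<gamma> > 0" "p \<ge> 0" "t > 0" "\<delta> > 0"
  shows "RLi \<delta> (mlE \<beta> \<gamma> A B p k) t"
    "RL \<delta> (mlE \<beta> \<gamma> A B p k) t = (\<Sum>n\<le>k. (real (k choose n) * A ^ (k - n) * B ^ n) * gpow (\<beta> * real (k - n) + \<gamma> * real n + p + \<delta>) t)"
proof -
  have g: "RLi \<delta> (gpow (\<beta> * real (k - n) + \<gamma> * real n + p)) t"
    "RL \<delta> (gpow (\<beta> * real (k - n) + \<gamma> * real n + p)) t = gpow (\<beta> * real (k - n) + \<gamma> * real n + p + \<delta>) t" for n
    using assms by (auto intro!: RL_gpow add_nonneg_nonneg)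
  have e: "mlE \<beta> \<gamma> A B p k = (\<lambda>s. \<Sum>n\<le>k. (real (k choose n) * A ^ (k - n) * B ^ n) * gpow (\<beta> * real (k - n) + \<gamma> * real n + p) s)"
    by (simp add: mlE_def fun_eq_iff)
  have "RLi \<delta> (mlE \<beta> \<gamma> A B p k) t \<and> RL \<delta> (mlE \<beta> \<gamma> A B p k) t =
     (\<Sum>n\<le>k. (real (k choose n) * A ^ (k - n) * B ^ n) * RL \<delta> (gpow (\<beta> * real (k - n) + \<gamma> * real n + p)) t)"
    unfolding e by (rule RL_sum[OF finite_atMost g(1)])
  then show "RLi \<delta> (mlE \<beta> \<gamma> A B p k) t"
    "RL \<delta> (mlE \<beta> \<gamma> A B p k) t = (\<Sum>n\<le>k. (real (k choose n) * A ^ (k - n) * B ^ n) * gpow (\<beta> * real (k - n) + \<gamma> * real n + p + \<delta>) t)"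
    unfolding g(2) by blast+
qed

lemma mlE_Suc:
  assumes "\<beta> > 0" "\<gamma> > 0" "p \<ge> 0" "t > 0"
  shows "A * RL \<beta> (mlE \<beta> \<gamma> A B p k) t + B * RL \<gamma> (mlE \<beta> \<gamma> A B p k) t = mlE \<beta> \<gamma> A B p (Suc k) t"
proof -
  have "A * RL \<beta> (mlE \<beta> \<gamma> A B p k) t = (\<Sum>n\<le>k. real (k choose n) * (A ^ Suc (k - n) * B ^ n * gpow (\<beta> * real (Suc (k - n)) + \<gamma> * real n + p) t))"
    using assms by (simp add: RL_mlE sum_distrib_left algebra_simps)
  moreover have "B * RL \<gamma> (mlE \<beta> \<gamma> A B p k) t = (\<Sum>n\<le>k. real (k choose n) * (A ^ (k - n) * B ^ Suc n * gpow (\<beta> * real (k - n) + \<gamma> * real (Suc n) + p) t))"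
    using assms by (simp add: RL_mlE sum_distrib_left algebra_simps)
  ultimately show ?thesis
    using pascal_sum[of k "\<lambda>i j. A ^ i * B ^ j * gpow (\<beta> * real i + \<gamma> * real j + p) t"]
    by (simp only: mlE_def mult.assoc)
qed

lemma gpow_bound:
  assumes "X > 0" "p \<ge> 0" "t \<ge> 0"
  shows "0 \<le> gpow p t" "gpow p t \<le> exp (X + 1) * (t / X) powr p"
proof -
  have G: "Gamma (p + 1) > 0" using assms by (intro Gamma_real_pos) auto
  then show "0 \<le> gpow p t" by (simp add: gpow_def)
  have "t powr p * X powr p \<le> t powr p * (exp (X + 1) * Gamma (p + 1))"
    using Gamma_lower_bound[OF assms(1,2)] by (intro mult_left_mono) auto
  then show "gpow p t \<le> exp (X + 1) * (t / X) powr p"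
    using G assms by (simp add: gpow_def powr_divide field_simps)
qed

text \<open>Replacing each \<open>gpow q t\<close> by \<open>exp (X + 1) * (t / X) powr q\<close>
  leaves a binomial expansion. A large X makes the base of the k-th power small at the price of the
  constant \<open>exp (X + 1)\<close>, which gives geometric decay in k at any fixed t.\<close>

lemma mlE_bound:
  assumes "\<beta> > 0" "\<gamma> > 0" "p \<ge> 0" "t > 0" "X > 0"
  shows "(\<Sum>n\<le>k. \<bar>(real (k choose n) * A ^ (k - n) * B ^ n) * gpow (\<beta> * real (k - n) + \<gamma> * real n + p) t\<bar>)
      \<le> exp (X + 1) * (t / X) powr p * (\<bar>A\<bar> * (t / X) powr \<beta> + \<bar>B\<bar> * (t / X) powr \<gamma>) ^ k"
    "\<bar>mlE \<beta> \<gamma> A B p k t\<bar> \<le> exp (X + 1) * (t / X) powr p * (\<bar>A\<bar> * (t / X) powr \<beta> + \<bar>B\<bar> * (t / X) powr \<gamma>) ^ k"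
proof -
  define x where "x = t / X"
  have x: "x > 0" using assms by (simp add: x_def)
  have "(\<Sum>n\<le>k. \<bar>(real (k choose n) * A ^ (k - n) * B ^ n) * gpow (\<beta> * real (k - n) + \<gamma> * real n + p) t\<bar>) \<le>
     (\<Sum>n\<le>k. exp (X + 1) * x powr p * (real (k choose n) * (\<bar>B\<bar> * x powr \<gamma>) ^ n * (\<bar>A\<bar> * x powr \<beta>) ^ (k - n)))"
  proof (rule sum_mono)
    fix n
    define q where "q = \<beta> * real (k - n) + \<gamma> * real n + p"
    have "q \<ge> 0" using assms by (simp add: q_def)
    then have g: "0 \<le> gpow q t" "gpow q t \<le> exp (X + 1) * x powr q"
      using gpow_bound[OF assms(5), of q t] assms unfolding x_def by auto
    have xq: "x powr q = x powr p * (x powr \<gamma>) ^ n * (x powr \<beta>) ^ (k - n)"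
      using x by (simp add: q_def powr_add powr_powr[symmetric] powr_realpow)
    have "\<bar>(real (k choose n) * A ^ (k - n) * B ^ n) * gpow q t\<bar> = (real (k choose n) * \<bar>A\<bar> ^ (k - n) * \<bar>B\<bar> ^ n) * gpow q t"
      using g by (simp add: abs_mult power_abs)
    also have "\<dots> \<le> (real (k choose n) * \<bar>A\<bar> ^ (k - n) * \<bar>B\<bar> ^ n) * (exp (X + 1) * x powr q)"
      by (intro mult_left_mono g) auto
    also have "\<dots> = exp (X + 1) * x powr p * (real (k choose n) * (\<bar>B\<bar> * x powr \<gamma>) ^ n * (\<bar>A\<bar> * x powr \<beta>) ^ (k - n))"
      unfolding xq by (simp add: power_mult_distrib mult_ac)
    finally show "\<bar>(real (k choose n) * A ^ (k - n) * B ^ n) * gpow (\<beta> * real (k - n) + \<gamma> * real n + p) t\<bar> \<le>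
      exp (X + 1) * x powr p * (real (k choose n) * (\<bar>B\<bar> * x powr \<gamma>) ^ n * (\<bar>A\<bar> * x powr \<beta>) ^ (k - n))" by (simp add: q_def)
  qed
  also have "\<dots> = exp (X + 1) * x powr p * (\<bar>A\<bar> * x powr \<beta> + \<bar>B\<bar> * x powr \<gamma>) ^ k"
    unfolding sum_distrib_left[symmetric] by (subst add.commute) (simp add: binomial_ring)
  finally show 1: "(\<Sum>n\<le>k. \<bar>(real (k choose n) * A ^ (k - n) * B ^ n) * gpow (\<beta> * real (k - n) + \<gamma> * real n + p) t\<bar>)
      \<le> exp (X + 1) * (t / X) powr p * (\<bar>A\<bar> * (t / X) powr \<beta> + \<bar>B\<bar> * (t / X) powr \<gamma>) ^ k"
    by (simp add: x_def)
  show "\<bar>mlE \<beta> \<gamma> A B p k t\<bar> \<le> exp (X + 1) * (t / X) powr p * (\<bar>A\<bar> * (t / X) powr \<beta> + \<bar>B\<bar> * (t / X) powr \<gamma>) ^ k"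
    unfolding mlE_def by (rule order_trans[OF sum_abs 1])
qed

text \<open>Both exponents are positive and t / X tends to 0. The value 1 / 2 is an arbitrary ratio
  below 1.\<close>

lemma mlE_scale_exists:
  fixes A B \<beta> \<gamma> t :: real
  assumes "\<beta> > 0" "\<gamma> > 0" "t > 0"
  shows "\<exists>X>0. \<bar>A\<bar> * (t / X) powr \<beta> + \<bar>B\<bar> * (t / X) powr \<gamma> \<le> 1 / 2"
proof -
  have z: "((\<lambda>X. t / X) \<longlongrightarrow> 0) at_top" by (rule real_tendsto_divide_at_top[OF tendsto_const filterlim_ident])
  have "((\<lambda>X. \<bar>A\<bar> * (t / X) powr \<beta> + \<bar>B\<bar> * (t / X) powr \<gamma>) \<longlongrightarrow> \<bar>A\<bar> * 0 + \<bar>B\<bar> * 0) at_top"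
    using assms by (intro tendsto_intros tendsto_powr'[OF z tendsto_const, of \<beta>, simplified] tendsto_powr'[OF z tendsto_const, of \<gamma>, simplified]
       eventually_mono[OF eventually_gt_at_top[of 0]]) (auto intro: eventually_mono[OF eventually_gt_at_top[of 0]])
  then have "\<forall>\<^sub>F X in at_top. \<bar>A\<bar> * (t / X) powr \<beta> + \<bar>B\<bar> * (t / X) powr \<gamma> < 1 / 2"
    by (rule order_tendstoD(2)) simp
  then have "\<forall>\<^sub>F X in at_top. X > 0 \<and> \<bar>A\<bar> * (t / X) powr \<beta> + \<bar>B\<bar> * (t / X) powr \<gamma> < 1 / 2"
    using eventually_gt_at_top[of 0] by eventually_elim auto
  then obtain X where "X > 0 \<and> \<bar>A\<bar> * (t / X) powr \<beta> + \<bar>B\<bar> * (t / X) powr \<gamma> < 1 / 2"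
    using eventually_happens'[OF trivial_limit_at_top_linorder] by blast
  then show ?thesis by (auto intro!: exI[of _ X])
qed

text \<open>Order 0 occurs at the end points \<alpha> = 1 and \<alpha> + \<beta> = 2 of the
  parameter range, where a Caputo derivative is an ordinary one.\<close>

definition RLz :: "real \<Rightarrow> (real \<Rightarrow> real) \<Rightarrow> real \<Rightarrow> real" where
  "RLz b f t = (if b = 0 then f t else RL b f t)"

text \<open>
  The equation of one Fourier mode, with the Caputo derivatives written as fractional integrals of
  the derivatives \<open>w\<close> and \<open>w2\<close>.
\<close>

locale frac_ode =
  fixes \<alpha> \<beta> a b u0 :: real and u w w2 :: "real \<Rightarrow> real"
  assumes \<alpha>: "0 < \<alpha>" "\<alpha> \<le> 1" and \<gamma>: "1 < \<alpha> + \<beta>" "\<alpha> + \<beta> \<le> 2" and ab: "a \<ge> 0" "b \<ge> 0"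
    and u_cont: "continuous_on {0..} u" and w_cont: "continuous_on {0..} w"
    and du: "\<And>t. t > 0 \<Longrightarrow> (u has_real_derivative w t) (at t)"
    and dw: "\<And>t. t > 0 \<Longrightarrow> (w has_real_derivative w2 t) (at t)"
    and w2_int: "\<And>T. T > 0 \<Longrightarrow> set_integrable lborel {0<..<T} w2"
    and u_0: "u 0 = u0" and w_0: "w 0 = 0"
    and eq: "\<And>t. t > 0 \<Longrightarrow> RLz (2 - (\<alpha> + \<beta>)) w2 t + a * RLz (1 - \<alpha>) w t + b * u t = 0"
begin

lemma \<beta>_pos: "\<beta> > 0" using \<alpha> \<gamma> by simp

text \<open>Taylor's formula at 0 with integral remainder; the linear term is absent because w 0 =
  0. The antiderivative is differentiated in the open interval only, since \<open>w2\<close> may be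
  unbounded at 0.\<close>

lemma RL_2_w2: assumes t: "t > 0" shows "RL 2 w2 t = u t - u0"
proof -
  have c: "continuous_on {0..t} u" "continuous_on {0..t} w"
    by (auto intro: continuous_on_subset[OF u_cont] continuous_on_subset[OF w_cont])
  have "((\<lambda>s. w2 s * (t - s)) has_integral ((t - t) * w t + u t) - ((t - 0) * w 0 + u 0)) {0..t}"
  proof (rule fundamental_theorem_of_calculus_interior)
    show "((\<lambda>s. (t - s) * w s + u s) has_vector_derivative w2 s * (t - s)) (at s)" if "s \<in> {0<..<t}" for s
      unfolding has_real_derivative_iff_has_vector_derivative[symmetric]
      by (rule derivative_eq_intros du dw refl | use that in \<open>simp add: algebra_simps\<close>)+
  qed (use t in \<open>auto intro!: continuous_intros c\<close>)
  from LINT_Ioo_eq[OF this set_integrable_mult_bounded[OF w2_int[OF t]]]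
  have "(LINT s:{0<..<t}|lborel. w2 s * (t - s)) = u t - u0"
    by (simp add: w_0 u_0 continuous_intros)
  moreover have "(LINT s:{0<..<t}|lborel. (t - s) powr (2 - 1) * w2 s) = (LINT s:{0<..<t}|lborel. w2 s * (t - s))"
    by (rule set_lebesgue_integral_cong) auto
  ultimately show ?thesis by (simp add: RL_def Gamma_numeral)
qed

lemma RL_1_w: assumes t: "t > 0" shows "RL 1 w t = u t - u0"
proof -
  have c: "continuous_on {0..t} u" "continuous_on {0..t} w"
    by (auto intro: continuous_on_subset[OF u_cont] continuous_on_subset[OF w_cont])
  have "(w has_integral u t - u 0) {0..t}"
    by (rule fundamental_theorem_of_calculus_interior)
      (use t c du in \<open>auto simp: has_real_derivative_iff_has_vector_derivative[symmetric]\<close>)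
  from LINT_Ioo_eq[OF this continuous_set_integrable_Ioo[OF c(2)]]
  have "(LINT s:{0<..<t}|lborel. w s) = u t - u0" by (simp add: u_0)
  moreover have "(LINT s:{0<..<t}|lborel. (t - s) powr (1 - 1) * w s) = (LINT s:{0<..<t}|lborel. w s)"
    by (rule set_lebesgue_integral_cong) auto
  ultimately show ?thesis by (simp add: RL_def)
qed

lemma w_integrable: "t > 0 \<Longrightarrow> set_integrable lborel {0<..<t} w"
  by (intro continuous_set_integrable_Ioo continuous_on_subset[OF w_cont]) auto

text \<open>The two orders add up to 2, so the semigroup law reduces the claim to
  \<open>RL_2_w2\<close>; at \<alpha> + \<beta> = 2 there is no inner integral and that lemma
  applies directly.\<close>

lemma RL_RLz_w2:
  assumes t: "t > 0"
  shows "RLi (\<alpha> + \<beta>) (RLz (2 - (\<alpha> + \<beta>)) w2) t" "RL (\<alpha> + \<beta>) (RLz (2 - (\<alpha> + \<beta>)) w2) t = u t - u0"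
proof -
  have "RLi (\<alpha> + \<beta>) (RLz (2 - (\<alpha> + \<beta>)) w2) t \<and> RL (\<alpha> + \<beta>) (RLz (2 - (\<alpha> + \<beta>)) w2) t = u t - u0"
  proof (cases "\<alpha> + \<beta> = 2")
    case True
    have "set_integrable lborel {0<..<t} (\<lambda>s. w2 s * (t - s))"
      by (rule set_integrable_mult_bounded[OF w2_int[OF t]]) (intro continuous_intros)
    also have "?this \<longleftrightarrow> RLi 2 w2 t" unfolding RLi_def by (rule set_integrable_cong) auto
    finally show ?thesis using True RL_2_w2[OF t] by (simp add: RLz_def[abs_def])
  next
    case False
    then have z: "RLz (2 - (\<alpha> + \<beta>)) w2 = RL (2 - (\<alpha> + \<beta>)) w2" by (simp add: RLz_def[abs_def])
    show ?thesis using RL_RL[of "\<alpha> + \<beta>" "2 - (\<alpha> + \<beta>)" t w2] RL_2_w2[OF t] w2_int[OF t] \<gamma> False t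
      unfolding z RLi_def by simp
  qed
  then show "RLi (\<alpha> + \<beta>) (RLz (2 - (\<alpha> + \<beta>)) w2) t" "RL (\<alpha> + \<beta>) (RLz (2 - (\<alpha> + \<beta>)) w2) t = u t - u0" by auto
qed

text \<open>The order \<beta> + 1 is reached in two ways, as (\<alpha> + \<beta>) + (1 - \<alpha>)
  and as \<beta> + 1 with \<open>RL 1 w\<close> giving back u - u0.\<close>

lemma RL_RLz_w:
  assumes t: "t > 0"
  shows "RLi (\<alpha> + \<beta>) (RLz (1 - \<alpha>) w) t" "RL (\<alpha> + \<beta>) (RLz (1 - \<alpha>) w) t = RL \<beta> (\<lambda>s. u s - u0) t"
proof -
  have b1: "RL (\<beta> + 1) w t = RL \<beta> (\<lambda>s. u s - u0) t"
    using RL_RL(2)[of \<beta> 1 t w] \<beta>_pos t w_integrable[OF t] RL_cong[of t "RL 1 w" "\<lambda>s. u s - u0" \<beta>] RL_1_w by simp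
  have "RLi (\<alpha> + \<beta>) (RLz (1 - \<alpha>) w) t \<and> RL (\<alpha> + \<beta>) (RLz (1 - \<alpha>) w) t = RL (\<beta> + 1) w t"
  proof (cases "\<alpha> = 1")
    case True
    then show ?thesis using \<beta>_pos t RLi_continuous[of "1 + \<beta>" t w] continuous_on_subset[OF w_cont, of "{0..t}"]
      by (auto simp: RLz_def[abs_def] add.commute)
  next
    case False
    then have z: "RLz (1 - \<alpha>) w = RL (1 - \<alpha>) w" by (simp add: RLz_def[abs_def])
    show ?thesis using RL_RL[of "\<alpha> + \<beta>" "1 - \<alpha>" t w] w_integrable[OF t] \<alpha> \<gamma> \<beta>_pos False t
      unfolding z RLi_def by (simp add: add.commute)
  qed
  then show "RLi (\<alpha> + \<beta>) (RLz (1 - \<alpha>) w) t" "RL (\<alpha> + \<beta>) (RLz (1 - \<alpha>) w) t = RL \<beta> (\<lambda>s. u s - u0) t" using b1 by auto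
qed

text \<open>The fractional integral of order \<alpha> + \<beta> of the differential equation. It is
  written for u - u0, so that the inhomogeneity is a single normalised power and the Neumann series
  consists of \<open>mlE\<close> terms.\<close>

lemma integral_equation:
  assumes t: "t > 0"
  shows "u t - u0 = (- a) * RL \<beta> (\<lambda>s. u s - u0) t + (- b) * RL (\<alpha> + \<beta>) (\<lambda>s. u s - u0) t + (- b * u0) * gpow (\<alpha> + \<beta>) t"
proof -
  have uc: "continuous_on {0..t} u" by (rule continuous_on_subset[OF u_cont]) auto
  have gp: "\<alpha> + \<beta> > 0" using \<gamma> by simp
  have iu: "RLi (\<alpha> + \<beta>) u t" by (rule RLi_continuous[OF gp t uc])
  note i1 = RL_lincomb[OF iu RL_gpow(1)[OF gp order_refl t], of 1 "- u0"]
  have "RL (\<alpha> + \<beta>) (\<lambda>s. u s - u0) t = RL (\<alpha> + \<beta>) (\<lambda>s. 1 * u s + (- u0) * gpow 0 s) t"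
    by (rule RL_cong) (auto simp: gpow_def)
  also have "\<dots> = RL (\<alpha> + \<beta>) u t - u0 * gpow (\<alpha> + \<beta>) t" unfolding i1(2) using RL_gpow(2)[OF gp _ t, of 0] by simp
  finally have ru: "RL (\<alpha> + \<beta>) u t = RL (\<alpha> + \<beta>) (\<lambda>s. u s - u0) t + u0 * gpow (\<alpha> + \<beta>) t" by simp
  have "RL (\<alpha> + \<beta>) (RLz (2 - (\<alpha> + \<beta>)) w2) t = RL (\<alpha> + \<beta>) (\<lambda>s. (- a) * RLz (1 - \<alpha>) w s + (- b) * u s) t"
    by (rule RL_cong) (use eq in \<open>auto simp: algebra_simps eq_neg_iff_add_eq_0\<close>)
  also have "\<dots> = (- a) * RL (\<alpha> + \<beta>) (RLz (1 - \<alpha>) w) t + (- b) * RL (\<alpha> + \<beta>) u t"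
    by (rule RL_lincomb(2)[OF RL_RLz_w(1)[OF t] iu])
  finally show ?thesis unfolding RL_RLz_w2[OF t] RL_RLz_w[OF t] ru by (simp add: algebra_simps)
qed

text \<open>The remainder R of the Neumann series satisfies R (m + 1) = - a I^\<beta> R m - b
  I^(\<alpha> + \<beta>) R m. As fractional integrals preserve inequalities, |R m| is majorised by
  the same recursion without signs, started at the constant K; this is \<open>mlE\<close> with p =
  0.\<close>

lemma remainder_bound:
  assumes K: "\<And>s. 0 < s \<Longrightarrow> s \<le> T \<Longrightarrow> \<bar>u s - u0\<bar> \<le> K"
  shows "0 < t \<Longrightarrow> t \<le> T \<Longrightarrow> \<bar>(u t - u0) - (\<Sum>k<m. (- b * u0) * mlE \<beta> (\<alpha> + \<beta>) (- a) (- b) (\<alpha> + \<beta>) k t)\<bar> \<le> K * mlE \<beta> (\<alpha> + \<beta>) a b 0 m t"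
proof (induction m arbitrary: t)
  case 0
  then show ?case using K[of t] by (simp add: mlE_def gpow_def)
next
  case (Suc m)
  define g where "g = \<alpha> + \<beta>"
  have gp: "g > 0" using \<gamma> by (simp add: g_def)
  note bp = \<beta>_pos
  have t: "t > 0" using Suc.prems by simp
  define R where "R m s = (u s - u0) - (\<Sum>k<m. (- b * u0) * mlE \<beta> g (- a) (- b) g k s)" for m s
  have uc: "continuous_on {0..t} (\<lambda>s. u s - u0)" by (intro continuous_intros continuous_on_subset[OF u_cont]) auto
  have ru: "RLi \<delta> (R m) t \<and> RL \<delta> (R m) t = RL \<delta> (\<lambda>s. u s - u0) t - (\<Sum>k<m. (- b * u0) * RL \<delta> (mlE \<beta> g (- a) (- b) g k) t)" if "\<delta> > 0" for \<delta>
  proof -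
    have S: "RLi \<delta> (\<lambda>s. \<Sum>k<m. (- b * u0) * mlE \<beta> g (- a) (- b) g k s) t \<and> RL \<delta> (\<lambda>s. \<Sum>k<m. (- b * u0) * mlE \<beta> g (- a) (- b) g k s) t =
      (\<Sum>k<m. (- b * u0) * RL \<delta> (mlE \<beta> g (- a) (- b) g k) t)"
      by (rule RL_sum) (use bp gp t that in \<open>auto intro: RL_mlE\<close>)
    have "R m = (\<lambda>s. 1 * (u s - u0) + (-1) * (\<Sum>k<m. (- b * u0) * mlE \<beta> g (- a) (- b) g k s))" by (simp add: R_def fun_eq_iff)
    then show ?thesis
      using RL_lincomb[OF RLi_continuous[OF that t uc] conjunct1[OF S], of 1 "-1"] S by simp
  qed
  have Rstep: "R (Suc m) t = (- a) * RL \<beta> (R m) t + (- b) * RL g (R m) t"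
  proof -
    have P: "(\<Sum>k<Suc m. (- b * u0) * mlE \<beta> g (- a) (- b) g k t) = (- b * u0) * gpow g t + (\<Sum>k<m. (- b * u0) * mlE \<beta> g (- a) (- b) g (Suc k) t)"
      by (subst sum.lessThan_Suc_shift) (simp add: mlE_def)
    have P2: "(\<Sum>k<m. (- b * u0) * mlE \<beta> g (- a) (- b) g (Suc k) t) =
       (- a) * (\<Sum>k<m. (- b * u0) * RL \<beta> (mlE \<beta> g (- a) (- b) g k) t) + (- b) * (\<Sum>k<m. (- b * u0) * RL g (mlE \<beta> g (- a) (- b) g k) t)"
      unfolding sum_distrib_left sum.distrib[symmetric]
      using mlE_Suc[OF bp gp less_imp_le[OF gp] t, of "- a" "- b"] by (intro sum.cong refl) (metis (no_types, opaque_lifting) distrib_left mult.left_commute)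
    show ?thesis
      unfolding R_def[of "Suc m"] integral_equation[OF t, folded g_def] P P2 conjunct2[OF ru[OF bp]] conjunct2[OF ru[OF gp]]
      by (simp add: algebra_simps)
  qed
  have IH: "\<bar>R m s\<bar> \<le> K * mlE \<beta> g a b 0 m s" if "s \<in> {0<..<t}" for s
    using Suc.IH[of s] that Suc.prems by (simp add: R_def g_def)
  have KM: "RLi \<delta> (\<lambda>s. K * mlE \<beta> g a b 0 m s) t \<and> RL \<delta> (\<lambda>s. K * mlE \<beta> g a b 0 m s) t = K * RL \<delta> (mlE \<beta> g a b 0 m) t" if "\<delta> > 0" for \<delta>
    using RL_lincomb[OF RL_mlE(1)[OF bp gp order_refl t that] RL_mlE(1)[OF bp gp order_refl t that], of K a b m 0 a b m] by simp
  have bd: "\<bar>RL \<delta> (R m) t\<bar> \<le> K * RL \<delta> (mlE \<beta> g a b 0 m) t" if "\<delta> > 0" for \<delta>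
    using RL_mono[OF that conjunct1[OF ru[OF that]] conjunct1[OF KM[OF that]] IH] unfolding conjunct2[OF KM[OF that]] .
  have "\<bar>R (Suc m) t\<bar> \<le> a * \<bar>RL \<beta> (R m) t\<bar> + b * \<bar>RL g (R m) t\<bar>"
    unfolding Rstep using ab by (intro order_trans[OF abs_triangle_ineq]) (simp add: abs_mult)
  also have "\<dots> \<le> a * (K * RL \<beta> (mlE \<beta> g a b 0 m) t) + b * (K * RL g (mlE \<beta> g a b 0 m) t)"
    using ab by (intro add_mono mult_left_mono bd bp gp) auto
  also have "\<dots> = K * mlE \<beta> g a b 0 (Suc m) t"
    using mlE_Suc[OF bp gp order_refl t, of a b m] by (simp add: algebra_simps flip: distrib_left)
  finally show ?case by (simp add: R_def g_def)
qed

text \<open>On [0, t] the function u - u0 is bounded by some K, and the majorant of the remainder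
  decays like K (1 / 2)^m once X is chosen large.\<close>

lemma solution_sums:
  assumes t: "t > 0"
  shows "(\<lambda>k. (- b * u0) * mlE \<beta> (\<alpha> + \<beta>) (- a) (- b) (\<alpha> + \<beta>) k t) sums (u t - u0)"
proof -
  have gp: "\<alpha> + \<beta> > 0" using \<gamma> by simp
  have "continuous_on {0..t} (\<lambda>s. u s - u0)" by (intro continuous_intros continuous_on_subset[OF u_cont]) auto
  then have "bounded ((\<lambda>s. u s - u0) ` {0..t})" by (intro compact_imp_bounded compact_continuous_image) auto
  then obtain K where "\<forall>y\<in>(\<lambda>s. u s - u0) ` {0..t}. norm y \<le> K" unfolding bounded_iff by blast
  then have K: "\<And>s. 0 < s \<Longrightarrow> s \<le> t \<Longrightarrow> \<bar>u s - u0\<bar> \<le> K" by auto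
  have K0: "K \<ge> 0" using K[OF t order_refl] by linarith
  obtain X where X: "X > 0" "\<bar>a\<bar> * (t / X) powr \<beta> + \<bar>b\<bar> * (t / X) powr (\<alpha> + \<beta>) \<le> 1 / 2"
    using mlE_scale_exists[OF \<beta>_pos gp t, of a b] by auto
  have bd: "\<bar>mlE \<beta> (\<alpha> + \<beta>) a b 0 m t\<bar> \<le> exp (X + 1) * (1 / 2) ^ m" for m
  proof -
    have "\<bar>mlE \<beta> (\<alpha> + \<beta>) a b 0 m t\<bar> \<le> exp (X + 1) * (t / X) powr 0 * (\<bar>a\<bar> * (t / X) powr \<beta> + \<bar>b\<bar> * (t / X) powr (\<alpha> + \<beta>)) ^ m"
      by (rule mlE_bound(2)[OF \<beta>_pos gp order_refl t X(1)])
    also have "\<dots> \<le> exp (X + 1) * 1 * (1 / 2) ^ m"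
      using X t by (intro mult_mono power_mono) auto
    finally show ?thesis by simp
  qed
  have z: "(\<lambda>m. K * (exp (X + 1) * (1 / 2) ^ m)) \<longlonglongrightarrow> K * (exp (X + 1) * 0)"
    by (intro tendsto_intros LIMSEQ_power_zero) auto
  have "(\<lambda>m. (\<Sum>k<m. (- b * u0) * mlE \<beta> (\<alpha> + \<beta>) (- a) (- b) (\<alpha> + \<beta>) k t) - (u t - u0)) \<longlonglongrightarrow> 0"
  proof (rule Lim_null_comparison)
    show "(\<lambda>m. K * (exp (X + 1) * (1 / 2) ^ m)) \<longlonglongrightarrow> 0" using z by simp
    show "\<forall>\<^sub>F m in sequentially. norm ((\<Sum>k<m. (- b * u0) * mlE \<beta> (\<alpha> + \<beta>) (- a) (- b) (\<alpha> + \<beta>) k t) - (u t - u0)) \<le> K * (exp (X + 1) * (1 / 2) ^ m)"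
    proof (intro always_eventually allI)
      fix m
      have "\<bar>(u t - u0) - (\<Sum>k<m. (- b * u0) * mlE \<beta> (\<alpha> + \<beta>) (- a) (- b) (\<alpha> + \<beta>) k t)\<bar> \<le> K * mlE \<beta> (\<alpha> + \<beta>) a b 0 m t"
        by (rule remainder_bound[OF K t order_refl])
      also have "\<dots> \<le> K * (exp (X + 1) * (1 / 2) ^ m)"
        using bd[of m] K0 by (intro mult_left_mono) auto
      finally show "norm ((\<Sum>k<m. (- b * u0) * mlE \<beta> (\<alpha> + \<beta>) (- a) (- b) (\<alpha> + \<beta>) k t) - (u t - u0)) \<le> K * (exp (X + 1) * (1 / 2) ^ m)"
        by (simp add: abs_minus_commute)
    qed
  qed
  then show ?thesis by (simp add: sums_def LIM_zero_iff)
qed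

text \<open>Energy estimate: multiply the equation by \<open>u' = w\<close> and integrate over \<open>(0, T)\<close>.\<close>

lemma solution_bound:
  assumes "b > 0" and T: "T > 0"
  shows "(u T)\<^sup>2 \<le> u0\<^sup>2"
proof -
  have uc: "continuous_on {0..T} u" and wc: "continuous_on {0..T} w"
    by (auto intro: continuous_on_subset[OF u_cont] continuous_on_subset[OF w_cont])
  \<comment> \<open>For \<alpha> + \<beta> < 2 this is the positivity of the fractional kernel
    paired with \<open>w2\<close> = w'. At \<alpha> + \<beta> = 2 the integral is the kinetic energy
    w(T)^2 / 2.\<close>
  have A: "set_integrable lborel {0<..<T} (\<lambda>t. RLz (2 - (\<alpha> + \<beta>)) w2 t * w t) \<and> 0 \<le> (LINT t:{0<..<T}|lborel. RLz (2 - (\<alpha> + \<beta>)) w2 t * w t)"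
  proof (cases "\<alpha> + \<beta> = 2")
    case True
    have i: "set_integrable lborel {0<..<T} (\<lambda>t. w2 t * w t)" by (rule set_integrable_mult_bounded[OF w2_int[OF T] wc])
    have "((\<lambda>t. w2 t * w t) has_integral (w T)\<^sup>2 / 2 - (w 0)\<^sup>2 / 2) {0..T}"
    proof (rule fundamental_theorem_of_calculus_interior)
      show "((\<lambda>t. (w t)\<^sup>2 / 2) has_vector_derivative w2 t * w t) (at t)" if "t \<in> {0<..<T}" for t
        unfolding has_real_derivative_iff_has_vector_derivative[symmetric]
        by (rule derivative_eq_intros dw refl | use that in simp)+
    qed (use T in \<open>auto intro!: continuous_intros wc\<close>)
    from LINT_Ioo_eq[OF this i] have "(LINT t:{0<..<T}|lborel. w2 t * w t) = (w T)\<^sup>2 / 2" by (simp only: w_0) simp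
    then have "0 \<le> (LINT t:{0<..<T}|lborel. w2 t * w t)" by (simp only:) simp
    then show ?thesis using i True by (simp add: RLz_def)
  next
    case False
    then show ?thesis
      using RL_derivative_positive[of "2 - (\<alpha> + \<beta>)" T w w2] \<gamma> T wc w_0 dw w2_int[OF T] by (simp add: RLz_def)
  qed
  have B: "set_integrable lborel {0<..<T} (\<lambda>t. RLz (1 - \<alpha>) w t * w t) \<and> 0 \<le> (LINT t:{0<..<T}|lborel. RLz (1 - \<alpha>) w t * w t)"
  proof (cases "\<alpha> = 1")
    case True
    have i: "set_integrable lborel {0<..<T} (\<lambda>t. w t * w t)" by (intro continuous_set_integrable_Ioo continuous_intros wc)
    moreover have "0 \<le> (LINT t:{0<..<T}|lborel. w t * w t)" unfolding set_lebesgue_integral_def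
      by (rule Bochner_Integration.integral_nonneg) (auto simp: indicator_def)
    ultimately show ?thesis using True by (simp add: RLz_def)
  next
    case False
    then show ?thesis using RL_positive[of "1 - \<alpha>" T w] \<alpha> T wc by (simp add: RLz_def)
  qed
  have iu: "set_integrable lborel {0<..<T} (\<lambda>t. w t * u t)" by (intro continuous_set_integrable_Ioo continuous_intros wc uc)
  have "((\<lambda>t. w t * u t) has_integral (u T)\<^sup>2 / 2 - (u 0)\<^sup>2 / 2) {0..T}"
  proof (rule fundamental_theorem_of_calculus_interior)
    show "((\<lambda>t. (u t)\<^sup>2 / 2) has_vector_derivative w t * u t) (at t)" if "t \<in> {0<..<T}" for t
      unfolding has_real_derivative_iff_has_vector_derivative[symmetric]
      by (rule derivative_eq_intros du refl | use that in simp)+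
  qed (use T in \<open>auto intro!: continuous_intros uc\<close>)
  from LINT_Ioo_eq[OF this iu] have U: "(LINT t:{0<..<T}|lborel. w t * u t) = (u T)\<^sup>2 / 2 - u0\<^sup>2 / 2" by (simp add: u_0)
  have "(LINT t:{0<..<T}|lborel. RLz (2 - (\<alpha> + \<beta>)) w2 t * w t) = (LINT t:{0<..<T}|lborel. (- a) * (RLz (1 - \<alpha>) w t * w t) + (- b) * (w t * u t))"
  proof (rule set_lebesgue_integral_cong, simp, intro allI impI)
    fix t assume "t \<in> {0<..<T}"
    then have E: "RLz (2 - (\<alpha> + \<beta>)) w2 t = (- a) * RLz (1 - \<alpha>) w t + (- b) * u t" using eq[of t] by simp
    show "RLz (2 - (\<alpha> + \<beta>)) w2 t * w t = (- a) * (RLz (1 - \<alpha>) w t * w t) + (- b) * (w t * u t)"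
      unfolding E by (simp add: algebra_simps)
  qed
  also have "\<dots> = (- a) * (LINT t:{0<..<T}|lborel. RLz (1 - \<alpha>) w t * w t) + (- b) * ((u T)\<^sup>2 / 2 - u0\<^sup>2 / 2)"
    using B iu by (subst set_integral_add(2)) (auto simp only: set_integral_mult_right set_integrable_mult_right U)
  finally have "b * ((u T)\<^sup>2 / 2 - u0\<^sup>2 / 2) = - (LINT t:{0<..<T}|lborel. RLz (2 - (\<alpha> + \<beta>)) w2 t * w t) - a * (LINT t:{0<..<T}|lborel. RLz (1 - \<alpha>) w t * w t)"
    by simp
  moreover have "0 \<le> a * (LINT t:{0<..<T}|lborel. RLz (1 - \<alpha>) w t * w t)" using B ab by simp
  ultimately have "b * ((u T)\<^sup>2 / 2 - u0\<^sup>2 / 2) \<le> 0" using A by linarith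
  then show ?thesis using assms(1) by (simp add: mult_le_0_iff)
qed

end

text \<open>Absolute summability along the diagonals m = n + k gives unconditional summability over
  all pairs (n, k), so the sum may also be taken row by row.\<close>

lemma triangle_rearrange:
  fixes f :: "nat \<Rightarrow> nat \<Rightarrow> real"
  assumes bound: "summable (\<lambda>m. \<Sum>n\<le>m. \<bar>f n (m - n)\<bar>)" and sums: "(\<lambda>m. \<Sum>n\<le>m. f n (m - n)) sums S"
  shows "summable (f n)" "(\<lambda>n. \<Sum>k. f n k) sums S"
proof -
  define F where "F = (\<lambda>(m, n). f n (m - n))"
  have "(\<lambda>m. \<Sum>n\<le>m. \<bar>f n (m - n)\<bar>) summable_on UNIV"
    by (rule norm_summable_imp_summable_on) (use bound in \<open>simp add: sum_nonneg\<close>)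
  then have abs: "(\<lambda>x. norm (F x)) summable_on Sigma UNIV (\<lambda>m. {..m})"
    unfolding Infinite_Sum.abs_summable_on_Sigma_iff by (auto simp: F_def sum_nonneg)
  then have "F summable_on Sigma UNIV (\<lambda>m. {..m})" by (rule Infinite_Sum.abs_summable_summable)
  then obtain S' where S': "(F has_sum S') (Sigma UNIV (\<lambda>m. {..m}))" by (auto simp: summable_on_def)
  have "((\<lambda>m. \<Sum>n\<le>m. F (m, n)) has_sum S') UNIV"
    by (rule has_sum_SigmaD[OF S']) (rule has_sum_finite, simp)
  from has_sum_imp_sums[OF this] have "S' = S" using sums_unique2[OF _ sums] by (simp add: F_def)
  define g where "g = (\<lambda>(n, k). f n k)"
  have g: "(g has_sum S) (UNIV \<times> UNIV)"
    by (rule has_sum_reindex_bij_witness[where i="\<lambda>(n, k). (n + k, n)" and j="\<lambda>(m, n). (n, m - n)" and g=F and S="Sigma UNIV (\<lambda>m. {..m})", THEN iffD1])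
       (use S' \<open>S' = S\<close> in \<open>auto simp: F_def g_def\<close>)
  have "(\<lambda>x. norm (g x)) summable_on (UNIV \<times> UNIV)"
    by (rule summable_on_reindex_bij_witness[where i="\<lambda>(n, k). (n + k, n)" and j="\<lambda>(m, n). (n, m - n)" and g="\<lambda>x. norm (F x)" and S="Sigma UNIV (\<lambda>m. {..m})", THEN iffD1])
       (use abs in \<open>auto simp: F_def g_def\<close>)
  then have "\<forall>n. (\<lambda>k. norm (g (n, k))) summable_on UNIV"
    unfolding Infinite_Sum.abs_summable_on_Sigma_iff by simp
  then have row: "(\<lambda>k. g (n, k)) summable_on UNIV" for n
    by - (rule Infinite_Sum.abs_summable_summable, blast)
  then show "summable (f n)" using summable_on_imp_summable[OF row[of n]] by (simp add: g_def)
  have fs: "f n sums infsum (\<lambda>k. g (n, k)) UNIV" for n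
    using has_sum_imp_sums[OF has_sum_infsum[OF row[of n]]] by (simp add: g_def)
  have "((\<lambda>n. infsum (\<lambda>k. g (n, k)) UNIV) has_sum S) UNIV"
    by (rule has_sum_SigmaD[OF g]) (rule has_sum_infsum[OF row])
  from has_sum_imp_sums[OF this] show "(\<lambda>n. \<Sum>k. f n k) sums S"
    using sums_unique[OF fs] by simp
qed

text \<open>The two series of the theorem are rearrangements of the Neumann series of the integral equation.\<close>

lemma mittag_leffler_series:
  fixes \<alpha> \<beta> c D \<mu> t :: real
  assumes \<alpha>: "0 < \<alpha>" "1 < \<alpha> + \<beta>" "\<beta> > 0" and t: "t > 0"
  defines "T \<equiv> (\<lambda>k. (- (\<mu>\<^sup>2 * c\<^sup>2)) * mlE \<beta> (\<alpha> + \<beta>) (- (c\<^sup>2 / D)) (- (\<mu>\<^sup>2 * c\<^sup>2)) (\<alpha> + \<beta>) k t)"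
  assumes D: "D > 0" and T: "T sums S"
  shows "(\<lambda>n. (- (\<mu>\<^sup>2 * c\<^sup>2 * t powr (\<alpha> + \<beta>))) ^ (n + 1) *
            mittag_leffler3 (real (n + 1)) \<beta> ((\<alpha> + \<beta>) * real (n + 1) + 1) (- (c\<^sup>2 / D * t powr \<beta>))) sums S"
    and "T k = - (\<mu>\<^sup>2 * c\<^sup>2 * t powr (\<alpha> + \<beta>)) *
         (\<Sum>n\<le>k. real (k choose n) * (- (c\<^sup>2 / D * t powr \<beta>)) ^ k * (\<mu>\<^sup>2 * D * t powr \<alpha>) ^ n / Gamma (\<beta> * real k + \<alpha> * real n + \<alpha> + \<beta> + 1))"
proof -
  define g where "g = \<alpha> + \<beta>"
  define a where "a = c\<^sup>2 / D"
  define b where "b = \<mu>\<^sup>2 * c\<^sup>2"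
  have gp: "g > 0" using \<alpha> by (simp add: g_def)
  \<comment> \<open>Here n and k count the applications of the integrals of order \<alpha> + \<beta>
    and \<beta>. The diagonals of \<open>f\<close> are the Neumann terms, its rows the
    Mittag-Leffler functions.\<close>
  define f where "f n k = (- b) * (real ((n + k) choose n) * (- a) ^ k * (- b) ^ n * gpow (\<beta> * real k + g * real n + g) t)" for n k
  have Tf: "T m = (\<Sum>n\<le>m. f n (m - n))" for m
    by (simp add: T_def mlE_def f_def sum_distrib_left a_def[symmetric] b_def[symmetric] g_def[symmetric] mult_ac)
  obtain X where X: "X > 0" "\<bar>- a\<bar> * (t / X) powr \<beta> + \<bar>- b\<bar> * (t / X) powr g \<le> 1 / 2"
    using mlE_scale_exists[OF \<alpha>(3) gp t, of "- a" "- b"] by auto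
  have "summable (\<lambda>m. \<Sum>n\<le>m. \<bar>f n (m - n)\<bar>)"
  proof (rule summable_comparison_test')
    show "summable (\<lambda>m. b * (exp (X + 1) * (t / X) powr g) * (1 / 2) ^ m)" by (intro summable_mult summable_geometric) auto
    fix m :: nat
    have b0: "b \<ge> 0" by (simp add: b_def)
    have "(\<Sum>n\<le>m. \<bar>f n (m - n)\<bar>) = b * (\<Sum>n\<le>m. \<bar>(real (m choose n) * (- a) ^ (m - n) * (- b) ^ n) * gpow (\<beta> * real (m - n) + g * real n + g) t\<bar>)"
      using b0 by (simp add: f_def abs_mult sum_distrib_left)
    also have "\<dots> \<le> b * (exp (X + 1) * (t / X) powr g * (\<bar>- a\<bar> * (t / X) powr \<beta> + \<bar>- b\<bar> * (t / X) powr g) ^ m)"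
      using b0 gp by (intro mult_left_mono mlE_bound(1) \<alpha> t X) auto
    also have "\<dots> \<le> b * (exp (X + 1) * (t / X) powr g * (1 / 2) ^ m)"
      using b0 X by (intro mult_left_mono power_mono) auto
    finally show "norm (\<Sum>n\<le>m. \<bar>f n (m - n)\<bar>) \<le> b * (exp (X + 1) * (t / X) powr g) * (1 / 2) ^ m"
      by (simp add: sum_nonneg mult_ac)
  qed
  moreover have "(\<lambda>m. \<Sum>n\<le>m. f n (m - n)) sums S" using T unfolding Tf .
  ultimately have fs: "\<And>n. summable (f n)" "(\<lambda>n. \<Sum>k. f n k) sums S" by (rule triangle_rearrange)+
  have pw: "t powr (\<beta> * real k + g * real n + g) = (t powr \<beta>) ^ k * (t powr g) ^ (n + 1)" for n k
    using t by (simp add: powr_add powr_powr[symmetric] powr_realpow algebra_simps)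
  have "(\<Sum>k. f n k) = (- (\<mu>\<^sup>2 * c\<^sup>2 * t powr (\<alpha> + \<beta>))) ^ (n + 1) *
            mittag_leffler3 (real (n + 1)) \<beta> ((\<alpha> + \<beta>) * real (n + 1) + 1) (- (c\<^sup>2 / D * t powr \<beta>))" for n
  proof -
    define B where "B = (- (b * t powr g)) ^ (n + 1)"
    define e where "e k = pochhammer (real (n + 1)) k * (- (a * t powr \<beta>)) ^ k / (fact k * Gamma (\<beta> * real k + (g * real (n + 1) + 1)))" for k
    have fe: "f n k = B * e k" for k
    proof -
      \<comment> \<open>The binomial coefficient as a rising factorial: this is the origin of the
        upper index n + 1 of the three-parameter Mittag-Leffler function.\<close>
      have c: "real ((n + k) choose n) = pochhammer (real (n + 1)) k / fact k"
      proof -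
        have "fact (n + k) = (fact n * pochhammer (real (n + 1)) k :: real)"
          unfolding pochhammer_fact pochhammer_product' by (simp add: add.commute)
        moreover have "real ((n + k) choose n) = fact (n + k) / (fact n * fact k)"
          using binomial_fact[of n "n + k", where 'a=real] by simp
        ultimately show ?thesis by simp
      qed
      have G: "Gamma (\<beta> * real k + g * real n + g + 1) = Gamma (\<beta> * real k + (g * real (n + 1) + 1))"
        by (intro arg_cong[where f=Gamma]) (simp add: algebra_simps)
      have "f n k = (- b) ^ (n + 1) * ((- a) ^ k * (real ((n + k) choose n) * (t powr (\<beta> * real k + g * real n + g) / Gamma (\<beta> * real k + g * real n + g + 1))))"
        by (simp add: f_def gpow_def)
      also have "\<dots> = (- b) ^ (n + 1) * (t powr g) ^ (n + 1) * (((- a) ^ k * (t powr \<beta>) ^ k) * (pochhammer (real (n + 1)) k / fact k) / Gamma (\<beta> * real k + (g * real (n + 1) + 1)))"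
        unfolding G c pw by simp
      also have "\<dots> = B * e k"
      proof -
        have "(- b) ^ (n + 1) * (t powr g) ^ (n + 1) = B" "(- a) ^ k * (t powr \<beta>) ^ k = (- (a * t powr \<beta>)) ^ k"
          unfolding B_def power_mult_distrib[symmetric] by simp_all
        then show ?thesis by (simp add: e_def)
      qed
      finally show ?thesis .
    qed
    have "(\<Sum>k. f n k) = B * (\<Sum>k. e k)"
    \<comment> \<open>Summability of \<open>B * e k\<close> carries over to \<open>e\<close> only if
      B is nonzero; for B = 0 both sides vanish, whatever the value of the sum of
      \<open>e\<close>.\<close>
    proof (cases "B = 0")
      case False
      have "f n = (\<lambda>k. B * e k)" by (rule ext) (rule fe)
      then have "summable (\<lambda>k. B * e k)" using fs(1)[of n] by (simp only:)
      then show ?thesis unfolding fe using suminf_mult[of e B] summable_cmult_iff[of B e] False by simp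
    qed (simp add: fe)
    then show ?thesis by (simp add: B_def e_def[abs_def] mittag_leffler3_def a_def b_def g_def)
  qed
  then show "(\<lambda>n. (- (\<mu>\<^sup>2 * c\<^sup>2 * t powr (\<alpha> + \<beta>))) ^ (n + 1) *
            mittag_leffler3 (real (n + 1)) \<beta> ((\<alpha> + \<beta>) * real (n + 1) + 1) (- (c\<^sup>2 / D * t powr \<beta>))) sums S"
    using fs(2) by simp
  have "(- a) ^ (k - n) * (- b) ^ n * gpow (\<beta> * real (k - n) + g * real n + g) t =
     t powr g * ((- (a * t powr \<beta>)) ^ k * (\<mu>\<^sup>2 * D * t powr \<alpha>) ^ n / Gamma (\<beta> * real k + \<alpha> * real n + \<alpha> + \<beta> + 1))" if "n \<le> k" for n
  proof -
    \<comment> \<open>The coefficient of the second integral is a multiple of that of the first, so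
      all powers of c^2 / D merge into the k-th power.\<close>
    have ba: "- b = (- a) * (\<mu>\<^sup>2 * D)" using D by (simp add: a_def b_def)
    have "(- a) ^ (k - n) * (- b) ^ n = ((- a) ^ (k - n) * (- a) ^ n) * (\<mu>\<^sup>2 * D) ^ n"
      unfolding ba power_mult_distrib by simp
    also have "(- a) ^ (k - n) * (- a) ^ n = (- a) ^ k" using that by (simp flip: power_add)
    finally have 1: "(- a) ^ (k - n) * (- b) ^ n = (- a) ^ k * (\<mu>\<^sup>2 * D) ^ n" .
    have e: "\<beta> * real (k - n) + g * real n + g = (\<beta> * real k + \<alpha> * real n) + g" using that by (simp add: g_def of_nat_diff algebra_simps)
    have 2: "t powr ((\<beta> * real k + \<alpha> * real n) + g) = t powr g * ((t powr \<beta>) ^ k * (t powr \<alpha>) ^ n)"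
      using t by (simp add: powr_add powr_powr[symmetric] powr_realpow)
    have 3: "Gamma (\<beta> * real k + \<alpha> * real n + g + 1) = Gamma (\<beta> * real k + \<alpha> * real n + \<alpha> + \<beta> + 1)" by (simp add: g_def add.assoc)
    have 4: "(- a) ^ k * (t powr \<beta>) ^ k = (- (a * t powr \<beta>)) ^ k" "(\<mu>\<^sup>2 * D) ^ n * (t powr \<alpha>) ^ n = (\<mu>\<^sup>2 * D * t powr \<alpha>) ^ n"
      unfolding power_mult_distrib[symmetric] by simp_all
    have "(- a) ^ k * (\<mu>\<^sup>2 * D) ^ n * (t powr g * ((t powr \<beta>) ^ k * (t powr \<alpha>) ^ n)) = t powr g * (((- a) ^ k * (t powr \<beta>) ^ k) * ((\<mu>\<^sup>2 * D) ^ n * (t powr \<alpha>) ^ n))"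
      by (simp only: mult_ac)
    then show ?thesis unfolding gpow_def e 1 2 3 4 by simp
  qed
  then have "(\<Sum>n\<le>k. (real (k choose n) * (- a) ^ (k - n) * (- b) ^ n) * gpow (\<beta> * real (k - n) + g * real n + g) t) =
     (\<Sum>n\<le>k. t powr g * (real (k choose n) * (- (a * t powr \<beta>)) ^ k * (\<mu>\<^sup>2 * D * t powr \<alpha>) ^ n / Gamma (\<beta> * real k + \<alpha> * real n + \<alpha> + \<beta> + 1)))"
    by (intro sum.cong refl) (simp add: mult.assoc)
  then show "T k = - (\<mu>\<^sup>2 * c\<^sup>2 * t powr (\<alpha> + \<beta>)) *
         (\<Sum>n\<le>k. real (k choose n) * (- (c\<^sup>2 / D * t powr \<beta>)) ^ k * (\<mu>\<^sup>2 * D * t powr \<alpha>) ^ n / Gamma (\<beta> * real k + \<alpha> * real n + \<alpha> + \<beta> + 1))"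
    unfolding T_def mlE_def a_def[symmetric] b_def[symmetric] g_def[symmetric] by (simp add: sum_distrib_left mult.assoc)
qed

section \<open>Plane waves as test functions\<close>

lemma plane_wave_has_derivative:
  "((\<lambda>x. C * exp (\<i> * of_real (\<kappa> \<bullet> x))) has_derivative (\<lambda>h. C * (exp (\<i> * of_real (\<kappa> \<bullet> x)) * (\<i> * of_real (\<kappa> \<bullet> h))))) (at x)"
proof -
  have "((\<lambda>x. \<i> * complex_of_real (\<kappa> \<bullet> x)) has_derivative (\<lambda>h. \<i> * of_real (\<kappa> \<bullet> h))) (at x)"
    by (intro has_derivative_mult_right has_derivative_of_real has_derivative_inner_right has_derivative_ident)
  from has_derivative_compose[OF this DERIV_exp[unfolded has_field_derivative_def]]
  show ?thesis by (intro has_derivative_mult_right) simp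
qed

lemma plane_wave_partial_deriv:
  "partial_deriv i (\<lambda>x. C * exp (\<i> * of_real (\<kappa> \<bullet> x))) = (\<lambda>x. (C * (\<i> * of_real (\<kappa> $ i))) * exp (\<i> * of_real (\<kappa> \<bullet> x)))"
proof
  fix x :: "real^3"
  from frechet_derivative_at[OF plane_wave_has_derivative, symmetric, of C \<kappa> x]
  show "partial_deriv i (\<lambda>x. C * exp (\<i> * of_real (\<kappa> \<bullet> x))) x = (C * (\<i> * of_real (\<kappa> $ i))) * exp (\<i> * of_real (\<kappa> \<bullet> x))"
    by (simp add: partial_deriv_def inner_axis mult_ac)
qed

lemma plane_wave_multi_deriv:
  "\<exists>C. multi_deriv is (\<lambda>x. exp (\<i> * of_real (\<kappa> \<bullet> x))) = (\<lambda>x. C * exp (\<i> * of_real (\<kappa> \<bullet> x)))"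
proof (induction "is")
  case Nil
  show ?case by (rule exI[of _ 1]) simp
next
  case (Cons i "is")
  then obtain C where "multi_deriv is (\<lambda>x. exp (\<i> * of_real (\<kappa> \<bullet> x))) = (\<lambda>x. C * exp (\<i> * of_real (\<kappa> \<bullet> x)))" by blast
  then show ?case by (auto simp: plane_wave_partial_deriv)
qed

lemma plane_wave_bounded_smooth: "(\<lambda>x. exp (\<i> * of_real (\<kappa> \<bullet> x))) \<in> bounded_smooth"
  unfolding bounded_smooth_def mem_Collect_eq
proof
  fix "is"
  obtain C where C: "multi_deriv is (\<lambda>x. exp (\<i> * of_real (\<kappa> \<bullet> x))) = (\<lambda>x. C * exp (\<i> * of_real (\<kappa> \<bullet> x)))"
    using plane_wave_multi_deriv by blast
  have "(\<lambda>x. C * exp (\<i> * of_real (\<kappa> \<bullet> x))) differentiable (at x)" for x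
    unfolding differentiable_def using plane_wave_has_derivative by blast
  moreover have "bounded (range (\<lambda>x. C * exp (\<i> * of_real (\<kappa> \<bullet> x))))"
    unfolding bounded_iff by (auto simp: norm_mult intro!: exI[of _ "norm C"])
  ultimately show "multi_deriv is (\<lambda>x. exp (\<i> * of_real (\<kappa> \<bullet> x))) differentiable_on UNIV \<and> bounded (range (multi_deriv is (\<lambda>x. exp (\<i> * of_real (\<kappa> \<bullet> x)))))"
    unfolding C by (simp add: differentiable_on_def)
qed

lemma plane_wave_laplacian:
  "laplacian (\<lambda>x. exp (\<i> * of_real (\<kappa> \<bullet> x))) = (\<lambda>x. of_real (- (norm \<kappa>)\<^sup>2) * exp (\<i> * of_real (\<kappa> \<bullet> x)))"
proof
  fix x :: "real^3"
  have p1: "partial_deriv i (\<lambda>x. exp (\<i> * of_real (\<kappa> \<bullet> x))) = (\<lambda>x. (\<i> * of_real (\<kappa> $ i)) * exp (\<i> * of_real (\<kappa> \<bullet> x)))" for i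
    using plane_wave_partial_deriv[of i 1 \<kappa>] by simp
  have "laplacian (\<lambda>x. exp (\<i> * of_real (\<kappa> \<bullet> x))) x = (\<Sum>i\<in>UNIV. of_real (- (\<kappa> $ i)\<^sup>2) * exp (\<i> * of_real (\<kappa> \<bullet> x)))"
    unfolding laplacian_def p1 plane_wave_partial_deriv by (intro sum.cong refl) (simp add: power2_eq_square algebra_simps)
  also have "\<dots> = of_real (- (\<Sum>i\<in>UNIV. (\<kappa> $ i)\<^sup>2)) * exp (\<i> * of_real (\<kappa> \<bullet> x))"
    by (simp add: sum_distrib_right sum_negf)
  also have "(\<Sum>i\<in>UNIV. (\<kappa> $ i)\<^sup>2) = (norm \<kappa>)\<^sup>2"
    unfolding power2_norm_eq_inner inner_vec_def by (simp add: power2_eq_square)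
  finally show "laplacian (\<lambda>x. exp (\<i> * of_real (\<kappa> \<bullet> x))) x = of_real (- (norm \<kappa>)\<^sup>2) * exp (\<i> * of_real (\<kappa> \<bullet> x))" .
qed

section \<open>The Fourier transform of the fundamental solution\<close>

text \<open>The singularities lie at opposite ends, that of \<open>f\<close> at 0 and that of the
  kernel at t. The interval is cut at t / 2, so that on each half one factor is continuous up to the
  boundary.\<close>

lemma kernel_mult_integrable:
  fixes f :: "real \<Rightarrow> real"
  assumes b: "b > 0" and t: "t > 0" and f: "set_integrable lborel {0<..<t} f" and c: "continuous_on {0<..} f"
  shows "set_integrable lborel {0<..<t} (\<lambda>s. (t - s) powr (b - 1) * f s)"
proof -
  have "set_integrable lborel {0<..<t/2} (\<lambda>s. f s * (t - s) powr (b - 1))"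
  proof (rule set_integrable_mult_bounded)
    show "set_integrable lborel {0<..<t/2} f" by (rule set_integrable_subset[OF f]) (use t in auto)
    show "continuous_on {0..t/2} (\<lambda>s. (t - s) powr (b - 1))" using t by (intro continuous_intros) auto
  qed
  then have 1: "set_integrable lborel {0<..<t/2} (\<lambda>s. (t - s) powr (b - 1) * f s)" by (simp add: mult.commute)
  \<comment> \<open>Freezing \<open>f\<close> at t / 2 to the left of that point makes it continuous
    on the whole closed interval without changing it on the right half.\<close>
  define g where "g s = f (max s (t/2))" for s
  have "continuous_on {0..t} g"
    unfolding g_def by (rule continuous_on_compose2[OF c]) (use t in \<open>auto intro!: continuous_intros\<close>)
  from RLi_continuous[OF b t this] have "set_integrable lborel {t/2..<t} (\<lambda>s. (t - s) powr (b - 1) * g s)"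
    unfolding RLi_def by (rule set_integrable_subset) (use t in auto)
  also have "?this \<longleftrightarrow> set_integrable lborel {t/2..<t} (\<lambda>s. (t - s) powr (b - 1) * f s)"
    by (rule set_integrable_cong) (auto simp: g_def max_def)
  finally have "set_integrable lborel ({0<..<t/2} \<union> {t/2..<t}) (\<lambda>s. (t - s) powr (b - 1) * f s)"
    by (intro set_integrable_Un 1) auto
  also have "{0<..<t/2} \<union> {t/2..<t} = {0<..<t}" using t by auto
  finally show ?thesis .
qed

lemma set_integrable_Re_Im:
  fixes f :: "real \<Rightarrow> complex"
  shows "set_integrable M S f \<longleftrightarrow> set_integrable M S (\<lambda>x. Re (f x)) \<and> set_integrable M S (\<lambda>x. Im (f x))"
proof safe
  assume "set_integrable M S (\<lambda>x. Re (f x))" "set_integrable M S (\<lambda>x. Im (f x))"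
  then have "integrable M (\<lambda>x. complex_of_real (indicator S x *\<^sub>R Re (f x)) + \<i> * of_real (indicator S x *\<^sub>R Im (f x)))"
    unfolding set_integrable_def by (intro Bochner_Integration.integrable_add integrable_mult_right integrable_of_real)
  also have "(\<lambda>x. complex_of_real (indicator S x *\<^sub>R Re (f x)) + \<i> * of_real (indicator S x *\<^sub>R Im (f x))) = (\<lambda>x. indicator S x *\<^sub>R f x)"
    by (auto simp: fun_eq_iff complex_eq_iff)
  finally show "set_integrable M S f" by (simp add: set_integrable_def)
next
  assume "set_integrable M S f"
  then have "integrable M (\<lambda>x. Re (indicator S x *\<^sub>R f x))" "integrable M (\<lambda>x. Im (indicator S x *\<^sub>R f x))"
    unfolding set_integrable_def by (auto simp only: integrable_Re integrable_Im)
  then show "set_integrable M S (\<lambda>x. Re (f x))" "set_integrable M S (\<lambda>x. Im (f x))" by (simp_all add: set_integrable_def)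
qed

lemma set_integral_Re_Im:
  fixes f :: "real \<Rightarrow> complex"
  assumes "set_integrable M S f"
  shows "Re (LINT x:S|M. f x) = (LINT x:S|M. Re (f x))" "Im (LINT x:S|M. f x) = (LINT x:S|M. Im (f x))"
proof -
  have "integrable M (\<lambda>x. indicator S x *\<^sub>R f x)" using assms by (simp add: set_integrable_def)
  from integral_Re[OF this] integral_Im[OF this]
  show "Re (LINT x:S|M. f x) = (LINT x:S|M. Re (f x))" "Im (LINT x:S|M. f x) = (LINT x:S|M. Im (f x))"
    by (simp_all add: set_lebesgue_integral_def)
qed

lemma caputo_kernel_RL:
  fixes f :: "real \<Rightarrow> complex"
  assumes b: "b > 0" and t: "t > 0" and f: "set_integrable lborel {0<..<t} f" and c: "continuous_on {0<..} f"
  shows "Re (of_real (1 / Gamma b) * (LINT s:{0<..<t}|lborel. f s / of_real ((t - s) powr (1 - b)))) = RL b (\<lambda>s. Re (f s)) t"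
    and "Im (of_real (1 / Gamma b) * (LINT s:{0<..<t}|lborel. f s / of_real ((t - s) powr (1 - b)))) = RL b (\<lambda>s. Im (f s)) t"
proof -
  have eq: "f s / of_real ((t - s) powr (1 - b)) = of_real ((t - s) powr (b - 1)) * f s" for s
  proof -
    have "(t - s) powr (b - 1) = inverse ((t - s) powr (1 - b))" by (simp flip: powr_minus)
    then show ?thesis by (simp add: divide_inverse mult.commute)
  qed
  have i: "set_integrable lborel {0<..<t} (\<lambda>s. Re (f s))" "set_integrable lborel {0<..<t} (\<lambda>s. Im (f s))"
    using f by (auto simp: set_integrable_Re_Im)
  have "set_integrable lborel {0<..<t} (\<lambda>s. of_real ((t - s) powr (b - 1)) * f s)"
    unfolding set_integrable_Re_Im
    using kernel_mult_integrable[OF b t i(1)] kernel_mult_integrable[OF b t i(2)] c by (simp add: continuous_on_Re continuous_on_Im)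
  note R = set_integral_Re_Im[OF this]
  show "Re (of_real (1 / Gamma b) * (LINT s:{0<..<t}|lborel. f s / of_real ((t - s) powr (1 - b)))) = RL b (\<lambda>s. Re (f s)) t"
    "Im (of_real (1 / Gamma b) * (LINT s:{0<..<t}|lborel. f s / of_real ((t - s) powr (1 - b)))) = RL b (\<lambda>s. Im (f s)) t"
    unfolding eq RL_def using R by simp_all
qed

text \<open>The bounds on \<gamma> identify the ceiling in \<open>caputo\<close> with n, and its
  integer branch \<gamma> = n corresponds to order 0 of \<open>RLz\<close>.\<close>

lemma caputo_RLz:
  fixes v :: "real \<Rightarrow> complex"
  assumes n: "n > 0" "real n - 1 < \<gamma>" "\<gamma> \<le> real n" and t: "t > 0"
    and f: "set_integrable lborel {0<..<t} ((tderiv ^^ n) v)" and c: "continuous_on {0<..} ((tderiv ^^ n) v)"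
  shows "Re (caputo \<gamma> v t) = RLz (real n - \<gamma>) (\<lambda>s. Re ((tderiv ^^ n) v s)) t"
    and "Im (caputo \<gamma> v t) = RLz (real n - \<gamma>) (\<lambda>s. Im ((tderiv ^^ n) v s)) t"
proof -
  have "\<lceil>\<gamma>\<rceil> = int n" using n by (intro ceiling_unique) auto
  then have nn: "nat \<lceil>\<gamma>\<rceil> = n" by simp
  have e: "\<gamma> + 1 - real n = 1 - (real n - \<gamma>)" by simp
  show "Re (caputo \<gamma> v t) = RLz (real n - \<gamma>) (\<lambda>s. Re ((tderiv ^^ n) v s)) t"
    "Im (caputo \<gamma> v t) = RLz (real n - \<gamma>) (\<lambda>s. Im ((tderiv ^^ n) v s)) t"
    unfolding caputo_def nn Let_def RLz_def e
    using caputo_kernel_RL[OF _ t f c, of "real n - \<gamma>"] n by auto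
qed

text \<open>At t > 0 the half line is a neighbourhood of t, so the derivative relative to it is the
  two-sided one.\<close>

lemma tderiv_has_derivative:
  fixes v :: "real \<Rightarrow> complex"
  assumes "v differentiable_on {0<..}" "t > 0"
  shows "((\<lambda>s. Re (v s)) has_real_derivative Re (tderiv v t)) (at t)" "((\<lambda>s. Im (v s)) has_real_derivative Im (tderiv v t)) (at t)"
proof -
  have "v differentiable (at t)"
    using assms by (auto simp: differentiable_on_eq_differentiable_at)
  then have "(v has_vector_derivative vector_derivative v (at t)) (at t)" using vector_derivative_works by blast
  moreover have "tderiv v t = vector_derivative v (at t)"
  proof -
    have "at t within {0..} = at t" by (rule at_within_interior) (use assms(2) in simp)
    then show ?thesis by (simp only: tderiv_def)
  qed
  ultimately have "(v has_vector_derivative tderiv v t) (at t)" by (simp only:)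
  note d = bounded_linear.has_vector_derivative[OF bounded_linear_Re this] bounded_linear.has_vector_derivative[OF bounded_linear_Im this]
  show "((\<lambda>s. Re (v s)) has_real_derivative Re (tderiv v t)) (at t)" "((\<lambda>s. Im (v s)) has_real_derivative Im (tderiv v t)) (at t)"
    unfolding has_real_derivative_iff_has_vector_derivative by (rule d)+
qed

locale fundamental =
  fixes \<alpha> \<beta> c D :: real and Q :: "real \<Rightarrow> (real^3 \<Rightarrow> complex) \<Rightarrow> complex" and H :: "real \<Rightarrow> real \<Rightarrow> complex"
  assumes \<alpha>: "0 < \<alpha>" "\<alpha> \<le> 1" and \<gamma>: "1 < \<alpha> + \<beta>" "\<alpha> + \<beta> \<le> 2" and cD: "c > 0" "D > 0"
    and Q: "fundamental_solution \<alpha> \<beta> c D Q"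
    and H: "\<And>\<kappa> t. t \<ge> 0 \<Longrightarrow> H (norm \<kappa>) t = fourier_distribution (Q t) \<kappa>"
begin

text \<open>Testing the equation with a plane wave replaces the Laplacian by the factor - \<mu>^2.
  The coefficients are real, so real and imaginary part solve the same scalar equation, with initial
  values 1 and 0. Since \<open>H\<close> is specified at nonnegative times only, time enters as
  \<open>max 0 t\<close>.\<close>

lemma H_real_solution:
  assumes \<mu>: "\<mu> \<ge> 0"
  shows "\<exists>w w2. frac_ode \<alpha> \<beta> (c\<^sup>2 / D) (\<mu>\<^sup>2 * c\<^sup>2) 1 (\<lambda>t. Re (H \<mu> (max 0 t))) w w2"
    and "\<exists>w w2. frac_ode \<alpha> \<beta> (c\<^sup>2 / D) (\<mu>\<^sup>2 * c\<^sup>2) 0 (\<lambda>t. Im (H \<mu> (max 0 t))) w w2"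
proof -
  \<comment> \<open>Some vector of norm \<mu>; its direction is immaterial because \<open>H\<close>
    depends on the norm alone.\<close>
  define \<kappa> :: "real^3" where "\<kappa> = axis 1 \<mu>"
  have \<kappa>: "norm \<kappa> = \<mu>" using \<mu> by (simp add: \<kappa>_def norm_eq_sqrt_inner inner_axis_axis)
  define \<phi> :: "real^3 \<Rightarrow> complex" where "\<phi> = (\<lambda>x. exp (\<i> * of_real (\<kappa> \<bullet> x)))"
  have \<phi>: "\<phi> \<in> bounded_smooth" unfolding \<phi>_def by (rule plane_wave_bounded_smooth)
  define v where "v t = Q t \<phi>" for t
  have Hv: "H \<mu> t = v t" if "t \<ge> 0" for t
    using H[OF that, of \<kappa>] by (simp add: \<kappa> fourier_distribution_def v_def \<phi>_def)
  have reg: "caputo_regular 2 v" and eqn: "\<And>t. t > 0 \<Longrightarrow> of_real (1 / c\<^sup>2) * caputo (\<alpha> + \<beta>) v t + of_real (1 / D) * caputo \<alpha> v t = Q t (laplacian \<phi>)"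
    and v0: "v 0 = 1" "tderiv v 0 = 0" and lin: "\<And>t a. t \<ge> 0 \<Longrightarrow> Q t (\<lambda>x. a * \<phi> x) = a * v t"
    using Q \<phi> unfolding fundamental_solution_def v_def[abs_def] integrable_distribution_def by (auto simp: \<phi>_def)
  have lap: "Q t (laplacian \<phi>) = of_real (- \<mu>\<^sup>2) * v t" if "t > 0" for t
  proof -
    have "laplacian \<phi> = (\<lambda>x. of_real (- \<mu>\<^sup>2) * \<phi> x)" unfolding \<phi>_def plane_wave_laplacian \<kappa> ..
    then show ?thesis using lin[of t "of_real (- \<mu>\<^sup>2)"] that by simp
  qed
  define w where "w = tderiv v"
  define w2 where "w2 = tderiv w"
  have t2: "(tderiv ^^ 0) v = v" "(tderiv ^^ 1) v = w" "(tderiv ^^ 2) v = w2" by (simp_all add: w_def w2_def numeral_2_eq_2)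
  have less2: "(\<forall>k<2. P k) \<longleftrightarrow> P 0 \<and> P 1" for P :: "nat \<Rightarrow> bool" by (auto simp: less_2_cases_iff)
  have R: "continuous_on {0..} v" "continuous_on {0..} w" "v differentiable_on {0<..}" "w differentiable_on {0<..}"
    "continuous_on {0<..} w2" "\<And>T. T > 0 \<Longrightarrow> set_integrable lborel {0<..<T} w2"
    using reg unfolding caputo_regular_def less2 t2 by auto
  have wi: "set_integrable lborel {0<..<t} w" if "t > 0" for t
  proof -
    have "continuous_on {0..t} w" by (rule continuous_on_subset[OF R(2)]) auto
    then have "set_integrable lborel {0<..<t} (\<lambda>s. Re (w s))" "set_integrable lborel {0<..<t} (\<lambda>s. Im (w s))"
      by (auto intro!: continuous_set_integrable_Ioo continuous_intros)
    then show ?thesis by (simp add: set_integrable_Re_Im)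
  qed
  have wc: "continuous_on {0<..} w" by (rule continuous_on_subset[OF R(2)]) auto
  have cap2: "Re (caputo (\<alpha> + \<beta>) v t) = RLz (2 - (\<alpha> + \<beta>)) (\<lambda>s. Re (w2 s)) t" "Im (caputo (\<alpha> + \<beta>) v t) = RLz (2 - (\<alpha> + \<beta>)) (\<lambda>s. Im (w2 s)) t" if "t > 0" for t
    using caputo_RLz[of 2 "\<alpha> + \<beta>" t v] \<gamma> that R(5) R(6)[OF that] unfolding t2 by auto
  have cap1: "Re (caputo \<alpha> v t) = RLz (1 - \<alpha>) (\<lambda>s. Re (w s)) t" "Im (caputo \<alpha> v t) = RLz (1 - \<alpha>) (\<lambda>s. Im (w s)) t" if "t > 0" for t
    using caputo_RLz[of 1 \<alpha> t v] \<alpha> that wc wi[OF that] unfolding t2 by auto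
  have e: "RLz (2 - (\<alpha> + \<beta>)) (\<lambda>s. Re (w2 s)) t + (c\<^sup>2 / D) * RLz (1 - \<alpha>) (\<lambda>s. Re (w s)) t + \<mu>\<^sup>2 * c\<^sup>2 * Re (v t) = 0"
    "RLz (2 - (\<alpha> + \<beta>)) (\<lambda>s. Im (w2 s)) t + (c\<^sup>2 / D) * RLz (1 - \<alpha>) (\<lambda>s. Im (w s)) t + \<mu>\<^sup>2 * c\<^sup>2 * Im (v t) = 0" if t: "t > 0" for t
  proof -
    have E: "of_real (1 / c\<^sup>2) * caputo (\<alpha> + \<beta>) v t + of_real (1 / D) * caputo \<alpha> v t = of_real (- \<mu>\<^sup>2) * v t"
      using eqn[OF t] lap[OF t] by simp
    have E1: "(1 / c\<^sup>2) * RLz (2 - (\<alpha> + \<beta>)) (\<lambda>s. Re (w2 s)) t + (1 / D) * RLz (1 - \<alpha>) (\<lambda>s. Re (w s)) t = - \<mu>\<^sup>2 * Re (v t)"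
      using arg_cong[OF E, of Re] unfolding cap1[OF t, symmetric] cap2[OF t, symmetric] by simp
    have E2: "(1 / c\<^sup>2) * RLz (2 - (\<alpha> + \<beta>)) (\<lambda>s. Im (w2 s)) t + (1 / D) * RLz (1 - \<alpha>) (\<lambda>s. Im (w s)) t = - \<mu>\<^sup>2 * Im (v t)"
      using arg_cong[OF E, of Im] unfolding cap1[OF t, symmetric] cap2[OF t, symmetric] by simp
    have gen: "x + (c\<^sup>2 / D) * y + \<mu>\<^sup>2 * c\<^sup>2 * z = 0" if "(1 / c\<^sup>2) * x + (1 / D) * y = - \<mu>\<^sup>2 * z" for x y z
    proof -
      have "c\<^sup>2 * ((1 / c\<^sup>2) * x + (1 / D) * y) = c\<^sup>2 * (- \<mu>\<^sup>2 * z)" unfolding that ..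
      then show ?thesis using cD by (simp add: algebra_simps)
    qed
    show "RLz (2 - (\<alpha> + \<beta>)) (\<lambda>s. Re (w2 s)) t + (c\<^sup>2 / D) * RLz (1 - \<alpha>) (\<lambda>s. Re (w s)) t + \<mu>\<^sup>2 * c\<^sup>2 * Re (v t) = 0"
      "RLz (2 - (\<alpha> + \<beta>)) (\<lambda>s. Im (w2 s)) t + (c\<^sup>2 / D) * RLz (1 - \<alpha>) (\<lambda>s. Im (w s)) t + \<mu>\<^sup>2 * c\<^sup>2 * Im (v t) = 0"
      by (rule gen[OF E1], rule gen[OF E2])
  qed
  have cont: "continuous_on {0..} (\<lambda>t. Re (H \<mu> (max 0 t)))" "continuous_on {0..} (\<lambda>t. Im (H \<mu> (max 0 t)))"
    using continuous_on_Re[OF R(1)] continuous_on_Im[OF R(1)] by (auto simp: Hv max_def cong: continuous_on_cong_simp)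
  have der: "((\<lambda>t. Re (H \<mu> (max 0 t))) has_real_derivative Re (w t)) (at t)" "((\<lambda>t. Im (H \<mu> (max 0 t))) has_real_derivative Im (w t)) (at t)" if t: "t > 0" for t
  proof -
    have ev: "\<forall>\<^sub>F s in nhds t. v s = H \<mu> (max 0 s)"
      using eventually_nhds_in_open[of "{0<..}" t] t by (auto elim!: eventually_mono simp: Hv)
    show "((\<lambda>t. Re (H \<mu> (max 0 t))) has_real_derivative Re (w t)) (at t)" "((\<lambda>t. Im (H \<mu> (max 0 t))) has_real_derivative Im (w t)) (at t)"
      using tderiv_has_derivative[OF R(3) t, folded w_def] ev
      by (auto elim!: DERIV_cong_ev[OF refl _ refl, THEN iffD1, rotated] eventually_mono)
  qed
  have i2: "set_integrable lborel {0<..<T} (\<lambda>s. Re (w2 s))" "set_integrable lborel {0<..<T} (\<lambda>s. Im (w2 s))" if "T > 0" for T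
    using R(6)[OF that] by (auto simp: set_integrable_Re_Im)
  have "frac_ode \<alpha> \<beta> (c\<^sup>2 / D) (\<mu>\<^sup>2 * c\<^sup>2) 1 (\<lambda>t. Re (H \<mu> (max 0 t))) (\<lambda>s. Re (w s)) (\<lambda>s. Re (w2 s))"
    by unfold_locales (use \<alpha> \<gamma> cD cont der i2 e v0 R tderiv_has_derivative[OF R(4), folded w2_def] in \<open>auto simp: Hv w_def[symmetric] intro!: continuous_intros\<close>)
  then show "\<exists>w w2. frac_ode \<alpha> \<beta> (c\<^sup>2 / D) (\<mu>\<^sup>2 * c\<^sup>2) 1 (\<lambda>t. Re (H \<mu> (max 0 t))) w w2" by blast
  have "frac_ode \<alpha> \<beta> (c\<^sup>2 / D) (\<mu>\<^sup>2 * c\<^sup>2) 0 (\<lambda>t. Im (H \<mu> (max 0 t))) (\<lambda>s. Im (w s)) (\<lambda>s. Im (w2 s))"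
    by unfold_locales (use \<alpha> \<gamma> cD cont der i2 e v0 R tderiv_has_derivative[OF R(4), folded w2_def] in \<open>auto simp: Hv w_def[symmetric] intro!: continuous_intros\<close>)
  then show "\<exists>w w2. frac_ode \<alpha> \<beta> (c\<^sup>2 / D) (\<mu>\<^sup>2 * c\<^sup>2) 0 (\<lambda>t. Im (H \<mu> (max 0 t))) w w2" by blast
qed

definition h :: "real \<Rightarrow> real \<Rightarrow> real" where "h \<mu> t = Re (H \<mu> t)"

definition T :: "real \<Rightarrow> real \<Rightarrow> nat \<Rightarrow> real" where
  "T \<mu> t k = (- (\<mu>\<^sup>2 * c\<^sup>2)) * mlE \<beta> (\<alpha> + \<beta>) (- (c\<^sup>2 / D)) (- (\<mu>\<^sup>2 * c\<^sup>2)) (\<alpha> + \<beta>) k t"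

lemma h_0: assumes "\<mu> \<ge> 0" shows "h \<mu> 0 = 1"
proof -
  obtain w w2 where "frac_ode \<alpha> \<beta> (c\<^sup>2 / D) (\<mu>\<^sup>2 * c\<^sup>2) 1 (\<lambda>t. Re (H \<mu> (max 0 t))) w w2" using H_real_solution(1)[OF assms] by blast
  then interpret frac_ode \<alpha> \<beta> "c\<^sup>2 / D" "\<mu>\<^sup>2 * c\<^sup>2" 1 "\<lambda>t. Re (H \<mu> (max 0 t))" w w2 .
  show ?thesis using u_0 by (simp add: h_def)
qed

lemma h_sums: assumes "\<mu> \<ge> 0" "t > 0" shows "T \<mu> t sums (h \<mu> t - 1)"
proof -
  obtain w w2 where "frac_ode \<alpha> \<beta> (c\<^sup>2 / D) (\<mu>\<^sup>2 * c\<^sup>2) 1 (\<lambda>t. Re (H \<mu> (max 0 t))) w w2" using H_real_solution(1)[OF assms(1)] by blast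
  then interpret frac_ode \<alpha> \<beta> "c\<^sup>2 / D" "\<mu>\<^sup>2 * c\<^sup>2" 1 "\<lambda>t. Re (H \<mu> (max 0 t))" w w2 .
  show ?thesis using solution_sums[OF assms(2)] assms(2) by (simp add: h_def T_def[abs_def])
qed

text \<open>The imaginary part has initial value 0, which is a factor of every term of its Neumann
  series.\<close>

lemma H_real: assumes "\<mu> \<ge> 0" "t \<ge> 0" shows "H \<mu> t = of_real (h \<mu> t)"
proof -
  obtain w w2 where "frac_ode \<alpha> \<beta> (c\<^sup>2 / D) (\<mu>\<^sup>2 * c\<^sup>2) 0 (\<lambda>t. Im (H \<mu> (max 0 t))) w w2" using H_real_solution(2)[OF assms(1)] by blast
  then interpret frac_ode \<alpha> \<beta> "c\<^sup>2 / D" "\<mu>\<^sup>2 * c\<^sup>2" 0 "\<lambda>t. Im (H \<mu> (max 0 t))" w w2 .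
  have "Im (H \<mu> t) = 0"
  proof (cases "t = 0")
    case False
    then have "(\<lambda>k. 0) sums Im (H \<mu> t)" using solution_sums[of t] assms by simp
    then show ?thesis using sums_unique2[OF _ sums_zero] by blast
  qed (use u_0 in simp)
  then show ?thesis by (simp add: h_def complex_eq_iff)
qed

lemma h_bound: assumes "\<mu> \<ge> 0" "t \<ge> 0" shows "\<bar>h \<mu> t\<bar> \<le> 1"
proof -
  consider "t = 0" | "t > 0" "\<mu> = 0" | "t > 0" "\<mu> > 0" using assms by linarith
  then show ?thesis
  proof cases
    case 1 then show ?thesis using h_0[OF assms(1)] by simp
  next
    \<comment> \<open>The energy estimate divides by b, which is 0 here; instead all terms of the
      series vanish and h = 1.\<close>
    case 2
    then have "(\<lambda>k. 0) sums (h 0 t - 1)" using h_sums[of 0 t] by (simp add: T_def[abs_def])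
    then have "h 0 t - 1 = 0" using sums_unique2[OF _ sums_zero] by blast
    then show ?thesis using 2 by simp
  next
    case 3
    obtain w w2 where "frac_ode \<alpha> \<beta> (c\<^sup>2 / D) (\<mu>\<^sup>2 * c\<^sup>2) 1 (\<lambda>t. Re (H \<mu> (max 0 t))) w w2" using H_real_solution(1)[OF assms(1)] by blast
    then interpret frac_ode \<alpha> \<beta> "c\<^sup>2 / D" "\<mu>\<^sup>2 * c\<^sup>2" 1 "\<lambda>t. Re (H \<mu> (max 0 t))" w w2 .
    have "(h \<mu> t)\<^sup>2 \<le> 1" using solution_bound[of t] 3 cD assms by (simp add: h_def)
    then show ?thesis by (simp add: abs_square_le_1)
  qed
qed

lemma h_continuous_time: assumes "\<mu> \<ge> 0" shows "continuous_on {0..} (h \<mu>)"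
proof -
  obtain w w2 where "frac_ode \<alpha> \<beta> (c\<^sup>2 / D) (\<mu>\<^sup>2 * c\<^sup>2) 1 (\<lambda>t. Re (H \<mu> (max 0 t))) w w2" using H_real_solution(1)[OF assms] by blast
  then interpret frac_ode \<alpha> \<beta> "c\<^sup>2 / D" "\<mu>\<^sup>2 * c\<^sup>2" 1 "\<lambda>t. Re (H \<mu> (max 0 t))" w w2 .
  show ?thesis using u_cont by (rule continuous_on_eq) (simp add: h_def)
qed

text \<open>The terms of the Neumann series are polynomials in \<mu>, and choosing X for the largest
  frequency R makes the series converge uniformly on [0, R].\<close>

lemma h_continuous: assumes "t \<ge> 0" shows "continuous_on {0..} (\<lambda>\<mu>. h \<mu> t)"
proof (cases "t = 0")
  case True
  have "continuous_on {0..} (\<lambda>_::real. 1::real)" by (rule continuous_on_const)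
  then show ?thesis by (rule continuous_on_eq) (simp add: True h_0)
next
  case False
  then have t: "t > 0" using assms by simp
  have gp: "\<alpha> + \<beta> > 0" "\<beta> > 0" using \<gamma> \<alpha> by auto
  have R: "continuous_on {0..R} (\<lambda>\<mu>. h \<mu> t)" for R
  proof -
    obtain X where X: "X > 0" "\<bar>c\<^sup>2 / D\<bar> * (t / X) powr \<beta> + \<bar>R\<^sup>2 * c\<^sup>2\<bar> * (t / X) powr (\<alpha> + \<beta>) \<le> 1 / 2"
      using mlE_scale_exists[OF gp(2,1) t, of "c\<^sup>2 / D" "R\<^sup>2 * c\<^sup>2"] by auto
    have T_bound: "norm (T \<mu> t k) \<le> R\<^sup>2 * c\<^sup>2 * (exp (X + 1) * (t / X) powr (\<alpha> + \<beta>) * (1 / 2) ^ k)" if "\<mu> \<in> {0..R}" for \<mu> k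
    proof -
      have m: "\<mu>\<^sup>2 \<le> R\<^sup>2" using that by (intro power_mono) auto
      have "\<bar>mlE \<beta> (\<alpha> + \<beta>) (- (c\<^sup>2 / D)) (- (\<mu>\<^sup>2 * c\<^sup>2)) (\<alpha> + \<beta>) k t\<bar> \<le>
        exp (X + 1) * (t / X) powr (\<alpha> + \<beta>) * (\<bar>- (c\<^sup>2 / D)\<bar> * (t / X) powr \<beta> + \<bar>- (\<mu>\<^sup>2 * c\<^sup>2)\<bar> * (t / X) powr (\<alpha> + \<beta>)) ^ k"
        by (rule mlE_bound(2)) (use gp t X in auto)
      also have "\<dots> \<le> exp (X + 1) * (t / X) powr (\<alpha> + \<beta>) * (1 / 2) ^ k"
      proof (intro mult_left_mono power_mono)
        have "\<bar>\<mu>\<^sup>2 * c\<^sup>2\<bar> * (t / X) powr (\<alpha> + \<beta>) \<le> \<bar>R\<^sup>2 * c\<^sup>2\<bar> * (t / X) powr (\<alpha> + \<beta>)"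
          using m by (intro mult_right_mono) (auto simp: abs_mult mult_right_mono)
        then show "\<bar>- (c\<^sup>2 / D)\<bar> * (t / X) powr \<beta> + \<bar>- (\<mu>\<^sup>2 * c\<^sup>2)\<bar> * (t / X) powr (\<alpha> + \<beta>) \<le> 1 / 2" using X(2) by simp
      qed auto
      finally have "\<mu>\<^sup>2 * c\<^sup>2 * \<bar>mlE \<beta> (\<alpha> + \<beta>) (- (c\<^sup>2 / D)) (- (\<mu>\<^sup>2 * c\<^sup>2)) (\<alpha> + \<beta>) k t\<bar> \<le> R\<^sup>2 * c\<^sup>2 * (exp (X + 1) * (t / X) powr (\<alpha> + \<beta>) * (1 / 2) ^ k)"
        using m by (intro mult_mono mult_right_mono) auto
      then show ?thesis by (simp add: T_def abs_mult)
    qed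
    have "summable (\<lambda>k. R\<^sup>2 * c\<^sup>2 * (exp (X + 1) * (t / X) powr (\<alpha> + \<beta>) * (1 / 2) ^ k))"
      by (intro summable_mult summable_geometric) auto
    then have ul: "uniform_limit {0..R} (\<lambda>n \<mu>. \<Sum>k<n. T \<mu> t k) (\<lambda>\<mu>. \<Sum>k. T \<mu> t k) sequentially"
    proof (rule Weierstrass_m_test[rotated])
      show "norm (T \<mu> t k) \<le> R\<^sup>2 * c\<^sup>2 * (exp (X + 1) * (t / X) powr (\<alpha> + \<beta>) * (1 / 2) ^ k)" if "\<mu> \<in> {0..R}" for k \<mu>
        by (rule T_bound[OF that])
    qed
    have "continuous_on {0..R} (\<lambda>\<mu>. \<Sum>k. T \<mu> t k)"
      by (rule uniform_limit_theorem[OF _ ul]) (auto intro!: always_eventually continuous_intros simp: T_def mlE_def)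
    then have "continuous_on {0..R} (\<lambda>\<mu>. 1 + (\<Sum>k. T \<mu> t k))" by (intro continuous_intros)
    then show ?thesis by (rule continuous_on_eq) (use h_sums[OF _ t] in \<open>auto simp: sums_iff\<close>)
  qed
  show ?thesis
    unfolding continuous_on_eq_continuous_within
  proof
    fix \<mu> :: real assume "\<mu> \<in> {0..}"
    then have "continuous (at \<mu> within {0..\<mu>+1}) (\<lambda>\<mu>. h \<mu> t)" using R[of "\<mu> + 1"] by (simp add: continuous_on_eq_continuous_within)
    \<comment> \<open>Continuity at \<mu> only sees a neighbourhood of \<mu>, so continuity on the
      compact intervals carries over to the half line.\<close>
    moreover have "at \<mu> within {0..\<mu>+1} = at \<mu> within {0..}"
      by (rule at_within_nhd[of _ "{..<\<mu>+1}"]) auto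
    ultimately show "continuous (at \<mu> within {0..}) (\<lambda>\<mu>. h \<mu> t)" by simp
  qed
qed

text \<open>The second sum arises from the Neumann series by dividing out the factor \<mu>^2 c^2
  t^(\<alpha> + \<beta>). Where this factor vanishes, at t = 0 or \<mu> = 0, one has H = 1 and
  convergence of the second series is shown separately.\<close>

lemma H_series:
  assumes "\<mu> \<ge> 0" "t \<ge> 0"
  shows "\<exists>S1 S2 :: real.
      (\<lambda>n. (- (\<mu>\<^sup>2 * c\<^sup>2 * t powr (\<alpha> + \<beta>))) ^ (n + 1) *
           mittag_leffler3 (real (n + 1)) \<beta> ((\<alpha> + \<beta>) * real (n + 1) + 1) (- (c\<^sup>2 / D * t powr \<beta>))) sums S1 \<and>
      (\<lambda>m. \<Sum>n\<le>m. real (m choose n) * (- (c\<^sup>2 / D * t powr \<beta>)) ^ m * (\<mu>\<^sup>2 * D * t powr \<alpha>) ^ n /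
           Gamma (\<beta> * real m + \<alpha> * real n + \<alpha> + \<beta> + 1)) sums S2 \<and>
      H \<mu> t = of_real (1 + S1) \<and> H \<mu> t = of_real (1 - \<mu>\<^sup>2 * c\<^sup>2 * t powr (\<alpha> + \<beta>) * S2)"
proof (cases "t = 0")
  case True
  let ?f = "\<lambda>m. \<Sum>n\<le>m. real (m choose n) * (- (c\<^sup>2 / D * t powr \<beta>)) ^ m * (\<mu>\<^sup>2 * D * t powr \<alpha>) ^ n / Gamma (\<beta> * real m + \<alpha> * real n + \<alpha> + \<beta> + 1)"
  \<comment> \<open>As 0 powr \<beta> = 0 while its zeroth power is 1, the term m = 0 alone
    survives.\<close>
  have "?f sums (\<Sum>m\<in>{0}. ?f m)"
    by (rule sums_finite) (auto simp: True power_0_left)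
  moreover have "H \<mu> t = 1" using H_real[OF assms] h_0[OF assms(1)] True by simp
  ultimately show ?thesis by (intro exI[of _ 0] exI[of _ "\<Sum>m\<in>{0}. ?f m"]) (simp add: True)
next
  case False
  then have t: "t > 0" using assms by simp
  have bp: "\<beta> > 0" using \<gamma> \<alpha> by auto
  have T: "(\<lambda>k. (- (\<mu>\<^sup>2 * c\<^sup>2)) * mlE \<beta> (\<alpha> + \<beta>) (- (c\<^sup>2 / D)) (- (\<mu>\<^sup>2 * c\<^sup>2)) (\<alpha> + \<beta>) k t) sums (h \<mu> t - 1)"
    using h_sums[OF assms(1) t] by (simp add: T_def[abs_def])
  note M = mittag_leffler_series[OF \<alpha>(1) \<gamma>(1) bp t cD(2) T]
  let ?f = "\<lambda>m. \<Sum>n\<le>m. real (m choose n) * (- (c\<^sup>2 / D * t powr \<beta>)) ^ m * (\<mu>\<^sup>2 * D * t powr \<alpha>) ^ n / Gamma (\<beta> * real m + \<alpha> * real n + \<alpha> + \<beta> + 1)"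
  define x where "x = \<mu>\<^sup>2 * c\<^sup>2 * t powr (\<alpha> + \<beta>)"
  show ?thesis
  proof (cases "\<mu> = 0")
    case False
    then have x: "x \<noteq> 0" using t cD by (simp add: x_def)
    have "(\<lambda>k. - x * ?f k) sums (h \<mu> t - 1)" using T unfolding M(2) x_def .
    then have "(\<lambda>k. (- 1 / x) * (- x * ?f k)) sums ((- 1 / x) * (h \<mu> t - 1))" by (rule sums_mult)
    then have s2: "?f sums ((- 1 / x) * (h \<mu> t - 1))" using x by simp
    show ?thesis
      by (rule exI[of _ "h \<mu> t - 1"], rule exI[of _ "(- 1 / x) * (h \<mu> t - 1)"], intro conjI M(1) s2)
         (use x in \<open>simp_all add: H_real assms x_def[symmetric]\<close>)
  next
    case True
    have "(\<lambda>k. 0) sums (h \<mu> t - 1)" using T True by simp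
    then have h1: "h \<mu> t = 1" using sums_unique2[OF _ sums_zero] by force
    have fe: "?f m = (- (c\<^sup>2 / D * t powr \<beta>)) ^ m / Gamma (\<beta> * real m + \<alpha> + \<beta> + 1)" for m
    proof -
      have "?f m = (\<Sum>n\<le>m. if n = 0 then (- (c\<^sup>2 / D * t powr \<beta>)) ^ m / Gamma (\<beta> * real m + \<alpha> + \<beta> + 1) else 0)"
        by (intro sum.cong refl) (auto simp: True)
      then show ?thesis by simp
    qed
    obtain X where X: "X > 0" "\<bar>c\<^sup>2 / D\<bar> * (t / X) powr \<beta> + \<bar>0\<bar> * (t / X) powr \<beta> \<le> 1 / 2"
      using mlE_scale_exists[OF bp bp t, of "c\<^sup>2 / D" 0] by auto
    have "summable ?f"
      unfolding fe
    proof (rule summable_comparison_test')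
      show "summable (\<lambda>m. (exp (X + 1) / X powr (\<alpha> + \<beta>)) * (1 / 2) ^ m)" by (intro summable_mult summable_geometric) auto
      fix m :: nat
      have p: "\<beta> * real m + \<alpha> + \<beta> \<ge> 0" using bp \<alpha> by simp
      then have G: "Gamma (\<beta> * real m + \<alpha> + \<beta> + 1) > 0" by (intro Gamma_real_pos) auto
      have "1 / Gamma (\<beta> * real m + \<alpha> + \<beta> + 1) \<le> exp (X + 1) / X powr (\<beta> * real m + \<alpha> + \<beta>)"
        using Gamma_lower_bound[OF X(1) p] G X by (simp add: field_simps)
      also have "X powr (\<beta> * real m + \<alpha> + \<beta>) = (X powr \<beta>) ^ m * X powr (\<alpha> + \<beta>)"
        using X by (simp add: powr_add powr_powr[symmetric] powr_realpow)
      finally have 1: "1 / Gamma (\<beta> * real m + \<alpha> + \<beta> + 1) \<le> exp (X + 1) / ((X powr \<beta>) ^ m * X powr (\<alpha> + \<beta>))" .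
      have "norm ((- (c\<^sup>2 / D * t powr \<beta>)) ^ m / Gamma (\<beta> * real m + \<alpha> + \<beta> + 1)) = (c\<^sup>2 / D * t powr \<beta>) ^ m * (1 / Gamma (\<beta> * real m + \<alpha> + \<beta> + 1))"
        using G cD by (simp add: norm_mult norm_divide norm_power power_abs abs_mult)
      also have "\<dots> \<le> (c\<^sup>2 / D * t powr \<beta>) ^ m * (exp (X + 1) / ((X powr \<beta>) ^ m * X powr (\<alpha> + \<beta>)))"
        using cD by (intro mult_left_mono 1) auto
      also have "\<dots> = (exp (X + 1) / X powr (\<alpha> + \<beta>)) * (c\<^sup>2 / D * (t / X) powr \<beta>) ^ m"
        using X t by (simp add: powr_divide power_divide power_mult_distrib mult_ac)
      also have "\<dots> \<le> (exp (X + 1) / X powr (\<alpha> + \<beta>)) * (1 / 2) ^ m"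
        using X cD by (intro mult_left_mono power_mono) auto
      finally show "norm ((- (c\<^sup>2 / D * t powr \<beta>)) ^ m / Gamma (\<beta> * real m + \<alpha> + \<beta> + 1)) \<le> (exp (X + 1) / X powr (\<alpha> + \<beta>)) * (1 / 2) ^ m" .
    qed
    then show ?thesis
      by - (rule exI[of _ "h \<mu> t - 1"], rule exI[of _ "suminf ?f"], intro conjI M(1) summable_sums,
         simp_all add: H_real[OF assms] h1, simp add: True)
  qed
qed

end

section \<open>Spherical harmonics\<close>

text \<open>
  \<open>sphc l m x y z\<close> is the coefficient of \<open>w\<^sup>m\<close> in the Laurent polynomial
  \<open>(- (x - \<i> y) / w + 2 z + (x + \<i> y) w)\<^sup>l\<close>.  Up to constants these are the solid harmonics.
\<close>

fun sphc :: "nat \<Rightarrow> int \<Rightarrow> real \<Rightarrow> real \<Rightarrow> real \<Rightarrow> complex" where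
  "sphc 0 m x y z = (if m = 0 then 1 else 0)"
| "sphc (Suc l) m x y z = - (of_real x - \<i> * of_real y) * sphc l (m + 1) x y z
     + 2 * of_real z * sphc l m x y z + (of_real x + \<i> * of_real y) * sphc l (m - 1) x y z"

lemma sphc_eq_0: "\<bar>m\<bar> > int l \<Longrightarrow> sphc l m x y z = 0"
  by (induction l arbitrary: m) auto

text \<open>Conjugating the coefficients of the generating Laurent polynomial and substituting -1 /
  w for w leaves the polynomial unchanged.\<close>

lemma sphc_uminus: "sphc l (- m) x y z = (-1) powi m * cnj (sphc l m x y z)"
proof (induction l arbitrary: m)
  case (Suc l)
  have p: "(-1::complex) powi (m + 1) = - ((-1) powi m)" "(-1::complex) powi (m - 1) = - ((-1) powi m)"
    by (auto simp: power_int_add power_int_diff)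
  have e: "- m + 1 = - (m - 1)" "- m - 1 = - (m + 1)" by simp_all
  show ?case unfolding sphc.simps e Suc.IH p by (simp add: algebra_simps)
qed auto

lemma sphc_pole: "sphc l m 0 0 z = (if m = 0 then (2 * of_real z) ^ l else 0)"
  by (induction l arbitrary: m) auto

text \<open>The rotation multiplies x + i y by \<open>cis a\<close>, which in the generating
  polynomial amounts to replacing w by \<open>cis a * w\<close>.\<close>

lemma sphc_rotate_z:
  "sphc l m (x * cos a - y * sin a) (x * sin a + y * cos a) z = cis (of_int m * a) * sphc l m x y z"
proof (induction l arbitrary: m)
  case (Suc l)
  have p: "complex_of_real (x * cos a - y * sin a) + \<i> * of_real (x * sin a + y * cos a) = cis a * (of_real x + \<i> * of_real y)"
    and n: "complex_of_real (x * cos a - y * sin a) - \<i> * of_real (x * sin a + y * cos a) = cis (- a) * (of_real x - \<i> * of_real y)"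
    by (auto simp: complex_eq_iff algebra_simps)
  have c: "cis (- a) * cis (of_int (m + 1) * a) = cis (of_int m * a)" "cis a * cis (of_int (m - 1) * a) = cis (of_int m * a)"
    by (auto simp: cis_mult algebra_simps)
  have "sphc (Suc l) m (x * cos a - y * sin a) (x * sin a + y * cos a) z =
      - (cis (- a) * cis (of_int (m + 1) * a)) * (of_real x - \<i> * of_real y) * sphc l (m + 1) x y z
      + 2 * of_real z * (cis (of_int m * a) * sphc l m x y z) +
      (cis a * cis (of_int (m - 1) * a)) * (of_real x + \<i> * of_real y) * sphc l (m - 1) x y z"
    unfolding sphc.simps Suc.IH p n by (simp add: algebra_simps)
  also have "\<dots> = cis (of_int m * a) * sphc (Suc l) m x y z"
    unfolding c by (simp add: algebra_simps)
  finally show ?case .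
qed auto

text \<open>The infinitesimal rotation about the second axis acts on the generating polynomial as a
  first order differential operator in w; on the coefficients it becomes a combination of a raising
  and a lowering step.\<close>

lemma sphc_rotate_y_deriv:
  assumes "\<And>s. (X has_vector_derivative Z s) (at s)" "\<And>s. (Z has_vector_derivative - X s) (at s)"
  shows "((\<lambda>s. sphc l m (X s) y (Z s)) has_vector_derivative
    (of_int (int l - m + 1) / 2 * sphc l (m - 1) (X s) y (Z s)
     - of_int (int l + m + 1) / 2 * sphc l (m + 1) (X s) y (Z s))) (at s)"
proof (induction l arbitrary: m)
  case 0
  \<comment> \<open>For m = 1 and m = -1 the neighbour of index 0 is nonzero, but its ladder
    coefficient vanishes.\<close>
  have "m = 0 \<or> m = 1 \<or> m = -1 \<or> \<bar>m\<bar> > 1" by linarith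
  then show ?case by (auto simp: has_vector_derivative_const)
next
  case (Suc l)
  have dX: "((\<lambda>s. complex_of_real (X s)) has_vector_derivative of_real (Z s)) (at s)"
    by (rule bounded_linear.has_vector_derivative[OF bounded_linear_of_real assms(1)])
  have dZ: "((\<lambda>s. complex_of_real (Z s)) has_vector_derivative of_real (- X s)) (at s)"
    by (rule bounded_linear.has_vector_derivative[OF bounded_linear_of_real assms(2)])
  define c where "c k = sphc l k (X s) y (Z s)" for k
  define x where "x = complex_of_real (X s)"
  define z where "z = complex_of_real (Z s)"
  define w where "w = \<i> * complex_of_real y"
  define a where "a = complex_of_int m"
  define b where "b = complex_of_nat l"
  have d: "((\<lambda>s. sphc (Suc l) m (X s) y (Z s)) has_vector_derivative
     - ((x - w) * (of_int (int l - (m + 1) + 1) / 2 * c (m + 1 - 1) - of_int (int l + (m + 1) + 1) / 2 * c (m + 1 + 1)) + z * c (m + 1))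
     + (2 * z * (of_int (int l - m + 1) / 2 * c (m - 1) - of_int (int l + m + 1) / 2 * c (m + 1)) + 2 * (- x) * c m)
     + ((x + w) * (of_int (int l - (m - 1) + 1) / 2 * c (m - 1 - 1) - of_int (int l + (m - 1) + 1) / 2 * c (m - 1 + 1)) + z * c (m - 1)))
     (at s)"
    unfolding sphc.simps c_def x_def z_def w_def
    by (rule has_vector_derivative_eq_rhs, (rule has_vector_derivative_const has_vector_derivative_add has_vector_derivative_diff
        has_vector_derivative_minus has_vector_derivative_mult dX dZ Suc.IH)+) (simp add: field_simps)
  show ?case
  proof (rule has_vector_derivative_eq_rhs[OF d])
    have E: "sphc (Suc l) (m - 1) (X s) y (Z s) = - (x - w) * c m + 2 * z * c (m - 1) + (x + w) * c (m - 2)"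
      "sphc (Suc l) (m + 1) (X s) y (Z s) = - (x - w) * c (m + 2) + 2 * z * c (m + 1) + (x + w) * c m"
      by (simp_all add: c_def x_def z_def w_def add.commute[of 2 m])
    show "- ((x - w) * (of_int (int l - (m + 1) + 1) / 2 * c (m + 1 - 1) - of_int (int l + (m + 1) + 1) / 2 * c (m + 1 + 1)) + z * c (m + 1))
     + (2 * z * (of_int (int l - m + 1) / 2 * c (m - 1) - of_int (int l + m + 1) / 2 * c (m + 1)) + 2 * (- x) * c m)
     + ((x + w) * (of_int (int l - (m - 1) + 1) / 2 * c (m - 1 - 1) - of_int (int l + (m - 1) + 1) / 2 * c (m - 1 + 1)) + z * c (m - 1)) =
     of_int (int (Suc l) - m + 1) / 2 * sphc (Suc l) (m - 1) (X s) y (Z s)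
     - of_int (int (Suc l) + m + 1) / 2 * sphc (Suc l) (m + 1) (X s) y (Z s)"
      unfolding E by (simp add: a_def[symmetric] b_def[symmetric] field_simps)
  qed
qed

text \<open>With these weights the raising and lowering parts of \<open>sphc_rotate_y_deriv\<close>
  are adjoint to each other, which makes the weighted kernel \<open>sphK\<close> rotation
  invariant.\<close>

definition sph_weight :: "nat \<Rightarrow> int \<Rightarrow> real" where
  "sph_weight l m = fact (nat (int l - m)) * fact (nat (int l + m))"

lemma sph_weight_Suc:
  assumes "m \<ge> - int l" "m < int l"
  shows "sph_weight l (m + 1) * of_int (int l - m) = sph_weight l m * of_int (int l + m + 1)"
proof -
  have "nat (int l - m) = Suc (nat (int l - (m + 1)))" "nat (int l + (m + 1)) = Suc (nat (int l + m))"
    using assms by auto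
  then show ?thesis using assms by (simp add: sph_weight_def algebra_simps)
qed

text \<open>A shift of m by one together with \<open>sph_weight_Suc\<close>; the boundary terms
  vanish because both sequences are supported on |m| \<le> l.\<close>

lemma sph_weight_shift_sum:
  fixes c d :: "int \<Rightarrow> complex"
  assumes "\<And>m. \<bar>m\<bar> > int l \<Longrightarrow> c m = 0" "\<And>m. \<bar>m\<bar> > int l \<Longrightarrow> d m = 0"
  shows "(\<Sum>m=-int l..int l. of_real (sph_weight l m) * of_int (int l - m + 1) * c (m - 1) * d m) =
    (\<Sum>m=-int l..int l. of_real (sph_weight l m) * of_int (int l + m + 1) * c m * d (m + 1))"
proof -
  have "(\<Sum>m=-int l..int l. of_real (sph_weight l m) * of_int (int l - m + 1) * c (m - 1) * d m) =
     (\<Sum>m=-int l+1..int l. of_real (sph_weight l m) * of_int (int l - m + 1) * c (m - 1) * d m)"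
    by (rule sum.mono_neutral_right) (auto simp: assms)
  also have "\<dots> = (\<Sum>m=-int l..int l-1. of_real (sph_weight l (m + 1)) * of_int (int l - m) * c m * d (m + 1))"
    by (rule sum.reindex_bij_witness[of _ "\<lambda>m. m + 1" "\<lambda>m. m - 1"]) auto
  also have "\<dots> = (\<Sum>m=-int l..int l-1. of_real (sph_weight l m) * of_int (int l + m + 1) * c m * d (m + 1))"
  proof (intro sum.cong refl)
    fix m assume "m \<in> {-int l..int l-1}"
    then have "sph_weight l (m + 1) * of_int (int l - m) = sph_weight l m * of_int (int l + m + 1)"
      by (intro sph_weight_Suc) auto
    from arg_cong[OF this, of complex_of_real]
    show "of_real (sph_weight l (m + 1)) * of_int (int l - m) * c m * d (m + 1) =
      of_real (sph_weight l m) * of_int (int l + m + 1) * c m * d (m + 1)"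
      by (simp del: of_int_add of_int_diff)
  qed
  also have "\<dots> = (\<Sum>m=-int l..int l. of_real (sph_weight l m) * of_int (int l + m + 1) * c m * d (m + 1))"
    by (rule sum.mono_neutral_left) (auto simp: assms)
  finally show ?thesis .
qed

text \<open>Up to a factor depending on \<open>l\<close> only, the reproducing kernel of the
  harmonics of degree \<open>l\<close>. Triples of coordinates allow rotations to be written out
  explicitly.\<close>

definition sphK :: "nat \<Rightarrow> real \<times> real \<times> real \<Rightarrow> real \<times> real \<times> real \<Rightarrow> complex" where
  "sphK l = (\<lambda>(x, y, z) (x', y', z'). \<Sum>m=-int l..int l.
      of_real (sph_weight l m) * sphc l m x y z * cnj (sphc l m x' y' z'))"

lemma sphK_rotate_z:
  "sphK l (x * cos a - y * sin a, x * sin a + y * cos a, z) (x' * cos a - y' * sin a, x' * sin a + y' * cos a, z') =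
   sphK l (x, y, z) (x', y', z')"
proof -
  have "of_real w * (cis (of_int m * a) * u) * cnj (cis (of_int m * a) * v) = of_real w * u * cnj v" for m u v w
  proof -
    have "of_real w * (cis (of_int m * a) * u) * cnj (cis (of_int m * a) * v) =
      of_real w * u * cnj v * (cis (of_int m * a) * cis (- (of_int m * a)))"
      by (simp add: cis_cnj)
    then show ?thesis by (simp only: cis_mult) simp
  qed
  then show ?thesis
    unfolding sphK_def split sphc_rotate_z by (intro sum.cong refl)
qed

text \<open>As a function of the angle s the kernel at the rotated points has derivative 0: by
  \<open>sph_weight_shift_sum\<close> every raising term of one factor cancels a lowering term of
  the other. Its value at s = 0 is the kernel at the original points.\<close>

lemma sphK_rotate_y:
  "sphK l (x * cos s + z * sin s, y, z * cos s - x * sin s) (x' * cos s + z' * sin s, y', z' * cos s - x' * sin s) =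
   sphK l (x, y, z) (x', y', z')"
proof -
  define X where "X s = x * cos s + z * sin s" for s
  define Z where "Z s = z * cos s - x * sin s" for s
  define X' where "X' s = x' * cos s + z' * sin s" for s
  define Z' where "Z' s = z' * cos s - x' * sin s" for s
  have dX: "(X has_vector_derivative Z s) (at s)" "(Z has_vector_derivative - X s) (at s)" for s
    unfolding X_def[abs_def] Z_def[abs_def] has_real_derivative_iff_has_vector_derivative[symmetric]
    by (auto intro!: derivative_eq_intros)
  have dX': "(X' has_vector_derivative Z' s) (at s)" "(Z' has_vector_derivative - X' s) (at s)" for s
    unfolding X'_def[abs_def] Z'_def[abs_def] has_real_derivative_iff_has_vector_derivative[symmetric]
    by (auto intro!: derivative_eq_intros)
  define C where "C m s = sphc l m (X s) y (Z s)" for m s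
  define E where "E m s = cnj (sphc l m (X' s) y' (Z' s))" for m s
  have dC: "(C m has_vector_derivative (of_int (int l - m + 1) / 2 * C (m - 1) s - of_int (int l + m + 1) / 2 * C (m + 1) s)) (at s)" for m s
    unfolding C_def[abs_def] by (rule sphc_rotate_y_deriv[OF dX])
  have dE: "(E m has_vector_derivative (of_int (int l - m + 1) / 2 * E (m - 1) s - of_int (int l + m + 1) / 2 * E (m + 1) s)) (at s)" for m s
    unfolding E_def[abs_def]
    by (rule has_vector_derivative_eq_rhs[OF bounded_linear.has_vector_derivative[OF bounded_linear_cnj sphc_rotate_y_deriv[OF dX']]]) simp
  define P where "P s = (\<Sum>m=-int l..int l. of_real (sph_weight l m) * (C m s * E m s))" for s
  have "(P has_vector_derivative 0) (at s)" for s
  proof -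
    have C0: "\<And>m. \<bar>m\<bar> > int l \<Longrightarrow> C m s = 0" "\<And>m. \<bar>m\<bar> > int l \<Longrightarrow> E m s = 0"
      by (auto simp: C_def E_def sphc_eq_0)
    have "(P has_vector_derivative (\<Sum>m=-int l..int l. of_real (sph_weight l m) *
      (C m s * (of_int (int l - m + 1) / 2 * E (m - 1) s - of_int (int l + m + 1) / 2 * E (m + 1) s) +
      (of_int (int l - m + 1) / 2 * C (m - 1) s - of_int (int l + m + 1) / 2 * C (m + 1) s) * E m s))) (at s)"
      unfolding P_def[abs_def]
      by (intro has_vector_derivative_sum has_vector_derivative_mult_right has_vector_derivative_mult dC dE)
    also have "(\<Sum>m=-int l..int l. of_real (sph_weight l m) *
      (C m s * (of_int (int l - m + 1) / 2 * E (m - 1) s - of_int (int l + m + 1) / 2 * E (m + 1) s) +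
      (of_int (int l - m + 1) / 2 * C (m - 1) s - of_int (int l + m + 1) / 2 * C (m + 1) s) * E m s)) =
      1/2 * ((\<Sum>m=-int l..int l. of_real (sph_weight l m) * of_int (int l - m + 1) * E (m - 1) s * C m s)
       - (\<Sum>m=-int l..int l. of_real (sph_weight l m) * of_int (int l + m + 1) * C m s * E (m + 1) s)
       + (\<Sum>m=-int l..int l. of_real (sph_weight l m) * of_int (int l - m + 1) * C (m - 1) s * E m s)
       - (\<Sum>m=-int l..int l. of_real (sph_weight l m) * of_int (int l + m + 1) * E m s * C (m + 1) s))"
      unfolding sum.distrib[symmetric] sum_subtractf[symmetric] sum_distrib_left
      by (intro sum.cong refl) (simp add: field_simps)
    also have "\<dots> = 0"
      using sph_weight_shift_sum[of l "\<lambda>m. C m s" "\<lambda>m. E m s", OF C0]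
        sph_weight_shift_sum[of l "\<lambda>m. E m s" "\<lambda>m. C m s", OF C0(2,1)] by simp
    finally show ?thesis .
  qed
  then obtain k where k: "\<And>s. P s = k"
    using has_vector_derivative_zero_constant[of UNIV P] by auto
  have "P s = P 0" unfolding k ..
  then show ?thesis
    by (simp add: P_def sphK_def C_def E_def X_def Z_def X'_def Z'_def mult.assoc)
qed

lemma exists_rotation_to_half_plane:
  fixes x y :: real
  shows "\<exists>a. x * cos a - y * sin a = sqrt (x\<^sup>2 + y\<^sup>2) \<and> x * sin a + y * cos a = 0"
proof (cases "x = 0 \<and> y = 0")
  case False
  define r where "r = sqrt (x\<^sup>2 + y\<^sup>2)"
  have r: "r > 0" "r\<^sup>2 = x\<^sup>2 + y\<^sup>2" using False unfolding r_def
    by (auto simp: add_nonneg_pos add_pos_nonneg sum_power2_gt_zero_iff)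
  have "(x / r)\<^sup>2 + (- y / r)\<^sup>2 = (x\<^sup>2 + y\<^sup>2) / r\<^sup>2"
    by (simp add: power_divide add_divide_distrib)
  then have "(x / r)\<^sup>2 + (- y / r)\<^sup>2 = 1" unfolding r(2)[symmetric] using r(1) by simp
  then obtain a where a: "x / r = cos a" "- y / r = sin a" using sincos_total_2pi by metis
  have "x * (x / r) - y * (- y / r) = (x\<^sup>2 + y\<^sup>2) / r" by (simp add: add_divide_distrib power2_eq_square)
  then have "x * (x / r) - y * (- y / r) = r" unfolding r(2)[symmetric] using r(1) by (simp add: power2_eq_square)
  moreover have "x * (- y / r) + y * (x / r) = 0" by (simp add: field_simps)
  ultimately show ?thesis unfolding a r_def[symmetric] by blast
qed (auto intro!: exI[of _ 0])

text \<open>Three rotations, about the third, second and third axis, bring the first point to the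
  pole and the second into the half plane y = 0, x \<ge> 0. There a unit vector is determined by its
  third coordinate, which is the preserved inner product c.\<close>

lemma sphK_canonical:
  assumes u: "x\<^sup>2 + y\<^sup>2 + z\<^sup>2 = 1" and u': "x'\<^sup>2 + y'\<^sup>2 + z'\<^sup>2 = 1"
  shows "sphK l (x, y, z) (x', y', z') =
    (let c = x * x' + y * y' + z * z' in sphK l (0, 0, 1) (sqrt (1 - c\<^sup>2), 0, c))"
proof -
  define c where "c = x * x' + y * y' + z * z'"
  obtain a where a: "x * cos a - y * sin a = sqrt (x\<^sup>2 + y\<^sup>2)" "x * sin a + y * cos a = 0"
    using exists_rotation_to_half_plane by metis
  define r where "r = sqrt (x\<^sup>2 + y\<^sup>2)"
  define x1 where "x1 = x' * cos a - y' * sin a"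
  define y1 where "y1 = x' * sin a + y' * cos a"
  have sc: "(cos a)\<^sup>2 = 1 - (sin a)\<^sup>2" by (simp add: cos_squared_eq)
  have 1: "sphK l (x, y, z) (x', y', z') = sphK l (r, 0, z) (x1, y1, z')"
    using sphK_rotate_z[of l x a y z x' y' z'] by (simp add: a r_def x1_def y1_def)
  have u1: "x1\<^sup>2 + y1\<^sup>2 = x'\<^sup>2 + y'\<^sup>2"
    unfolding x1_def y1_def by (simp add: power2_sum power2_diff power_mult_distrib sc algebra_simps)
  have c1: "r * x1 + z * z' = c"
  proof -
    have "r * x1 + 0 * y1 = (x * cos a - y * sin a) * x1 + (x * sin a + y * cos a) * y1"
      using a by (simp add: r_def)
    also have "\<dots> = (x * x' + y * y') * ((sin a)\<^sup>2 + (cos a)\<^sup>2)" unfolding x1_def y1_def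
      by algebra
    finally show ?thesis by (simp add: c_def)
  qed
  have r: "r\<^sup>2 + z\<^sup>2 = 1" using u by (simp add: r_def)
  then have "z\<^sup>2 + (- r)\<^sup>2 = 1" by simp
  then obtain s where s: "z = cos s" "- r = sin s" using sincos_total_2pi by metis
  define x2 where "x2 = x1 * cos s + z' * sin s"
  define z2 where "z2 = z' * cos s - x1 * sin s"
  have 2: "sphK l (r, 0, z) (x1, y1, z') = sphK l (0, 0, 1) (x2, y1, z2)"
  proof -
    have "r * cos s + z * sin s = 0" "z * cos s - r * sin s = 1"
      using r by (auto simp: s(1)[symmetric] s(2)[symmetric] power2_eq_square)
    then show ?thesis using sphK_rotate_y[of l r s z 0 x1 z' y1] by (simp add: x2_def z2_def)
  qed
  have z2: "z2 = c" using c1 unfolding z2_def s(1)[symmetric] s(2)[symmetric] by (simp add: algebra_simps)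
  have u2: "x2\<^sup>2 + z2\<^sup>2 = x1\<^sup>2 + z'\<^sup>2"
    unfolding x2_def z2_def by (simp add: power2_sum power2_diff power_mult_distrib cos_squared_eq algebra_simps)
  have "x2\<^sup>2 + y1\<^sup>2 = 1 - c\<^sup>2" using u2 u1 u' z2 by simp
  then obtain b where b: "x2 * cos b - y1 * sin b = sqrt (1 - c\<^sup>2)" "x2 * sin b + y1 * cos b = 0"
    using exists_rotation_to_half_plane[of x2 y1] by metis
  have 3: "sphK l (0, 0, 1) (x2, y1, z2) = sphK l (0, 0, 1) (sqrt (1 - c\<^sup>2), 0, c)"
    using sphK_rotate_z[of l 0 b 0 1 x2 y1 z2] by (simp add: b z2)
  show ?thesis unfolding Let_def c_def[symmetric] 1 2 3 ..
qed

text \<open>By the canonical form the kernel may be evaluated at the pole, where \<open>sphc\<close>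
  vanishes except for m = 0.\<close>

lemma sphK_diag:
  assumes "x\<^sup>2 + y\<^sup>2 + z\<^sup>2 = 1"
  shows "sphK l (x, y, z) (x, y, z) = of_real ((fact l)\<^sup>2 * 4 ^ l)"
proof -
  have "x * x + y * y + z * z = 1" using assms by (simp add: power2_eq_square)
  then have "sphK l (x, y, z) (x, y, z) = sphK l (0, 0, 1) (0, 0, 1)"
    using sphK_canonical[OF assms assms] by (simp add: Let_def)
  also have "\<dots> = (\<Sum>m=-int l..int l. if m = 0 then of_real ((fact l)\<^sup>2 * 4 ^ l) else 0)"
    unfolding sphK_def split
    by (rule sum.cong[OF refl]) (simp add: sphc_pole sph_weight_def power2_eq_square flip: power_mult_distrib)
  also have "\<dots> = of_real ((fact l)\<^sup>2 * 4 ^ l)" by (subst sum.delta) auto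
  finally show ?thesis .
qed

section \<open>Legendre functions through Rodrigues' formula\<close>

lemma higher_pderiv_taylor:
  fixes p :: "real poly"
  shows "poly ((pderiv ^^ k) p) x = fact k * coeff (pcompose p [:x, 1:]) k"
proof -
  have "(pderiv ^^ k) (pcompose p [:x, 1:]) = pcompose ((pderiv ^^ k) p) [:x, 1:]"
    by (induction k) (simp_all add: pderiv_pcompose pderiv_pCons)
  then have "poly ((pderiv ^^ k) p) x = coeff ((pderiv ^^ k) (pcompose p [:x, 1:])) 0"
    by (simp add: pcompose_coeff_0)
  then show ?thesis by (simp add: coeff_higher_pderiv pochhammer_fact)
qed

text \<open>The derivative in Rodrigues' formula divided by (l + m)!, read as a Taylor coefficient:
  (x + X)^2 - 1 is the trinomial in X whose power appears here. As a coefficient of a power it obeys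
  a three-term recursion like that of \<open>sphc\<close>. Negative indices get the value 0, so that
  the recursion holds without exceptions.\<close>

definition legc :: "nat \<Rightarrow> int \<Rightarrow> real \<Rightarrow> real" where
  "legc l m x = (if int l + m < 0 then 0 else coeff ([:x\<^sup>2 - 1, 2 * x, 1:] ^ l) (nat (int l + m)))"

lemma legc_0: "legc 0 m x = (if m = 0 then 1 else 0)"
  by (auto simp: legc_def coeff_1)

lemma legc_Suc:
  "legc (Suc l) m x = (x\<^sup>2 - 1) * legc l (m + 1) x + 2 * x * legc l m x + legc l (m - 1) x"
proof (cases "int (Suc l) + m < 0")
  case False
  then obtain k where k: "int l + 1 + m = int k" by (metis of_nat_Suc add.commute nonneg_int_cases not_less)
  then have m: "nat (int (Suc l) + m) = k" "nat (int l + (m + 1)) = k" "nat (int l + m) = k - 1" "nat (int l + (m - 1)) = k - 2"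
    "int l + m < 0 \<longleftrightarrow> k = 0" "int l + (m - 1) < 0 \<longleftrightarrow> k < 2"
    by auto
  show ?thesis
    unfolding legc_def m using False k
    by (cases k; cases "k - 1") (auto simp: algebra_simps)
qed (auto simp: legc_def)

lemma pcompose_rodrigues_base:
  "pcompose ([:-1, 0, 1:] ^ l) [:x, 1:] = [:x\<^sup>2 - 1, 2 * x, 1 :: real:] ^ l"
proof (induction l)
  case (Suc l)
  have "pcompose [:-1, 0, 1:] [:x, 1:] = [:x\<^sup>2 - 1, 2 * x, 1:]"
    by (simp add: pcompose_pCons power2_eq_square)
  then show ?case by (simp only: power_Suc pcompose_mult Suc.IH)
qed (simp add: pcompose_1)

lemma assoc_legendre_legc:
  "assoc_legendre l m x = 1 / (2 ^ l * fact l) * sqrt (1 - x\<^sup>2) powi m * (fact (nat (int l + m)) * legc l m x)"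
  if "- int l \<le> m"
  using that unfolding assoc_legendre_def higher_pderiv_taylor legc_def pcompose_rodrigues_base by simp

text \<open>With w = s cis \<phi> the factors in the recursion of \<open>sphc\<close> become w and
  (1 - x^2) / w, and after splitting off w^m it is the recursion of \<open>legc\<close>. Division by
  w requires s to be nonzero; the poles of the sphere are handled separately.\<close>

lemma sphc_legc:
  assumes "s \<noteq> 0" "s\<^sup>2 = 1 - x\<^sup>2"
  shows "sphc l m (s * cos \<phi>) (s * sin \<phi>) x = (of_real s * cis \<phi>) powi m * of_real (legc l m x)"
proof (induction l arbitrary: m)
  case (Suc l)
  define w where "w = of_real s * cis \<phi>"
  have w0: "w \<noteq> 0" using assms by (simp add: w_def)
  have p: "of_real (s * cos \<phi>) + \<i> * of_real (s * sin \<phi>) = w"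
    by (simp add: w_def complex_eq_iff)
  have n: "of_real (s * cos \<phi>) - \<i> * of_real (s * sin \<phi>) = of_real (1 - x\<^sup>2) / w"
  proof -
    have "(of_real (s * cos \<phi>) - \<i> * of_real (s * sin \<phi>)) * w = (of_real s)\<^sup>2 * (cis (-\<phi>) * cis \<phi>)"
      by (simp add: w_def complex_eq_iff power2_eq_square algebra_simps)
    also have "\<dots> = of_real (1 - x\<^sup>2)" unfolding assms(2)[symmetric] by (simp add: cis_mult)
    finally show ?thesis using w0 by (simp add: field_simps)
  qed
  have e: "w powi (m + 1) = w powi m * w" "w powi (m - 1) = w powi m / w"
    using w0 by (auto simp: power_int_add power_int_diff)
  show ?case
    unfolding sphc.simps p n Suc.IH w_def[symmetric] e legc_Suc
    using w0 by (simp add: field_simps)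
qed (simp add: legc_0)

definition sph_coef :: "nat \<Rightarrow> int \<Rightarrow> complex" where
  "sph_coef l m = (-1) powi m * of_real (sqrt ((2 * real l + 1) / (4 * pi) * sph_weight l m) / (2 ^ l * fact l))"

definition sph_Y :: "nat \<Rightarrow> int \<Rightarrow> real^3 \<Rightarrow> complex" where
  "sph_Y l m v = sph_coef l m * sphc l m (v $ 1) (v $ 2) (v $ 3)"

text \<open>The Cartesian form is the one from which continuity on the sphere, the conjugation rule
  and the addition theorem are read off.\<close>

lemma sph_harm_sph_Y:
  assumes m: "\<bar>m\<bar> \<le> int l" and \<theta>: "\<theta> \<in> {0..pi}"
  shows "sph_harm l m \<theta> \<phi> = sph_Y l m (sph_point \<theta> \<phi>)"
proof -
  have s: "sqrt (1 - (cos \<theta>)\<^sup>2) = sin \<theta>"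
    using \<theta> by (simp add: sin_squared_eq[symmetric] sin_ge_zero)
  define a where "a = fact (nat (int l - m)) * (1::real)"
  define b where "b = fact (nat (int l + m)) * (1::real)"
  have ab: "a > 0" "b > 0" by (auto simp: a_def b_def)
  \<comment> \<open>The factor \<open>b\<close> = (l + m)! left over from Taylor's formula is moved
    under the root, where it combines to \<open>sph_weight\<close>.\<close>
  have "sqrt X * b = sqrt (X * b\<^sup>2)" for X using ab by (simp add: real_sqrt_mult)
  then have "sqrt ((2 * real l + 1) * a / (4 * pi * b)) * b = sqrt ((2 * real l + 1) * a / (4 * pi * b) * b\<^sup>2)" .
  also have "(2 * real l + 1) * a / (4 * pi * b) * b\<^sup>2 = (2 * real l + 1) / (4 * pi) * (a * b)"
    using ab by (simp add: field_simps power2_eq_square)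
  finally have c: "sqrt ((2 * real l + 1) * fact (nat (int l - m)) / (4 * pi * fact (nat (int l + m)))) * fact (nat (int l + m)) =
    sqrt ((2 * real l + 1) / (4 * pi) * sph_weight l m)" by (simp add: a_def b_def sph_weight_def)
  have S: "sphc l m (sin \<theta> * cos \<phi>) (sin \<theta> * sin \<phi>) (cos \<theta>) = exp (\<i> * of_int m * of_real \<phi>) * of_real (sin \<theta> powi m) * of_real (legc l m (cos \<theta>))"
  proof (cases "sin \<theta> = 0")
    case False
    have "(cis \<phi>) powi m = exp (\<i> * of_int m * of_real \<phi>)"
      by (simp add: cis_conv_exp exp_power_int mult_ac)
    then show ?thesis
      by (subst sphc_legc[OF False]) (auto simp: sin_squared_eq power_int_mult_distrib of_real_power_int)
  next
    case True
    then have c2: "(cos \<theta>)\<^sup>2 - 1 = 0" by (metis sin_squared_eq diff_self minus_diff_eq minus_zero power_zero_numeral neg_equal_0_iff_equal)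
    show ?thesis
    proof (cases "m = 0")
      case True
      \<comment> \<open>At a pole the trinomial loses its constant term, so X^l splits off and the
        wanted coefficient is the constant term of the remaining factor.\<close>
      have "[:0, 2 * cos \<theta>, 1:] ^ l = monom 1 l * [:2 * cos \<theta>, 1:] ^ l"
        by (simp add: monom_altdef power_mult_distrib[symmetric] mult.commute)
      then have "coeff ([:0, 2 * cos \<theta>, 1:] ^ l) l = (2 * cos \<theta>) ^ l"
        by (simp add: coeff_monom_mult coeff_0_power)
      then show ?thesis using True \<open>sin \<theta> = 0\<close> by (simp add: sphc_pole legc_def c2)
    qed (simp add: True sphc_pole)
  qed
  show ?thesis
    unfolding sph_harm_def sph_Y_def sph_coef_def sph_point_def vector_3 S assoc_legendre_legc[OF abs_le_D2[OF m, THEN le_imp_neg_le, simplified]] s c[symmetric]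
    by (simp add: field_simps)
qed

lemma cnj_sph_Y: "cnj (sph_Y l m v) = (-1) powi m * sph_Y l (- m) v"
proof -
  have w: "sph_weight l (- m) = sph_weight l m" by (simp add: sph_weight_def mult.commute)
  have e: "((-1::complex) powi m) * ((-1) powi m) = 1" "(-1::complex) powi (-m) = (-1) powi m"
    by (auto simp: power_int_minus_one_minus power_int_mult_distrib[symmetric])
  have c: "cnj ((-1) powi m) = (-1) powi m"
    by (metis complex_cnj_complex_of_real of_real_power_int of_real_minus of_real_1)
  have "(-1) powi m * sph_Y l (- m) v = (((-1) powi m) * ((-1) powi m)) * cnj (sph_Y l m v)"
    unfolding sph_Y_def sph_coef_def w sphc_uminus e(2) by (simp add: c)
  then show ?thesis by (simp add: e)
qed

lemma continuous_on_sph_Y [continuous_intros]: "continuous_on A (sph_Y l m)"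
proof -
  have "continuous_on A (\<lambda>v::real^3. sphc l m (v $ 1) (v $ 2) (v $ 3))" for m
    by (induction l arbitrary: m) (auto intro!: continuous_intros)
  then show ?thesis unfolding sph_Y_def[abs_def] by (intro continuous_intros)
qed

lemma sph_weight_pos: "sph_weight l m > 0"
  by (simp add: sph_weight_def)

lemma sph_Y_kernel:
  "(\<Sum>m=-int l..int l. sph_Y l m v * cnj (sph_Y l m w)) =
   of_real ((2 * real l + 1) / (4 * pi) / (4 ^ l * (fact l)\<^sup>2)) * sphK l (v$1, v$2, v$3) (w$1, w$2, w$3)"
proof -
  have c: "sph_coef l m * cnj (sph_coef l m) = of_real ((2 * real l + 1) / (4 * pi) / (4 ^ l * (fact l)\<^sup>2)) * of_real (sph_weight l m)" for m
  proof -
    have "sph_coef l m * cnj (sph_coef l m) = of_real ((norm (sph_coef l m))\<^sup>2)" by (simp only: complex_norm_square)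
    also have "norm (sph_coef l m) = sqrt ((2 * real l + 1) / (4 * pi) * sph_weight l m) / (2 ^ l * fact l)"
      using sph_weight_pos[of l m] by (simp add: sph_coef_def norm_mult norm_power_int norm_divide norm_power)
    also have "\<dots>\<^sup>2 = (2 * real l + 1) / (4 * pi) * sph_weight l m / ((2 ^ l)\<^sup>2 * (fact l)\<^sup>2)"
      using sph_weight_pos[of l m] by (simp add: power_divide power_mult_distrib)
    also have "((2::real) ^ l)\<^sup>2 = 4 ^ l" by (simp add: power2_eq_square flip: power_mult_distrib)
    finally show ?thesis by simp
  qed
  have "sph_Y l m v * cnj (sph_Y l m w) = of_real ((2 * real l + 1) / (4 * pi) / (4 ^ l * (fact l)\<^sup>2)) *
     (of_real (sph_weight l m) * sphc l m (v$1) (v$2) (v$3) * cnj (sphc l m (w$1) (w$2) (w$3)))" for m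
  proof -
    have "sph_Y l m v * cnj (sph_Y l m w) = (sph_coef l m * cnj (sph_coef l m)) * (sphc l m (v$1) (v$2) (v$3) * cnj (sphc l m (w$1) (w$2) (w$3)))"
      by (simp add: sph_Y_def mult_ac)
    then show ?thesis unfolding c by (simp only: mult_ac)
  qed
  then show ?thesis by (simp add: sphK_def sum_distrib_left)
qed

lemma unit_vec3: "norm v = 1 \<Longrightarrow> (v$1)\<^sup>2 + (v$2)\<^sup>2 + (v$3)\<^sup>2 = (1::real)" for v :: "real^3"
  by (simp add: norm_eq_1 inner_vec_def sum_3 power2_eq_square)

text \<open>The addition theorem: the kernel of degree \<open>l\<close> is a function of the inner product.\<close>

lemma sph_Y_kernel_inner:
  assumes "norm v = 1" "norm w = 1" "norm v' = 1" "norm w' = 1" "v \<bullet> w = v' \<bullet> w'"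
  shows "(\<Sum>m=-int l..int l. sph_Y l m v * cnj (sph_Y l m w)) = (\<Sum>m=-int l..int l. sph_Y l m v' * cnj (sph_Y l m w'))"
  unfolding sph_Y_kernel sphK_canonical[OF unit_vec3[OF assms(1)] unit_vec3[OF assms(2)]]
    sphK_canonical[OF unit_vec3[OF assms(3)] unit_vec3[OF assms(4)]]
  using assms(5) by (simp add: inner_vec_def sum_3)

text \<open>Unsoeld's theorem. Besides bounding the harmonics it fixes their normalisation in
  \<open>sph_harm_theta_integral_same\<close>.\<close>

lemma sph_Y_diag:
  assumes "norm v = 1"
  shows "(\<Sum>m=-int l..int l. sph_Y l m v * cnj (sph_Y l m v)) = of_real ((2 * real l + 1) / (4 * pi))"
  unfolding sph_Y_kernel sphK_diag[OF unit_vec3[OF assms]] of_real_mult[symmetric]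
  by (simp add: field_simps)

lemma sph_Y_bound:
  assumes "norm v = 1" "\<bar>m\<bar> \<le> int l"
  shows "(norm (sph_Y l m v))\<^sup>2 \<le> (2 * real l + 1) / (4 * pi)"
proof -
  have "complex_of_real (\<Sum>m=-int l..int l. (norm (sph_Y l m v))\<^sup>2) = of_real ((2 * real l + 1) / (4 * pi))"
    using sph_Y_diag[OF assms(1), of l] unfolding of_real_sum complex_norm_square .
  then have "(\<Sum>m=-int l..int l. (norm (sph_Y l m v))\<^sup>2) = (2 * real l + 1) / (4 * pi)"
    by (simp only: of_real_eq_iff)
  moreover have "(norm (sph_Y l m v))\<^sup>2 \<le> (\<Sum>m=-int l..int l. (norm (sph_Y l m v))\<^sup>2)"
    by (rule member_le_sum) (use assms in auto)
  ultimately show ?thesis by simp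
qed

section \<open>Spherical angles and orthonormality\<close>

lemma norm_sph_point: "norm (sph_point \<theta> \<phi>) = 1"
proof -
  have "(sin \<theta> * cos \<phi>)\<^sup>2 + (sin \<theta> * sin \<phi>)\<^sup>2 + (cos \<theta>)\<^sup>2 = (sin \<theta>)\<^sup>2 * ((sin \<phi>)\<^sup>2 + (cos \<phi>)\<^sup>2) + (cos \<theta>)\<^sup>2"
    by (simp only: power_mult_distrib) algebra
  also have "\<dots> = 1" by simp
  finally show ?thesis
    by (simp add: norm_eq_1 inner_vec_def sum_3 sph_point_def power2_eq_square)
qed

lemma sph_point_surj:
  assumes "norm v = 1"
  obtains \<theta> \<phi> where "\<theta> \<in> {0..pi}" "\<phi> \<in> {0..<2*pi}" "v = sph_point \<theta> \<phi>"
proof -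
  have u: "(v$1)\<^sup>2 + (v$2)\<^sup>2 + (v$3)\<^sup>2 = 1" by (rule unit_vec3[OF assms])
  then have "(v$3)\<^sup>2 \<le> 1" using sum_power2_ge_zero[of "v$1" "v$2"] by linarith
  then have b: "-1 \<le> v$3" "v$3 \<le> 1" by (auto simp: abs_square_le_1 abs_le_iff)
  define \<theta> where "\<theta> = arccos (v$3)"
  have t: "\<theta> \<in> {0..pi}" "cos \<theta> = v$3" using b by (auto simp: \<theta>_def arccos_lbound arccos_ubound cos_arccos)
  have s: "(sin \<theta>)\<^sup>2 = (v$1)\<^sup>2 + (v$2)\<^sup>2" using u t by (simp add: sin_squared_eq)
  obtain \<phi> where p: "\<phi> \<in> {0..<2*pi}" "v$1 = sin \<theta> * cos \<phi>" "v$2 = sin \<theta> * sin \<phi>"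
  proof (cases "sin \<theta> = 0")
    case True
    with s have "v$1 = 0" "v$2 = 0" by (auto simp: sum_power2_eq_zero_iff dest: sym)
    with True that[of 0] show ?thesis by simp
  next
    case False
    have "(v$1 / sin \<theta>)\<^sup>2 + (v$2 / sin \<theta>)\<^sup>2 = ((v$1)\<^sup>2 + (v$2)\<^sup>2) / (sin \<theta>)\<^sup>2" by (simp add: power_divide add_divide_distrib)
    then have "(v$1 / sin \<theta>)\<^sup>2 + (v$2 / sin \<theta>)\<^sup>2 = 1" unfolding s[symmetric] using False by simp
    then obtain \<phi> where "0 \<le> \<phi>" "\<phi> < 2 * pi" "v$1 / sin \<theta> = cos \<phi>" "v$2 / sin \<theta> = sin \<phi>" using sincos_total_2pi by metis
    then show ?thesis using False by (intro that[of \<phi>]) (auto simp: field_simps)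
  qed
  have "v = sph_point \<theta> \<phi>"
    unfolding sph_point_def by (subst vec_eq_iff) (simp add: forall_3 p t)
  with t p that show ?thesis by blast
qed

text \<open>The integral of \<open>p\<close> over [-1, 1], given through an explicit antiderivative,
  so that integration by parts is pure algebra.\<close>

definition poly_bracket :: "real poly \<Rightarrow> real" where
  "poly_bracket p = (let R = (\<Sum>i\<le>degree p. monom (coeff p i / (real i + 1)) (Suc i)) in poly R 1 - poly R (-1))"

lemma poly_antiderivative: "pderiv (\<Sum>i\<le>degree p. monom (coeff p i / (real i + 1)) (Suc i)) = (p :: real poly)"
proof -
  have "pderiv (\<Sum>i\<le>degree p. monom (coeff p i / (real i + 1)) (Suc i)) = (\<Sum>i\<le>degree p. monom (coeff p i) i)"
  proof -
    have "pderiv (monom (coeff p i / (real i + 1)) (Suc i)) = monom (coeff p i) i" for i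
      using of_nat_neq_0[of i, where 'a=real] by (simp add: pderiv_monom add.commute)
    then show ?thesis
      using higher_pderiv_sum[of 1 "\<lambda>i. monom (coeff p i / (real i + 1)) (Suc i)" "{..degree p}"] by simp
  qed
  then show ?thesis by (simp add: poly_as_sum_of_monoms)
qed

lemma poly_bracket_eq:
  assumes "pderiv R = p"
  shows "poly_bracket p = poly R 1 - poly R (-1)"
proof -
  define S where "S = (\<Sum>i\<le>degree p. monom (coeff p i / (real i + 1)) (Suc i))"
  have "pderiv (R - S) = 0" unfolding pderiv_diff S_def poly_antiderivative assms by simp
  then have "degree (R - S) = 0" by (simp add: pderiv_eq_0_iff)
  then obtain c where "R - S = [:c:]" by (metis degree_0_id)
  then have "R = S + [:c:]" by (metis add.commute diff_add_cancel)
  then show ?thesis unfolding poly_bracket_def Let_def S_def[symmetric] by simp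
qed

lemma poly_bracket_add: "poly_bracket (p + q) = poly_bracket p + poly_bracket q"
proof -
  obtain R S where "pderiv R = p" "pderiv S = q" using poly_antiderivative by metis
  then have "pderiv (R + S) = p + q" by (simp add: pderiv_add)
  then show ?thesis using \<open>pderiv R = p\<close> \<open>pderiv S = q\<close> by (simp add: poly_bracket_eq)
qed

lemma poly_bracket_by_parts:
  assumes "poly p 1 = 0 \<or> poly q 1 = 0" "poly p (-1) = 0 \<or> poly q (-1) = 0"
  shows "poly_bracket (pderiv p * q) = - poly_bracket (p * pderiv q)"
proof -
  have "poly_bracket (pderiv p * q + p * pderiv q) = 0"
    using assms by (subst poly_bracket_eq[of "p * q"]) (auto simp: pderiv_mult mult.commute)
  then show ?thesis by (simp add: poly_bracket_add)
qed

definition rodrigues :: "nat \<Rightarrow> nat \<Rightarrow> real poly" where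
  "rodrigues l k = (pderiv ^^ k) ([:-1, 0, 1:] ^ l)"

lemma rodrigues_Suc: "rodrigues l (Suc k) = pderiv (rodrigues l k)"
  by (simp add: rodrigues_def)

text \<open>The polynomial (X^2 - 1)^l has zeros of order l at 1 and -1; expanded around such a
  point it is divisible by X^l.\<close>

lemma rodrigues_boundary:
  assumes "k < l" "x\<^sup>2 = 1"
  shows "poly (rodrigues l k) x = 0"
proof -
  have "[:x\<^sup>2 - 1, 2 * x, 1:] ^ l = monom 1 l * [:2 * x, 1:] ^ l"
    by (simp add: assms monom_altdef power_mult_distrib[symmetric] mult.commute)
  then show ?thesis using assms(1) unfolding rodrigues_def higher_pderiv_taylor pcompose_rodrigues_base by (simp add: coeff_monom_mult)
qed

lemma rodrigues_high: "k > 2 * l \<Longrightarrow> rodrigues l k = 0"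
proof -
  assume k: "k > 2 * l"
  have "degree ([:-1, 0, 1::real:] ^ l) \<le> 2 * l" by (rule order_trans[OF degree_power_le]) simp
  then show ?thesis unfolding rodrigues_def using k
    by (intro poly_eqI) (simp add: coeff_higher_pderiv coeff_eq_0)
qed

text \<open>Integration by parts without boundary terms: a + b + 1 = l + l' forces a < l or b < l',
  and the corresponding factor vanishes at both end points.\<close>

lemma rodrigues_bracket_step:
  assumes "a + b + 1 = l + l'"
  shows "poly_bracket (rodrigues l (Suc a) * rodrigues l' b) = - poly_bracket (rodrigues l a * rodrigues l' (Suc b))"
  unfolding rodrigues_Suc
proof (rule poly_bracket_by_parts)
  have "a < l \<or> b < l'" using assms by linarith
  then show "poly (rodrigues l a) 1 = 0 \<or> poly (rodrigues l' b) 1 = 0" "poly (rodrigues l a) (-1) = 0 \<or> poly (rodrigues l' b) (-1) = 0"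
    by (auto simp: rodrigues_boundary)
qed

lemma rodrigues_bracket:
  "a + b = l + l' \<Longrightarrow> poly_bracket (rodrigues l a * rodrigues l' b) = (-1) ^ a * poly_bracket (rodrigues l 0 * rodrigues l' (l + l'))"
proof (induction a arbitrary: b)
  case (Suc a)
  then show ?case using rodrigues_bracket_step[of a b l l'] Suc.IH[of "Suc b"] by simp
qed simp

text \<open>All l + l' derivatives can be moved onto the polynomial with the smaller index l', and
  for l' < l their number exceeds its degree 2 l'.\<close>

lemma rodrigues_bracket_orthogonal:
  assumes "a + b = l + l'" "l \<noteq> l'"
  shows "poly_bracket (rodrigues l a * rodrigues l' b) = 0"
proof -
  have z: "poly_bracket 0 = 0" by (simp add: poly_bracket_def)
  have *: "poly_bracket (rodrigues l a * rodrigues l' b) = 0" if "a + b = l + l'" "l' < l" for a b l l'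
    using that by (subst rodrigues_bracket[OF that(1)]) (simp add: rodrigues_high z)
  from assms consider "l' < l" | "l < l'" by linarith
  then show ?thesis
  proof cases
    case 2
    then show ?thesis using *[of b a l' l] assms by (simp add: add.commute mult.commute)
  qed (use *[OF assms(1)] in simp)
qed

lemma LINT_Icc_FTC:
  fixes f :: "real \<Rightarrow> 'a::euclidean_space"
  assumes "a \<le> b" "\<And>x. a \<le> x \<Longrightarrow> x \<le> b \<Longrightarrow> (F has_vector_derivative f x) (at x)" "continuous_on {a..b} f"
  shows "(LINT x:{a..b}|lborel. f x) = F b - F a"
  unfolding set_lebesgue_integral_def
  by (rule integral_FTC_Icc[OF assms(1) _ assms(3)]) (auto intro: has_vector_derivative_at_within assms)

lemma LINT_cis_period:
  "(LINT \<phi>:{0..2*pi}|lborel. cis (of_int k * \<phi>)) = (if k = 0 then of_real (2 * pi) else 0)"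
proof (cases "k = 0")
  case True
  have "(complex_of_real has_vector_derivative 1) (at x)" for x
    using bounded_linear.has_vector_derivative[OF bounded_linear_of_real has_vector_derivative_id, of "at x"] by simp
  from LINT_Icc_FTC[of 0 "2*pi", OF _ this] True show ?thesis by simp
next
  case False
  have d: "((\<lambda>\<phi>. cis (of_int k * \<phi>) / (\<i> * of_int k)) has_vector_derivative cis (of_int k * \<phi>)) (at \<phi>)" for \<phi>
  proof -
    have "((\<lambda>\<phi>. exp (\<i> * of_int k * \<phi>) / (\<i> * of_int k)) has_field_derivative exp (\<i> * of_int k * of_real \<phi>)) (at (of_real \<phi>))"
      using False by (auto intro!: derivative_eq_intros)
    from has_vector_derivative_real_field[OF this] show ?thesis
      by (simp add: cis_conv_exp mult_ac)
  qed
  have "cis (of_int k * (2 * pi)) = 1"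
    using cis_multiple_2pi[of "of_int k"] by (simp add: mult_ac)
  then show ?thesis
    using LINT_Icc_FTC[of 0 "2*pi" "\<lambda>\<phi>. cis (of_int k * \<phi>) / (\<i> * of_int k)" "\<lambda>\<phi>. cis (of_int k * \<phi>)"] d False
    by (simp add: continuous_intros continuous_on_cis)
qed

lemma LINT_poly_cos:
  "(LINT \<theta>:{0..pi}|lborel. complex_of_real (poly p (cos \<theta>) * sin \<theta>)) = of_real (poly_bracket p)"
proof -
  obtain R where R: "pderiv R = p" using poly_antiderivative by blast
  have "((\<lambda>\<theta>. complex_of_real (- poly R (cos \<theta>))) has_vector_derivative complex_of_real (poly p (cos \<theta>) * sin \<theta>)) (at \<theta>)" for \<theta>
    unfolding R[symmetric]
    by (intro has_vector_derivative_of_real) (auto intro!: derivative_eq_intros)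
  from LINT_Icc_FTC[OF _ this] show ?thesis
    by (simp add: poly_bracket_eq[OF R] continuous_intros)
qed

lemma sph_harm_azimuth: "sph_harm l m \<theta> \<phi> = cis (of_int m * \<phi>) * sph_harm l m \<theta> 0"
  by (simp add: sph_harm_def cis_conv_exp mult_ac)

definition sph_norm :: "nat \<Rightarrow> int \<Rightarrow> real" where
  "sph_norm l m = sqrt ((2 * real l + 1) * fact (nat (int l - m)) / (4 * pi * fact (nat (int l + m)))) / (2 ^ l * fact l)"

lemma minus_one_powi_sq: "((-1::'a::field) powi m) * ((-1) powi m) = 1"
  by (simp add: power_int_mult_distrib[symmetric])

text \<open>Conjugation turns m into -m in the second factor, so the powers of the sine with
  exponents m and -m cancel and a polynomial in the cosine remains, with the factor sin \<theta> of
  the surface measure.\<close>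

lemma sph_harm_product:
  assumes "\<bar>m\<bar> \<le> int l" "\<bar>m\<bar> \<le> int l'" "\<theta> \<in> {0..pi}"
  shows "sph_harm l m \<theta> 0 * cnj (sph_harm l' m \<theta> 0) * of_real (sin \<theta>) =
    (-1) powi m * of_real (sph_norm l m * sph_norm l' (- m)) *
     of_real (poly (rodrigues l (nat (int l + m)) * rodrigues l' (nat (int l' - m))) (cos \<theta>) * sin \<theta>)"
proof (cases "sin \<theta> = 0")
  case False
  have s: "sqrt (1 - (cos \<theta>)\<^sup>2) = sin \<theta>"
    using assms by (simp add: sin_squared_eq[symmetric] sin_ge_zero)
  have e: "(-1::complex) powi (-m) = (-1) powi m" by (simp add: power_int_minus_one_minus)
  have "cnj (sph_harm l' m \<theta> 0) = (-1) powi m * sph_harm l' (- m) \<theta> 0"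
    using assms by (simp add: sph_harm_sph_Y cnj_sph_Y)
  then have "sph_harm l m \<theta> 0 * cnj (sph_harm l' m \<theta> 0) =
    (((-1) powi m) * ((-1) powi m)) * (-1) powi m * of_real (sph_norm l m * sph_norm l' (- m)) * of_real (sin \<theta> powi m * sin \<theta> powi (- m)) *
     of_real (poly (rodrigues l (nat (int l + m)) * rodrigues l' (nat (int l' - m))) (cos \<theta>))"
    by (simp add: sph_harm_def assoc_legendre_def s sph_norm_def rodrigues_def e)
  also have "sin \<theta> powi m * sin \<theta> powi (- m) = 1" using False by (simp add: power_int_minus)
  finally show ?thesis by (simp add: minus_one_powi_sq)
qed simp

lemma sph_harm_theta_integral_bracket:
  assumes "\<bar>m\<bar> \<le> int l" "\<bar>m\<bar> \<le> int l'"
  shows "(LINT \<theta>:{0..pi}|lborel. sph_harm l m \<theta> 0 * cnj (sph_harm l' m \<theta> 0) * of_real (sin \<theta>)) =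
    (-1) powi m * of_real (sph_norm l m * sph_norm l' (- m)) *
    of_real (poly_bracket (rodrigues l (nat (int l + m)) * rodrigues l' (nat (int l' - m))))"
proof -
  have "(LINT \<theta>:{0..pi}|lborel. sph_harm l m \<theta> 0 * cnj (sph_harm l' m \<theta> 0) * of_real (sin \<theta>)) =
    (LINT \<theta>:{0..pi}|lborel. (-1) powi m * of_real (sph_norm l m * sph_norm l' (- m)) *
     of_real (poly (rodrigues l (nat (int l + m)) * rodrigues l' (nat (int l' - m))) (cos \<theta>) * sin \<theta>))"
    by (rule set_lebesgue_integral_cong, simp, intro allI impI, rule sph_harm_product[OF assms])
  then show ?thesis by (simp only: set_integral_mult_right LINT_poly_cos)
qed

text \<open>Integration by parts shows that the value K is the same for all m. Adding up the 2 l + 1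
  values and inserting \<open>sph_Y_diag\<close> determines K, without evaluating the integral of (1
  - x^2)^l.\<close>

lemma sph_harm_theta_integral_same:
  assumes "\<bar>m\<bar> \<le> int l"
  shows "(LINT \<theta>:{0..pi}|lborel. sph_harm l m \<theta> 0 * cnj (sph_harm l m \<theta> 0) * of_real (sin \<theta>)) = of_real (1 / (2 * pi))"
proof -
  define J where "J m = (LINT \<theta>:{0..pi}|lborel. sph_harm l m \<theta> 0 * cnj (sph_harm l m \<theta> 0) * of_real (sin \<theta>))" for m
  define K where "K = complex_of_real ((-1) ^ l * ((2 * real l + 1) / (4 * pi) / (2 ^ l * fact l)\<^sup>2) * poly_bracket (rodrigues l 0 * rodrigues l (l + l)))"
  have J: "J m = K" if m: "\<bar>m\<bar> \<le> int l" for m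
  proof -
    define a where "a = (fact (nat (int l - m)) :: real)"
    define b where "b = (fact (nat (int l + m)) :: real)"
    have ab: "a > 0" "b > 0" by (auto simp: a_def b_def)
    have n: "sph_norm l m * sph_norm l (- m) = (2 * real l + 1) / (4 * pi) / (2 ^ l * fact l)\<^sup>2"
    proof -
      have "sph_norm l m * sph_norm l (- m) = sqrt (((2 * real l + 1) * a / (4 * pi * b)) * ((2 * real l + 1) * b / (4 * pi * a))) / (2 ^ l * fact l)\<^sup>2"
        unfolding real_sqrt_mult[of "(2 * real l + 1) * a / (4 * pi * b)"]
        by (simp add: sph_norm_def a_def b_def power2_eq_square)
      also have "((2 * real l + 1) * a / (4 * pi * b)) * ((2 * real l + 1) * b / (4 * pi * a)) = ((2 * real l + 1) / (4 * pi))\<^sup>2"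
        using ab by (simp add: power2_eq_square field_simps)
      finally show ?thesis by simp
    qed
    have r: "poly_bracket (rodrigues l (nat (int l + m)) * rodrigues l (nat (int l - m))) = (-1) ^ nat (int l + m) * poly_bracket (rodrigues l 0 * rodrigues l (l + l))"
      using m by (intro rodrigues_bracket) linarith
    have s: "(-1) powi m * complex_of_real ((-1) ^ nat (int l + m)) = (-1) ^ l"
    proof -
      have "complex_of_real ((-1) ^ nat (int l + m)) = (-1) powi (int l + m)" using m by (simp add: power_int_nonneg_exp)
      also have "\<dots> = (-1) ^ l * (-1) powi m" by (simp add: power_int_add)
      finally show ?thesis using minus_one_powi_sq[of m, where 'a=complex] by (simp add: mult_ac)
    qed
    have "J m = ((-1) powi m * complex_of_real ((-1) ^ nat (int l + m))) * of_real ((2 * real l + 1) / (4 * pi) / (2 ^ l * fact l)\<^sup>2) * of_real (poly_bracket (rodrigues l 0 * rodrigues l (l + l)))"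
      unfolding J_def sph_harm_theta_integral_bracket[OF m m] n r of_real_mult by (simp only: mult_ac)
    then show ?thesis unfolding s K_def by simp
  qed
  have int: "set_integrable lborel {0..pi} (\<lambda>\<theta>. sph_harm l m \<theta> 0 * cnj (sph_harm l m \<theta> 0) * of_real (sin \<theta>))" if "m \<in> {-int l..int l}" for m
  proof (rule borel_integrable_atLeastAtMost')
    have "continuous_on {0..pi} (\<lambda>\<theta>. (-1) powi m * complex_of_real (sph_norm l m * sph_norm l (- m)) *
     of_real (poly (rodrigues l (nat (int l + m)) * rodrigues l (nat (int l - m))) (cos \<theta>) * sin \<theta>))"
      by (intro continuous_intros)
    then show "continuous_on {0..pi} (\<lambda>\<theta>. sph_harm l m \<theta> 0 * cnj (sph_harm l m \<theta> 0) * of_real (sin \<theta>))"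
      by (rule continuous_on_eq) (rule sph_harm_product[symmetric], use that in auto)
  qed
  have "of_nat (2 * l + 1) * K = (\<Sum>m=-int l..int l. J m)"
    by (subst sum.cong[OF refl J]) auto
  also have "\<dots> = (LINT \<theta>:{0..pi}|lborel. (\<Sum>m=-int l..int l. sph_harm l m \<theta> 0 * cnj (sph_harm l m \<theta> 0) * of_real (sin \<theta>)))"
    unfolding J_def set_lebesgue_integral_def scaleR_sum_right
    by (rule Bochner_Integration.integral_sum[symmetric]) (use int in \<open>auto simp: set_integrable_def\<close>)
  also have "\<dots> = (LINT \<theta>:{0..pi}|lborel. of_real ((2 * real l + 1) / (4 * pi)) * complex_of_real (poly 1 (cos \<theta>) * sin \<theta>))"
  proof (rule set_lebesgue_integral_cong, simp, intro allI impI)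
    fix \<theta> assume \<theta>: "\<theta> \<in> {0..pi}"
    have "(\<Sum>m=-int l..int l. sph_harm l m \<theta> 0 * cnj (sph_harm l m \<theta> 0) * of_real (sin \<theta>)) =
      (\<Sum>m=-int l..int l. sph_Y l m (sph_point \<theta> 0) * cnj (sph_Y l m (sph_point \<theta> 0))) * of_real (sin \<theta>)"
      unfolding sum_distrib_right using \<theta> by (intro sum.cong refl) (simp add: sph_harm_sph_Y abs_le_iff)
    then show "(\<Sum>m=-int l..int l. sph_harm l m \<theta> 0 * cnj (sph_harm l m \<theta> 0) * of_real (sin \<theta>)) = of_real ((2 * real l + 1) / (4 * pi)) * complex_of_real (poly 1 (cos \<theta>) * sin \<theta>)"
      unfolding sph_Y_diag[OF norm_sph_point] by simp
  qed
  also have "\<dots> = of_real ((2 * real l + 1) / (4 * pi)) * of_real (poly_bracket 1)"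
    by (simp only: set_integral_mult_right LINT_poly_cos)
  also have "poly_bracket 1 = 2"
    by (subst poly_bracket_eq[of "[:0, 1:]"]) (auto simp: pderiv_pCons)
  finally have K: "of_nat (2 * l + 1) * K = of_real ((2 * real l + 1) / (4 * pi)) * of_real 2" .
  have "(2 * real l + 1) / (4 * pi) * 2 = real (2 * l + 1) * (1 / (2 * pi))" by (simp add: field_simps)
  from arg_cong[OF this, of complex_of_real]
  have "of_nat (2 * l + 1) * K = of_nat (2 * l + 1) * of_real (1 / (2 * pi))"
    unfolding K of_real_mult of_real_of_nat_eq .
  moreover have "of_nat (2 * l + 1) \<noteq> (0::complex)" by (simp only: of_nat_eq_0_iff)
  ultimately have "K = of_real (1 / (2 * pi))" using mult_left_cancel by blast
  then show ?thesis using J[OF assms] by (simp add: J_def)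
qed

lemma sph_harm_theta_integral:
  assumes "\<bar>m\<bar> \<le> int l" "\<bar>m\<bar> \<le> int l'"
  shows "(LINT \<theta>:{0..pi}|lborel. sph_harm l m \<theta> 0 * cnj (sph_harm l' m \<theta> 0) * of_real (sin \<theta>)) = (if l = l' then of_real (1 / (2 * pi)) else 0)"
proof (cases "l = l'")
  case False
  have "nat (int l + m) + nat (int l' - m) = l + l'" using assms by linarith
  from rodrigues_bracket_orthogonal[OF this False] show ?thesis
    unfolding sph_harm_theta_integral_bracket[OF assms] using False by simp
qed (use sph_harm_theta_integral_same[OF assms(1)] in simp)

lemma sph_harm_orthonormal_iterated:
  assumes "\<bar>m\<bar> \<le> int l" "\<bar>m'\<bar> \<le> int l'"
  shows "(LINT \<theta>:{0..pi}|lborel. LINT \<phi>:{0..2*pi}|lborel.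
     (sph_harm l m \<theta> \<phi> * cnj (sph_harm l' m' \<theta> \<phi>)) * of_real (sin \<theta>)) = (if l = l' \<and> m = m' then 1 else 0)"
proof -
  have "(LINT \<phi>:{0..2*pi}|lborel. (sph_harm l m \<theta> \<phi> * cnj (sph_harm l' m' \<theta> \<phi>)) * of_real (sin \<theta>)) =
     (sph_harm l m \<theta> 0 * cnj (sph_harm l' m' \<theta> 0) * of_real (sin \<theta>)) * (if m = m' then of_real (2 * pi) else 0)" for \<theta>
  proof -
    have "(sph_harm l m \<theta> \<phi> * cnj (sph_harm l' m' \<theta> \<phi>)) * of_real (sin \<theta>) =
      (sph_harm l m \<theta> 0 * cnj (sph_harm l' m' \<theta> 0) * of_real (sin \<theta>)) * cis (of_int (m - m') * \<phi>)" for \<phi>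
    proof -
      have "cis (of_int (m - m') * \<phi>) = cis (of_int m * \<phi>) * cnj (cis (of_int m' * \<phi>))"
        by (simp add: cis_cnj cis_mult algebra_simps)
      then show ?thesis
        unfolding sph_harm_azimuth[of l m \<theta> \<phi>] sph_harm_azimuth[of l' m' \<theta> \<phi>] by (simp add: mult_ac)
    qed
    then have "(LINT \<phi>:{0..2*pi}|lborel. (sph_harm l m \<theta> \<phi> * cnj (sph_harm l' m' \<theta> \<phi>)) * of_real (sin \<theta>)) =
      (LINT \<phi>:{0..2*pi}|lborel. (sph_harm l m \<theta> 0 * cnj (sph_harm l' m' \<theta> 0) * of_real (sin \<theta>)) * cis (of_int (m - m') * \<phi>))"
      by (intro set_lebesgue_integral_cong allI impI) (simp, blast)
    also have "\<dots> = (sph_harm l m \<theta> 0 * cnj (sph_harm l' m' \<theta> 0) * of_real (sin \<theta>)) * (if m = m' then of_real (2 * pi) else 0)"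
      unfolding set_integral_mult_right LINT_cis_period by simp
    finally show ?thesis .
  qed
  then have "(LINT \<theta>:{0..pi}|lborel. LINT \<phi>:{0..2*pi}|lborel.
     (sph_harm l m \<theta> \<phi> * cnj (sph_harm l' m' \<theta> \<phi>)) * of_real (sin \<theta>)) =
     (LINT \<theta>:{0..pi}|lborel. sph_harm l m \<theta> 0 * cnj (sph_harm l' m' \<theta> 0) * of_real (sin \<theta>)) * (if m = m' then of_real (2 * pi) else 0)"
    by (simp only: set_integral_mult_left)
  also have "\<dots> = (if l = l' \<and> m = m' then 1 else 0)"
    using sph_harm_theta_integral[of m l l'] assms by auto
  finally show ?thesis .
qed

text \<open>Surface measure expressed in the angles. As a finite measure with a density on the plane
  it is open to Fubini's theorem and to the general L2 lemmas; \<open>sph_meas_iterated\<close>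
  leads back to the iterated integrals of \<open>laplace_coeff\<close>.\<close>

definition sph_meas :: "(real \<times> real) measure" where
  "sph_meas = density (lborel \<Otimes>\<^sub>M lborel) (\<lambda>p. ennreal (indicator ({0..pi} \<times> {0..2*pi}) p * sin (fst p)))"

definition sph_pt :: "real \<times> real \<Rightarrow> real^3" where
  "sph_pt p = sph_point (fst p) (snd p)"

lemma norm_sph_pt [simp]: "norm (sph_pt p) = 1"
  by (simp add: sph_pt_def norm_sph_point)

lemma sets_sph_meas [measurable_cong]: "sets sph_meas = sets (lborel \<Otimes>\<^sub>M lborel)"
  by (simp add: sph_meas_def)

lemma sph_meas_density_nonneg: "0 \<le> indicator ({0..pi} \<times> {0..2*pi}) p * sin (fst p)"
  by (auto simp: indicator_def sin_ge_zero)

lemma finite_measure_sph_meas: "finite_measure sph_meas"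
proof (rule finite_measureI)
  have "emeasure sph_meas (space sph_meas) = (\<integral>\<^sup>+p. ennreal (indicator ({0..pi} \<times> {0..2*pi}) p * sin (fst p)) * indicator (space (lborel \<Otimes>\<^sub>M lborel)) p \<partial>(lborel \<Otimes>\<^sub>M lborel))"
    unfolding sph_meas_def space_density by (rule emeasure_density[OF _ sets.top]) measurable
  also have "\<dots> = (\<integral>\<^sup>+p. ennreal (indicator ({0..pi} \<times> {0..2*pi}) p * sin (fst p)) \<partial>(lborel \<Otimes>\<^sub>M lborel))"
    by (intro nn_integral_cong) simp
  also have "\<dots> \<le> (\<integral>\<^sup>+p. indicator ({0..pi} \<times> {0..2*pi}) p \<partial>(lborel \<Otimes>\<^sub>M lborel))"
    by (rule nn_integral_mono) (auto split: split_indicator)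
  also have "\<dots> = emeasure lborel {0..pi} * emeasure lborel {0..2*pi}"
    by (simp add: lborel.emeasure_pair_measure_Times)
  also have "\<dots> < \<infinity>" by (simp add: ennreal_mult_less_top)
  finally show "emeasure sph_meas (space sph_meas) \<noteq> \<infinity>" by simp
qed

lemma sph_meas_iterated:
  fixes g :: "real \<times> real \<Rightarrow> complex"
  assumes g: "integrable sph_meas g"
  shows "(LINT \<theta>:{0..pi}|lborel. LINT \<phi>:{0..2*pi}|lborel. g (\<theta>, \<phi>) * of_real (sin \<theta>)) = (LINT p|sph_meas. g p)"
proof -
  define w where "w p = indicator ({0..pi} \<times> {0..2*pi}) p * sin (fst p)" for p :: "real \<times> real"
  have gm: "g \<in> borel_measurable (lborel \<Otimes>\<^sub>M lborel)" using g measurable_cong_sets[OF sets_sph_meas refl] by auto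
  have wm: "w \<in> borel_measurable (lborel \<Otimes>\<^sub>M lborel)" unfolding w_def by measurable
  have w0: "w p \<ge> 0" for p unfolding w_def by (rule sph_meas_density_nonneg)
  have int: "integrable (lborel \<Otimes>\<^sub>M lborel) (\<lambda>p. w p *\<^sub>R g p)"
    using g unfolding sph_meas_def w_def[symmetric] by (subst (asm) integrable_density) (use gm wm w0 in auto)
  have "(LINT p|sph_meas. g p) = (LINT p|(lborel \<Otimes>\<^sub>M lborel). w p *\<^sub>R g p)"
    unfolding sph_meas_def w_def[symmetric] by (subst integral_density) (use gm wm w0 in auto)
  also have "\<dots> = (LINT \<theta>|lborel. LINT \<phi>|lborel. w (\<theta>, \<phi>) *\<^sub>R g (\<theta>, \<phi>))"
    using lborel_pair.integral_fst'[OF int] by simp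
  also have "\<dots> = (LINT \<theta>:{0..pi}|lborel. LINT \<phi>:{0..2*pi}|lborel. g (\<theta>, \<phi>) * of_real (sin \<theta>))"
    unfolding set_lebesgue_integral_def
  proof (intro Bochner_Integration.integral_cong refl)
    fix \<theta> :: real
    have "indicator {0..pi} \<theta> *\<^sub>R (LINT \<phi>|lborel. indicator {0..2*pi} \<phi> *\<^sub>R (g (\<theta>, \<phi>) * of_real (sin \<theta>))) =
       (LINT \<phi>|lborel. indicator {0..pi} \<theta> *\<^sub>R indicator {0..2*pi} \<phi> *\<^sub>R (g (\<theta>, \<phi>) * of_real (sin \<theta>)))"
      by (cases "\<theta> \<in> {0..pi}") auto
    also have "\<dots> = (LINT \<phi>|lborel. w (\<theta>, \<phi>) *\<^sub>R g (\<theta>, \<phi>))"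
      by (intro Bochner_Integration.integral_cong refl) (auto simp: w_def indicator_def scaleR_conv_of_real mult_ac)
    finally show "(LINT \<phi>|lborel. w (\<theta>, \<phi>) *\<^sub>R g (\<theta>, \<phi>)) =
      indicator {0..pi} \<theta> *\<^sub>R (LINT \<phi>|lborel. indicator {0..2*pi} \<phi> *\<^sub>R (g (\<theta>, \<phi>) * of_real (sin \<theta>)))" ..
  qed
  finally show ?thesis ..
qed

lemma continuous_on_sph_pt: "continuous_on A sph_pt"
proof -
  have "sph_pt = (\<lambda>p. (sin (fst p) * cos (snd p)) *\<^sub>R axis 1 1 + (sin (fst p) * sin (snd p)) *\<^sub>R axis 2 1 + cos (fst p) *\<^sub>R axis 3 1)"
    unfolding sph_pt_def sph_point_def by (rule ext, subst vec_eq_iff) (simp add: forall_3 axis_def)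
  moreover have "continuous_on A (\<lambda>p::real \<times> real. (sin (fst p) * cos (snd p)) *\<^sub>R axis 1 1 + (sin (fst p) * sin (snd p)) *\<^sub>R axis 2 1 + cos (fst p) *\<^sub>R (axis 3 1 :: real^3))"
    by (intro continuous_intros)
  ultimately show ?thesis by (simp only:)
qed

lemma sph_pt_measurable [measurable]: "sph_pt \<in> borel_measurable (lborel \<Otimes>\<^sub>M lborel)"
  using borel_measurable_continuous_onI[OF continuous_on_sph_pt] by (simp add: borel_prod[symmetric])

lemma sph_Y_measurable [measurable]: "sph_Y l m \<in> borel_measurable borel"
  by (intro borel_measurable_continuous_onI continuous_intros)

lemma measurable_cnj [measurable]: "cnj \<in> borel_measurable borel"
  by (intro borel_measurable_continuous_onI continuous_intros)

lemma sph_Y_integrable: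
  assumes "\<bar>m\<bar> \<le> int l" "\<bar>m'\<bar> \<le> int l'"
  shows "integrable sph_meas (\<lambda>p. sph_Y l m (sph_pt p) * cnj (sph_Y l' m' (sph_pt p)))"
proof (rule finite_measure.integrable_const_bound[OF finite_measure_sph_meas,
      where B="sqrt ((2 * real l + 1) / (4 * pi)) * sqrt ((2 * real l' + 1) / (4 * pi))"])
  have "norm (sph_Y l m (sph_pt p)) \<le> sqrt ((2 * real l + 1) / (4 * pi))" if "\<bar>m\<bar> \<le> int l" for l m p
    using sph_Y_bound[OF norm_sph_pt that] by (intro real_le_rsqrt)
  then show "AE p in sph_meas. norm (sph_Y l m (sph_pt p) * cnj (sph_Y l' m' (sph_pt p))) \<le> sqrt ((2 * real l + 1) / (4 * pi)) * sqrt ((2 * real l' + 1) / (4 * pi))"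
    unfolding norm_mult complex_mod_cnj using assms by (intro AE_I2 mult_mono) auto
qed measurable

lemma sph_Y_orthonormal:
  assumes "\<bar>m\<bar> \<le> int l" "\<bar>m'\<bar> \<le> int l'"
  shows "(LINT p|sph_meas. sph_Y l m (sph_pt p) * cnj (sph_Y l' m' (sph_pt p))) = (if l = l' \<and> m = m' then 1 else 0)"
  unfolding sph_meas_iterated[OF sph_Y_integrable[OF assms], symmetric] sph_harm_orthonormal_iterated[OF assms, symmetric]
  by (intro set_lebesgue_integral_cong) (auto simp: sph_pt_def sph_harm_sph_Y assms set_lebesgue_integral_def)

section \<open>Mean square convergence and stochastic integrals\<close>

lemma sq_integrable_measurable: "sq_integrable M X \<Longrightarrow> X \<in> borel_measurable M"
  by (simp add: sq_integrable_def)

lemma sq_integrable_bounded_by: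
  fixes X :: "'a \<Rightarrow> 'b::{banach, second_countable_topology}" and Y :: "'a \<Rightarrow> real"
  assumes "X \<in> borel_measurable M" "integrable M Y" "AE x in M. (norm (X x))\<^sup>2 \<le> Y x"
  shows "sq_integrable M X"
  unfolding sq_integrable_def
proof
  show "integrable M (\<lambda>\<omega>. (norm (X \<omega>))\<^sup>2)"
    by (rule Bochner_Integration.integrable_bound[OF assms(2)]) (use assms in \<open>auto elim!: eventually_mono\<close>)
qed (use assms in auto)

lemma norm_add_sq_le: "(norm (x + y))\<^sup>2 \<le> 2 * (norm x)\<^sup>2 + 2 * (norm (y::'a::real_normed_vector))\<^sup>2"
proof -
  have "(norm (x + y))\<^sup>2 \<le> (norm x + norm y)\<^sup>2"
    by (rule power_mono) (auto simp: norm_triangle_ineq)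
  also have "\<dots> \<le> 2 * (norm x)\<^sup>2 + 2 * (norm y)\<^sup>2"
    using sum_squares_bound[of "norm x" "norm y"] by (simp add: power2_sum)
  finally show ?thesis .
qed

lemma sq_integrable_add:
  assumes "sq_integrable M X" "sq_integrable M Y"
  shows "sq_integrable M (\<lambda>\<omega>. X \<omega> + Y \<omega>)"
proof (rule sq_integrable_bounded_by)
  show "integrable M (\<lambda>\<omega>. 2 * (norm (X \<omega>))\<^sup>2 + 2 * (norm (Y \<omega>))\<^sup>2)"
    using assms by (auto simp: sq_integrable_def)
  show "(\<lambda>\<omega>. X \<omega> + Y \<omega>) \<in> borel_measurable M"
    using assms by (auto simp: sq_integrable_def)
qed (auto simp: norm_add_sq_le)

lemma sq_integrable_mult_left:
  fixes X :: "'a \<Rightarrow> 'b::{banach, second_countable_topology, real_normed_div_algebra}"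
  assumes "sq_integrable M X"
  shows "sq_integrable M (\<lambda>\<omega>. c * X \<omega>)"
  using assms by (auto simp: sq_integrable_def norm_mult power_mult_distrib)

lemma sq_integrable_uminus: "sq_integrable M X \<Longrightarrow> sq_integrable M (\<lambda>\<omega>. - X \<omega>)"
  by (auto simp: sq_integrable_def)

lemma sq_integrable_diff:
  assumes "sq_integrable M X" "sq_integrable M Y"
  shows "sq_integrable M (\<lambda>\<omega>. X \<omega> - Y \<omega>)"
  using sq_integrable_add[OF assms(1) sq_integrable_uminus[OF assms(2)]] by simp

lemma sq_integrable_zero: "sq_integrable M (\<lambda>_. 0)"
  by (simp add: sq_integrable_def)

lemma sq_integrable_sum:
  assumes "\<And>i. i \<in> I \<Longrightarrow> sq_integrable M (X i)"
  shows "sq_integrable M (\<lambda>\<omega>. \<Sum>i\<in>I. X i \<omega>)"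
proof (cases "finite I")
  case True
  then show ?thesis using assms
    by (induction I rule: finite_induct) (auto intro: sq_integrable_add sq_integrable_zero)
qed (simp add: sq_integrable_zero)

lemma sq_integrable_cnj: "sq_integrable M X \<Longrightarrow> sq_integrable M (\<lambda>\<omega>. cnj (X \<omega>))"
  by (auto simp: sq_integrable_def intro: borel_measurable_continuous_on[where f=cnj]  continuous_intros)

lemma sq_integrable_Re:
  assumes "sq_integrable M X"
  shows "sq_integrable M (\<lambda>\<omega>. Re (X \<omega>))"
proof (rule sq_integrable_bounded_by)
  show "integrable M (\<lambda>\<omega>. (norm (X \<omega>))\<^sup>2)" "(\<lambda>\<omega>. Re (X \<omega>)) \<in> borel_measurable M"
    using assms by (auto simp: sq_integrable_def)
qed (simp add: cmod_power2)

lemma sq_integrable_of_real: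
  "sq_integrable M (\<lambda>\<omega>. complex_of_real (X \<omega>)) \<longleftrightarrow> sq_integrable M X"
proof
  assume "sq_integrable M (\<lambda>\<omega>. complex_of_real (X \<omega>))"
  from sq_integrable_Re[OF this] show "sq_integrable M X" by simp
qed (auto simp: sq_integrable_def borel_measurable_complex_iff)

lemma sq_integrable_inner:
  assumes "sq_integrable M X" "sq_integrable M Y"
  shows "integrable M (\<lambda>\<omega>. X \<omega> * cnj (Y \<omega>))"
proof (rule Bochner_Integration.integrable_bound)
  show "integrable M (\<lambda>\<omega>. (norm (X \<omega>))\<^sup>2 + (norm (Y \<omega>))\<^sup>2)"
    using assms by (auto simp: sq_integrable_def)
  show "(\<lambda>\<omega>. X \<omega> * cnj (Y \<omega>)) \<in> borel_measurable M"
    using assms sq_integrable_cnj[OF assms(2)] by (auto simp: sq_integrable_def)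
  have "norm (x * cnj y) \<le> (norm x)\<^sup>2 + (norm y)\<^sup>2" for x y :: complex
  proof -
    have "2 * (norm x * norm y) \<le> (norm x)\<^sup>2 + (norm y)\<^sup>2"
      using sum_squares_bound[of "norm x" "norm y"] by simp
    then show ?thesis unfolding norm_mult complex_mod_cnj
      using mult_nonneg_nonneg[OF norm_ge_zero[of x] norm_ge_zero[of y]] by linarith
  qed
  then show "AE \<omega> in M. norm (X \<omega> * cnj (Y \<omega>)) \<le> norm ((norm (X \<omega>))\<^sup>2 + (norm (Y \<omega>))\<^sup>2)"
    by simp
qed

lemma sq_integrable_const: "finite_measure M \<Longrightarrow> sq_integrable M (\<lambda>_. c)"
  by (simp add: sq_integrable_def finite_measure.integrable_const)

lemma integral_norm_sq:
  "complex_of_real (LINT \<omega>|M. (norm (X \<omega>))\<^sup>2) = (LINT \<omega>|M. X \<omega> * cnj (X \<omega>))"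
  unfolding integral_complex_of_real[symmetric] complex_norm_square ..

lemma L2_Cauchy_Schwarz:
  assumes "sq_integrable M X" "sq_integrable M Y"
  shows "(norm (LINT \<omega>|M. X \<omega> * cnj (Y \<omega>)))\<^sup>2 \<le>
    (LINT \<omega>|M. (norm (X \<omega>))\<^sup>2) * (LINT \<omega>|M. (norm (Y \<omega>))\<^sup>2)"
proof -
  have [measurable]: "X \<in> borel_measurable M" "Y \<in> borel_measurable M"
    using assms by (auto simp: sq_integrable_def)
  have int: "integrable M (\<lambda>\<omega>. norm (X \<omega>) * norm (Y \<omega>))"
    using integrable_norm[OF sq_integrable_inner[OF assms]] by (simp add: norm_mult)
  have "(\<integral>\<^sup>+\<omega>. ennreal (norm (X \<omega>)) * ennreal (norm (Y \<omega>)) \<partial>M)\<^sup>2 \<le>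
     (\<integral>\<^sup>+\<omega>. (ennreal (norm (X \<omega>)))\<^sup>2 \<partial>M) * (\<integral>\<^sup>+\<omega>. (ennreal (norm (Y \<omega>)))\<^sup>2 \<partial>M)"
    by (rule Cauchy_Schwarz_nn_integral) auto
  also have "(\<integral>\<^sup>+\<omega>. (ennreal (norm (X \<omega>)))\<^sup>2 \<partial>M) = ennreal (LINT \<omega>|M. (norm (X \<omega>))\<^sup>2)"
    using assms by (simp add: ennreal_power sq_integrable_def nn_integral_eq_integral)
  also have "(\<integral>\<^sup>+\<omega>. (ennreal (norm (Y \<omega>)))\<^sup>2 \<partial>M) = ennreal (LINT \<omega>|M. (norm (Y \<omega>))\<^sup>2)"
    using assms by (simp add: ennreal_power sq_integrable_def nn_integral_eq_integral)
  also have "(\<integral>\<^sup>+\<omega>. ennreal (norm (X \<omega>)) * ennreal (norm (Y \<omega>)) \<partial>M) =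
       ennreal (LINT \<omega>|M. norm (X \<omega>) * norm (Y \<omega>))"
    using int by (simp add: nn_integral_eq_integral ennreal_mult[symmetric])
  finally have "(LINT \<omega>|M. norm (X \<omega>) * norm (Y \<omega>))\<^sup>2 \<le>
     (LINT \<omega>|M. (norm (X \<omega>))\<^sup>2) * (LINT \<omega>|M. (norm (Y \<omega>))\<^sup>2)"
    by (simp add: ennreal_power ennreal_mult[symmetric])
  moreover have "norm (LINT \<omega>|M. X \<omega> * cnj (Y \<omega>)) \<le> (LINT \<omega>|M. norm (X \<omega>) * norm (Y \<omega>))"
    using integral_norm_bound[of M "\<lambda>\<omega>. X \<omega> * cnj (Y \<omega>)"] by (simp add: norm_mult)
  ultimately show ?thesis
    by (meson norm_ge_zero order_trans power_mono)
qed

lemma L2_norm_zero_AE: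
  assumes "sq_integrable M X" "(LINT \<omega>|M. (norm (X \<omega>))\<^sup>2) = 0"
  shows "AE \<omega> in M. X \<omega> = 0"
  using integral_nonneg_eq_0_iff_AE[of M "\<lambda>\<omega>. (norm (X \<omega>))\<^sup>2"] assms by (auto simp: sq_integrable_def)

lemma L2_norm_add_le:
  assumes "sq_integrable M X" "sq_integrable M Y"
  shows "(LINT \<omega>|M. (norm (X \<omega> + Y \<omega>))\<^sup>2) \<le>
     2 * (LINT \<omega>|M. (norm (X \<omega>))\<^sup>2) + 2 * (LINT \<omega>|M. (norm (Y \<omega>))\<^sup>2)"
proof -
  have "(LINT \<omega>|M. (norm (X \<omega> + Y \<omega>))\<^sup>2) \<le> (LINT \<omega>|M. 2 * (norm (X \<omega>))\<^sup>2 + 2 * (norm (Y \<omega>))\<^sup>2)"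
    by (rule integral_mono)
       (use assms sq_integrable_add[OF assms] in \<open>auto simp: sq_integrable_def norm_add_sq_le\<close>)
  also have "\<dots> = 2 * (LINT \<omega>|M. (norm (X \<omega>))\<^sup>2) + 2 * (LINT \<omega>|M. (norm (Y \<omega>))\<^sup>2)"
    using assms by (simp add: sq_integrable_def)
  finally show ?thesis .
qed

lemma ms_tendstoD:
  assumes "ms_tendsto M X Y"
  shows "\<And>n. sq_integrable M (X n)" "sq_integrable M Y"
    "(\<lambda>n. LINT \<omega>|M. (norm (X n \<omega> - Y \<omega>))\<^sup>2) \<longlonglongrightarrow> 0"
  using assms by (auto simp: ms_tendsto_def)

lemma ms_tendsto_squeeze:
  assumes "\<And>n. sq_integrable M (X n)" "sq_integrable M Y"
    "\<And>n. (LINT \<omega>|M. (norm (X n \<omega> - Y \<omega>))\<^sup>2) \<le> e n" "e \<longlonglongrightarrow> 0"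
  shows "ms_tendsto M X Y"
  unfolding ms_tendsto_def
  using assms by (auto intro!: tendsto_sandwich[OF _ _ tendsto_const assms(4)])

lemma ms_tendsto_const: "sq_integrable M X \<Longrightarrow> ms_tendsto M (\<lambda>_. X) X"
  by (simp add: ms_tendsto_def)

lemma ms_tendsto_add:
  assumes "ms_tendsto M X Y" "ms_tendsto M X' Y'"
  shows "ms_tendsto M (\<lambda>n \<omega>. X n \<omega> + X' n \<omega>) (\<lambda>\<omega>. Y \<omega> + Y' \<omega>)"
proof (rule ms_tendsto_squeeze)
  note D = ms_tendstoD[OF assms(1)] ms_tendstoD[OF assms(2)]
  show "sq_integrable M (\<lambda>\<omega>. X n \<omega> + X' n \<omega>)" for n by (intro sq_integrable_add D)
  show "sq_integrable M (\<lambda>\<omega>. Y \<omega> + Y' \<omega>)" by (intro sq_integrable_add D)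
  show "(LINT \<omega>|M. (norm (X n \<omega> + X' n \<omega> - (Y \<omega> + Y' \<omega>)))\<^sup>2) \<le>
     2 * (LINT \<omega>|M. (norm (X n \<omega> - Y \<omega>))\<^sup>2) + 2 * (LINT \<omega>|M. (norm (X' n \<omega> - Y' \<omega>))\<^sup>2)" for n
    using L2_norm_add_le[OF sq_integrable_diff[OF D(1)[of n] D(2)] sq_integrable_diff[OF D(4)[of n] D(5)]]
    by (simp add: algebra_simps)
  show "(\<lambda>n. 2 * (LINT \<omega>|M. (norm (X n \<omega> - Y \<omega>))\<^sup>2) + 2 * (LINT \<omega>|M. (norm (X' n \<omega> - Y' \<omega>))\<^sup>2)) \<longlonglongrightarrow> 0"
    using tendsto_add[OF tendsto_mult_left[OF D(3), of 2] tendsto_mult_left[OF D(6), of 2]] by simp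
qed

lemma ms_tendsto_mult_left:
  assumes "ms_tendsto M X Y"
  shows "ms_tendsto M (\<lambda>n \<omega>. c * X n \<omega>) (\<lambda>\<omega>. c * Y \<omega>)"
  unfolding ms_tendsto_def
proof (intro conjI allI sq_integrable_mult_left ms_tendstoD[OF assms])
  have "(\<lambda>n. (norm c)\<^sup>2 * (LINT \<omega>|M. (norm (X n \<omega> - Y \<omega>))\<^sup>2)) \<longlonglongrightarrow> (norm c)\<^sup>2 * 0"
    by (intro tendsto_intros ms_tendstoD[OF assms])
  then show "(\<lambda>n. LINT \<omega>|M. (norm (c * X n \<omega> - c * Y \<omega>))\<^sup>2) \<longlonglongrightarrow> 0"
    by (simp add: right_diff_distrib[symmetric] norm_mult power_mult_distrib)
qed

lemma ms_tendsto_diff: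
  assumes "ms_tendsto M X Y" "ms_tendsto M X' Y'"
  shows "ms_tendsto M (\<lambda>n \<omega>. X n \<omega> - X' n \<omega>) (\<lambda>\<omega>. Y \<omega> - Y' \<omega>)"
  using ms_tendsto_add[OF assms(1) ms_tendsto_mult_left[OF assms(2), of "-1"]] by simp

lemma ms_tendsto_cnj:
  assumes "ms_tendsto M X Y"
  shows "ms_tendsto M (\<lambda>n \<omega>. cnj (X n \<omega>)) (\<lambda>\<omega>. cnj (Y \<omega>))"
  using assms unfolding ms_tendsto_def
  by (auto intro!: sq_integrable_cnj simp: complex_cnj_diff[symmetric] simp del: complex_cnj_diff)

lemma ms_tendsto_cong_AE:
  assumes "ms_tendsto M X Y" "\<And>n. sq_integrable M (X' n)" "\<And>n. AE \<omega> in M. X n \<omega> = X' n \<omega>"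
  shows "ms_tendsto M X' Y"
  unfolding ms_tendsto_def
proof (intro conjI allI assms(2) ms_tendstoD(2)[OF assms(1)])
  have [measurable]: "X n \<in> borel_measurable M" "X' n \<in> borel_measurable M" "Y \<in> borel_measurable M" for n
    using ms_tendstoD[OF assms(1)] assms(2) by (auto simp: sq_integrable_def)
  have "(LINT \<omega>|M. (norm (X n \<omega> - Y \<omega>))\<^sup>2) = (LINT \<omega>|M. (norm (X' n \<omega> - Y \<omega>))\<^sup>2)" for n
    by (rule integral_cong_AE) (use assms(3)[of n] in \<open>auto elim!: eventually_mono\<close>)
  then show "(\<lambda>n. LINT \<omega>|M. (norm (X' n \<omega> - Y \<omega>))\<^sup>2) \<longlonglongrightarrow> 0"
    using ms_tendstoD(3)[OF assms(1)] by simp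
qed

text \<open>The difference of products is (X - Y) (X' - Y')* + (X - Y) Y'* + Y (X' - Y')*, and each
  part is controlled by the Cauchy-Schwarz inequality.\<close>

lemma ms_tendsto_inner:
  assumes "ms_tendsto M X Y" "ms_tendsto M X' Y'"
  shows "(\<lambda>n. LINT \<omega>|M. X n \<omega> * cnj (X' n \<omega>)) \<longlonglongrightarrow> (LINT \<omega>|M. Y \<omega> * cnj (Y' \<omega>))"
proof -
  note D = ms_tendstoD[OF assms(1)] ms_tendstoD[OF assms(2)]
  define d where "d = (\<lambda>n. LINT \<omega>|M. (norm (X n \<omega> - Y \<omega>))\<^sup>2)"
  define d' where "d' = (\<lambda>n. LINT \<omega>|M. (norm (X' n \<omega> - Y' \<omega>))\<^sup>2)"
  have bound: "norm (LINT \<omega>|M. U \<omega> * cnj (V \<omega>)) \<le> sqrt ((LINT \<omega>|M. (norm (U \<omega>))\<^sup>2) * (LINT \<omega>|M. (norm (V \<omega>))\<^sup>2))"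
    if "sq_integrable M U" "sq_integrable M V" for U V
    by (intro real_le_rsqrt L2_Cauchy_Schwarz that)
  have i: "sq_integrable M (\<lambda>\<omega>. X n \<omega> - Y \<omega>)" "sq_integrable M (\<lambda>\<omega>. X' n \<omega> - Y' \<omega>)" for n
    by (intro sq_integrable_diff D)+
  have eq: "(LINT \<omega>|M. X n \<omega> * cnj (X' n \<omega>)) - (LINT \<omega>|M. Y \<omega> * cnj (Y' \<omega>)) =
     (LINT \<omega>|M. (X n \<omega> - Y \<omega>) * cnj (X' n \<omega> - Y' \<omega>)) + (LINT \<omega>|M. (X n \<omega> - Y \<omega>) * cnj (Y' \<omega>))
      + (LINT \<omega>|M. Y \<omega> * cnj (X' n \<omega> - Y' \<omega>))" for n
    by (subst Bochner_Integration.integral_diff[symmetric] Bochner_Integration.integral_add[symmetric];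
        (intro sq_integrable_inner Bochner_Integration.integrable_add D i)?)+
       (simp add: algebra_simps)
  have z: "d \<longlonglongrightarrow> 0" "d' \<longlonglongrightarrow> 0" using D by (auto simp: d_def d'_def)
  have "(\<lambda>n. sqrt (d n * d' n) + sqrt (d n * (LINT \<omega>|M. (norm (Y' \<omega>))\<^sup>2)) +
      sqrt ((LINT \<omega>|M. (norm (Y \<omega>))\<^sup>2) * d' n)) \<longlonglongrightarrow> sqrt (0 * 0) + sqrt (0 * (LINT \<omega>|M. (norm (Y' \<omega>))\<^sup>2)) +
      sqrt ((LINT \<omega>|M. (norm (Y \<omega>))\<^sup>2) * 0)"
    by (intro tendsto_intros z)
  then have lim: "(\<lambda>n. sqrt (d n * d' n) + sqrt (d n * (LINT \<omega>|M. (norm (Y' \<omega>))\<^sup>2)) +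
      sqrt ((LINT \<omega>|M. (norm (Y \<omega>))\<^sup>2) * d' n)) \<longlonglongrightarrow> 0" by simp
  have "(\<lambda>n. (LINT \<omega>|M. X n \<omega> * cnj (X' n \<omega>)) - (LINT \<omega>|M. Y \<omega> * cnj (Y' \<omega>))) \<longlonglongrightarrow> 0"
    by (rule Lim_null_comparison[OF _ lim], rule always_eventually, rule allI, subst eq,
        intro norm_triangle_le add_mono)
       (auto simp: d_def d'_def intro!: bound i D norm_triangle_le add_mono simp del: complex_cnj_diff)
  then show ?thesis by (simp add: LIM_zero_iff)
qed

lemma ms_tendsto_norm_sq:
  assumes "ms_tendsto M X Y"
  shows "(\<lambda>n. LINT \<omega>|M. (norm (X n \<omega>))\<^sup>2) \<longlonglongrightarrow> (LINT \<omega>|M. (norm (Y \<omega>))\<^sup>2)"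
  using ms_tendsto_inner[OF assms assms] unfolding integral_norm_sq[symmetric]
  by (simp only: tendsto_of_real_iff)

lemma ms_tendsto_unique_AE:
  assumes "ms_tendsto M X Y" "ms_tendsto M X Y'"
  shows "AE \<omega> in M. Y \<omega> = Y' \<omega>"
proof -
  have m: "ms_tendsto M (\<lambda>n \<omega>. 0) (\<lambda>\<omega>. Y \<omega> - Y' \<omega>)"
    using ms_tendsto_diff[OF assms] by simp
  have "(LINT \<omega>|M. (norm (Y \<omega> - Y' \<omega>))\<^sup>2) = 0"
    using ms_tendsto_norm_sq[OF m] by (simp add: LIMSEQ_const_iff)
  from L2_norm_zero_AE[OF ms_tendstoD(2)[OF m] this] show ?thesis by simp
qed

section \<open>Completeness of mean square convergence\<close>

lemma L2_fast_Cauchy_bound: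
  assumes "\<And>n. sq_integrable M (X n)"
    "\<And>n. (LINT \<omega>|M. (norm (X (Suc n) \<omega> - X n \<omega>))\<^sup>2) \<le> (1/4) ^ n"
  shows "(LINT \<omega>|M. (norm (X (n + j) \<omega> - X n \<omega>))\<^sup>2) \<le> 4 * (1/4) ^ n"
proof (induction j arbitrary: n)
  case (Suc j)
  have "(LINT \<omega>|M. (norm ((X (Suc n + j) \<omega> - X (Suc n) \<omega>) + (X (Suc n) \<omega> - X n \<omega>)))\<^sup>2) \<le>
     2 * (LINT \<omega>|M. (norm (X (Suc n + j) \<omega> - X (Suc n) \<omega>))\<^sup>2) + 2 * (LINT \<omega>|M. (norm (X (Suc n) \<omega> - X n \<omega>))\<^sup>2)"
    by (intro L2_norm_add_le sq_integrable_diff assms)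
  also have "\<dots> \<le> 2 * (4 * (1/4) ^ Suc n) + 2 * (1/4) ^ n"
    by (intro add_mono mult_left_mono Suc.IH assms) auto
  \<comment> \<open>The constant 4 is the fixed point of K = 2 K / 4 + 2.\<close>
  also have "\<dots> = 4 * (1/4) ^ n" by simp
  finally show ?case by simp
qed simp

text \<open>The increments have summable L1 norms, so the sequence converges almost surely, and
  Fatou's lemma transfers the distance bounds to the limit. The limit is given by the explicit
  formula \<open>lim\<close>, which later makes the random field measurable in point and sample
  jointly.\<close>

lemma L2_fast_Cauchy:
  fixes X :: "nat \<Rightarrow> 'a \<Rightarrow> complex"
  assumes "finite_measure M" and X: "\<And>n. sq_integrable M (X n)"
    and le: "\<And>n. (LINT \<omega>|M. (norm (X (Suc n) \<omega> - X n \<omega>))\<^sup>2) \<le> (1/4) ^ n"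
  shows "AE \<omega> in M. convergent (\<lambda>n. X n \<omega>)"
    and "ms_tendsto M X (\<lambda>\<omega>. lim (\<lambda>n. X n \<omega>))"
proof -
  interpret finite_measure M by fact
  have [measurable]: "X n \<in> borel_measurable M" for n using X by (simp add: sq_integrable_def)
  define D where "D n \<omega> = norm (X (Suc n) \<omega> - X n \<omega>)" for n \<omega>
  have [measurable]: "D n \<in> borel_measurable M" for n unfolding D_def by measurable
  have sqD: "sq_integrable M (\<lambda>\<omega>. complex_of_real (D n \<omega>))" for n
    using sq_integrable_diff[OF X[of "Suc n"] X[of n]] by (auto simp: sq_integrable_def D_def)
  have int_D: "integrable M (D n)" for n
    using sq_integrable_inner[OF sqD[of n] sq_integrable_const[of M 1, OF finite_measure_axioms]]
    integrable_norm[of M "\<lambda>\<omega>. complex_of_real (D n \<omega>)"] by (simp add: D_def[abs_def])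
  \<comment> \<open>Cauchy-Schwarz against the constant 1: the measure is finite, so L1 norms are
    controlled by L2 norms.\<close>
  have D_le: "(LINT \<omega>|M. D n \<omega>) \<le> (1/2) ^ n * sqrt (measure M (space M))" for n
  proof (rule power2_le_imp_le)
    have "(LINT \<omega>|M. D n \<omega>)\<^sup>2 \<le> (LINT \<omega>|M. (D n \<omega>)\<^sup>2) * measure M (space M)"
      using L2_Cauchy_Schwarz[OF sqD[of n] sq_integrable_const[of M 1, OF finite_measure_axioms]] by simp
    also have "\<dots> \<le> (1/4) ^ n * measure M (space M)"
      using le[of n] by (intro mult_right_mono) (auto simp: D_def)
    also have "\<dots> = ((1/2) ^ n * sqrt (measure M (space M)))\<^sup>2"
    proof -
      have "(1/4::real) ^ n = ((1/2) ^ n)\<^sup>2" by (simp add: power2_eq_square flip: power_mult_distrib)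
      then show ?thesis by (simp add: power_mult_distrib)
    qed
    finally show "(LINT \<omega>|M. D n \<omega>)\<^sup>2 \<le> ((1/2) ^ n * sqrt (measure M (space M)))\<^sup>2" .
  qed auto
  have "(\<integral>\<^sup>+\<omega>. (\<Sum>n. ennreal (D n \<omega>)) \<partial>M) = (\<Sum>n. \<integral>\<^sup>+\<omega>. ennreal (D n \<omega>) \<partial>M)"
    by (rule nn_integral_suminf) auto
  also have "\<dots> = (\<Sum>n. ennreal (LINT \<omega>|M. D n \<omega>))"
    by (intro suminf_cong nn_integral_eq_integral int_D) (simp add: D_def)
  also have "\<dots> \<le> (\<Sum>n. ennreal ((1/2) ^ n * sqrt (measure M (space M))))"
    by (intro suminf_le ennreal_leI D_le) auto
  also have "\<dots> < \<infinity>"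
    by (subst suminf_ennreal2) (auto intro!: summable_mult2)
  finally have fin: "(\<integral>\<^sup>+\<omega>. (\<Sum>n. ennreal (D n \<omega>)) \<partial>M) \<noteq> \<infinity>" by simp
  have "AE \<omega> in M. (\<Sum>n. ennreal (D n \<omega>)) \<noteq> \<infinity>"
    by (rule nn_integral_PInf_AE[OF _ fin]) measurable
  then show AE_conv: "AE \<omega> in M. convergent (\<lambda>n. X n \<omega>)"
  proof eventually_elim
    case (elim \<omega>)
    then have "summable (\<lambda>n. D n \<omega>)"
      by (intro summable_suminf_not_top) (auto simp: D_def)
    then have "summable (\<lambda>n. X (Suc n) \<omega> - X n \<omega>)"
      unfolding D_def by (rule summable_norm_cancel)
    then have "convergent (\<lambda>n. \<Sum>i<n. X (Suc i) \<omega> - X i \<omega>)"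
      by (simp add: summable_iff_convergent)
    then have "convergent (\<lambda>n. X n \<omega> - X 0 \<omega>)"
      by (simp add: sum_lessThan_telescope[of "\<lambda>i. X i \<omega>"])
    from convergent_add[OF this convergent_const[of "X 0 \<omega>"]] show ?case by simp
  qed
  define Y where "Y \<omega> = lim (\<lambda>n. X n \<omega>)" for \<omega>
  have [measurable]: "Y \<in> borel_measurable M"
    unfolding Y_def by (rule borel_measurable_lim_metric) auto
  have nn: "(\<integral>\<^sup>+\<omega>. (norm (X n \<omega> - Y \<omega>))\<^sup>2 \<partial>M) \<le> ennreal (4 * (1/4) ^ n)" for n
  proof -
    have "(\<integral>\<^sup>+\<omega>. (norm (X n \<omega> - Y \<omega>))\<^sup>2 \<partial>M) =
      (\<integral>\<^sup>+\<omega>. liminf (\<lambda>j. ennreal ((norm (X (n + j) \<omega> - X n \<omega>))\<^sup>2)) \<partial>M)"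
    proof (rule nn_integral_cong_AE, use AE_conv in eventually_elim)
      case (elim \<omega>)
      then have "(\<lambda>j. X j \<omega>) \<longlonglongrightarrow> Y \<omega>" unfolding Y_def by (simp add: convergent_LIMSEQ_iff)
      then have "(\<lambda>j. X (n + j) \<omega>) \<longlonglongrightarrow> Y \<omega>" by (subst add.commute) (rule LIMSEQ_ignore_initial_segment)
      then have "(\<lambda>j. ennreal ((norm (X (n + j) \<omega> - X n \<omega>))\<^sup>2)) \<longlonglongrightarrow> ennreal ((norm (Y \<omega> - X n \<omega>))\<^sup>2)"
        by (intro tendsto_intros)
      from lim_imp_Liminf[OF _ this] show ?case by (simp add: norm_minus_commute)
    qed
    also have "\<dots> \<le> liminf (\<lambda>j. \<integral>\<^sup>+\<omega>. ennreal ((norm (X (n + j) \<omega> - X n \<omega>))\<^sup>2) \<partial>M)"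
      by (rule nn_integral_liminf) auto
    also have "\<dots> \<le> liminf (\<lambda>j. ennreal (4 * (1/4) ^ n))"
    proof (rule Liminf_mono, rule always_eventually, rule allI)
      fix j
      have "(\<integral>\<^sup>+\<omega>. ennreal ((norm (X (n + j) \<omega> - X n \<omega>))\<^sup>2) \<partial>M) =
         ennreal (LINT \<omega>|M. (norm (X (n + j) \<omega> - X n \<omega>))\<^sup>2)"
        using sq_integrable_diff[OF X[of "n+j"] X[of n]]
        by (intro nn_integral_eq_integral) (auto simp: sq_integrable_def)
      also have "\<dots> \<le> ennreal (4 * (1/4) ^ n)"
        by (intro ennreal_leI L2_fast_Cauchy_bound X le)
      finally show "(\<integral>\<^sup>+\<omega>. ennreal ((norm (X (n + j) \<omega> - X n \<omega>))\<^sup>2) \<partial>M) \<le> ennreal (4 * (1/4) ^ n)" .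
    qed
    also have "\<dots> = ennreal (4 * (1/4) ^ n)" by (simp add: Liminf_const)
    finally show ?thesis .
  qed
  have sqXY: "sq_integrable M (\<lambda>\<omega>. X n \<omega> - Y \<omega>)" for n
    unfolding sq_integrable_def
    by (auto intro!: integrableI_bounded simp: order.strict_trans1[OF nn])
  have "sq_integrable M Y"
    using sq_integrable_diff[OF X[of 0] sqXY[of 0]] by simp
  then show "ms_tendsto M X Y"
  proof (rule ms_tendsto_squeeze[OF X])
    show "(LINT \<omega>|M. (norm (X n \<omega> - Y \<omega>))\<^sup>2) \<le> 4 * (1/4) ^ n" for n
    proof -
      have "ennreal (LINT \<omega>|M. (norm (X n \<omega> - Y \<omega>))\<^sup>2) = (\<integral>\<^sup>+\<omega>. (norm (X n \<omega> - Y \<omega>))\<^sup>2 \<partial>M)"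
        using sqXY[of n] by (intro nn_integral_eq_integral[symmetric]) (auto simp: sq_integrable_def)
      then have "ennreal (LINT \<omega>|M. (norm (X n \<omega> - Y \<omega>))\<^sup>2) \<le> ennreal (4 * (1/4) ^ n)"
        using nn[of n] by simp
      then show ?thesis by (subst (asm) ennreal_le_iff) auto
    qed
    have "(\<lambda>n. 4 * (1/4) ^ n) \<longlonglongrightarrow> (4 * 0::real)"
      by (intro tendsto_intros LIMSEQ_power_zero) auto
    then show "(\<lambda>n. 4 * (1/4) ^ n) \<longlonglongrightarrow> (0::real)" by simp
  qed
qed

text \<open>The function \<open>d\<close> is arbitrary because it stands once for L2 distances and
  once for the numerical tails that bound them at all points simultaneously.\<close>

lemma fast_subsequence:
  fixes d :: "nat \<Rightarrow> nat \<Rightarrow> real"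
  assumes "\<And>e. e > 0 \<Longrightarrow> \<exists>N. \<forall>m\<ge>N. \<forall>n\<ge>N. d m n \<le> e"
  obtains r where "strict_mono r" "\<And>k n. n \<ge> r k \<Longrightarrow> d n (r k) \<le> (1/4) ^ k"
proof -
  have "\<exists>N. \<forall>k. \<forall>m\<ge>N k. \<forall>n\<ge>N k. d m n \<le> (1/4)^k"
    by (rule choice, intro allI assms) simp
  then obtain N :: "nat \<Rightarrow> nat" where N: "\<And>k m n. m \<ge> N k \<Longrightarrow> n \<ge> N k \<Longrightarrow> d m n \<le> (1/4)^k" by metis
  define r where "r k = k + (\<Sum>i\<le>k. N i)" for k
  have "strict_mono r" by (rule strict_monoI_Suc) (simp add: r_def)
  moreover have "N k \<le> r k" for k
    unfolding r_def by (rule order_trans[OF member_le_sum[of k "{..k}" N]]) auto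
  ultimately show ?thesis using N by (intro that[of r]) (meson order_trans)+
qed

lemma L2_complete:
  assumes "finite_measure M" and X: "\<And>n. sq_integrable M (X n)"
    and C: "\<And>e. e > 0 \<Longrightarrow> \<exists>N. \<forall>m\<ge>N. \<forall>n\<ge>N. (LINT \<omega>|M. (norm (X m \<omega> - X n \<omega>))\<^sup>2) \<le> e"
  shows "\<exists>Y. ms_tendsto M X Y"
proof -
  obtain r where r: "strict_mono r" "\<And>k n. n \<ge> r k \<Longrightarrow> (LINT \<omega>|M. (norm (X n \<omega> - X (r k) \<omega>))\<^sup>2) \<le> (1/4) ^ k"
    by (rule fast_subsequence[OF C]) auto
  define Y where "Y \<omega> = lim (\<lambda>n. X (r n) \<omega>)" for \<omega>
  have ms: "ms_tendsto M (\<lambda>n. X (r n)) Y"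
    unfolding Y_def
    by (rule L2_fast_Cauchy(2)[OF assms(1)]) (auto intro!: X r(2) simp: strict_mono_less_eq[OF r(1)])
  have "ms_tendsto M X Y"
    unfolding ms_tendsto_def
  proof (intro conjI allI X ms_tendstoD(2)[OF ms] LIMSEQ_I)
    fix e :: real assume "e > 0"
    then obtain N where N: "\<And>m n. m \<ge> N \<Longrightarrow> n \<ge> N \<Longrightarrow> (LINT \<omega>|M. (norm (X m \<omega> - X n \<omega>))\<^sup>2) \<le> e/8"
      using C[of "e/8"] by auto
    from ms_tendstoD(3)[OF ms] \<open>e > 0\<close> obtain K where
      K: "\<And>k. k \<ge> K \<Longrightarrow> norm ((LINT \<omega>|M. (norm (X (r k) \<omega> - Y \<omega>))\<^sup>2) - 0) < e/8"
      using LIMSEQ_D[OF ms_tendstoD(3)[OF ms], of "e/8"] by auto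
    define k where "k = max K N"
    have k: "k \<ge> K" "r k \<ge> N" using seq_suble[OF r(1), of k] by (auto simp: k_def)
    have "norm ((LINT \<omega>|M. (norm (X n \<omega> - Y \<omega>))\<^sup>2) - 0) < e" if "n \<ge> N" for n
    proof -
      have "(LINT \<omega>|M. (norm ((X n \<omega> - X (r k) \<omega>) + (X (r k) \<omega> - Y \<omega>)))\<^sup>2) \<le>
         2 * (LINT \<omega>|M. (norm (X n \<omega> - X (r k) \<omega>))\<^sup>2) + 2 * (LINT \<omega>|M. (norm (X (r k) \<omega> - Y \<omega>))\<^sup>2)"
        by (intro L2_norm_add_le sq_integrable_diff X ms_tendstoD(2)[OF ms])
      then show ?thesis using N[OF that k(2)] K[OF k(1)] \<open>e > 0\<close> by simp
    qed
    then show "\<exists>N. \<forall>n\<ge>N. norm ((LINT \<omega>|M. (norm (X n \<omega> - Y \<omega>))\<^sup>2) - 0) < e" by blast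
  qed
  then show ?thesis by blast
qed

section \<open>Integration against random measures\<close>

lemma integral_double_sum:
  fixes f :: "'i \<Rightarrow> 'j \<Rightarrow> 'a \<Rightarrow> complex"
  assumes "\<And>i j. integrable M (f i j)"
  shows "(LINT \<omega>|M. (\<Sum>i\<in>I. \<Sum>j\<in>J. c i j * f i j \<omega>)) = (\<Sum>i\<in>I. \<Sum>j\<in>J. c i j * (LINT \<omega>|M. f i j \<omega>))"
  by (simp add: Bochner_Integration.integral_sum Bochner_Integration.integrable_sum assms)

lemma simple_function_inner:
  assumes "finite_measure G" "simple_function G s" "simple_function G s'"
  shows "(LINT \<mu>|G. s \<mu> * cnj (s' \<mu>)) =
    (\<Sum>y\<in>s ` space G. \<Sum>z\<in>s' ` space G. y * cnj z *
       of_real (measure G ((s -` {y} \<inter> space G) \<inter> (s' -` {z} \<inter> space G))))"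
proof -
  interpret finite_measure G by fact
  have fin: "finite (s ` space G)" "finite (s' ` space G)" using assms by (auto simp: simple_function_def)
  have sets: "s -` {y} \<inter> space G \<in> sets G" "s' -` {z} \<inter> space G \<in> sets G" for y z
    using assms by (auto intro: simple_functionD)
  have "s \<mu> * cnj (s' \<mu>) = (\<Sum>y\<in>s ` space G. \<Sum>z\<in>s' ` space G. y * cnj z *
     indicator ((s -` {y} \<inter> space G) \<inter> (s' -` {z} \<inter> space G)) \<mu>)" if "\<mu> \<in> space G" for \<mu>
  proof -
    have "(\<Sum>y\<in>s ` space G. \<Sum>z\<in>s' ` space G. y * cnj z *
     indicator ((s -` {y} \<inter> space G) \<inter> (s' -` {z} \<inter> space G)) \<mu>) =
     (\<Sum>y\<in>s ` space G. \<Sum>z\<in>s' ` space G. if z = s' \<mu> then (if y = s \<mu> then y * cnj z else 0) else 0)"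
      using that by (intro sum.cong refl) (auto simp: indicator_def)
    also have "\<dots> = s \<mu> * cnj (s' \<mu>)"
      using that fin by (subst sum.delta) auto
    finally show ?thesis ..
  qed
  then have "(LINT \<mu>|G. s \<mu> * cnj (s' \<mu>)) = (LINT \<mu>|G. (\<Sum>y\<in>s ` space G. \<Sum>z\<in>s' ` space G. y * cnj z *
     indicator ((s -` {y} \<inter> space G) \<inter> (s' -` {z} \<inter> space G)) \<mu>))"
    by (intro Bochner_Integration.integral_cong) auto
  also have "\<dots> = (\<Sum>y\<in>s ` space G. \<Sum>z\<in>s' ` space G. y * cnj z *
       of_real (measure G ((s -` {y} \<inter> space G) \<inter> (s' -` {z} \<inter> space G))))"
  proof -
    have i: "integrable G (\<lambda>\<mu>. indicator ((s -` {y} \<inter> space G) \<inter> (s' -` {z} \<inter> space G)) \<mu> :: complex)" for y z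
      by (rule integrable_const_bound[where B=1], simp split: split_indicator,
          rule borel_measurable_indicator, rule sets.Int, rule sets, rule sets)
    have l: "(LINT \<mu>|G. indicator ((s -` {y} \<inter> space G) \<inter> (s' -` {z} \<inter> space G)) \<mu> :: complex) =
       of_real (measure G ((s -` {y} \<inter> space G) \<inter> (s' -` {z} \<inter> space G)))" for y z
    proof -
      have "(\<lambda>\<mu>. indicator ((s -` {y} \<inter> space G) \<inter> (s' -` {z} \<inter> space G)) \<mu> :: complex) =
        (\<lambda>\<mu>. of_real (indicator ((s -` {y} \<inter> space G) \<inter> (s' -` {z} \<inter> space G)) \<mu>))"
        by (auto split: split_indicator)
      moreover have "((s -` {y} \<inter> space G) \<inter> (s' -` {z} \<inter> space G)) \<inter> space G = (s -` {y} \<inter> space G) \<inter> (s' -` {z} \<inter> space G)"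
        by blast
      ultimately show ?thesis by (simp only: integral_complex_of_real Bochner_Integration.integral_indicator)
    qed
    show ?thesis
      by (subst integral_double_sum, rule i, subst l, rule refl)
  qed
  finally show ?thesis .
qed

text \<open>Used with \<open>\<kappa> = 1\<close> for one random measure and \<open>\<kappa> = 0\<close> for two uncorrelated ones.\<close>

definition random_measures_cov ::
    "'w measure \<Rightarrow> real measure \<Rightarrow> complex \<Rightarrow> (real set \<Rightarrow> 'w \<Rightarrow> complex) \<Rightarrow> (real set \<Rightarrow> 'w \<Rightarrow> complex) \<Rightarrow> bool" where
  "random_measures_cov M G \<kappa> Z Z' \<longleftrightarrow> finite_measure M \<and> finite_measure G \<and>
     (\<forall>A\<in>sets G. sq_integrable M (Z A) \<and> sq_integrable M (Z' A)) \<and>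
     (\<forall>A\<in>sets G. \<forall>A'\<in>sets G. (LINT \<omega>|M. Z A \<omega> * cnj (Z' A' \<omega>)) = \<kappa> * of_real (measure G (A \<inter> A')))"

lemma sq_integrable_simple_stoch_integral:
  assumes "random_measures_cov M G \<kappa> Z Z'" "simple_function G s"
  shows "sq_integrable M (simple_stoch_integral G Z s)" "sq_integrable M (simple_stoch_integral G Z' s)"
proof -
  have sets: "s -` {y} \<inter> space G \<in> sets G" for y
    using assms by (auto intro: simple_functionD)
  then show "sq_integrable M (simple_stoch_integral G Z s)" "sq_integrable M (simple_stoch_integral G Z' s)"
    using assms(1) by (auto simp: random_measures_cov_def simple_stoch_integral_def[abs_def]
        intro!: sq_integrable_sum sq_integrable_mult_left)
qed

lemma simple_stoch_integral_inner:
  assumes cov: "random_measures_cov M G \<kappa> Z Z'" and s: "simple_function G s" "simple_function G s'"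
  shows "(LINT \<omega>|M. simple_stoch_integral G Z s \<omega> * cnj (simple_stoch_integral G Z' s' \<omega>)) =
    \<kappa> * (LINT \<mu>|G. s \<mu> * cnj (s' \<mu>))"
proof -
  have sets: "s -` {y} \<inter> space G \<in> sets G" "s' -` {z} \<inter> space G \<in> sets G" for y z
    using s by (auto intro: simple_functionD)
  have fm: "finite_measure G" using cov by (simp add: random_measures_cov_def)
  let ?A = "\<lambda>y. s -` {y} \<inter> space G" and ?B = "\<lambda>z. s' -` {z} \<inter> space G"
  have i: "integrable M (\<lambda>\<omega>. Z (?A y) \<omega> * cnj (Z' (?B z) \<omega>))" for y z
    using cov sets by (intro sq_integrable_inner) (auto simp: random_measures_cov_def)
  have c: "(LINT \<omega>|M. Z (?A y) \<omega> * cnj (Z' (?B z) \<omega>)) = \<kappa> * of_real (measure G (?A y \<inter> ?B z))" for y z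
    using cov sets by (auto simp: random_measures_cov_def)
  have "(LINT \<omega>|M. simple_stoch_integral G Z s \<omega> * cnj (simple_stoch_integral G Z' s' \<omega>)) =
     (LINT \<omega>|M. (\<Sum>y\<in>s ` space G. \<Sum>z\<in>s' ` space G. y * cnj z * (Z (?A y) \<omega> * cnj (Z' (?B z) \<omega>))))"
    unfolding simple_stoch_integral_def cnj_sum sum_product
    by (simp add: algebra_simps)
  also have "\<dots> = (\<Sum>y\<in>s ` space G. \<Sum>z\<in>s' ` space G. y * cnj z * (\<kappa> * of_real (measure G (?A y \<inter> ?B z))))"
    by (subst integral_double_sum, rule i, subst c, rule refl)
  also have "\<dots> = \<kappa> * (LINT \<mu>|G. s \<mu> * cnj (s' \<mu>))"
    unfolding simple_function_inner[OF fm s] by (simp add: sum_distrib_left mult_ac)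
  finally show ?thesis .
qed

text \<open>Both sides are limits along arbitrary approximating sequences, so the isometry holds for
  every representative of the integrals, whichever one is chosen.\<close>

lemma has_stoch_integral_inner:
  assumes cov: "random_measures_cov M G \<kappa> Z Z'"
    and f: "has_stoch_integral M G Z f X" and g: "has_stoch_integral M G Z' g Y"
  shows "(LINT \<omega>|M. X \<omega> * cnj (Y \<omega>)) = \<kappa> * (LINT \<mu>|G. f \<mu> * cnj (g \<mu>))"
proof -
  obtain s where s: "\<And>n. simple_function G (s n)" "ms_tendsto G s f"
     "ms_tendsto M (\<lambda>n. simple_stoch_integral G Z (s n)) X"
    using f unfolding has_stoch_integral_def by blast
  obtain s' where s': "\<And>n. simple_function G (s' n)" "ms_tendsto G s' g"
     "ms_tendsto M (\<lambda>n. simple_stoch_integral G Z' (s' n)) Y"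
    using g unfolding has_stoch_integral_def by blast
  have "(\<lambda>n. \<kappa> * (LINT \<mu>|G. s n \<mu> * cnj (s' n \<mu>))) \<longlonglongrightarrow> \<kappa> * (LINT \<mu>|G. f \<mu> * cnj (g \<mu>))"
    by (intro tendsto_mult_left ms_tendsto_inner s s')
  moreover have "(\<lambda>n. \<kappa> * (LINT \<mu>|G. s n \<mu> * cnj (s' n \<mu>))) \<longlonglongrightarrow> (LINT \<omega>|M. X \<omega> * cnj (Y \<omega>))"
    using ms_tendsto_inner[OF s(3) s'(3)] by (simp add: simple_stoch_integral_inner[OF cov s(1) s'(1)])
  ultimately show ?thesis using LIMSEQ_unique by blast
qed

text \<open>Expanding the square and applying the isometry to each product avoids a common
  refinement of the two partitions.\<close>

lemma simple_stoch_integral_diff_norm: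
  assumes cov: "random_measures_cov M G 1 Z Z" and s: "simple_function G s" "simple_function G s'"
  shows "(LINT \<omega>|M. (norm (simple_stoch_integral G Z s \<omega> - simple_stoch_integral G Z s' \<omega>))\<^sup>2) =
    (LINT \<mu>|G. (norm (s \<mu> - s' \<mu>))\<^sup>2)"
proof -
  have fm: "finite_measure G" using cov by (simp add: random_measures_cov_def)
  have sq: "sq_integrable G s" "sq_integrable G s'"
  proof -
    have "sq_integrable G s" if "simple_function G s" for s :: "real \<Rightarrow> complex"
    proof -
      have [measurable]: "s \<in> borel_measurable G" using that by (rule borel_measurable_simple_function)
      have "finite (s ` space G)" using that by (simp add: simple_function_def)
      then have "(norm (s x))\<^sup>2 \<le> Max ((\<lambda>y. (norm y)\<^sup>2) ` s ` space G)" if "x \<in> space G" for x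
        using that by (intro Max_ge) auto
      then have "integrable G (\<lambda>x. (norm (s x))\<^sup>2)"
        by (intro finite_measure.integrable_const_bound[OF fm, where B="Max ((\<lambda>y. (norm y)\<^sup>2) ` s ` space G)"]) auto
      then show ?thesis by (simp add: sq_integrable_def)
    qed
    then show "sq_integrable G s" "sq_integrable G s'" using s by auto
  qed
  note S = sq_integrable_simple_stoch_integral(1)[OF cov s(1)] sq_integrable_simple_stoch_integral(1)[OF cov s(2)]
  have ex: "(LINT \<omega>|N. (a \<omega> - b \<omega>) * cnj (a \<omega> - b \<omega>)) = (LINT \<omega>|N. a \<omega> * cnj (a \<omega>)) - (LINT \<omega>|N. a \<omega> * cnj (b \<omega>))
     - ((LINT \<omega>|N. b \<omega> * cnj (a \<omega>)) - (LINT \<omega>|N. b \<omega> * cnj (b \<omega>)))"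
    if "sq_integrable N a" "sq_integrable N b" for N :: "'x measure" and a b
  proof -
    have "(LINT \<omega>|N. (a \<omega> - b \<omega>) * cnj (a \<omega> - b \<omega>)) =
      (LINT \<omega>|N. (a \<omega> * cnj (a \<omega>) - a \<omega> * cnj (b \<omega>)) - (b \<omega> * cnj (a \<omega>) - b \<omega> * cnj (b \<omega>)))"
      by (simp add: algebra_simps)
    then show ?thesis
      by (simp add: sq_integrable_inner that)
  qed
  have "complex_of_real (LINT \<omega>|M. (norm (simple_stoch_integral G Z s \<omega> - simple_stoch_integral G Z s' \<omega>))\<^sup>2) =
    complex_of_real (LINT \<mu>|G. (norm (s \<mu> - s' \<mu>))\<^sup>2)"
    unfolding integral_norm_sq ex[OF S] ex[OF sq]
    by (simp add: simple_stoch_integral_inner[OF cov] s)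
  then show ?thesis by simp
qed

text \<open>A measurable f is a pointwise limit of simple functions dominated by 2 |f|, hence an L2
  limit; by the isometry their integrals form a Cauchy sequence.\<close>

lemma has_stoch_integral_exists:
  assumes cov: "random_measures_cov M G 1 Z Z" and f: "sq_integrable G f"
  shows "\<exists>X. has_stoch_integral M G Z f X"
proof -
  have fm: "finite_measure G" "finite_measure M" using cov by (auto simp: random_measures_cov_def)
  have [measurable]: "f \<in> borel_measurable G" using f by (simp add: sq_integrable_def)
  obtain s where s: "\<And>i. simple_function G (s i)" "\<And>x. x \<in> space G \<Longrightarrow> (\<lambda>i. s i x) \<longlonglongrightarrow> f x"
    "\<And>i x. x \<in> space G \<Longrightarrow> dist (s i x) 0 \<le> 2 * dist (f x) 0"
    using borel_measurable_implies_sequence_metric[of f G 0] that by (metis \<open>f \<in> borel_measurable G\<close>)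
  have [measurable]: "s i \<in> borel_measurable G" for i by (intro borel_measurable_simple_function s)
  have int_f: "integrable G (\<lambda>x. (norm (f x))\<^sup>2)" using f by (simp add: sq_integrable_def)
  have sqs: "sq_integrable G (s i)" for i
  proof (rule sq_integrable_bounded_by)
    show "integrable G (\<lambda>x. 4 * (norm (f x))\<^sup>2)" using int_f by simp
    have "(norm (s i x))\<^sup>2 \<le> 4 * (norm (f x))\<^sup>2" if "x \<in> space G" for x
      using power_mono[OF s(3)[OF that, of i], of 2] by (simp add: power_mult_distrib)
    then show "AE x in G. (norm (s i x))\<^sup>2 \<le> 4 * (norm (f x))\<^sup>2" by simp
  qed simp
  have "(\<lambda>i. LINT x|G. (norm (s i x - f x))\<^sup>2) \<longlonglongrightarrow> (LINT x|G. 0)"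
  proof (rule integral_dominated_convergence)
    \<comment> \<open>The constant is 10 = 2 * 4 + 2, from the inequality for the square of a sum
      and |s| \<le> 2 |f|.\<close>
    show "integrable G (\<lambda>x. 10 * (norm (f x))\<^sup>2)" using int_f by simp
    show "AE x in G. (\<lambda>i. (norm (s i x - f x))\<^sup>2) \<longlonglongrightarrow> 0"
    proof (rule AE_I2)
      fix x assume "x \<in> space G"
      then have "(\<lambda>i. (norm (s i x - f x))\<^sup>2) \<longlonglongrightarrow> (norm (f x - f x))\<^sup>2"
        by (intro tendsto_intros s)
      then show "(\<lambda>i. (norm (s i x - f x))\<^sup>2) \<longlonglongrightarrow> 0" by simp
    qed
    have "(norm (s i x - f x))\<^sup>2 \<le> 10 * (norm (f x))\<^sup>2" if "x \<in> space G" for x i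
    proof -
      have "(norm (s i x))\<^sup>2 \<le> 4 * (norm (f x))\<^sup>2"
        using power_mono[OF s(3)[OF that, of i], of 2] by (simp add: power_mult_distrib)
      then show ?thesis using norm_add_sq_le[of "s i x" "- f x"] by simp
    qed
    then show "AE x in G. norm ((norm (s i x - f x))\<^sup>2) \<le> 10 * (norm (f x))\<^sup>2" for i by simp
  qed auto
  then have ms: "ms_tendsto G s f" using f sqs by (simp add: ms_tendsto_def)
  have "\<exists>X. ms_tendsto M (\<lambda>n. simple_stoch_integral G Z (s n)) X"
  proof (rule L2_complete[OF fm(2)])
    show "sq_integrable M (simple_stoch_integral G Z (s n))" for n
      by (rule sq_integrable_simple_stoch_integral[OF cov s(1)])
    fix e :: real assume "e > 0"
    then obtain N where N: "\<And>n. n \<ge> N \<Longrightarrow> norm ((LINT x|G. (norm (s n x - f x))\<^sup>2) - 0) < e/4"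
      using LIMSEQ_D[OF ms_tendstoD(3)[OF ms], of "e/4"] by auto
    have "(LINT \<omega>|M. (norm (simple_stoch_integral G Z (s m) \<omega> - simple_stoch_integral G Z (s n) \<omega>))\<^sup>2) \<le> e"
      if "m \<ge> N" "n \<ge> N" for m n
    proof -
      have "(LINT x|G. (norm ((s m x - f x) + - (s n x - f x)))\<^sup>2) \<le>
         2 * (LINT x|G. (norm (s m x - f x))\<^sup>2) + 2 * (LINT x|G. (norm (- (s n x - f x)))\<^sup>2)"
        by (intro L2_norm_add_le sq_integrable_diff sq_integrable_uminus sqs f)
      also have "(\<lambda>x. (norm (- (s n x - f x)))\<^sup>2) = (\<lambda>x. (norm (s n x - f x))\<^sup>2)"
        by (simp only: norm_minus_cancel)
      finally show ?thesis using N[OF that(1)] N[OF that(2)]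
        by (simp add: simple_stoch_integral_diff_norm[OF cov s(1) s(1)])
    qed
    then show "\<exists>N. \<forall>m\<ge>N. \<forall>n\<ge>N. (LINT \<omega>|M. (norm (simple_stoch_integral G Z (s m) \<omega> - simple_stoch_integral G Z (s n) \<omega>))\<^sup>2) \<le> e"
      by blast
  qed
  then show ?thesis using s ms unfolding has_stoch_integral_def by blast
qed

lemma stoch_integral_has:
  assumes "random_measures_cov M G 1 Z Z" "sq_integrable G f"
  shows "has_stoch_integral M G Z f (stoch_integral M G Z f)"
  unfolding stoch_integral_def by (rule someI_ex[OF has_stoch_integral_exists[OF assms]])

lemma stoch_integral_sq_integrable:
  assumes "random_measures_cov M G 1 Z Z" "sq_integrable G f"
  shows "sq_integrable M (stoch_integral M G Z f)"
  using stoch_integral_has[OF assms] unfolding has_stoch_integral_def by (blast dest: ms_tendstoD(2))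

lemma stoch_integral_inner:
  assumes "random_measures_cov M G 1 Z Z" "random_measures_cov M G 1 Z' Z'" "random_measures_cov M G \<kappa> Z Z'"
    and "sq_integrable G f" "sq_integrable G g"
  shows "(LINT \<omega>|M. stoch_integral M G Z f \<omega> * cnj (stoch_integral M G Z' g \<omega>)) = \<kappa> * (LINT \<mu>|G. f \<mu> * cnj (g \<mu>))"
  by (rule has_stoch_integral_inner[OF assms(3)]) (intro stoch_integral_has assms)+

text \<open>The isometry alone forces linearity: the defect of linearity has norm zero.\<close>

lemma stoch_integral_lincomb_AE:
  assumes cov: "random_measures_cov M G 1 Z Z" and f: "sq_integrable G f" "sq_integrable G g"
  shows "AE \<omega> in M. stoch_integral M G Z (\<lambda>\<mu>. a * f \<mu> + b * g \<mu>) \<omega> =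
    a * stoch_integral M G Z f \<omega> + b * stoch_integral M G Z g \<omega>"
proof -
  let ?I = "stoch_integral M G Z" and ?h = "\<lambda>\<mu>. a * f \<mu> + b * g \<mu>"
  let ?d = "\<lambda>\<omega>. ?I ?h \<omega> - (a * ?I f \<omega> + b * ?I g \<omega>)"
  have h: "sq_integrable G ?h" by (intro sq_integrable_add sq_integrable_mult_left f)
  note I = stoch_integral_sq_integrable[OF cov]
  have d: "sq_integrable M ?d" by (intro sq_integrable_diff sq_integrable_add sq_integrable_mult_left I f h)
  have z: "(LINT \<omega>|M. ?d \<omega> * cnj (?I k \<omega>)) = 0" if k: "sq_integrable G k" for k
  proof -
    have i: "integrable M (\<lambda>\<omega>. ?I f \<omega> * cnj (?I k \<omega>))" "integrable M (\<lambda>\<omega>. ?I g \<omega> * cnj (?I k \<omega>))"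
       "integrable M (\<lambda>\<omega>. ?I ?h \<omega> * cnj (?I k \<omega>))"
       "integrable G (\<lambda>\<mu>. f \<mu> * cnj (k \<mu>))" "integrable G (\<lambda>\<mu>. g \<mu> * cnj (k \<mu>))"
      by (intro sq_integrable_inner I f k h)+
    have "(LINT \<omega>|M. ?d \<omega> * cnj (?I k \<omega>)) = (LINT \<omega>|M. ?I ?h \<omega> * cnj (?I k \<omega>)
       - (a * (?I f \<omega> * cnj (?I k \<omega>)) + b * (?I g \<omega> * cnj (?I k \<omega>))))"
      by (simp add: algebra_simps)
    also have "\<dots> = (LINT \<omega>|M. ?I ?h \<omega> * cnj (?I k \<omega>))
       - (a * (LINT \<omega>|M. ?I f \<omega> * cnj (?I k \<omega>)) + b * (LINT \<omega>|M. ?I g \<omega> * cnj (?I k \<omega>)))"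
      using i by simp
    also have "\<dots> = (LINT \<mu>|G. (a * f \<mu> + b * g \<mu>) * cnj (k \<mu>))
       - (a * (LINT \<mu>|G. f \<mu> * cnj (k \<mu>)) + b * (LINT \<mu>|G. g \<mu> * cnj (k \<mu>)))"
      by (simp add: stoch_integral_inner[OF cov cov cov] f k h)
    also have "(\<lambda>\<mu>. (a * f \<mu> + b * g \<mu>) * cnj (k \<mu>)) = (\<lambda>\<mu>. a * (f \<mu> * cnj (k \<mu>)) + b * (g \<mu> * cnj (k \<mu>)))"
      by (simp add: algebra_simps)
    also have "(LINT \<mu>|G. a * (f \<mu> * cnj (k \<mu>)) + b * (g \<mu> * cnj (k \<mu>)))
       - (a * (LINT \<mu>|G. f \<mu> * cnj (k \<mu>)) + b * (LINT \<mu>|G. g \<mu> * cnj (k \<mu>))) = 0"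
      using i by simp
    finally show ?thesis .
  qed
  have i: "integrable M (\<lambda>\<omega>. ?d \<omega> * cnj (?I f \<omega>))" "integrable M (\<lambda>\<omega>. ?d \<omega> * cnj (?I g \<omega>))"
     "integrable M (\<lambda>\<omega>. ?d \<omega> * cnj (?I ?h \<omega>))"
    by (intro sq_integrable_inner I f h d)+
  have "(LINT \<omega>|M. ?d \<omega> * cnj (?d \<omega>)) = (LINT \<omega>|M. ?d \<omega> * cnj (?I ?h \<omega>)
     - (cnj a * (?d \<omega> * cnj (?I f \<omega>)) + cnj b * (?d \<omega> * cnj (?I g \<omega>))))"
    by (rule Bochner_Integration.integral_cong) (auto simp: algebra_simps)
  also have "\<dots> = (LINT \<omega>|M. ?d \<omega> * cnj (?I ?h \<omega>))
     - (cnj a * (LINT \<omega>|M. ?d \<omega> * cnj (?I f \<omega>)) + cnj b * (LINT \<omega>|M. ?d \<omega> * cnj (?I g \<omega>)))"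
    using i by (subst Bochner_Integration.integral_diff; (intro Bochner_Integration.integrable_add integrable_mult_right)?; (subst Bochner_Integration.integral_add)?; (intro integrable_mult_right)?; simp?)
  also have "\<dots> = 0" unfolding z[OF f(1)] z[OF f(2)] z[OF h] by simp
  finally have "(LINT \<omega>|M. (norm (?d \<omega>))\<^sup>2) = 0" unfolding integral_norm_sq[symmetric] by (simp only: of_real_eq_0_iff)
  from L2_norm_zero_AE[OF d this] show ?thesis by simp
qed

lemma stoch_integral_norm_sq:
  assumes cov: "random_measures_cov M G 1 Z Z" and f: "sq_integrable G f"
  shows "(LINT \<omega>|M. (norm (stoch_integral M G Z f \<omega>))\<^sup>2) = (LINT \<mu>|G. (norm (f \<mu>))\<^sup>2)"
proof -
  have "complex_of_real (LINT \<omega>|M. (norm (stoch_integral M G Z f \<omega>))\<^sup>2) = complex_of_real (LINT \<mu>|G. (norm (f \<mu>))\<^sup>2)"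
    unfolding integral_norm_sq stoch_integral_inner[OF cov cov cov f f] by simp
  then show ?thesis by simp
qed

lemma stoch_integral_ms_tendsto:
  assumes cov: "random_measures_cov M G 1 Z Z" and ms: "ms_tendsto G f g"
  shows "ms_tendsto M (\<lambda>n. stoch_integral M G Z (f n)) (stoch_integral M G Z g)"
  unfolding ms_tendsto_def
proof (intro conjI allI stoch_integral_sq_integrable[OF cov] ms_tendstoD[OF ms])
  note I = stoch_integral_sq_integrable[OF cov]
  note D = ms_tendstoD[OF ms]
  have "(LINT \<omega>|M. (norm (stoch_integral M G Z (f n) \<omega> - stoch_integral M G Z g \<omega>))\<^sup>2) =
    (LINT \<mu>|G. (norm (f n \<mu> - g \<mu>))\<^sup>2)" for n
  proof -
    have "AE \<omega> in M. stoch_integral M G Z (\<lambda>\<mu>. f n \<mu> - g \<mu>) \<omega> = stoch_integral M G Z (f n) \<omega> - stoch_integral M G Z g \<omega>"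
      using stoch_integral_lincomb_AE[OF cov D(1)[of n] D(2), of 1 "-1"] by simp
    then have "(LINT \<omega>|M. (norm (stoch_integral M G Z (f n) \<omega> - stoch_integral M G Z g \<omega>))\<^sup>2) =
       (LINT \<omega>|M. (norm (stoch_integral M G Z (\<lambda>\<mu>. f n \<mu> - g \<mu>) \<omega>))\<^sup>2)"
      by (intro integral_cong_AE)
         (use I[OF D(1)[of n]] I[OF D(2)] I[OF sq_integrable_diff[OF D(1)[of n] D(2)]] in \<open>auto simp: sq_integrable_def elim!: eventually_mono\<close>)
    then show ?thesis using stoch_integral_norm_sq[OF cov sq_integrable_diff[OF D(1)[of n] D(2)]] by simp
  qed
  then show "(\<lambda>n. LINT \<omega>|M. (norm (stoch_integral M G Z (f n) \<omega> - stoch_integral M G Z g \<omega>))\<^sup>2) \<longlonglongrightarrow> 0"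
    using D(3) by simp
qed

text \<open>Two densities that agree on the space of \<open>G\<close> may still differ as functions
  on the real line, and the choice of representatives then need not be the same; equality is almost
  sure only.\<close>

lemma stoch_integral_cong_AE:
  assumes cov: "random_measures_cov M G 1 Z Z" and f: "sq_integrable G f" "sq_integrable G g"
    and eq: "AE \<mu> in G. f \<mu> = g \<mu>"
  shows "AE \<omega> in M. stoch_integral M G Z f \<omega> = stoch_integral M G Z g \<omega>"
proof -
  have "(LINT \<mu>|G. (norm (f \<mu> - g \<mu>))\<^sup>2) = (LINT \<mu>|G. 0)"
    by (rule integral_cong_AE) (use f eq in \<open>auto simp: sq_integrable_def elim!: eventually_mono\<close>)
  then have ms: "ms_tendsto G (\<lambda>n::nat. f) g" using f by (simp add: ms_tendsto_def)
  show ?thesis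
    by (rule ms_tendsto_unique_AE[OF ms_tendsto_const stoch_integral_ms_tendsto[OF cov ms]])
       (rule stoch_integral_sq_integrable[OF cov f(1)])
qed

section \<open>Spherical Bessel functions\<close>

text \<open>The entire function \<open>bphi \<nu>\<close> satisfies \<open>J\<^sub>\<nu>(z) = (z/2)\<^sup>\<nu> bphi \<nu> (z\<^sup>2/4)\<close>.\<close>

definition bphi_coeff :: "real \<Rightarrow> nat \<Rightarrow> real" where
  "bphi_coeff \<nu> k = (-1) ^ k / (fact k * Gamma (\<nu> + real k + 1))"

definition bphi :: "real \<Rightarrow> real \<Rightarrow> real" where
  "bphi \<nu> w = (\<Sum>k. bphi_coeff \<nu> k * w ^ k)"

text \<open>By \<open>Gamma_lower_bound\<close> with A = 1 the reciprocal Gamma factor is at most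
  exp 2, which leaves the exponential series. Starting at k = 1 keeps \<nu> + k nonnegative down to
  \<nu> = - 1/2.\<close>

lemma bphi_abs_summable:
  assumes "\<nu> \<ge> - 1/2"
  shows "summable (\<lambda>k. \<bar>bphi_coeff \<nu> k * w ^ k\<bar>)"
proof (rule summable_comparison_test')
  show "summable (\<lambda>k. exp 2 * (inverse (fact k) * \<bar>w\<bar> ^ k))" by (intro summable_mult summable_exp)
  fix k :: nat assume "k \<ge> 1"
  then have p: "\<nu> + real k \<ge> 0" using assms by linarith
  then have G: "Gamma (\<nu> + real k + 1) > 0" by (intro Gamma_real_pos) auto
  have "1 \<le> exp 2 * Gamma (\<nu> + real k + 1)" using Gamma_lower_bound[of 1 "\<nu> + real k"] p by simp
  then have "1 / Gamma (\<nu> + real k + 1) \<le> exp 2" using G by (simp add: field_simps)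
  then have "(1 / Gamma (\<nu> + real k + 1)) * (inverse (fact k) * \<bar>w\<bar> ^ k) \<le> exp 2 * (inverse (fact k) * \<bar>w\<bar> ^ k)"
    by (intro mult_right_mono) auto
  then show "norm \<bar>bphi_coeff \<nu> k * w ^ k\<bar> \<le> exp 2 * (inverse (fact k) * \<bar>w\<bar> ^ k)"
    using G by (simp add: bphi_coeff_def abs_mult power_abs field_simps)
qed

lemma bphi_summable: "\<nu> \<ge> - 1/2 \<Longrightarrow> summable (\<lambda>k. bphi_coeff \<nu> k * w ^ k)"
  using summable_rabs_cancel[OF bphi_abs_summable] .

lemma bphi_sums: "\<nu> \<ge> - 1/2 \<Longrightarrow> (\<lambda>k. bphi_coeff \<nu> k * w ^ k) sums bphi \<nu> w"
  unfolding bphi_def by (rule summable_sums[OF bphi_summable])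

lemma continuous_on_bphi: "\<nu> \<ge> - 1/2 \<Longrightarrow> continuous_on A (bphi \<nu>)"
  unfolding bphi_def[abs_def]
  by (intro continuous_at_imp_continuous_on ballI isCont_powser_converges_everywhere bphi_summable)

text \<open>The classical relation J(\<nu> - 1) + J(\<nu> + 1) = (2 \<nu> / z) J(\<nu>) between
  orders, written for the entire parts and verified coefficient by coefficient.\<close>

lemma bphi_recurrence:
  assumes "\<nu> \<ge> 1/2"
  shows "bphi (\<nu> - 1) w = \<nu> * bphi \<nu> w - w * bphi (\<nu> + 1) w"
proof -
  have "(\<lambda>k. bphi_coeff (\<nu> - 1) k * w ^ k - \<nu> * (bphi_coeff \<nu> k * w ^ k)) sums (bphi (\<nu> - 1) w - \<nu> * bphi \<nu> w)"
    using assms by (intro sums_diff sums_mult bphi_sums) auto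
  moreover have "(\<lambda>k. bphi_coeff (\<nu> - 1) k * w ^ k - \<nu> * (bphi_coeff \<nu> k * w ^ k)) sums (0 + - w * bphi (\<nu> + 1) w)"
  proof -
    have s: "bphi_coeff (\<nu> - 1) (Suc k) * w ^ Suc k - \<nu> * (bphi_coeff \<nu> (Suc k) * w ^ Suc k) = - w * (bphi_coeff (\<nu> + 1) k * w ^ k)" for k
    proof -
      define G where "G = Gamma (\<nu> + real k + 1)"
      have G: "G > 0" unfolding G_def using assms by (intro Gamma_real_pos) auto
      have p: "\<nu> + real k + 1 > 0" using assms by auto
      have e: "\<nu> - 1 + real (Suc k) + 1 = \<nu> + real k + 1" "\<nu> + real (Suc k) + 1 = (\<nu> + real k + 1) + 1" "\<nu> + 1 + real k + 1 = (\<nu> + real k + 1) + 1" by auto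
      have G1: "Gamma ((\<nu> + real k + 1) + 1) = (\<nu> + real k + 1) * G" unfolding G_def using p by (intro Gamma_plus1) (auto simp: not_le nonpos_Ints_def)
      show ?thesis unfolding bphi_coeff_def e G1 G_def[symmetric] using G p
        by (simp add: divide_simps) (simp add: algebra_simps)
    qed
    have z: "bphi_coeff (\<nu> - 1) 0 * w ^ 0 - \<nu> * (bphi_coeff \<nu> 0 * w ^ 0) = 0"
    proof -
      have "Gamma (\<nu> + 1) = \<nu> * Gamma \<nu>" "Gamma \<nu> > 0" using assms by (auto intro!: Gamma_plus1 Gamma_real_pos simp: nonpos_Ints_def)
      then show ?thesis using assms by (simp add: bphi_coeff_def)
    qed
    have "(\<lambda>k. - w * (bphi_coeff (\<nu> + 1) k * w ^ k)) sums (- w * bphi (\<nu> + 1) w)"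
      using assms by (intro sums_mult bphi_sums) auto
    then show ?thesis using sums_Suc[of "\<lambda>k. bphi_coeff (\<nu> - 1) k * w ^ k - \<nu> * (bphi_coeff \<nu> k * w ^ k)"] unfolding s z by (simp add: add.commute)
  qed
  ultimately have "bphi (\<nu> - 1) w - \<nu> * bphi \<nu> w = 0 + - w * bphi (\<nu> + 1) w" by (rule sums_unique2)
  then show ?thesis by simp
qed

lemma Gamma_half_nat: "Gamma (real k + 1/2) = sqrt pi * fact (2 * k) / (4 ^ k * fact k)"
proof (induction k)
  case 0
  show ?case by (simp add: Gamma_one_half_real)
next
  case (Suc k)
  have "Gamma (real (Suc k) + 1/2) = Gamma ((real k + 1/2) + 1)" by (simp add: add_ac)
  also have "\<dots> = (real k + 1/2) * Gamma (real k + 1/2)" by (intro Gamma_plus1) (auto simp: nonpos_Ints_def)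
  also have "\<dots> = sqrt pi * fact (2 * Suc k) / (4 ^ Suc k * fact (Suc k))"
    unfolding Suc.IH by (simp add: divide_simps) (simp add: algebra_simps)
  finally show ?case .
qed

lemma bphi_minus_half: "bphi (- 1/2) (z\<^sup>2 / 4) = cos z / sqrt pi"
proof -
  have "bphi_coeff (- 1/2) k * (z\<^sup>2 / 4) ^ k = ((-1) ^ k / fact (2 * k) * z ^ (2 * k)) / sqrt pi" for k
  proof -
    have e: "- 1/2 + real k + 1 = real k + 1/2" by simp
    show ?thesis unfolding bphi_coeff_def e Gamma_half_nat by (simp add: power_divide power_mult)
  qed
  then have "(\<lambda>k. bphi_coeff (- 1/2) k * (z\<^sup>2 / 4) ^ k) sums (cos z / sqrt pi)"
    using sums_divide[OF cos_paired[of z], of "sqrt pi"] by simp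
  then show ?thesis using bphi_sums[of "- 1/2" "z\<^sup>2 / 4"] sums_unique2 by fastforce
qed

lemma bphi_half: "z * bphi (1/2) (z\<^sup>2 / 4) = 2 * sin z / sqrt pi"
proof -
  have "z * (bphi_coeff (1/2) k * (z\<^sup>2 / 4) ^ k) = 2 * ((-1) ^ k / fact (2 * k + 1) * z ^ (2 * k + 1)) / sqrt pi" for k
  proof -
    have e: "1/2 + real k + 1 = real (Suc k) + 1/2" by simp
    show ?thesis unfolding bphi_coeff_def e Gamma_half_nat by (simp add: power_divide power_mult divide_simps)
  qed
  then have "(\<lambda>k. z * (bphi_coeff (1/2) k * (z\<^sup>2 / 4) ^ k)) sums (2 * sin z / sqrt pi)"
    using sums_divide[OF sums_mult[OF sin_paired[of z], of 2], of "sqrt pi"] by simp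
  moreover have "(\<lambda>k. z * (bphi_coeff (1/2) k * (z\<^sup>2 / 4) ^ k)) sums (z * bphi (1/2) (z\<^sup>2 / 4))"
    by (intro sums_mult bphi_sums) simp
  ultimately show ?thesis by (rule sums_unique2[symmetric])
qed

text \<open>The entire function that agrees with \<open>bessel_quot l\<close> on the nonnegative
  half line; the factor 1 / sqrt 2 is what remains of (z / 2)^(1/2) after division by
  z^(1/2).\<close>

definition bq :: "nat \<Rightarrow> real \<Rightarrow> real" where
  "bq l z = (z / 2) ^ l * bphi (real l + 1/2) (z\<^sup>2 / 4) / sqrt 2"

lemma continuous_on_bq: "continuous_on A (bq l)"
  unfolding bq_def by (intro continuous_intros continuous_on_compose2[OF continuous_on_bphi[of _ UNIV]]) auto

lemma bessel_quot_pos: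
  assumes "z > 0"
  shows "bessel_J (real l + 1/2) z / sqrt z = bq l z"
proof -
  have "(-1) ^ k / (fact k * Gamma (real l + 1/2 + real k + 1)) * (z / 2) powr (2 * real k + (real l + 1/2)) =
     (sqrt (z / 2) * (z / 2) ^ l) * (bphi_coeff (real l + 1/2) k * (z\<^sup>2 / 4) ^ k)" for k
  proof -
    have "(z / 2) powr (2 * real k + (real l + 1/2)) = (z / 2) powr (real (2 * k)) * ((z / 2) powr real l * (z / 2) powr (1/2))"
      by (simp add: powr_add)
    also have "\<dots> = (z / 2) ^ (2 * k) * ((z / 2) ^ l * sqrt (z / 2))"
      using assms by (subst (1 2) powr_realpow) (auto simp: powr_half_sqrt)
    also have "(z / 2) ^ (2 * k) = (z\<^sup>2 / 4) ^ k" by (simp add: power_mult power_divide)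
    finally show ?thesis by (simp add: bphi_coeff_def)
  qed
  then have "bessel_J (real l + 1/2) z = (\<Sum>k. (sqrt (z / 2) * (z / 2) ^ l) * (bphi_coeff (real l + 1/2) k * (z\<^sup>2 / 4) ^ k))"
    unfolding bessel_J_def by (intro suminf_cong)
  also have "\<dots> = (sqrt (z / 2) * (z / 2) ^ l) * bphi (real l + 1/2) (z\<^sup>2 / 4)"
    unfolding bphi_def by (intro suminf_mult bphi_summable) auto
  finally show ?thesis using assms by (simp add: bq_def real_sqrt_divide)
qed

lemma bessel_quot_eq:
  assumes "z \<ge> 0"
  shows "bessel_quot l z = bq l z"
proof (cases "z = 0")
  case True
  have "(bq l \<longlongrightarrow> bq l 0) (at_right 0)"
    using continuous_on_bq[of UNIV l] by (auto simp: continuous_on_def intro: tendsto_within_subset)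
  then have "((\<lambda>w. bessel_J (real l + 1/2) w / sqrt w) \<longlongrightarrow> bq l 0) (at_right 0)"
    by (rule Lim_transform_eventually) (auto simp: eventually_at_filter bessel_quot_pos)
  then show ?thesis using True by (simp add: bessel_quot_def tendsto_Lim)
next
  case False
  then show ?thesis using assms bessel_quot_pos[of z l] by (simp add: bessel_quot_def)
qed

lemma bq_recurrence: "z > 0 \<Longrightarrow> bq (Suc (Suc l)) z = (2 * real l + 3) / z * bq (Suc l) z - bq l z"
proof -
  assume z: "z > 0"
  have r: "bphi (real l + 1/2) (z\<^sup>2 / 4) = (real l + 3/2) * bphi (real (Suc l) + 1/2) (z\<^sup>2 / 4) - (z\<^sup>2 / 4) * bphi (real (Suc (Suc l)) + 1/2) (z\<^sup>2 / 4)"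
    using bphi_recurrence[of "real (Suc l) + 1/2" "z\<^sup>2 / 4"] by (simp add: add_ac)
  show ?thesis unfolding bq_def r using z by (simp add: field_simps power2_eq_square)
qed

text \<open>Compactness covers [0, 1]. On z \<ge> 1 the coefficient of the recurrence in l is
  bounded, and the recurrence starts from elementary functions built of sin z / z and cos z / z.
  Being of second order, it calls for an induction over two consecutive indices.\<close>

lemma bq_bounded: "\<exists>C. \<forall>z\<ge>0. \<bar>bq l z\<bar> \<le> C"
proof -
  have J0: "bq 0 z = sqrt (2 / pi) * (sin z / z)" if "z > 0" for z
    using bphi_half[of z] that by (simp add: bq_def real_sqrt_divide field_simps)
  have J1: "bq 1 z = bq 0 z / z - sqrt (2 / pi) * (cos z / z)" if "z > 0" for z
  proof -
    have "cos z / sqrt pi = (1/2) * bphi (1/2) (z\<^sup>2 / 4) - (z\<^sup>2 / 4) * bphi (3/2) (z\<^sup>2 / 4)"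
      using bphi_recurrence[of "1/2" "z\<^sup>2 / 4"] bphi_minus_half[of z] by simp
    then have c: "cos z = sqrt pi * ((1/2) * bphi (1/2) (z\<^sup>2 / 4) - (z\<^sup>2 / 4) * bphi (3/2) (z\<^sup>2 / 4))"
      by (simp add: field_simps)
    have s2: "sqrt 2 * (sqrt 2 * x) = 2 * x" for x by (simp add: mult.assoc[symmetric])
    show ?thesis unfolding c using that by (simp add: bq_def real_sqrt_divide field_simps power2_eq_square s2)
  qed
  have "(\<exists>C. \<forall>z\<ge>1. \<bar>bq l z\<bar> \<le> C) \<and> (\<exists>C. \<forall>z\<ge>1. \<bar>bq (Suc l) z\<bar> \<le> C)"
  proof (induction l)
    case 0
    have b0: "\<bar>bq 0 z\<bar> \<le> sqrt (2 / pi)" if "z \<ge> 1" for z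
    proof -
      have "\<bar>sin z\<bar> \<le> z" using that abs_sin_le_one[of z] by linarith
      then have "\<bar>sin z / z\<bar> \<le> 1" using that by (simp add: abs_divide)
      then have b: "sqrt (2 / pi) * \<bar>sin z / z\<bar> \<le> sqrt (2 / pi)" by (intro mult_left_le) auto
      have "bq 0 z = sqrt (2 / pi) * (sin z / z)" by (rule J0) (use that in linarith)
      then have "\<bar>bq 0 z\<bar> = sqrt (2 / pi) * \<bar>sin z / z\<bar>" by (simp only: abs_mult) simp
      then show ?thesis using b by linarith
    qed
    have "\<bar>bq 1 z\<bar> \<le> sqrt (2 / pi) + sqrt (2 / pi)" if "z \<ge> 1" for z
    proof -
      have "\<bar>cos z\<bar> \<le> z" using that abs_cos_le_one[of z] by linarith
      then have "\<bar>cos z / z\<bar> \<le> 1" using that by (simp add: abs_divide)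
      then have "sqrt (2 / pi) * \<bar>cos z / z\<bar> \<le> sqrt (2 / pi)" by (intro mult_left_le) auto
      moreover have "\<bar>sqrt (2 / pi) * (cos z / z)\<bar> = sqrt (2 / pi) * \<bar>cos z / z\<bar>" by (simp only: abs_mult) simp
      ultimately have "\<bar>sqrt (2 / pi) * (cos z / z)\<bar> \<le> sqrt (2 / pi)" by linarith
      moreover have "\<bar>bq 0 z / z\<bar> \<le> \<bar>bq 0 z\<bar>"
        using that mult_left_mono[of 1 z "\<bar>bq 0 z\<bar>"] by (simp add: abs_divide pos_divide_le_eq)
      ultimately show ?thesis using b0[OF that] J1[of z] that by linarith
    qed
    then show ?case using b0 by auto
  next
    case (Suc l)
    then obtain C C' where C: "\<And>z. z \<ge> 1 \<Longrightarrow> \<bar>bq l z\<bar> \<le> C" "\<And>z. z \<ge> 1 \<Longrightarrow> \<bar>bq (Suc l) z\<bar> \<le> C'" by blast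
    have "\<bar>bq (Suc (Suc l)) z\<bar> \<le> (2 * real l + 3) * C' + C" if "z \<ge> 1" for z
    proof -
      have "\<bar>(2 * real l + 3) / z * bq (Suc l) z\<bar> \<le> (2 * real l + 3) * C'"
      proof -
        have "\<bar>(2 * real l + 3) / z\<bar> \<le> 2 * real l + 3" using that by (simp add: divide_le_eq mult_le_cancel_left1)
        then show ?thesis unfolding abs_mult using C(2)[OF that] by (intro mult_mono) auto
      qed
      then show ?thesis using bq_recurrence[of z l] C(1)[OF that] that by linarith
    qed
    then show ?case using Suc.IH by blast
  qed
  then obtain C where C: "\<And>z. z \<ge> 1 \<Longrightarrow> \<bar>bq l z\<bar> \<le> C" by blast
  have "bounded (bq l ` {0..1})" by (intro compact_imp_bounded compact_continuous_image continuous_on_bq) auto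
  then obtain C' where C': "\<forall>y\<in>bq l ` {0..1}. norm y \<le> C'" unfolding bounded_iff by blast
  have "\<bar>bq l z\<bar> \<le> max C C'" if "z \<ge> 0" for z
  proof (cases "z \<ge> 1")
    case False
    then have "\<bar>bq l z\<bar> \<le> C'" using C' that by auto
    then show ?thesis by simp
  qed (use C[of z] in simp)
  then show ?thesis by blast
qed

text \<open>For z \<ge> 2 the factor (z / 2)^l is at least 1, so the bound for \<open>bq\<close>
  carries over; below 2 compactness suffices. This makes the quotient of \<open>bq l\<close> by the
  power z^l bounded.\<close>

lemma bphi_bounded: "\<exists>C. \<forall>z\<ge>0. \<bar>bphi (real l + 1/2) (z\<^sup>2 / 4)\<bar> \<le> C"
proof -
  let ?f = "\<lambda>z::real. bphi (real l + 1/2) (z\<^sup>2 / 4)"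
  obtain C where C: "\<And>z. z \<ge> 0 \<Longrightarrow> \<bar>bq l z\<bar> \<le> C" using bq_bounded by blast
  have "continuous_on {0..2} ?f" by (intro continuous_on_compose2[OF continuous_on_bphi[of _ UNIV]] continuous_intros) auto
  then have "bounded (?f ` {0..2})" by (intro compact_imp_bounded compact_continuous_image) auto
  then obtain C' where C': "\<forall>y\<in>?f ` {0..2}. norm y \<le> C'" unfolding bounded_iff by blast
  have "\<bar>?f z\<bar> \<le> max (sqrt 2 * C) C'" if "z \<ge> 0" for z
  proof (cases "z \<le> 2")
    case True
    then have "\<bar>?f z\<bar> \<le> C'" using C' that by auto
    then show ?thesis by simp
  next
    case False
    have "1 \<le> (z / 2) ^ l" using False by (intro one_le_power) auto
    then have "\<bar>?f z\<bar> \<le> \<bar>(z / 2) ^ l * ?f z\<bar>" using mult_right_mono[of 1 "(z/2)^l" "\<bar>?f z\<bar>"] by (simp add: abs_mult)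
    also have "\<dots> = sqrt 2 * \<bar>bq l z\<bar>" by (simp add: bq_def abs_mult)
    also have "\<dots> \<le> sqrt 2 * C" using C[OF that] by simp
    finally show ?thesis by simp
  qed
  then show ?thesis by blast
qed

text \<open>Weber's integral. The weight r^(l + 2) is chosen so that the k-th Bessel term meets the
  Gaussian moment of even order 2 (k + l + 1), whose value is half of the very Gamma factor in the
  denominator of that term. After cancellation the exponential series remains.\<close>

lemma bq_gaussian:
  assumes "z \<ge> 0"
  shows "(LINT r|lborel. indicator {0..} r * (bq l (z * r) * r ^ (l + 2) * exp (- r\<^sup>2))) = (z / 2) ^ l * exp (- (z\<^sup>2 / 4)) / (2 * sqrt 2)"
proof -
  define f where "f k r = ((z / 2) ^ l / sqrt 2 * bphi_coeff (real l + 1/2) k * (z\<^sup>2 / 4) ^ k) * (indicator {0..} r *\<^sub>R (exp (- r\<^sup>2) * r ^ (2 * (k + l + 1))))" for k and r :: real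
  define m where "m j = Gamma (real j + 1/2) / 2" for j
  have mom: "has_bochner_integral lborel (\<lambda>r::real. indicator {0..} r *\<^sub>R (exp (- r\<^sup>2) * r ^ (2 * j))) (m j)" for j
  proof -
    have "(sqrt pi / 2) * (fact (2 * j) / (2 ^ (2 * j) * fact j)) = m j"
      unfolding m_def Gamma_half_nat by (simp add: power_mult)
    with gaussian_moment_even_pos[of j] show ?thesis by simp
  qed
  have mi: "integrable lborel (\<lambda>r::real. indicator {0..} r *\<^sub>R (exp (- r\<^sup>2) * r ^ (2 * j)))"
    "(LINT r|lborel. indicator {0..} r *\<^sub>R (exp (- r\<^sup>2) * r ^ (2 * j))) = m j" for j
    using mom[of j] by (auto simp: has_bochner_integral_iff)
  have mpos: "m j > 0" for j unfolding m_def by (intro divide_pos_pos Gamma_real_pos) auto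
  have fi: "integrable lborel (f k)" for k unfolding f_def by (intro integrable_mult_right mi)
  have fI: "(LINT r|lborel. f k r) = ((z / 2) ^ l / sqrt 2 * bphi_coeff (real l + 1/2) k * (z\<^sup>2 / 4) ^ k) * m (k + l + 1)" for k
    unfolding f_def mi(2)[symmetric] by (rule Bochner_Integration.integral_mult_right_zero)
  have cm: "((z / 2) ^ l / sqrt 2 * bphi_coeff (real l + 1/2) k * (z\<^sup>2 / 4) ^ k) * m (k + l + 1) = (z / 2) ^ l / (2 * sqrt 2) * (inverse (fact k) * (- (z\<^sup>2 / 4)) ^ k)" for k
  proof -
    have e: "real l + 1/2 + real k + 1 = real (k + l + 1) + 1/2" by simp
    have G: "Gamma (real (k + l + 1) + 1/2) \<noteq> 0"
    proof
      assume "Gamma (real (k + l + 1) + 1/2) = 0"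
      then have "m (k + l + 1) = 0" by (simp only: m_def div_0)
      then show False using mpos[of "k + l + 1"] by (simp only: less_irrefl)
    qed
    have p: "(- (z\<^sup>2 / 4)) ^ k = (-1) ^ k * (z\<^sup>2 / 4) ^ k" by (rule power_minus)
    show ?thesis unfolding bphi_coeff_def e m_def p using G by (simp add: field_simps)
  qed
  have "\<bar>f k r\<bar> = \<bar>(z / 2) ^ l / sqrt 2 * bphi_coeff (real l + 1/2) k * (z\<^sup>2 / 4) ^ k\<bar> * (indicator {0..} r *\<^sub>R (exp (- r\<^sup>2) * r ^ (2 * (k + l + 1))))" for k r
    by (auto simp: f_def abs_mult indicator_def)
  then have "(LINT r|lborel. norm (f k r)) = \<bar>(z / 2) ^ l / sqrt 2 * bphi_coeff (real l + 1/2) k * (z\<^sup>2 / 4) ^ k\<bar> * m (k + l + 1)" for k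
    unfolding mi(2)[symmetric] by simp
  also have "\<And>k. \<bar>(z / 2) ^ l / sqrt 2 * bphi_coeff (real l + 1/2) k * (z\<^sup>2 / 4) ^ k\<bar> * m (k + l + 1) = (z / 2) ^ l / (2 * sqrt 2) * (inverse (fact k) * (z\<^sup>2 / 4) ^ k)"
  proof -
    fix k
    have "\<bar>(z / 2) ^ l / sqrt 2 * bphi_coeff (real l + 1/2) k * (z\<^sup>2 / 4) ^ k\<bar> * m (k + l + 1) = \<bar>((z / 2) ^ l / sqrt 2 * bphi_coeff (real l + 1/2) k * (z\<^sup>2 / 4) ^ k) * m (k + l + 1)\<bar>"
      using mpos[of "k + l + 1"] by (simp only: abs_mult abs_of_pos)
    also have "\<dots> = (z / 2) ^ l / (2 * sqrt 2) * (inverse (fact k) * (z\<^sup>2 / 4) ^ k)"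
      unfolding cm using assms by (simp add: abs_mult power_abs)
    finally show "\<bar>(z / 2) ^ l / sqrt 2 * bphi_coeff (real l + 1/2) k * (z\<^sup>2 / 4) ^ k\<bar> * m (k + l + 1) = (z / 2) ^ l / (2 * sqrt 2) * (inverse (fact k) * (z\<^sup>2 / 4) ^ k)" .
  qed
  finally have nI: "\<And>k. (LINT r|lborel. norm (f k r)) = (z / 2) ^ l / (2 * sqrt 2) * (inverse (fact k) * (z\<^sup>2 / 4) ^ k)" .
  have fs: "f k r = indicator {0..} r * (r ^ (l + 2) * exp (- r\<^sup>2) * ((z * r / 2) ^ l / sqrt 2)) * (bphi_coeff (real l + 1/2) k * ((z * r)\<^sup>2 / 4) ^ k)" for k r
  proof -
    have "r ^ (2 * (k + l + 1)) = r ^ (l + 2) * r ^ l * (r\<^sup>2) ^ k" by (simp add: power_add power_mult power2_eq_square power_mult_distrib)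
    moreover have "((z * r)\<^sup>2 / 4) ^ k = (z\<^sup>2 / 4) ^ k * (r\<^sup>2) ^ k" by (simp add: power_mult_distrib power_divide)
    moreover have "(z * r / 2) ^ l = (z / 2) ^ l * r ^ l" by (simp add: power_mult_distrib power_divide)
    ultimately show ?thesis by (simp add: f_def)
  qed
  \<comment> \<open>Integration term by term is justified by the same computation with absolute
    values, which yields the exponential series at z^2 / 4.\<close>
  have "(\<lambda>k. LINT r|lborel. f k r) sums (LINT r|lborel. (\<Sum>k. f k r))"
  proof (rule sums_integral[OF fi])
    show "AE r in lborel. summable (\<lambda>k. norm (f k r))"
    proof (rule AE_I2)
      fix r :: real
      have "summable (\<lambda>k. \<bar>indicator {0..} r * (r ^ (l + 2) * exp (- r\<^sup>2) * ((z * r / 2) ^ l / sqrt 2))\<bar> * \<bar>bphi_coeff (real l + 1/2) k * ((z * r)\<^sup>2 / 4) ^ k\<bar>)"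
        by (intro summable_mult bphi_abs_summable) auto
      then show "summable (\<lambda>k. norm (f k r))" unfolding fs real_norm_def abs_mult[of _ "bphi_coeff _ _ * _"] .
    qed
    show "summable (\<lambda>k. LINT r|lborel. norm (f k r))" unfolding nI by (intro summable_mult summable_exp)
  qed
  moreover have "(\<lambda>k. LINT r|lborel. f k r) sums ((z / 2) ^ l / (2 * sqrt 2) * exp (- (z\<^sup>2 / 4)))"
  proof -
    have "(\<lambda>k. inverse (fact k) * (- (z\<^sup>2 / 4)) ^ k) sums exp (- (z\<^sup>2 / 4))"
      using exp_converges[of "- (z\<^sup>2 / 4)"] by (simp only: real_scaleR_def)
    then show ?thesis unfolding fI cm by (rule sums_mult)
  qed
  ultimately have "(LINT r|lborel. (\<Sum>k. f k r)) = (z / 2) ^ l / (2 * sqrt 2) * exp (- (z\<^sup>2 / 4))" by (rule sums_unique2)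
  moreover have "(\<Sum>k. f k r) = indicator {0..} r * (bq l (z * r) * r ^ (l + 2) * exp (- r\<^sup>2))" for r
  proof -
    have "(\<Sum>k. f k r) = indicator {0..} r * (r ^ (l + 2) * exp (- r\<^sup>2) * ((z * r / 2) ^ l / sqrt 2)) * bphi (real l + 1/2) ((z * r)\<^sup>2 / 4)"
      unfolding fs bphi_def by (intro suminf_mult bphi_summable) auto
    then show ?thesis by (simp add: bq_def)
  qed
  ultimately show ?thesis by simp
qed

section \<open>Totality of the Bessel densities\<close>

lemma riemann_sum_bound:
  fixes f :: "real \<Rightarrow> real"
  assumes c: "continuous_on {0..R} f" and \<delta>: "\<delta> \<ge> 0" "real k * \<delta> \<le> R"
    and u: "\<And>x y. x \<in> {0..R} \<Longrightarrow> y \<in> {0..R} \<Longrightarrow> \<bar>x - y\<bar> \<le> \<delta> \<Longrightarrow> \<bar>f x - f y\<bar> \<le> e"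
  shows "\<bar>integral {0..real k * \<delta>} f - \<delta> * (\<Sum>i<k. f (real i * \<delta>))\<bar> \<le> real k * \<delta> * e"
  using \<delta>(2)
proof (induction k)
  case (Suc k)
  let ?a = "real k * \<delta>" and ?b = "real (Suc k) * \<delta>"
  have ab: "0 \<le> ?a" "?a \<le> ?b" "?b \<le> R" "?b - ?a = \<delta>" using \<delta>(1) Suc.prems by (auto simp: algebra_simps)
  have i: "f integrable_on {0..?b}" "f integrable_on {?a..?b}"
    by (intro integrable_continuous_interval continuous_on_subset[OF c]; use ab in auto)+
  have split: "integral {0..?b} f = integral {0..?a} f + integral {?a..?b} f"
    by (rule Henstock_Kurzweil_Integration.integral_combine[symmetric]) (use ab i in auto)
  have ca: "continuous_on {?a..?b} f" by (rule continuous_on_subset[OF c]) (use ab in auto)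
  have "((\<lambda>x. f x - f ?a) has_integral integral {?a..?b} f - (?b - ?a) *\<^sub>R f ?a) {?a..?b}"
    using ab has_integral_const_real[of "f ?a" ?a ?b] by (intro has_integral_diff integrable_integral i) auto
  then have "integral {?a..?b} (\<lambda>x. f x - f ?a) = integral {?a..?b} f - (?b - ?a) *\<^sub>R f ?a" by (rule integral_unique)
  moreover have "norm (integral {?a..?b} (\<lambda>x. f x - f ?a)) \<le> e * (?b - ?a)"
  proof (rule integral_bound[OF ab(2)])
    show "continuous_on {?a..?b} (\<lambda>x. f x - f ?a)" by (rule continuous_on_diff[OF ca continuous_on_const])
    show "norm (f t - f ?a) \<le> e" if "t \<in> {?a..?b}" for t
    proof -
      have "0 \<le> t" "t \<le> R" "\<bar>t - ?a\<bar> \<le> \<delta>" "?a \<le> R" using that ab unfolding atLeastAtMost_iff by linarith+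
      then show ?thesis using ab(1) unfolding real_norm_def by (intro u) (simp_all only: atLeastAtMost_iff simp_thms)
    qed
  qed
  ultimately have "norm (integral {?a..?b} f - (?b - ?a) *\<^sub>R f ?a) \<le> e * (?b - ?a)" by (simp only:)
  then have "\<bar>integral {?a..?b} f - \<delta> * f ?a\<bar> \<le> \<delta> * e" unfolding ab(4) by (simp add: mult.commute)
  moreover have "\<bar>integral {0..?a} f - \<delta> * (\<Sum>i<k. f (real i * \<delta>))\<bar> \<le> ?a * e" using Suc.IH ab by linarith
  moreover have "integral {0..?b} f - \<delta> * (\<Sum>i<Suc k. f (real i * \<delta>)) = (integral {0..?a} f - \<delta> * (\<Sum>i<k. f (real i * \<delta>))) + (integral {?a..?b} f - \<delta> * f ?a)"
    unfolding split by (simp add: algebra_simps)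
  moreover have "?b * e = ?a * e + \<delta> * e" by (simp add: algebra_simps)
  ultimately show ?case by linarith
qed simp

text \<open>It presents an average over r as a limit of finite linear combinations, in terms of the
  operations that \<open>bounded_limit_class\<close> provides.\<close>

lemma riemann_sum_tendsto:
  fixes f :: "real \<Rightarrow> real"
  assumes c: "continuous_on {0..R} f" and R: "R > 0"
  shows "(\<lambda>n. (R / real (Suc n)) * (\<Sum>i<Suc n. f (real i * (R / real (Suc n))))) \<longlonglongrightarrow> integral {0..R} f"
proof (rule LIMSEQ_I)
  fix e :: real assume "e > 0"
  then have e: "e / (2 * R) > 0" using R by simp
  have "uniformly_continuous_on {0..R} f" by (rule compact_uniformly_continuous[OF c]) simp
  then obtain d where d: "d > 0" "\<And>x y. x \<in> {0..R} \<Longrightarrow> y \<in> {0..R} \<Longrightarrow> dist y x < d \<Longrightarrow> dist (f y) (f x) < e / (2 * R)"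
    using e unfolding uniformly_continuous_on_def by metis
  obtain N where N: "R / d < real N" using reals_Archimedean2 by blast
  show "\<exists>no. \<forall>n\<ge>no. norm ((R / real (Suc n)) * (\<Sum>i<Suc n. f (real i * (R / real (Suc n)))) - integral {0..R} f) < e"
  proof (intro exI[of _ N] allI impI)
    fix n assume "n \<ge> N"
    then have "R / d < real (Suc n)" using N by simp
    then have small: "R / real (Suc n) < d" using d(1) by (simp add: field_simps)
    have "\<bar>integral {0..real (Suc n) * (R / real (Suc n))} f - (R / real (Suc n)) * (\<Sum>i<Suc n. f (real i * (R / real (Suc n))))\<bar>
       \<le> real (Suc n) * (R / real (Suc n)) * (e / (2 * R))"
    proof (rule riemann_sum_bound[OF c])
      show "\<bar>f x - f y\<bar> \<le> e / (2 * R)" if "x \<in> {0..R}" "y \<in> {0..R}" "\<bar>x - y\<bar> \<le> R / real (Suc n)" for x y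
        using d(2)[OF that(2,1)] that(3) small by (simp add: dist_real_def)
    qed (use R in auto)
    also have "real (Suc n) * (R / real (Suc n)) = R" by simp
    also have "R * (e / (2 * R)) = e / 2" using R by simp
    finally have "\<bar>integral {0..R} f - (R / real (Suc n)) * (\<Sum>i<Suc n. f (real i * (R / real (Suc n))))\<bar> \<le> e / 2"
      by simp
    then show "norm ((R / real (Suc n)) * (\<Sum>i<Suc n. f (real i * (R / real (Suc n)))) - integral {0..R} f) < e"
      using \<open>e > 0\<close> by (simp add: abs_minus_commute)
  qed
qed

lemma power_le_exp: "x \<ge> 0 \<Longrightarrow> x ^ n \<le> fact n * exp (x::real)"
proof -
  assume x: "x \<ge> 0"
  have "(\<Sum>k\<in>{n}. inverse (fact k) * x ^ k) \<le> (\<Sum>k. inverse (fact k) * x ^ k)"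
    by (rule sum_le_suminf[OF summable_exp]) (use x in auto)
  also have "(\<Sum>k. inverse (fact k) * x ^ k) = exp x"
    using sums_unique[OF exp_converges[of x]] by (simp only: real_scaleR_def)
  finally have "inverse (fact n) * x ^ n \<le> exp x" by simp
  then have le: "fact n * (inverse (fact n) * x ^ n) \<le> fact n * exp x" by (intro mult_left_mono) auto
  have "x ^ n = fact n * (inverse (fact n) * x ^ n)" by simp
  with le show ?thesis by (simp only:)
qed

text \<open>
  The functions \<open>\<mu> \<mapsto> bq l (\<mu> r)\<close>, \<open>r \<ge> 0\<close>, are total: averaging them over \<open>r\<close> with weight
  \<open>r\<^sup>l\<^sup>+\<^sup>2 exp (- r\<^sup>2)\<close> gives \<open>\<mu>\<^sup>l exp (- a \<mu>\<^sup>2)\<close> for every \<open>a > 0\<close>, and polynomials in \<open>exp (- \<mu>\<^sup>2)\<close>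
  approximate by the Weierstrass theorem.
\<close>

locale bounded_limit_class =
  fixes P :: "(real \<Rightarrow> real) \<Rightarrow> bool" and l :: nat
  assumes lin: "\<And>f g a b. P f \<Longrightarrow> P g \<Longrightarrow> P (\<lambda>x. a * f x + b * g x)"
    and lim: "\<And>f g C. (\<And>n::nat. P (f n)) \<Longrightarrow> (\<And>n x. x \<ge> 0 \<Longrightarrow> \<bar>f n x\<bar> \<le> C) \<Longrightarrow> (\<And>x. x \<ge> 0 \<Longrightarrow> (\<lambda>n. f n x) \<longlonglongrightarrow> g x) \<Longrightarrow> P g"
    and base: "\<And>r. r \<ge> 0 \<Longrightarrow> P (\<lambda>x. bq l (x * r))"
begin

lemma scale: "P f \<Longrightarrow> P (\<lambda>x. a * f x)"
  using lin[of f f a 0] by simp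

lemma zero: "P (\<lambda>x. 0)"
  using scale[OF base[of 0], of 0] by simp

lemma sum: "(\<And>i. i \<in> I \<Longrightarrow> P (f i)) \<Longrightarrow> P (\<lambda>x. \<Sum>i\<in>I. c i * f i x)"
proof (induction I rule: infinite_finite_induct)
  case (insert i I)
  then show ?case using lin[of "f i" "\<lambda>x. \<Sum>i\<in>I. c i * f i x" "c i" 1] by simp
qed (simp_all add: zero)

text \<open>A constant sequence in \<open>lim\<close>: membership depends on the values at
  nonnegative arguments only.\<close>

lemma cong: "P f \<Longrightarrow> (\<And>x. x \<ge> 0 \<Longrightarrow> f x = g x) \<Longrightarrow> (\<And>x. x \<ge> 0 \<Longrightarrow> \<bar>f x\<bar> \<le> C) \<Longrightarrow> P g"
  by (rule lim[of "\<lambda>_. f" C g]) auto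

text \<open>The average over r is taken over [0, R] as a limit of Riemann sums and then for R
  tending to infinity. Both limits stay below a bound independent of x, because \<open>bq l\<close>
  is bounded and the weight is integrable.\<close>

lemma gaussian:
  assumes s: "s > 0"
  shows "P (\<lambda>x. x ^ l * exp (- ((x * s)\<^sup>2 / 4)))"
proof -
  obtain C where C: "\<And>z. z \<ge> 0 \<Longrightarrow> \<bar>bq l z\<bar> \<le> C" using bq_bounded by blast
  have C0: "C \<ge> 0" using C[of 0] by linarith
  define m where "m r = r ^ (l + 2) * exp (- r\<^sup>2)" for r :: real
  have mc: "continuous_on A m" for A unfolding m_def by (intro continuous_intros)
  have m0: "m r \<ge> 0" if "r \<ge> 0" for r using that by (simp add: m_def)
  \<comment> \<open>The estimate r^(l + 2) \<le> 1 + r^(2 (l + 2)) reduces integrability to even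
    Gaussian moments.\<close>
  have mi: "integrable lborel (\<lambda>r. indicator {0..} r * m r)"
  proof (rule Bochner_Integration.integrable_bound)
    show "integrable lborel (\<lambda>r::real. indicator {0..} r *\<^sub>R (exp (- r\<^sup>2) * r ^ (2 * 0)) + indicator {0..} r *\<^sub>R (exp (- r\<^sup>2) * r ^ (2 * (l + 2))))"
      using gaussian_moment_even_pos[of 0] gaussian_moment_even_pos[of "l + 2"]
      by (intro Bochner_Integration.integrable_add) (auto simp only: has_bochner_integral_iff)
    show "AE r in lborel. norm (indicator {0..} r * m r) \<le> norm (indicator {0..} r *\<^sub>R (exp (- r\<^sup>2) * r ^ (2 * 0)) + indicator {0..} r *\<^sub>R (exp (- r\<^sup>2) * r ^ (2 * (l + 2))))"
    proof (rule AE_I2)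
      fix r :: real
      have x2: "x \<le> 1 + x\<^sup>2" if "x \<ge> 0" for x :: real
        using sum_squares_bound[of 1 x] that by (simp add: power2_eq_square)
      have sq: "r ^ (2 * (l + 2)) = (r ^ (l + 2))\<^sup>2" by (simp only: power_mult[symmetric] mult.commute)
      have "r ^ (l + 2) \<le> 1 + r ^ (2 * (l + 2))" if "r \<ge> 0"
        unfolding sq by (rule x2) (use that in simp)
      then have "m r \<le> exp (- r\<^sup>2) * r ^ (2 * 0) + exp (- r\<^sup>2) * r ^ (2 * (l + 2))" if "r \<ge> 0"
        using that mult_left_mono[of "r ^ (l + 2)" "1 + r ^ (2 * (l + 2))" "exp (- r\<^sup>2)"] by (simp add: m_def algebra_simps)
      then show "norm (indicator {0..} r * m r) \<le> norm (indicator {0..} r *\<^sub>R (exp (- r\<^sup>2) * r ^ (2 * 0)) + indicator {0..} r *\<^sub>R (exp (- r\<^sup>2) * r ^ (2 * (l + 2))))"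
        using m0 by (cases "r \<ge> 0") (auto simp: abs_of_nonneg)
    qed
    show "(\<lambda>r. indicator {0..} r * m r) \<in> borel_measurable lborel"
      using borel_measurable_continuous_onI[OF mc[of UNIV]] by measurable
  qed
  define F where "F x r = bq l (x * (s * r)) * m r" for x r
  have Fc: "continuous_on A (F x)" for A x
    unfolding F_def by (intro continuous_intros continuous_on_compose2[OF continuous_on_bq[of UNIV]] mc) auto
  have Fb: "\<bar>F x r\<bar> \<le> C * m r" if "x \<ge> 0" "r \<ge> 0" for x r
    unfolding F_def abs_mult using that s C[of "x * (s * r)"] m0[OF that(2)] by (simp add: mult_right_mono)
  have int: "P (\<lambda>x. integral {0..R} (F x))" if R: "R > 0" for R
  proof -
    have "bounded (m ` {0..R})" by (intro compact_imp_bounded compact_continuous_image mc) auto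
    then obtain K where K: "\<forall>y\<in>m ` {0..R}. norm y \<le> K" unfolding bounded_iff by blast
    show ?thesis
    proof (rule lim)
      fix n :: nat
      let ?r = "\<lambda>i. real i * (R / real (Suc n))"
      have "P (\<lambda>x. \<Sum>i<Suc n. ((R / real (Suc n)) * m (?r i)) * bq l (x * (s * ?r i)))"
        using s R by (intro sum base) auto
      then show "P (\<lambda>x. (R / real (Suc n)) * (\<Sum>i<Suc n. F x (real i * (R / real (Suc n)))))"
        by (simp only: F_def sum_distrib_left mult_ac)
      fix x :: real assume x: "x \<ge> 0"
      have "\<bar>\<Sum>i<Suc n. F x (?r i)\<bar> \<le> (\<Sum>i<Suc n. C * K)"
      proof (rule order_trans[OF sum_abs sum_mono])
        fix i assume "i \<in> {..<Suc n}"
        then have "real i * (R / real (Suc n)) \<le> real (Suc n) * (R / real (Suc n))"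
          using R by (intro mult_right_mono) auto
        then have "?r i \<in> {0..R}" using R by (simp del: of_nat_Suc)
        then have "m (?r i) \<le> K" "0 \<le> ?r i" using K by (auto dest!: bspec abs_le_D1)
        then show "\<bar>F x (?r i)\<bar> \<le> C * K" using Fb[OF x, of "?r i"] mult_left_mono[of "m (?r i)" K C] C0 by linarith
      qed
      then have "(R / real (Suc n)) * \<bar>\<Sum>i<Suc n. F x (?r i)\<bar> \<le> (R / real (Suc n)) * (real (Suc n) * (C * K))"
        using R by (intro mult_left_mono) (auto simp del: of_nat_Suc)
      then show "\<bar>(R / real (Suc n)) * (\<Sum>i<Suc n. F x (real i * (R / real (Suc n))))\<bar> \<le> R * (C * K)"
        using R by (simp add: abs_mult del: of_nat_Suc sum.lessThan_Suc)
    next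
      fix x :: real assume "x \<ge> 0"
      show "(\<lambda>n. (R / real (Suc n)) * (\<Sum>i<Suc n. F x (real i * (R / real (Suc n))))) \<longlonglongrightarrow> integral {0..R} (F x)"
        by (rule riemann_sum_tendsto[OF Fc R])
    qed
  qed
  have LI: "integral {0..R} (F x) = (LINT r|lborel. indicator {0..R} r * F x r)" for x R
    using set_borel_integral_eq_integral(2)[OF borel_integrable_atLeastAtMost'[OF Fc]] by (simp add: set_lebesgue_integral_def)
  have Fm: "F x \<in> borel_measurable borel" for x by (rule borel_measurable_continuous_onI[OF Fc])
  define M where "M = C * (LINT r|lborel. indicator {0..} r * m r)"
  have "P (\<lambda>x. LINT r|lborel. indicator {0..} r * F x r)"
  proof (rule lim)
    fix n :: nat
    show "P (\<lambda>x. integral {0..real (Suc n)} (F x))" by (rule int) simp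
    fix x :: real assume x: "x \<ge> 0"
    show "\<bar>integral {0..real (Suc n)} (F x)\<bar> \<le> M"
      unfolding LI M_def Bochner_Integration.integral_mult_right_zero[symmetric]
    proof (rule order_trans[OF integral_abs_bound integral_mono'])
      show "integrable lborel (\<lambda>r. C * (indicator {0..} r * m r))" using mi by simp
      show "\<bar>indicator {0..real (Suc n)} r * F x r\<bar> \<le> C * (indicator {0..} r * m r)" for r
        using Fb[OF x, of r] C0 m0[of r] by (auto simp: indicator_def abs_mult)
      show "0 \<le> C * (indicator {0..} r * m r)" for r using C0 m0[of r] by (auto simp: indicator_def)
    qed
  next
    fix x :: real assume x: "x \<ge> 0"
    show "(\<lambda>n. integral {0..real (Suc n)} (F x)) \<longlonglongrightarrow> (LINT r|lborel. indicator {0..} r * F x r)"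
      unfolding LI
    proof (rule integral_dominated_convergence[where w="\<lambda>r. C * (indicator {0..} r * m r)"])
      show "integrable lborel (\<lambda>r. C * (indicator {0..} r * m r))" using mi by simp
      show "AE r in lborel. (\<lambda>n. indicator {0..real (Suc n)} r * F x r) \<longlonglongrightarrow> indicator {0..} r * F x r"
      proof (rule AE_I2)
        fix r :: real
        obtain N :: nat where N: "r \<le> real N" using real_arch_simple by blast
        have "\<forall>\<^sub>F n in sequentially. indicator {0..real (Suc n)} r * F x r = indicator {0..} r * F x r"
          using eventually_ge_at_top[of N] by eventually_elim (use N in \<open>auto simp: indicator_def\<close>)
        then show "(\<lambda>n. indicator {0..real (Suc n)} r * F x r) \<longlonglongrightarrow> indicator {0..} r * F x r"
          by (rule tendsto_eventually)
      qed
      show "AE r in lborel. norm (indicator {0..real (Suc n)} r * F x r) \<le> C * (indicator {0..} r * m r)" for n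
        using Fb[OF x] C0 m0 by (intro AE_I2) (auto simp: indicator_def abs_mult)
    qed (use Fm in measurable)
  qed
  \<comment> \<open>The constant cancels the factor \<open>(s / 2) ^ l / (2 * sqrt 2)\<close>
    produced by \<open>bq_gaussian\<close>.\<close>
  then have G: "P (\<lambda>x. (2 * sqrt 2 * (2 / s) ^ l) * (LINT r|lborel. indicator {0..} r * F x r))" by (rule scale)
  have eq: "(2 * sqrt 2 * (2 / s) ^ l) * (LINT r|lborel. indicator {0..} r * F x r) = x ^ l * exp (- ((x * s)\<^sup>2 / 4))" if "x \<ge> 0" for x
  proof -
    have "(LINT r|lborel. indicator {0..} r * F x r) = (x * s / 2) ^ l * exp (- ((x * s)\<^sup>2 / 4)) / (2 * sqrt 2)"
      using bq_gaussian[of "x * s" l] that s by (simp add: F_def m_def mult_ac)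
    moreover have "(2 / s) ^ l * (x * s / 2) ^ l = x ^ l" using s by (simp flip: power_mult_distrib)
    ultimately show ?thesis by simp
  qed
  have bd: "\<bar>(2 * sqrt 2 * (2 / s) ^ l) * (LINT r|lborel. indicator {0..} r * F x r)\<bar> \<le> (2 * sqrt 2 * (2 / s) ^ l) * M" if x: "x \<ge> 0" for x
  proof -
    have "\<bar>LINT r|lborel. indicator {0..} r * F x r\<bar> \<le> M"
      unfolding M_def Bochner_Integration.integral_mult_right_zero[symmetric]
    proof (rule order_trans[OF integral_abs_bound integral_mono'])
      show "integrable lborel (\<lambda>r. C * (indicator {0..} r * m r))" using mi by simp
      show "\<bar>indicator {0..} r * F x r\<bar> \<le> C * (indicator {0..} r * m r)" for r
        using Fb[OF x, of r] by (auto simp: indicator_def abs_mult)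
      show "0 \<le> C * (indicator {0..} r * m r)" for r using C0 m0[of r] by (auto simp: indicator_def)
    qed
    then show ?thesis using s by (simp add: abs_mult mult_left_mono)
  qed
  show ?thesis by (rule cong[OF G eq bd])
qed

text \<open>Write the product as x^l k(x) with k bounded and continuous. Damped by exp (- \<epsilon>
  x^2) it becomes accessible in the variable y = exp (- x^2): Weierstrass approximation on [0, 1]
  yields polynomials in y, and y^i times the retained Gaussian factor is again Gaussian. The damping
  is split in halves, one for continuity at y = 0 and one to keep x^l bounded, and is removed by
  \<epsilon> tending to 0.\<close>

lemma product:
  assumes h: "continuous_on {0..} h" and hb: "\<And>x. x \<ge> 0 \<Longrightarrow> \<bar>h x\<bar> \<le> B"
  shows "P (\<lambda>x. bq l x * h x)"
proof -
  define k where "k x = bphi (real l + 1/2) (x\<^sup>2 / 4) * h x / (2 ^ l * sqrt 2)" for x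
  have bk: "bq l x * h x = x ^ l * k x" for x by (simp add: bq_def k_def power_divide)
  have kc: "continuous_on {0..} k" unfolding k_def
    by (intro continuous_intros h continuous_on_compose2[OF continuous_on_bphi[of _ UNIV]]) auto
  obtain C where C: "\<And>z. z \<ge> 0 \<Longrightarrow> \<bar>bphi (real l + 1/2) (z\<^sup>2 / 4)\<bar> \<le> C" using bphi_bounded by blast
  have C0: "C \<ge> 0" using C[of 0] by linarith
  have kb: "\<bar>k x\<bar> \<le> C * B" if "x \<ge> 0" for x
  proof -
    have "\<bar>bphi (real l + 1/2) (x\<^sup>2 / 4) * h x\<bar> \<le> C * B" unfolding abs_mult using C[OF that] hb[OF that] C0 by (intro mult_mono) auto
    moreover have "1 \<le> 2 ^ l * sqrt 2" using mult_mono[of 1 "2 ^ l" 1 "sqrt 2"] by simp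
    moreover have "0 \<le> C * B" using C0 hb[of 0] by (intro mult_nonneg_nonneg) auto
    ultimately have "\<bar>bphi (real l + 1/2) (x\<^sup>2 / 4) * h x\<bar> \<le> C * B * (2 ^ l * sqrt 2)"
      using mult_left_mono[of 1 "2 ^ l * sqrt 2" "C * B"] by linarith
    moreover have "2 ^ l * sqrt 2 > (0::real)" by simp
    ultimately show ?thesis by (simp only: k_def abs_divide abs_of_pos pos_divide_le_eq)
  qed
  define K where "K = C * B"
  have K0: "K \<ge> 0" using kb[of 0] by (simp add: K_def)
  have damped: "P (\<lambda>x. x ^ l * k x * exp (- \<epsilon> * x\<^sup>2))" if \<epsilon>: "\<epsilon> > 0" for \<epsilon>
  proof -
    \<comment> \<open>Here x = sqrt (- ln y), and \<open>y powr (\<epsilon> / 2)\<close> is exp (-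
      \<epsilon> x^2 / 2); it forces the limit 0 at y = 0, that is, at x = infinity, where k itself
      need not converge.\<close>
    define \<psi> where "\<psi> y = (if y \<le> 0 then 0 else k (sqrt (- ln y)) * y powr (\<epsilon> / 2))" for y
    have \<psi>b: "\<bar>\<psi> y\<bar> \<le> K * y powr (\<epsilon> / 2)" if "y \<in> {0..1}" for y
      using that kb[of "sqrt (- ln y)"] by (auto simp: \<psi>_def abs_mult K_def intro!: mult_right_mono)
    have \<psi>c: "continuous_on {0..1} \<psi>"
      unfolding continuous_on_eq_continuous_within
    proof
      fix y :: real assume y: "y \<in> {0..1}"
      show "continuous (at y within {0..1}) \<psi>"
      proof (cases "y = 0")
        case True
        have "((\<lambda>y. K * y powr (\<epsilon> / 2)) \<longlongrightarrow> K * 0) (at 0 within {0..1})"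
          using \<epsilon> by (intro tendsto_intros tendsto_powr'[OF tendsto_ident_at tendsto_const, of 0, simplified]) (auto simp: eventually_at_filter)
        then have "((\<lambda>y. K * y powr (\<epsilon> / 2)) \<longlongrightarrow> 0) (at 0 within {0..1})" by simp
        then have "(\<psi> \<longlongrightarrow> 0) (at 0 within {0..1})"
          by (rule Lim_null_comparison[rotated]) (use \<psi>b in \<open>auto simp: eventually_at_filter\<close>)
        then show ?thesis using True by (simp add: continuous_within \<psi>_def)
      next
        case False
        have "continuous_on {0<..1} (\<lambda>y. k (sqrt (- ln y)) * y powr (\<epsilon> / 2))"
          by (intro continuous_intros continuous_on_compose2[OF kc]) auto
        then have "continuous_on {0<..1} \<psi>" by (rule continuous_on_eq) (simp add: \<psi>_def)
        then have "continuous (at y within {0<..1}) \<psi>" using y False by (simp add: continuous_on_eq_continuous_within)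
        moreover have "at y within {0<..1} = at y within {0..1}"
          by (rule at_within_nhd[of _ "{0<..}"]) (use y False in auto)
        ultimately show ?thesis by simp
      qed
    qed
    have "\<exists>a N. \<forall>y\<in>{0..1}. \<bar>\<psi> y - (\<Sum>i\<le>N. a i * y ^ i)\<bar> < 1 / real (Suc j)" for j
    proof -
      obtain g where g: "real_polynomial_function g" "\<And>y. y \<in> {0..1} \<Longrightarrow> \<bar>\<psi> y - g y\<bar> < 1 / real (Suc j)"
        using Stone_Weierstrass_real_polynomial_function[OF compact_Icc \<psi>c, of "1 / real (Suc j)"] by auto
      then show ?thesis unfolding real_polynomial_function_iff_sum by blast
    qed
    then obtain a N where aN: "\<And>j y. y \<in> {0..1} \<Longrightarrow> \<bar>\<psi> y - (\<Sum>i\<le>N j. a j i * y ^ i)\<bar> < 1 / real (Suc j)" by metis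
    define p where "p j y = (\<Sum>i\<le>N j. a j i * y ^ i)" for j and y :: real
    \<comment> \<open>The second half of the damping, which dominates the power of x.\<close>
    define e where "e x = x ^ l * exp (- (\<epsilon> / 2) * x\<^sup>2)" for x
    have y01: "exp (- x\<^sup>2) \<in> {0..1}" for x :: real by simp
    have \<psi>x: "\<psi> (exp (- x\<^sup>2)) = k x * exp (- (\<epsilon> / 2) * x\<^sup>2)" if "x \<ge> 0" for x
      using that by (simp add: \<psi>_def powr_def)
    have eb: "\<bar>e x\<bar> \<le> 1 + (2 / \<epsilon>) ^ l * fact l" if x: "x \<ge> 0" for x
    proof -
      define u where "u = \<epsilon> / 2 * x\<^sup>2"
      have u0: "u \<ge> 0" using \<epsilon> by (simp add: u_def)
      have xu: "x\<^sup>2 = (2 / \<epsilon>) * u" using \<epsilon> by (simp add: u_def)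
      have "x ^ l \<le> 1 + (x ^ l)\<^sup>2" using sum_squares_bound[of 1 "x ^ l"] zero_le_power[OF x, of l] by (simp add: power2_eq_square)
      also have "(x ^ l)\<^sup>2 = (2 / \<epsilon>) ^ l * u ^ l" by (simp add: power_mult[symmetric] mult.commute[of l] xu flip: power_mult_distrib) (simp add: power_mult xu power_mult_distrib power_divide)
      also have "1 + (2 / \<epsilon>) ^ l * u ^ l \<le> 1 * exp u + (2 / \<epsilon>) ^ l * (fact l * exp u)"
        using \<epsilon> u0 power_le_exp[OF u0, of l] by (intro add_mono mult_left_mono) auto
      finally have "x ^ l * exp (- u) \<le> (1 * exp u + (2 / \<epsilon>) ^ l * (fact l * exp u)) * exp (- u)" by (rule mult_right_mono) simp
      also have "\<dots> = (1 + (2 / \<epsilon>) ^ l * fact l) * (exp u * exp (- u))" by (simp add: algebra_simps)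
      also have "exp u * exp (- u) = 1" by (simp flip: exp_add)
      finally show ?thesis using x by (simp add: e_def u_def)
    qed
    have Pj: "P (\<lambda>x. e x * p j (exp (- x\<^sup>2)))" for j
    proof -
      \<comment> \<open>The scale s = 2 sqrt (\<epsilon> / 2 + i) turns (x s)^2 / 4 into (\<epsilon>
        / 2 + i) x^2, the exponent of the i-th monomial together with the retained damping.\<close>
      have g: "P (\<lambda>x. x ^ l * exp (- ((x * (2 * sqrt (\<epsilon> / 2 + real i)))\<^sup>2 / 4)))" for i
        by (rule gaussian) (use \<epsilon> in \<open>simp add: add_pos_nonneg\<close>)
      have "(x * (2 * sqrt (\<epsilon> / 2 + real i)))\<^sup>2 / 4 = (\<epsilon> / 2 + real i) * x\<^sup>2" for x i
        using \<epsilon> by (simp add: power_mult_distrib)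
      then have g: "P (\<lambda>x. x ^ l * exp (- ((\<epsilon> / 2 + real i) * x\<^sup>2)))" for i using g[of i] by simp
      have "P (\<lambda>x. \<Sum>i\<le>N j. a j i * (x ^ l * exp (- ((\<epsilon> / 2 + real i) * x\<^sup>2))))" by (intro sum g)
      moreover have "(\<Sum>i\<le>N j. a j i * (x ^ l * exp (- ((\<epsilon> / 2 + real i) * x\<^sup>2)))) = e x * p j (exp (- x\<^sup>2))" for x
      proof -
        have "exp (- ((\<epsilon> / 2 + real i) * x\<^sup>2)) = exp (- (\<epsilon> / 2) * x\<^sup>2) * exp (- x\<^sup>2) ^ i" for i
          by (simp add: exp_of_nat_mult[symmetric] algebra_simps flip: exp_add)
        then show ?thesis by (simp add: e_def p_def sum_distrib_left mult_ac)
      qed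
      ultimately show ?thesis by simp
    qed
    have pj: "(\<lambda>j. p j (exp (- x\<^sup>2))) \<longlonglongrightarrow> \<psi> (exp (- x\<^sup>2))" for x
    proof -
      have "(\<lambda>j. p j (exp (- x\<^sup>2)) - \<psi> (exp (- x\<^sup>2))) \<longlonglongrightarrow> 0"
        by (rule Lim_null_comparison[OF _ LIMSEQ_inverse_real_of_nat])
           (use aN[OF y01[of x]] in \<open>auto simp: p_def abs_minus_commute inverse_eq_divide intro!: always_eventually less_imp_le\<close>)
      then show ?thesis by (simp add: LIM_zero_iff)
    qed
    show ?thesis
    proof (rule lim[OF Pj])
      fix j and x :: real assume x: "x \<ge> 0"
      have "\<bar>\<psi> (exp (- x\<^sup>2))\<bar> \<le> K * 1"
        by (rule order_trans[OF \<psi>b[OF y01]]) (use K0 \<epsilon> in \<open>auto intro!: mult_left_le powr_le1\<close>)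
      moreover have "1 / real (Suc j) \<le> 1" by simp
      ultimately have "\<bar>p j (exp (- x\<^sup>2))\<bar> \<le> K + 1" using aN[OF y01[of x], of j] unfolding p_def by linarith
      then show "\<bar>e x * p j (exp (- x\<^sup>2))\<bar> \<le> (1 + (2 / \<epsilon>) ^ l * fact l) * (K + 1)"
        unfolding abs_mult using eb[OF x] K0 \<epsilon> by (intro mult_mono) auto
    next
      fix x :: real assume x: "x \<ge> 0"
      have "e x * \<psi> (exp (- x\<^sup>2)) = x ^ l * k x * (exp (- (\<epsilon> / 2) * x\<^sup>2) * exp (- (\<epsilon> / 2) * x\<^sup>2))"
        by (simp add: \<psi>x[OF x] e_def)
      also have "exp (- (\<epsilon> / 2) * x\<^sup>2) * exp (- (\<epsilon> / 2) * x\<^sup>2) = exp (- \<epsilon> * x\<^sup>2)" by (simp flip: exp_add)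
      finally show "(\<lambda>j. e x * p j (exp (- x\<^sup>2))) \<longlonglongrightarrow> x ^ l * k x * exp (- \<epsilon> * x\<^sup>2)"
        using tendsto_mult_left[OF pj[of x], of "e x"] by simp
    qed
  qed
  obtain Cq where Cq: "\<And>z. z \<ge> 0 \<Longrightarrow> \<bar>bq l z\<bar> \<le> Cq" using bq_bounded by blast
  have Cq0: "Cq \<ge> 0" using Cq[of 0] by linarith
  show ?thesis
  \<comment> \<open>The bound along \<epsilon> = 1 / (n + 1) is that of the undamped product and
    does not depend on n.\<close>
  proof (rule lim[OF damped[of "inverse (real (Suc n))" for n]])
    fix n and x :: real assume x: "x \<ge> 0"
    have xk: "\<bar>x ^ l * k x\<bar> \<le> Cq * B" unfolding bk[symmetric] abs_mult using Cq[OF x] hb[OF x] Cq0 by (intro mult_mono) auto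
    then show "\<bar>x ^ l * k x * exp (- inverse (real (Suc n)) * x\<^sup>2)\<bar> \<le> Cq * B"
      using order_trans[OF abs_ge_zero xk] mult_mono[of "\<bar>x ^ l * k x\<bar>" "Cq * B" "\<bar>exp (- inverse (real (Suc n)) * x\<^sup>2)\<bar>" 1] by (simp add: abs_mult)
  next
    fix x :: real
    have "(\<lambda>n. x ^ l * k x * exp (- inverse (real (Suc n)) * x\<^sup>2)) \<longlonglongrightarrow> x ^ l * k x * exp (- 0 * x\<^sup>2)"
      by (intro tendsto_intros LIMSEQ_inverse_real_of_nat)
    then show "(\<lambda>n. x ^ l * k x * exp (- inverse (real (Suc n)) * x\<^sup>2)) \<longlonglongrightarrow> bq l x * h x" by (simp add: bk)
  qed simp
qed

end

section \<open>Random Laplace series\<close>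

text \<open>An arbitrary set of degrees is allowed, so that differences of partial sums have the
  same form.\<close>

definition Ysum :: "nat set \<Rightarrow> (nat \<Rightarrow> int \<Rightarrow> 'w \<Rightarrow> complex) \<Rightarrow> real^3 \<Rightarrow> 'w \<Rightarrow> complex" where
  "Ysum I a v \<omega> = (\<Sum>l\<in>I. \<Sum>m=-int l..int l. sph_Y l m v * a l m \<omega>)"

definition Yker :: "nat \<Rightarrow> real^3 \<Rightarrow> real^3 \<Rightarrow> complex" where
  "Yker l v w = (\<Sum>m=-int l..int l. sph_Y l m v * cnj (sph_Y l m w))"

text \<open>The number of harmonics of degree \<open>l\<close> divided by the area of the sphere;
  this is the value of \<open>Yker l\<close> on the diagonal.\<close>

definition sph_dim :: "nat \<Rightarrow> real" where
  "sph_dim l = (2 * real l + 1) / (4 * pi)"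

lemma sph_dim_pos: "sph_dim l > 0" by (simp add: sph_dim_def)

lemma laplace_partial_sum_Ysum:
  assumes "\<theta> \<in> {0..pi}"
  shows "laplace_partial_sum a \<theta> \<phi> = (\<lambda>L. Ysum {..L} a (sph_point \<theta> \<phi>))"
proof (intro ext)
  fix L \<omega>
  show "laplace_partial_sum a \<theta> \<phi> L \<omega> = Ysum {..L} a (sph_point \<theta> \<phi>) \<omega>"
    unfolding laplace_partial_sum_def Ysum_def
    using assms by (intro sum.cong refl) (auto simp: sph_harm_sph_Y)
qed

lemma Yker_diag: "norm v = 1 \<Longrightarrow> Yker l v v = of_real (sph_dim l)"
  unfolding Yker_def sph_dim_def by (rule sph_Y_diag)

text \<open>The inequality 2 |x y| \<le> |x|^2 + |y|^2 in each term leaves the mean of two diagonal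
  sums, both equal to \<open>sph_dim l\<close>.\<close>

lemma Yker_bound:
  assumes "norm v = 1" "norm w = 1"
  shows "norm (Yker l v w) \<le> sph_dim l"
proof -
  have e: "(\<Sum>m=-int l..int l. (norm (sph_Y l m u))\<^sup>2) = sph_dim l" if "norm u = 1" for u
  proof -
    have "complex_of_real (\<Sum>m=-int l..int l. (norm (sph_Y l m u))\<^sup>2) = of_real (sph_dim l)"
      using Yker_diag[OF that, of l] unfolding of_real_sum complex_norm_square Yker_def .
    then show ?thesis by (simp only: of_real_eq_iff)
  qed
  have "norm (Yker l v w) \<le> (\<Sum>m=-int l..int l. norm (sph_Y l m v * cnj (sph_Y l m w)))"
    unfolding Yker_def by (rule norm_sum)
  also have "\<dots> \<le> (\<Sum>m=-int l..int l. ((norm (sph_Y l m v))\<^sup>2 + (norm (sph_Y l m w))\<^sup>2) / 2)"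
  proof (rule sum_mono)
    fix m show "norm (sph_Y l m v * cnj (sph_Y l m w)) \<le> ((norm (sph_Y l m v))\<^sup>2 + (norm (sph_Y l m w))\<^sup>2) / 2"
      using sum_squares_bound[of "norm (sph_Y l m v)" "norm (sph_Y l m w)"] by (simp add: norm_mult)
  qed
  also have "\<dots> = sph_dim l"
    by (simp add: sum_divide_distrib[symmetric] sum.distrib e assms)
  finally show ?thesis .
qed

lemma continuous_on_Yker: "continuous_on A (\<lambda>p. Yker l (fst p) (snd p))"
  unfolding Yker_def by (intro continuous_intros continuous_on_compose2[OF continuous_on_sph_Y[of UNIV]]) auto

lemma Ysum_sq_integrable:
  assumes "\<And>l m. \<bar>m\<bar> \<le> int l \<Longrightarrow> sq_integrable M (a l m)"
  shows "sq_integrable M (Ysum I a v)"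
  unfolding Ysum_def[abs_def] using assms by (intro sq_integrable_sum sq_integrable_mult_left) auto

lemma Ysum_inner:
  assumes a: "\<And>l m. \<bar>m\<bar> \<le> int l \<Longrightarrow> sq_integrable M (a l m)" "\<And>l m. \<bar>m\<bar> \<le> int l \<Longrightarrow> sq_integrable M (b l m)"
    and o: "\<And>l m l' m'. \<bar>m\<bar> \<le> int l \<Longrightarrow> \<bar>m'\<bar> \<le> int l' \<Longrightarrow>
      (LINT \<omega>|M. a l m \<omega> * cnj (b l' m' \<omega>)) = (if l = l' \<and> m = m' then C l else 0)"
    and I: "finite I"
  shows "(LINT \<omega>|M. Ysum I a v \<omega> * cnj (Ysum I b w \<omega>)) = (\<Sum>l\<in>I. Yker l v w * C l)"
proof -
  define S where "S = (SIGMA l:I. {-int l..int l})"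
  have S: "finite S" "\<And>p. p \<in> S \<Longrightarrow> \<bar>snd p\<bar> \<le> int (fst p)" using I by (auto simp: S_def)
  have Y: "Ysum I c u \<omega> = (\<Sum>p\<in>S. sph_Y (fst p) (snd p) u * c (fst p) (snd p) \<omega>)" for c u \<omega>
    unfolding Ysum_def S_def using I by (subst sum.Sigma) (auto simp: case_prod_beta)
  have "(LINT \<omega>|M. Ysum I a v \<omega> * cnj (Ysum I b w \<omega>)) =
    (LINT \<omega>|M. (\<Sum>p\<in>S. \<Sum>q\<in>S. (sph_Y (fst p) (snd p) v * cnj (sph_Y (fst q) (snd q) w)) * (a (fst p) (snd p) \<omega> * cnj (b (fst q) (snd q) \<omega>))))"
    unfolding Y cnj_sum sum_product by (simp add: mult_ac)
  also have "\<dots> = (\<Sum>p\<in>S. \<Sum>q\<in>S. (sph_Y (fst p) (snd p) v * cnj (sph_Y (fst q) (snd q) w)) * (LINT \<omega>|M. a (fst p) (snd p) \<omega> * cnj (b (fst q) (snd q) \<omega>)))"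
    using S by (simp add: Bochner_Integration.integral_sum sq_integrable_inner a)
  also have "\<dots> = (\<Sum>p\<in>S. \<Sum>q\<in>S. if p = q then sph_Y (fst p) (snd p) v * cnj (sph_Y (fst p) (snd p) w) * C (fst p) else 0)"
    using S by (intro sum.cong refl) (auto simp: o prod_eq_iff)
  also have "\<dots> = (\<Sum>p\<in>S. sph_Y (fst p) (snd p) v * cnj (sph_Y (fst p) (snd p) w) * C (fst p))"
    using S by simp
  also have "\<dots> = (\<Sum>l\<in>I. Yker l v w * C l)"
    unfolding S_def Yker_def sum_distrib_right using I by (subst sum.Sigma) (auto simp: case_prod_beta)
  finally show ?thesis .
qed

lemma Ysum_diff: "L \<le> N \<Longrightarrow> Ysum {..N} a v \<omega> - Ysum {..L} a v \<omega> = Ysum {L<..N} a v \<omega>"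
proof -
  assume "L \<le> N"
  then have "{..N} = {..L} \<union> {L<..N}" "{..L} \<inter> {L<..N} = {}" by auto
  then show ?thesis unfolding Ysum_def by (simp add: sum.union_disjoint)
qed

lemma sph_Y_project:
  assumes m: "\<bar>m\<bar> \<le> int l" and L: "l \<le> L"
  shows "(LINT p|sph_meas. (\<Sum>k\<le>L. \<Sum>j=-int k..int k. sph_Y k j (sph_pt p) * e k j) * cnj (sph_Y l m (sph_pt p))) = e l m"
proof -
  have "(LINT p|sph_meas. (\<Sum>k\<le>L. \<Sum>j=-int k..int k. sph_Y k j (sph_pt p) * e k j) * cnj (sph_Y l m (sph_pt p))) =
    (LINT p|sph_meas. (\<Sum>k\<le>L. \<Sum>j=-int k..int k. e k j * (sph_Y k j (sph_pt p) * cnj (sph_Y l m (sph_pt p)))))"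
    unfolding sum_distrib_right by (simp add: mult_ac)
  also have "\<dots> = (\<Sum>k\<le>L. LINT p|sph_meas. (\<Sum>j=-int k..int k. e k j * (sph_Y k j (sph_pt p) * cnj (sph_Y l m (sph_pt p)))))"
    by (intro Bochner_Integration.integral_sum Bochner_Integration.integrable_sum integrable_mult_right sph_Y_integrable m) auto
  also have "\<dots> = (\<Sum>k\<le>L. \<Sum>j=-int k..int k. LINT p|sph_meas. e k j * (sph_Y k j (sph_pt p) * cnj (sph_Y l m (sph_pt p))))"
    by (intro sum.cong refl Bochner_Integration.integral_sum integrable_mult_right sph_Y_integrable m) auto
  also have "\<dots> = (\<Sum>k\<le>L. \<Sum>j=-int k..int k. if k = l then (if j = m then e l m else 0) else 0)"
    by (intro sum.cong refl, subst integral_mult_right_zero, subst sph_Y_orthonormal[OF _ m]) auto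
  also have "\<dots> = (\<Sum>k\<le>L. if k = l then (\<Sum>j=-int l..int l. if j = m then e l m else 0) else 0)"
    by (intro sum.cong refl) auto
  also have "\<dots> = e l m" using L m by (simp add: abs_le_iff)
  finally show ?thesis .
qed

text \<open>An interface that hides the Bessel functions and the differential equation: from here on
  the coefficients are known through their second moments, their symmetry and a summable bound that
  does not depend on time.\<close>

locale laplace_series = prob_space M for M :: "'w measure" +
  fixes a :: "nat \<Rightarrow> int \<Rightarrow> real \<Rightarrow> 'w \<Rightarrow> complex" and C :: "nat \<Rightarrow> real \<Rightarrow> real \<Rightarrow> complex" and A :: "nat \<Rightarrow> real"
  assumes sq: "\<And>l m t. \<bar>m\<bar> \<le> int l \<Longrightarrow> t \<ge> 0 \<Longrightarrow> sq_integrable M (a l m t)"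
    and orth: "\<And>l m l' m' t t'. \<bar>m\<bar> \<le> int l \<Longrightarrow> \<bar>m'\<bar> \<le> int l' \<Longrightarrow> t \<ge> 0 \<Longrightarrow> t' \<ge> 0 \<Longrightarrow>
      (LINT \<omega>|M. a l m t \<omega> * cnj (a l' m' t' \<omega>)) = (if l = l' \<and> m = m' then C l t t' else 0)"
    and mean_zero: "\<And>l m t. \<bar>m\<bar> \<le> int l \<Longrightarrow> t \<ge> 0 \<Longrightarrow> (LINT \<omega>|M. a l m t \<omega>) = 0"
    and conj: "\<And>l m t. \<bar>m\<bar> \<le> int l \<Longrightarrow> t \<ge> 0 \<Longrightarrow> AE \<omega> in M. a l m t \<omega> = (-1) powi m * cnj (a l (- m) t \<omega>)"
    and C_bound: "\<And>l t t'. t \<ge> 0 \<Longrightarrow> t' \<ge> 0 \<Longrightarrow> norm (C l t t') \<le> A l"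
    and A_summable: "summable (\<lambda>l. sph_dim l * A l)"
    and C_cont: "\<And>l s s' t t'. (\<And>n. s n \<ge> 0) \<Longrightarrow> (\<And>n. s' n \<ge> 0) \<Longrightarrow> t \<ge> 0 \<Longrightarrow> t' \<ge> 0 \<Longrightarrow> s \<longlonglongrightarrow> t \<Longrightarrow> s' \<longlonglongrightarrow> t' \<Longrightarrow>
      (\<lambda>n::nat. C l (s n) (s' n)) \<longlonglongrightarrow> C l t t'"
begin

abbreviation S :: "nat \<Rightarrow> real \<Rightarrow> real^3 \<Rightarrow> 'w \<Rightarrow> complex" where
  "S L t v \<equiv> Ysum {..L} (\<lambda>l m. a l m t) v"

lemma S_sq: "t \<ge> 0 \<Longrightarrow> sq_integrable M (Ysum I (\<lambda>l m. a l m t) v)"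
  by (intro Ysum_sq_integrable sq)

lemma S_inner:
  assumes "t \<ge> 0" "t' \<ge> 0" "finite I"
  shows "(LINT \<omega>|M. Ysum I (\<lambda>l m. a l m t) v \<omega> * cnj (Ysum I (\<lambda>l m. a l m t') w \<omega>)) = (\<Sum>l\<in>I. Yker l v w * C l t t')"
  using assms by (intro Ysum_inner sq orth) auto

lemma S_norm_le:
  assumes "t \<ge> 0" "finite I" "norm v = 1"
  shows "(LINT \<omega>|M. (norm (Ysum I (\<lambda>l m. a l m t) v \<omega>))\<^sup>2) \<le> (\<Sum>l\<in>I. sph_dim l * A l)"
proof -
  have n: "(LINT \<omega>|M. (norm (Ysum I (\<lambda>l m. a l m t) v \<omega>))\<^sup>2) \<ge> 0" by (rule Bochner_Integration.integral_nonneg) simp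
  have "complex_of_real (LINT \<omega>|M. (norm (Ysum I (\<lambda>l m. a l m t) v \<omega>))\<^sup>2) = (\<Sum>l\<in>I. Yker l v v * C l t t)"
    unfolding integral_norm_sq using assms by (intro S_inner)
  from arg_cong[OF this, of norm]
  have "(LINT \<omega>|M. (norm (Ysum I (\<lambda>l m. a l m t) v \<omega>))\<^sup>2) = norm (\<Sum>l\<in>I. Yker l v v * C l t t)"
    unfolding norm_of_real using n by linarith
  also have "\<dots> \<le> (\<Sum>l\<in>I. sph_dim l * A l)"
    using assms by (intro sum_norm_le) (auto simp: norm_mult intro!: mult_mono Yker_bound C_bound less_imp_le[OF sph_dim_pos])
  finally show ?thesis .
qed

abbreviation tail :: "nat \<Rightarrow> real" where
  "tail L \<equiv> (\<Sum>l. sph_dim l * A l) - (\<Sum>l\<le>L. sph_dim l * A l)"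

lemma partial_sums: "(\<lambda>L. \<Sum>l\<le>L. sph_dim l * A l) \<longlonglongrightarrow> (\<Sum>l. sph_dim l * A l)"
  using A_summable by (simp add: summable_LIMSEQ')

lemma tail_tendsto: "tail \<longlonglongrightarrow> 0"
  using tendsto_diff[OF tendsto_const[of "\<Sum>l. sph_dim l * A l"] partial_sums] by simp

text \<open>The right side depends on neither the point nor the time, so one subsequence can be fast
  everywhere.\<close>

lemma S_diff_le:
  assumes "t \<ge> 0" "norm v = 1"
  shows "(LINT \<omega>|M. (norm (S m t v \<omega> - S n t v \<omega>))\<^sup>2) \<le> \<bar>(\<Sum>l\<le>m. sph_dim l * A l) - (\<Sum>l\<le>n. sph_dim l * A l)\<bar>"
proof -
  have w: "(LINT \<omega>|M. (norm (S N t v \<omega> - S L t v \<omega>))\<^sup>2) \<le> \<bar>(\<Sum>l\<le>N. sph_dim l * A l) - (\<Sum>l\<le>L. sph_dim l * A l)\<bar>" if "L \<le> N" for L N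
  proof -
    have "{..N} = {..L} \<union> {L<..N}" "{..L} \<inter> {L<..N} = {}" using that by auto
    then have "(\<Sum>l\<le>N. sph_dim l * A l) - (\<Sum>l\<le>L. sph_dim l * A l) = (\<Sum>l\<in>{L<..N}. sph_dim l * A l)"
      by (simp add: sum.union_disjoint)
    moreover have "(LINT \<omega>|M. (norm (Ysum {L<..N} (\<lambda>l m. a l m t) v \<omega>))\<^sup>2) \<le> (\<Sum>l\<in>{L<..N}. sph_dim l * A l)"
      using assms by (intro S_norm_le) auto
    ultimately show ?thesis unfolding Ysum_diff[OF that] by linarith
  qed
  show ?thesis
  proof (cases "n \<le> m")
    case False
    then show ?thesis using w[of m n] by (simp add: norm_minus_commute abs_minus_commute)
  qed (rule w)
qed

text \<open>The substitution m -> -m exchanges each term with the conjugate of its partner; finitely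
  many almost sure relations hold simultaneously.\<close>

lemma S_real:
  assumes "t \<ge> 0"
  shows "AE \<omega> in M. cnj (S L t v \<omega>) = S L t v \<omega>"
proof -
  have "AE \<omega> in M. \<forall>l\<in>{..L}. \<forall>m\<in>{-int l..int l}. a l m t \<omega> = (-1) powi m * cnj (a l (- m) t \<omega>)"
    using assms by (intro AE_finite_allI conj) auto
  then show ?thesis
  proof eventually_elim
    case (elim \<omega>)
    have "(\<Sum>m=-int l..int l. cnj (sph_Y l m v * a l m t \<omega>)) = (\<Sum>m=-int l..int l. sph_Y l m v * a l m t \<omega>)" if "l \<le> L" for l
    proof -
      have "(\<Sum>m=-int l..int l. sph_Y l m v * a l m t \<omega>) = (\<Sum>m=-int l..int l. cnj (sph_Y l (-m) v * a l (-m) t \<omega>))"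
      proof (rule sum.cong[OF refl])
        fix m assume m: "m \<in> {-int l..int l}"
        have am: "a l m t \<omega> = (-1) powi m * cnj (a l (- m) t \<omega>)"
          by (rule elim[rule_format]) (use that m in simp_all)
        have ym: "cnj (sph_Y l (-m) v) = (-1) powi m * sph_Y l m v"
          using cnj_sph_Y[of l "-m" v] by (simp add: power_int_minus_one_minus)
        show "sph_Y l m v * a l m t \<omega> = cnj (sph_Y l (-m) v * a l (-m) t \<omega>)"
          unfolding am complex_cnj_mult ym by (simp only: mult_ac)
      qed
      also have "\<dots> = (\<Sum>m=-int l..int l. cnj (sph_Y l m v * a l m t \<omega>))"
        by (rule sum.reindex_bij_witness[of _ uminus uminus]) auto
      finally show ?thesis by simp
    qed
    then show ?case unfolding Ysum_def cnj_sum by (rule sum.cong[OF refl]) simp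
  qed
qed

text \<open>A mean square sum is determined at each point up to a null set depending on the point,
  which says nothing about joint measurability. Therefore the version is defined as the pointwise
  limit along a subsequence fast for the numerical tails, hence common to all points and times,
  followed by the real part.\<close>

lemma ex_field: "\<exists>T. laplace_series_field M a T"
proof -
  let ?B = "\<lambda>n. \<Sum>l\<le>n. sph_dim l * A l"
  have "\<exists>N. \<forall>m\<ge>N. \<forall>n\<ge>N. \<bar>?B m - ?B n\<bar> \<le> e" if "e > 0" for e
  proof -
    have "Cauchy ?B" using partial_sums by (intro LIMSEQ_imp_Cauchy)
    then obtain N where "\<And>m n. m \<ge> N \<Longrightarrow> n \<ge> N \<Longrightarrow> dist (?B m) (?B n) < e" using \<open>e > 0\<close> by (meson CauchyD Cauchy_def)
    then show ?thesis by (auto simp: dist_real_def intro!: exI[of _ N] less_imp_le)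
  qed
  then obtain r where r: "strict_mono r" "\<And>k n. n \<ge> r k \<Longrightarrow> \<bar>?B n - ?B (r k)\<bar> \<le> (1/4) ^ k"
    using fast_subsequence[of "\<lambda>m n. \<bar>?B m - ?B n\<bar>"] by blast
  define Y where "Y x t \<omega> = lim (\<lambda>k. S (r k) t x \<omega>)" for x t \<omega>
  define T where "T x t \<omega> = Re (Y x t \<omega>)" for x t \<omega>
  have meas: "(\<lambda>(x, \<omega>). T x t \<omega>) \<in> borel_measurable (restrict_space borel (sphere 0 1) \<Otimes>\<^sub>M M)" if t: "t \<ge> 0" for t
  proof -
    have "(\<lambda>p. S L t (fst p) (snd p)) \<in> borel_measurable (restrict_space borel (sphere 0 1) \<Otimes>\<^sub>M M)" for L
      unfolding Ysum_def
    proof (intro borel_measurable_sum borel_measurable_times)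
      fix l m assume "m \<in> {-int l..int l}"
      then have "a l m t \<in> borel_measurable M" using t by (intro sq_integrable_measurable sq) auto
      then show "(\<lambda>p. a l m t (snd p)) \<in> borel_measurable (restrict_space borel (sphere 0 1) \<Otimes>\<^sub>M M)" by measurable
      have "sph_Y l m \<in> borel_measurable (restrict_space borel (sphere 0 1))" by (intro measurable_restrict_space1 sph_Y_measurable)
      then show "(\<lambda>p. sph_Y l m (fst p)) \<in> borel_measurable (restrict_space borel (sphere 0 1) \<Otimes>\<^sub>M M)" by measurable
    qed
    then have "(\<lambda>p. Y (fst p) t (snd p)) \<in> borel_measurable (restrict_space borel (sphere 0 1) \<Otimes>\<^sub>M M)"
      unfolding Y_def by (intro borel_measurable_lim_metric)
    then show ?thesis unfolding T_def case_prod_beta by measurable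
  qed
  have conv: "ms_tendsto M (\<lambda>L. S L t v) (\<lambda>\<omega>. of_real (T v t \<omega>))" if t: "t \<ge> 0" and v: "norm v = 1" for t v
  proof -
    have c: "(LINT \<omega>|M. (norm (S (r (Suc n)) t v \<omega> - S (r n) t v \<omega>))\<^sup>2) \<le> (1/4) ^ n" for n
      using S_diff_le[OF t v, of "r (Suc n)" "r n"] r(2)[of n "r (Suc n)"] strict_monoD[OF r(1), of n "Suc n"] by fastforce
    have Y: "ms_tendsto M (\<lambda>k. S (r k) t v) (Y v t)"
      unfolding Y_def[abs_def] by (rule L2_fast_Cauchy(2)) (intro finite_measure_axioms S_sq t c)+
    \<comment> \<open>The full sequence of partial sums has a mean square limit too, and it agrees
      almost surely with the limit along the subsequence.\<close>
    have "\<exists>X. ms_tendsto M (\<lambda>L. S L t v) X"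
    proof (rule L2_complete[OF finite_measure_axioms S_sq[OF t]])
      fix e :: real assume "e > 0"
      have "Cauchy ?B" using partial_sums by (intro LIMSEQ_imp_Cauchy)
      then obtain N where "\<And>m n. m \<ge> N \<Longrightarrow> n \<ge> N \<Longrightarrow> dist (?B m) (?B n) < e" using \<open>e > 0\<close> by (meson CauchyD Cauchy_def)
      then show "\<exists>N. \<forall>m\<ge>N. \<forall>n\<ge>N. (LINT \<omega>|M. (norm (S m t v \<omega> - S n t v \<omega>))\<^sup>2) \<le> e"
      proof (intro exI[of _ N] allI impI)
        fix m n assume "N \<le> m" "N \<le> n"
        then have "\<bar>?B m - ?B n\<bar> < e" using \<open>\<And>m n. m \<ge> N \<Longrightarrow> n \<ge> N \<Longrightarrow> dist (?B m) (?B n) < e\<close> by (simp add: dist_real_def)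
        with S_diff_le[OF t v, of m n] show "(LINT \<omega>|M. (norm (S m t v \<omega> - S n t v \<omega>))\<^sup>2) \<le> e" by linarith
      qed
    qed
    then obtain X where X: "ms_tendsto M (\<lambda>L. S L t v) X" by blast
    have "ms_tendsto M (\<lambda>k. S (r k) t v) X"
      using X LIMSEQ_subseq_LIMSEQ[OF ms_tendstoD(3)[OF X] r(1)] by (auto simp: ms_tendsto_def o_def)
    from ms_tendsto_unique_AE[OF this Y] have eq: "AE \<omega> in M. X \<omega> = Y v t \<omega>" .
    show ?thesis
    proof (rule ms_tendsto_squeeze[OF S_sq[OF t] _ _ ms_tendstoD(3)[OF X]])
      show T: "sq_integrable M (\<lambda>\<omega>. complex_of_real (T v t \<omega>))"
        unfolding sq_integrable_of_real T_def by (intro sq_integrable_Re ms_tendstoD(2)[OF Y])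
      fix n
      show "(LINT \<omega>|M. (norm (S n t v \<omega> - of_real (T v t \<omega>)))\<^sup>2) \<le> (LINT \<omega>|M. (norm (S n t v \<omega> - X \<omega>))\<^sup>2)"
      proof (rule integral_mono_AE)
        show "integrable M (\<lambda>\<omega>. (norm (S n t v \<omega> - of_real (T v t \<omega>)))\<^sup>2)"
          using sq_integrable_diff[OF S_sq[OF t] T] by (simp add: sq_integrable_def)
        show "integrable M (\<lambda>\<omega>. (norm (S n t v \<omega> - X \<omega>))\<^sup>2)"
          using sq_integrable_diff[OF S_sq[OF t] ms_tendstoD(2)[OF X]] by (simp add: sq_integrable_def)
        \<comment> \<open>The partial sums are almost surely real, so replacing the limit by its
          real part can only reduce the distance.\<close>
        show "AE \<omega> in M. (norm (S n t v \<omega> - of_real (T v t \<omega>)))\<^sup>2 \<le> (norm (S n t v \<omega> - X \<omega>))\<^sup>2"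
          using eq S_real[OF t, of n v]
        proof eventually_elim
          case (elim \<omega>)
          then have "Im (S n t v \<omega>) = 0" by (metis complex_cnj_cancel_iff Reals_cnj_iff complex_is_Real_iff)
          then show ?case using elim by (simp add: cmod_power2 T_def)
        qed
      qed
    qed
  qed
  have "laplace_series_field M a T"
    unfolding laplace_series_field_def
    using meas conv[OF _ norm_sph_point] by (auto simp: laplace_partial_sum_Ysum)
  then show ?thesis by blast
qed

section \<open>Covariance, isotropy and spectrum of an arbitrary version\<close>

context
  fixes T
  assumes T: "laplace_series_field M a T"
begin

lemma field_measurable:
  "t \<ge> 0 \<Longrightarrow> (\<lambda>(x, \<omega>). T x t \<omega>) \<in> borel_measurable (restrict_space borel (sphere 0 1) \<Otimes>\<^sub>M M)"
  using T by (simp add: laplace_series_field_def)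

lemma field_ms:
  assumes "t \<ge> 0" "norm v = 1"
  shows "ms_tendsto M (\<lambda>L. S L t v) (\<lambda>\<omega>. of_real (T v t \<omega>))"
proof -
  obtain \<theta> \<phi> where "\<theta> \<in> {0..pi}" "\<phi> \<in> {0..<2*pi}" "v = sph_point \<theta> \<phi>" using sph_point_surj[OF assms(2)] .
  moreover from this have "ms_tendsto M (laplace_partial_sum (\<lambda>l m. a l m t) \<theta> \<phi>) (\<lambda>\<omega>. of_real (T (sph_point \<theta> \<phi>) t \<omega>))"
    using T assms(1) unfolding laplace_series_field_def by blast
  ultimately show ?thesis by (simp add: laplace_partial_sum_Ysum)
qed

lemma field_sq: "t \<ge> 0 \<Longrightarrow> norm v = 1 \<Longrightarrow> sq_integrable M (T v t)"
  using ms_tendstoD(2)[OF field_ms] by (simp add: sq_integrable_of_real)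

lemma field_inner:
  assumes t: "t \<ge> 0" "t' \<ge> 0" and v: "norm v = 1" "norm w = 1"
  shows "of_real (LINT \<omega>|M. T v t \<omega> * T w t' \<omega>) = (\<Sum>l. Yker l v w * C l t t')"
proof -
  have "(\<lambda>L. LINT \<omega>|M. S L t v \<omega> * cnj (S L t' w \<omega>)) \<longlonglongrightarrow> (LINT \<omega>|M. of_real (T v t \<omega>) * cnj (of_real (T w t' \<omega>)))"
    by (intro ms_tendsto_inner field_ms t v)
  then have "(\<lambda>L. \<Sum>l\<le>L. Yker l v w * C l t t') \<longlonglongrightarrow> of_real (LINT \<omega>|M. T v t \<omega> * T w t' \<omega>)"
    by (simp add: S_inner t flip: of_real_mult)
  moreover have "summable (\<lambda>l. Yker l v w * C l t t')"
    using t v by (intro summable_comparison_test'[OF A_summable])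
      (auto simp: norm_mult intro!: mult_mono Yker_bound C_bound less_imp_le[OF sph_dim_pos])
  ultimately show ?thesis using LIMSEQ_unique summable_LIMSEQ' by blast
qed

text \<open>Tannery's theorem: the terms of the covariance series are continuous in points and times
  and dominated by \<open>sph_dim l * A l\<close> uniformly in them.\<close>

lemma field_inner_tendsto:
  assumes "\<And>n. s n \<ge> 0" "\<And>n. s' n \<ge> 0" "t \<ge> 0" "t' \<ge> 0" "s \<longlonglongrightarrow> t" "s' \<longlonglongrightarrow> t'"
    and "\<And>n. norm (x n) = 1" "\<And>n. norm (y n) = 1" "norm v = 1" "norm w = 1" "x \<longlonglongrightarrow> v" "y \<longlonglongrightarrow> w"
  shows "(\<lambda>n::nat. LINT \<omega>|M. T (x n) (s n) \<omega> * T (y n) (s' n) \<omega>) \<longlonglongrightarrow> (LINT \<omega>|M. T v t \<omega> * T w t' \<omega>)"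
proof -
  have "(\<lambda>n. \<Sum>l. Yker l (x n) (y n) * C l (s n) (s' n)) \<longlonglongrightarrow> (\<Sum>l. Yker l v w * C l t t')"
  proof (rule tannerys_theorem[THEN conjunct2, THEN conjunct2])
    fix l
    have "(\<lambda>n. (x n, y n)) \<longlonglongrightarrow> (v, w)" by (intro tendsto_Pair assms)
    then have "(\<lambda>n. Yker l (fst (x n, y n)) (snd (x n, y n))) \<longlonglongrightarrow> Yker l (fst (v, w)) (snd (v, w))"
      by (intro continuous_on_tendsto_compose[OF continuous_on_Yker[of UNIV l]]) auto
    then show "(\<lambda>n. Yker l (x n) (y n) * C l (s n) (s' n)) \<longlonglongrightarrow> Yker l v w * C l t t'"
      by (intro tendsto_mult C_cont assms) simp
  next
    show "\<forall>\<^sub>F (l, n) in sequentially \<times>\<^sub>F sequentially. norm (Yker l (x n) (y n) * C l (s n) (s' n)) \<le> sph_dim l * A l"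
      using assms by (intro always_eventually)
       (auto simp: norm_mult intro!: mult_mono Yker_bound C_bound less_imp_le[OF sph_dim_pos])
  qed (use A_summable in auto)
  then have "(\<lambda>n. complex_of_real (LINT \<omega>|M. T (x n) (s n) \<omega> * T (y n) (s' n) \<omega>)) \<longlonglongrightarrow> of_real (LINT \<omega>|M. T v t \<omega> * T w t' \<omega>)"
    by (simp only: field_inner assms)
  then show ?thesis by (simp only: tendsto_of_real_iff)
qed

text \<open>The mean is the inner product with the constant 1 and so passes to mean square
  limits.\<close>

lemma field_mean_zero:
  assumes "t \<ge> 0" "norm v = 1"
  shows "(LINT \<omega>|M. T v t \<omega>) = 0"
proof -
  have "(\<lambda>L. LINT \<omega>|M. S L t v \<omega> * cnj 1) \<longlonglongrightarrow> (LINT \<omega>|M. of_real (T v t \<omega>) * cnj 1)"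
    by (intro ms_tendsto_inner field_ms assms ms_tendsto_const sq_integrable_const finite_measure_axioms)
  moreover have "(LINT \<omega>|M. S L t v \<omega>) = 0" for L
  proof -
    have i: "integrable M (a l m t)" if "m \<in> {-int l..int l}" for l m
      using sq_integrable_inner[OF sq[of m l t] sq_integrable_const[OF finite_measure_axioms, of 1]] that assms by auto
    have "(LINT \<omega>|M. S L t v \<omega>) = (\<Sum>l\<le>L. \<Sum>m=-int l..int l. sph_Y l m v * (LINT \<omega>|M. a l m t \<omega>))"
      unfolding Ysum_def
      by (subst Bochner_Integration.integral_sum, intro Bochner_Integration.integrable_sum integrable_mult_right i, assumption,
          intro sum.cong refl, subst Bochner_Integration.integral_sum, intro integrable_mult_right i, assumption) simp
    then show ?thesis using mean_zero assms by (auto intro!: sum.neutral)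
  qed
  ultimately have "(LINT \<omega>|M. complex_of_real (T v t \<omega>)) = 0" by (simp add: LIMSEQ_const_iff)
  then show ?thesis by simp
qed

lemma field_product_integrable:
  assumes "t \<ge> 0" "t' \<ge> 0" "norm v = 1" "norm w = 1"
  shows "integrable M (\<lambda>\<omega>. T v t \<omega> * T w t' \<omega>)"
proof -
  have "integrable M (\<lambda>\<omega>. complex_of_real (T v t \<omega>) * cnj (of_real (T w t' \<omega>)))"
    using field_sq assms by (intro sq_integrable_inner) (auto simp: sq_integrable_of_real)
  then have "complex_integrable M (\<lambda>\<omega>. complex_of_real (T v t \<omega> * T w t' \<omega>))" by simp
  then show ?thesis using integrable_Re by fastforce
qed

text \<open>The mean square of an increment expands into three covariances with a common limit,
  which cancel. Invariance holds term by term in the covariance series, since a rotation preserves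
  inner products.\<close>

lemma isotropic: "isotropic_sphere_field M T"
proof -
  have "((\<lambda>(y, s). LINT \<omega>|M. (T y s \<omega> - T x t \<omega>)\<^sup>2) \<longlongrightarrow> 0) (at (x, t) within sphere 0 1 \<times> {0..})"
    if x: "norm x = 1" and t: "t \<ge> 0" for x t
    unfolding tendsto_at_iff_sequentially
  proof (intro allI impI)
    fix X :: "nat \<Rightarrow> (real^3) \<times> real"
    assume X: "\<forall>i. X i \<in> sphere 0 1 \<times> {0..} - {(x, t)}" "X \<longlonglongrightarrow> (x, t)"
    define y s where "y n = fst (X n)" and "s n = snd (X n)" for n
    have y: "norm (y n) = 1" and s: "s n \<ge> 0" for n using X(1)[rule_format, of n] by (auto simp: y_def s_def)
    have l: "y \<longlonglongrightarrow> x" "s \<longlonglongrightarrow> t" unfolding y_def[abs_def] s_def[abs_def] using tendsto_fst[OF X(2)] tendsto_snd[OF X(2)] by auto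
    have e: "(LINT \<omega>|M. (T (y n) (s n) \<omega> - T x t \<omega>)\<^sup>2) = (LINT \<omega>|M. T (y n) (s n) \<omega> * T (y n) (s n) \<omega>)
       - 2 * (LINT \<omega>|M. T (y n) (s n) \<omega> * T x t \<omega>) + (LINT \<omega>|M. T x t \<omega> * T x t \<omega>)" for n
    proof -
      have "(LINT \<omega>|M. (T (y n) (s n) \<omega> - T x t \<omega>)\<^sup>2) = (LINT \<omega>|M. T (y n) (s n) \<omega> * T (y n) (s n) \<omega>
       - 2 * (T (y n) (s n) \<omega> * T x t \<omega>) + T x t \<omega> * T x t \<omega>)"
        by (intro Bochner_Integration.integral_cong) (auto simp: power2_eq_square algebra_simps)
      then show ?thesis using x t y s by (simp add: field_product_integrable)
    qed
    have "(\<lambda>n. LINT \<omega>|M. (T (y n) (s n) \<omega> - T x t \<omega>)\<^sup>2) \<longlonglongrightarrow> (LINT \<omega>|M. T x t \<omega> * T x t \<omega>)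
       - 2 * (LINT \<omega>|M. T x t \<omega> * T x t \<omega>) + (LINT \<omega>|M. T x t \<omega> * T x t \<omega>)"
      unfolding e by (intro tendsto_intros field_inner_tendsto x y s t l)
    then show "((\<lambda>(y, s). LINT \<omega>|M. (T y s \<omega> - T x t \<omega>)\<^sup>2) \<circ> X) \<longlonglongrightarrow> 0"
      by (simp add: o_def case_prod_beta y_def s_def)
  qed
  moreover have "(LINT \<omega>|M. T x t \<omega> * T y t' \<omega>) = (LINT \<omega>|M. T (g *v x) t \<omega> * T (g *v y) t' \<omega>)"
    if g: "rotation_matrix g" and x: "norm x = 1" "norm y = 1" and t: "t \<ge> 0" "t' \<ge> 0" for g x y t t'
  proof -
    have "(g *v u) \<bullet> (g *v w) = u \<bullet> ((transpose g ** g) *v w)" for u w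
      by (metis dot_lmul_matrix matrix_vector_mul_assoc vector_transpose_matrix)
    then have gi: "(g *v u) \<bullet> (g *v w) = u \<bullet> w" "norm (g *v u) = norm u" for u w
      using g by (auto simp: rotation_matrix_def orthogonal_matrix norm_eq)
    have "Yker l x y = Yker l (g *v x) (g *v y)" for l
      unfolding Yker_def using x by (intro sph_Y_kernel_inner) (auto simp: gi)
    then have "complex_of_real (LINT \<omega>|M. T x t \<omega> * T y t' \<omega>) = of_real (LINT \<omega>|M. T (g *v x) t \<omega> * T (g *v y) t' \<omega>)"
      using x t by (simp only: field_inner gi)
    then show ?thesis by (simp only: of_real_eq_iff)
  qed
  ultimately show ?thesis
    unfolding isotropic_sphere_field_def using field_sq field_mean_zero by simp
qed

text \<open>The estimate is uniform over the sphere, so it survives integration over the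
  sphere.\<close>

lemma field_tail:
  assumes t: "t \<ge> 0" and v: "norm v = 1"
  shows "(LINT \<omega>|M. (norm (of_real (T v t \<omega>) - S L t v \<omega>))\<^sup>2) \<le> tail L"
proof (rule LIMSEQ_le)
  have "ms_tendsto M (\<lambda>N \<omega>. S N t v \<omega> - S L t v \<omega>) (\<lambda>\<omega>. of_real (T v t \<omega>) - S L t v \<omega>)"
    by (intro ms_tendsto_diff field_ms t v ms_tendsto_const S_sq)
  then show "(\<lambda>N. LINT \<omega>|M. (norm (S N t v \<omega> - S L t v \<omega>))\<^sup>2) \<longlonglongrightarrow> (LINT \<omega>|M. (norm (of_real (T v t \<omega>) - S L t v \<omega>))\<^sup>2)"
    by (rule ms_tendsto_norm_sq)
  show "(\<lambda>N. \<Sum>l\<le>N. sph_dim l * A l - (if l \<le> L then sph_dim l * A l else 0)) \<longlonglongrightarrow> tail L"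
  proof -
    have "(\<lambda>N. (\<Sum>l\<le>N. sph_dim l * A l) - (\<Sum>l\<le>L. sph_dim l * A l)) \<longlonglongrightarrow> tail L"
      by (intro tendsto_intros partial_sums)
    moreover have "\<forall>\<^sub>F N in sequentially. (\<Sum>l\<le>N. sph_dim l * A l) - (\<Sum>l\<le>L. sph_dim l * A l) =
       (\<Sum>l\<le>N. sph_dim l * A l - (if l \<le> L then sph_dim l * A l else 0))"
      using eventually_ge_at_top[of L]
    proof eventually_elim
      case (elim N)
      then have "{..N} \<inter> {..L} = {..L}" by auto
      then show ?case by (simp add: sum_subtractf sum.If_cases flip: atMost_def)
    qed
    ultimately show ?thesis by (rule Lim_transform_eventually)
  qed
  show "\<exists>N. \<forall>n\<ge>N. (LINT \<omega>|M. (norm (S n t v \<omega> - S L t v \<omega>))\<^sup>2) \<le> (\<Sum>l\<le>n. sph_dim l * A l - (if l \<le> L then sph_dim l * A l else 0))"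
  proof (intro exI[of _ L] allI impI)
    fix n assume n: "L \<le> n"
    then have "{..n} \<inter> {..L} = {..L}" "{..n} = {..L} \<union> {L<..n}" by auto
    have "(LINT \<omega>|M. (norm (S n t v \<omega> - S L t v \<omega>))\<^sup>2) \<le> (\<Sum>l\<in>{L<..n}. sph_dim l * A l)"
      unfolding Ysum_diff[OF n] using t v by (intro S_norm_le) auto
    also have "\<dots> = (\<Sum>l\<le>n. if l \<in> {L<..n} then sph_dim l * A l else 0)"
      by (subst sum.inter_restrict[symmetric]) (auto intro!: sum.cong)
    also have "\<dots> = (\<Sum>l\<le>n. sph_dim l * A l - (if l \<le> L then sph_dim l * A l else 0))"
      by (intro sum.cong) auto
    finally show "(LINT \<omega>|M. (norm (S n t v \<omega> - S L t v \<omega>))\<^sup>2) \<le> \<dots>" .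
  qed
qed

lemma sph_pt_measurable_sphere: "sph_pt \<in> measurable (lborel \<Otimes>\<^sub>M lborel) (restrict_space borel (sphere 0 1))"
  by (rule measurable_restrict_space2) (auto intro: sph_pt_measurable)

lemma field_sph_pt_measurable:
  assumes "t \<ge> 0"
  shows "(\<lambda>(p, \<omega>). T (sph_pt p) t \<omega>) \<in> borel_measurable ((lborel \<Otimes>\<^sub>M lborel) \<Otimes>\<^sub>M M)"
proof -
  have "(\<lambda>q. (sph_pt (fst q), snd q)) \<in> measurable ((lborel \<Otimes>\<^sub>M lborel) \<Otimes>\<^sub>M M) (restrict_space borel (sphere 0 1) \<Otimes>\<^sub>M M)"
    by (intro measurable_Pair measurable_compose[OF measurable_fst sph_pt_measurable_sphere] measurable_snd)
  from measurable_compose[OF this field_measurable[OF assms]] show ?thesis by (simp add: case_prod_beta)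
qed

lemma laplace_coeff_eq:
  assumes m: "\<bar>m\<bar> \<le> int l"
  shows "laplace_coeff T l m t \<omega> = (LINT \<theta>:{0..pi}|lborel. LINT \<phi>:{0..2*pi}|lborel.
    (of_real (T (sph_pt (\<theta>, \<phi>)) t \<omega>) * cnj (sph_Y l m (sph_pt (\<theta>, \<phi>)))) * of_real (sin \<theta>))"
  unfolding laplace_coeff_def using m
  by (intro set_lebesgue_integral_cong) (auto simp: sph_harm_sph_Y sph_pt_def)

text \<open>Here joint measurability of the version enters: it makes both of the iterated integrals
  measurable in the sample.\<close>

lemma laplace_coeff_measurable:
  assumes t: "t \<ge> 0" and m: "\<bar>m\<bar> \<le> int l"
  shows "laplace_coeff T l m t \<in> borel_measurable M"
proof -
  have 1: "(\<lambda>q. ((snd (fst q), snd q), fst (fst q))) \<in> measurable ((M \<Otimes>\<^sub>M lborel) \<Otimes>\<^sub>M lborel) ((lborel \<Otimes>\<^sub>M lborel) \<Otimes>\<^sub>M M)"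
    by measurable
  from measurable_compose[OF 1 field_sph_pt_measurable[OF t]]
  have [measurable]: "(\<lambda>q. T (sph_pt (snd (fst q), snd q)) t (fst (fst q))) \<in> borel_measurable ((M \<Otimes>\<^sub>M lborel) \<Otimes>\<^sub>M lborel)" by simp
  have [measurable]: "(\<lambda>q. cnj (sph_Y l m (sph_pt (snd (fst q), snd q)))) \<in> borel_measurable ((M \<Otimes>\<^sub>M lborel) \<Otimes>\<^sub>M lborel)"
    by measurable
  have "(\<lambda>\<omega>. LINT \<theta>|lborel. indicator {0..pi} \<theta> *\<^sub>R (LINT \<phi>|lborel. indicator {0..2*pi} \<phi> *\<^sub>R
    ((of_real (T (sph_pt (\<theta>, \<phi>)) t \<omega>) * cnj (sph_Y l m (sph_pt (\<theta>, \<phi>)))) * of_real (sin \<theta>)))) \<in> borel_measurable M"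
    by (intro lborel.borel_measurable_lebesgue_integral) (simp add: case_prod_beta, measurable)
  then show ?thesis unfolding set_lebesgue_integral_def[symmetric] laplace_coeff_eq[OF m, symmetric] .
qed

text \<open>For l \<le> L the partial sum projects exactly onto a l m, so the error is the
  projection of D = T - S L, at most the norm of the path of D on the sphere. By Fubini the mean of
  its square is controlled by \<open>field_tail\<close>. Nonnegative integrals are used because
  finiteness along a single path is part of what has to be shown.\<close>

lemma laplace_coeff_approx:
  assumes t: "t \<ge> 0" and m: "\<bar>m\<bar> \<le> int l" and L: "l \<le> L"
  shows "(\<integral>\<^sup>+\<omega>. ennreal ((norm (laplace_coeff T l m t \<omega> - a l m t \<omega>))\<^sup>2) \<partial>M) \<le>
    ennreal (tail L) * emeasure sph_meas (space sph_meas)"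
proof -
  interpret sp: finite_measure sph_meas by (rule finite_measure_sph_meas)
  interpret P: pair_sigma_finite sph_meas M ..
  define D where "D p \<omega> = of_real (T (sph_pt p) t \<omega>) - S L t (sph_pt p) \<omega>" for p \<omega>
  have sm: "sets (sph_meas \<Otimes>\<^sub>M M) = sets ((lborel \<Otimes>\<^sub>M lborel) \<Otimes>\<^sub>M M)"
    by (intro sets_pair_measure_cong sets_sph_meas refl)
  have am: "a k j t \<in> borel_measurable M" if "\<bar>j\<bar> \<le> int k" for k j
    using that t by (intro sq_integrable_measurable sq)
  have Dm: "(\<lambda>(p, \<omega>). D p \<omega>) \<in> borel_measurable (sph_meas \<Otimes>\<^sub>M M)"
    unfolding measurable_cong_sets[OF sm refl] D_def case_prod_beta
  proof (intro borel_measurable_diff)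
    show "(\<lambda>q. complex_of_real (T (sph_pt (fst q)) t (snd q))) \<in> borel_measurable ((lborel \<Otimes>\<^sub>M lborel) \<Otimes>\<^sub>M M)"
      using measurable_compose[OF field_sph_pt_measurable[OF t], of complex_of_real borel] by (simp add: case_prod_beta)
    show "(\<lambda>q. S L t (sph_pt (fst q)) (snd q)) \<in> borel_measurable ((lborel \<Otimes>\<^sub>M lborel) \<Otimes>\<^sub>M M)"
      unfolding Ysum_def
    proof (intro borel_measurable_sum borel_measurable_times)
      fix k j assume "j \<in> {-int k..int k}"
      then have [measurable]: "a k j t \<in> borel_measurable M" by (intro am) auto
      show "(\<lambda>q. a k j t (snd q)) \<in> borel_measurable ((lborel \<Otimes>\<^sub>M lborel) \<Otimes>\<^sub>M M)"
         "(\<lambda>q. sph_Y k j (sph_pt (fst q))) \<in> borel_measurable ((lborel \<Otimes>\<^sub>M lborel) \<Otimes>\<^sub>M M)" by measurable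
    qed
  qed
  have N: "(\<lambda>(p, \<omega>). ennreal ((norm (D p \<omega>))\<^sup>2)) \<in> borel_measurable (sph_meas \<Otimes>\<^sub>M M)"
    using Dm by (simp add: case_prod_beta)
  have Nn: "(\<integral>\<^sup>+\<omega>. ennreal ((norm (D p \<omega>))\<^sup>2) \<partial>M) \<le> ennreal (tail L)" for p
  proof -
    have "sq_integrable M (D p)" unfolding D_def[abs_def]
      by (intro sq_integrable_diff S_sq t) (simp add: sq_integrable_of_real field_sq t)
    then have "(\<integral>\<^sup>+\<omega>. ennreal ((norm (D p \<omega>))\<^sup>2) \<partial>M) = ennreal (LINT \<omega>|M. (norm (D p \<omega>))\<^sup>2)"
      by (intro nn_integral_eq_integral) (auto simp: sq_integrable_def)
    also have "\<dots> \<le> ennreal (tail L)"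
      unfolding D_def using field_tail[OF t norm_sph_pt] by (intro ennreal_leI)
    finally show ?thesis .
  qed
  define q where "q \<omega> = (\<integral>\<^sup>+p. ennreal ((norm (D p \<omega>))\<^sup>2) \<partial>sph_meas)" for \<omega>
  have qi: "(\<integral>\<^sup>+\<omega>. q \<omega> \<partial>M) \<le> ennreal (tail L) * emeasure sph_meas (space sph_meas)"
  proof -
    have "(\<integral>\<^sup>+\<omega>. q \<omega> \<partial>M) = (\<integral>\<^sup>+p. \<integral>\<^sup>+\<omega>. ennreal ((norm (D p \<omega>))\<^sup>2) \<partial>M \<partial>sph_meas)"
      unfolding q_def using P.Fubini'[OF N] by simp
    also have "\<dots> \<le> (\<integral>\<^sup>+p. ennreal (tail L) \<partial>sph_meas)" by (intro nn_integral_mono Nn)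
    finally show ?thesis by simp
  qed
  have qm: "q \<in> borel_measurable M" unfolding q_def using P.borel_measurable_nn_integral_fst N
    by (intro sp.borel_measurable_nn_integral measurable_pair_swap[OF N, simplified case_prod_beta]) auto
  \<comment> \<open>From the finite mean, almost every path of D is square integrable over the
    sphere, which is what the pathwise argument below starts from.\<close>
  have fin: "AE \<omega> in M. q \<omega> \<noteq> \<infinity>"
  proof (rule nn_integral_noteq_infinite[OF qm])
    have "ennreal (tail L) * emeasure sph_meas (space sph_meas) < \<infinity>"
      by (simp add: ennreal_mult_less_top sp.emeasure_eq_measure)
    with qi show "(\<integral>\<^sup>+\<omega>. q \<omega> \<partial>M) \<noteq> \<infinity>" by auto
  qed
  have le: "ennreal ((norm (laplace_coeff T l m t \<omega> - a l m t \<omega>))\<^sup>2) \<le> q \<omega>" if \<omega>: "\<omega> \<in> space M" "q \<omega> \<noteq> \<infinity>" for \<omega>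
  proof -
    have Dw: "sq_integrable sph_meas (\<lambda>p. D p \<omega>)"
    proof -
      have "(\<lambda>p. D p \<omega>) \<in> borel_measurable sph_meas"
        using measurable_compose[OF measurable_Pair2'[OF \<omega>(1)] Dm] by simp
      moreover from this have "integrable sph_meas (\<lambda>p. (norm (D p \<omega>))\<^sup>2)"
        using \<omega>(2) by (intro integrableI_bounded) (auto simp: q_def less_top)
      ultimately show ?thesis by (simp add: sq_integrable_def)
    qed
    have Y: "sq_integrable sph_meas (\<lambda>p. sph_Y k j (sph_pt p))" if "\<bar>j\<bar> \<le> int k" for k j
    proof -
      have "integrable sph_meas (\<lambda>p. complex_of_real ((norm (sph_Y k j (sph_pt p)))\<^sup>2))"
        using sph_Y_integrable[OF that that] by (simp only: complex_norm_square)
      then have "integrable sph_meas (\<lambda>p. (norm (sph_Y k j (sph_pt p)))\<^sup>2)" using integrable_Re by fastforce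
      moreover have "(\<lambda>p. sph_Y k j (sph_pt p)) \<in> borel_measurable sph_meas" by measurable
      ultimately show ?thesis by (simp add: sq_integrable_def)
    qed
    have Sw: "sq_integrable sph_meas (\<lambda>p. S L t (sph_pt p) \<omega>)"
    proof -
      have "sq_integrable sph_meas (\<lambda>p. \<Sum>k\<le>L. \<Sum>j=-int k..int k. a k j t \<omega> * sph_Y k j (sph_pt p))"
        by (intro sq_integrable_sum sq_integrable_mult_left Y) auto
      then show ?thesis by (simp add: Ysum_def mult.commute)
    qed
    have Tw: "of_real (T (sph_pt p) t \<omega>) = D p \<omega> + S L t (sph_pt p) \<omega>" for p by (simp add: D_def)
    have "integrable sph_meas (\<lambda>p. of_real (T (sph_pt p) t \<omega>) * cnj (sph_Y l m (sph_pt p)))"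
      unfolding Tw by (intro sq_integrable_inner sq_integrable_add Dw Sw Y m)
    from sph_meas_iterated[OF this]
    have "laplace_coeff T l m t \<omega> = (LINT p|sph_meas. of_real (T (sph_pt p) t \<omega>) * cnj (sph_Y l m (sph_pt p)))"
      by (simp only: laplace_coeff_eq[OF m])
    also have "\<dots> = (LINT p|sph_meas. D p \<omega> * cnj (sph_Y l m (sph_pt p))) + (LINT p|sph_meas. S L t (sph_pt p) \<omega> * cnj (sph_Y l m (sph_pt p)))"
      unfolding Tw distrib_right by (intro Bochner_Integration.integral_add sq_integrable_inner Dw Sw Y m)
    also have "(LINT p|sph_meas. S L t (sph_pt p) \<omega> * cnj (sph_Y l m (sph_pt p))) = a l m t \<omega>"
      unfolding Ysum_def by (rule sph_Y_project[OF m L])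
    finally have "laplace_coeff T l m t \<omega> - a l m t \<omega> = (LINT p|sph_meas. D p \<omega> * cnj (sph_Y l m (sph_pt p)))" by simp
    then have "(norm (laplace_coeff T l m t \<omega> - a l m t \<omega>))\<^sup>2 \<le> (LINT p|sph_meas. (norm (D p \<omega>))\<^sup>2) * (LINT p|sph_meas. (norm (sph_Y l m (sph_pt p)))\<^sup>2)"
      using L2_Cauchy_Schwarz[OF Dw Y[OF m]] by simp
    also have "(LINT p|sph_meas. (norm (sph_Y l m (sph_pt p)))\<^sup>2) = 1"
    proof -
      have "complex_of_real (LINT p|sph_meas. (norm (sph_Y l m (sph_pt p)))\<^sup>2) = 1"
        unfolding integral_norm_sq using sph_Y_orthonormal[OF m m] by simp
      then show ?thesis by (simp only: of_real_eq_1_iff)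
    qed
    finally have "ennreal ((norm (laplace_coeff T l m t \<omega> - a l m t \<omega>))\<^sup>2) \<le> ennreal (LINT p|sph_meas. (norm (D p \<omega>))\<^sup>2)"
      by (intro ennreal_leI) simp
    also have "\<dots> = q \<omega>" unfolding q_def
      using Dw by (intro nn_integral_eq_integral[symmetric]) (auto simp: sq_integrable_def)
    finally show ?thesis .
  qed
  have "AE \<omega> in M. ennreal ((norm (laplace_coeff T l m t \<omega> - a l m t \<omega>))\<^sup>2) \<le> q \<omega>"
    using fin AE_space by eventually_elim (rule le)
  then have "(\<integral>\<^sup>+\<omega>. ennreal ((norm (laplace_coeff T l m t \<omega> - a l m t \<omega>))\<^sup>2) \<partial>M) \<le> (\<integral>\<^sup>+\<omega>. q \<omega> \<partial>M)"
    by (rule nn_integral_mono_AE)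
  with qi show ?thesis by (rule order_trans[rotated])
qed

text \<open>The left side of \<open>laplace_coeff_approx\<close> does not contain L, while the tail
  on the right tends to 0.\<close>

lemma laplace_coeff_AE:
  assumes t: "t \<ge> 0" and m: "\<bar>m\<bar> \<le> int l"
  shows "AE \<omega> in M. laplace_coeff T l m t \<omega> = a l m t \<omega>"
proof -
  interpret sp: finite_measure sph_meas by (rule finite_measure_sph_meas)
  define I where "I = (\<integral>\<^sup>+\<omega>. ennreal ((norm (laplace_coeff T l m t \<omega> - a l m t \<omega>))\<^sup>2) \<partial>M)"
  have am: "(\<lambda>\<omega>. ennreal ((norm (laplace_coeff T l m t \<omega> - a l m t \<omega>))\<^sup>2)) \<in> borel_measurable M"
    using laplace_coeff_measurable[OF t m] sq_integrable_measurable[OF sq[OF m t]] by measurable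
  have "(\<lambda>L. ennreal (tail L * measure sph_meas (space sph_meas))) \<longlonglongrightarrow> ennreal (0 * measure sph_meas (space sph_meas))"
    by (intro tendsto_ennrealI tendsto_mult tail_tendsto tendsto_const)
  moreover have "\<exists>N. \<forall>L\<ge>N. I \<le> ennreal (tail L * measure sph_meas (space sph_meas))"
  proof (intro exI[of _ l] allI impI)
    fix L assume "l \<le> L"
    from laplace_coeff_approx[OF t m this]
    have "I \<le> ennreal (tail L) * emeasure sph_meas (space sph_meas)" by (simp add: I_def)
    moreover have "ennreal (tail L) * emeasure sph_meas (space sph_meas) = ennreal (tail L * measure sph_meas (space sph_meas))"
      by (simp add: sp.emeasure_eq_measure ennreal_mult'')
    ultimately show "I \<le> ennreal (tail L * measure sph_meas (space sph_meas))" by simp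
  qed
  ultimately have "I \<le> ennreal (0 * measure sph_meas (space sph_meas))" by (rule LIMSEQ_le_const)
  then have "I = 0" by simp
  then have "AE \<omega> in M. ennreal ((norm (laplace_coeff T l m t \<omega> - a l m t \<omega>))\<^sup>2) = 0"
    unfolding I_def using am by (simp add: nn_integral_0_iff_AE)
  then show ?thesis by eventually_elim (simp add: ennreal_eq_0_iff)
qed

lemma angular: "angular_power_spectrum M T C"
  unfolding angular_power_spectrum_def
proof (intro conjI allI impI)
  fix l m t assume m: "\<bar>m\<bar> \<le> int l" and t: "(t::real) \<ge> 0"
  show "sq_integrable M (laplace_coeff T l m t)"
  proof (rule sq_integrable_bounded_by)
    show "laplace_coeff T l m t \<in> borel_measurable M" by (rule laplace_coeff_measurable[OF t m])
    show "integrable M (\<lambda>\<omega>. (norm (a l m t \<omega>))\<^sup>2)" using sq[OF m t] by (simp add: sq_integrable_def)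
    show "AE \<omega> in M. (norm (laplace_coeff T l m t \<omega>))\<^sup>2 \<le> (norm (a l m t \<omega>))\<^sup>2"
      using laplace_coeff_AE[OF t m] by eventually_elim simp
  qed
next
  fix l m l' m' and t t' :: real
  assume m: "\<bar>m\<bar> \<le> int l" "\<bar>m'\<bar> \<le> int l'" and t: "t \<ge> 0" "t' \<ge> 0"
  have [measurable]: "laplace_coeff T l m t \<in> borel_measurable M" "laplace_coeff T l' m' t' \<in> borel_measurable M"
    "a l m t \<in> borel_measurable M" "a l' m' t' \<in> borel_measurable M"
    using m t by (auto intro: laplace_coeff_measurable sq_integrable_measurable[OF sq])
  have "(LINT \<omega>|M. laplace_coeff T l m t \<omega> * cnj (laplace_coeff T l' m' t' \<omega>)) = (LINT \<omega>|M. a l m t \<omega> * cnj (a l' m' t' \<omega>))"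
  proof (rule integral_cong_AE)
    show "AE \<omega> in M. laplace_coeff T l m t \<omega> * cnj (laplace_coeff T l' m' t' \<omega>) = a l m t \<omega> * cnj (a l' m' t' \<omega>)"
      using laplace_coeff_AE[OF t(1) m(1)] laplace_coeff_AE[OF t(2) m(2)] by eventually_elim simp
  qed measurable
  then show "(LINT \<omega>|M. laplace_coeff T l m t \<omega> * cnj (laplace_coeff T l' m' t' \<omega>)) = (if l = l' \<and> m = m' then C l t t' else 0)"
    using orth[OF m t] by simp
qed

end

end

section \<open>The spectral representation\<close>

text \<open>Bounded pointwise convergence permits integrating the series against a conjugated
  harmonic; for L \<ge> l that integral is the coefficient itself.\<close>

lemma laplace_coefficients_unique:
  assumes lim: "\<And>v. norm v = 1 \<Longrightarrow> (\<lambda>L. \<Sum>k\<le>L. \<Sum>j=-int k..int k. sph_Y k j v * e k j) \<longlonglongrightarrow> 0"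
    and B: "\<And>v L. norm v = 1 \<Longrightarrow> norm (\<Sum>k\<le>L. \<Sum>j=-int k..int k. sph_Y k j v * e k j) \<le> B"
    and m: "\<bar>m\<bar> \<le> int l"
  shows "e l m = 0"
proof -
  interpret sp: finite_measure sph_meas by (rule finite_measure_sph_meas)
  define f where "f L p = (\<Sum>k\<le>L. \<Sum>j=-int k..int k. sph_Y k j (sph_pt p) * e k j) * cnj (sph_Y l m (sph_pt p))" for L p
  have Yb: "norm (sph_Y l m (sph_pt p)) \<le> sqrt (sph_dim l)" for p
    using sph_Y_bound[OF norm_sph_pt m, of p] by (simp add: sph_dim_def real_le_rsqrt)
  have "(\<lambda>L. LINT p|sph_meas. f L p) \<longlonglongrightarrow> (LINT p|sph_meas. 0)"
  proof (rule integral_dominated_convergence[where w="\<lambda>_. B * sqrt (sph_dim l)"])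
    show "f L \<in> borel_measurable sph_meas" for L unfolding f_def[abs_def] by measurable
    show "AE p in sph_meas. (\<lambda>L. f L p) \<longlonglongrightarrow> 0"
      unfolding f_def by (intro AE_I2 tendsto_mult_left_zero lim norm_sph_pt)
    show "AE p in sph_meas. norm (f L p) \<le> B * sqrt (sph_dim l)" for L
    proof (intro AE_I2)
      fix p
      have "norm (\<Sum>k\<le>L. \<Sum>j=-int k..int k. sph_Y k j (sph_pt p) * e k j) * norm (sph_Y l m (sph_pt p)) \<le> B * sqrt (sph_dim l)"
        by (intro mult_mono B Yb norm_sph_pt norm_ge_zero order_trans[OF norm_ge_zero B[OF norm_sph_pt, of p 0]])
      then show "norm (f L p) \<le> B * sqrt (sph_dim l)" by (simp only: f_def norm_mult complex_mod_cnj)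
    qed
  qed auto
  moreover have "(\<lambda>L. LINT p|sph_meas. f L p) \<longlonglongrightarrow> e l m"
  proof (rule tendsto_eventually)
    show "\<forall>\<^sub>F L in sequentially. (LINT p|sph_meas. f L p) = e l m"
      using eventually_ge_at_top[of l] by eventually_elim (simp only: f_def sph_Y_project[OF m])
  qed
  ultimately have "e l m = (LINT p|sph_meas. 0)" by (intro LIMSEQ_unique)
  then show ?thesis by simp
qed

text \<open>Pairing with a fixed X turns the random series into a numerical one, to which uniqueness
  of Laplace coefficients applies. With X = 1 this yields means; with X equal to a coefficient it
  shows that this coefficient vanishes almost surely.\<close>

lemma laplace_coefficients_orthogonal:
  assumes d: "\<And>l m. \<bar>m\<bar> \<le> int l \<Longrightarrow> sq_integrable M (d l m)"
    and W: "\<And>v. norm v = 1 \<Longrightarrow> ms_tendsto M (\<lambda>L. Ysum {..L} d v) (W v)"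
    and B: "\<And>v L. norm v = 1 \<Longrightarrow> (LINT \<omega>|M. (norm (Ysum {..L} d v \<omega>))\<^sup>2) \<le> B"
    and X: "sq_integrable M X" "\<And>v. norm v = 1 \<Longrightarrow> (LINT \<omega>|M. W v \<omega> * cnj (X \<omega>)) = 0"
    and m: "\<bar>m\<bar> \<le> int l"
  shows "(LINT \<omega>|M. d l m \<omega> * cnj (X \<omega>)) = 0"
proof -
  define e where "e l m = (LINT \<omega>|M. d l m \<omega> * cnj (X \<omega>))" for l m
  have i: "integrable M (\<lambda>\<omega>. d k j \<omega> * cnj (X \<omega>))" if "j \<in> {-int k..int k}" for k j
    using that by (intro sq_integrable_inner d X) auto
  have E: "(LINT \<omega>|M. Ysum {..L} d v \<omega> * cnj (X \<omega>)) = (\<Sum>k\<le>L. \<Sum>j=-int k..int k. sph_Y k j v * e k j)" for L v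
  proof -
    have "(LINT \<omega>|M. Ysum {..L} d v \<omega> * cnj (X \<omega>)) = (LINT \<omega>|M. (\<Sum>k\<le>L. \<Sum>j=-int k..int k. sph_Y k j v * (d k j \<omega> * cnj (X \<omega>))))"
      unfolding Ysum_def sum_distrib_right by (simp add: mult_ac)
    also have "\<dots> = (\<Sum>k\<le>L. LINT \<omega>|M. (\<Sum>j=-int k..int k. sph_Y k j v * (d k j \<omega> * cnj (X \<omega>))))"
      by (intro Bochner_Integration.integral_sum Bochner_Integration.integrable_sum integrable_mult_right i)
    also have "\<dots> = (\<Sum>k\<le>L. \<Sum>j=-int k..int k. LINT \<omega>|M. sph_Y k j v * (d k j \<omega> * cnj (X \<omega>)))"
      by (intro sum.cong refl Bochner_Integration.integral_sum integrable_mult_right i)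
    finally show ?thesis by (simp add: e_def)
  qed
  have "e l m = 0"
  proof (rule laplace_coefficients_unique[OF _ _ m])
    fix v :: "real^3" assume v: "norm v = 1"
    show "(\<lambda>L. \<Sum>k\<le>L. \<Sum>j=-int k..int k. sph_Y k j v * e k j) \<longlonglongrightarrow> 0"
      using ms_tendsto_inner[OF W[OF v] ms_tendsto_const[OF X(1)]] unfolding E X(2)[OF v] .
    fix L
    have "(norm (LINT \<omega>|M. Ysum {..L} d v \<omega> * cnj (X \<omega>)))\<^sup>2 \<le> (LINT \<omega>|M. (norm (Ysum {..L} d v \<omega>))\<^sup>2) * (LINT \<omega>|M. (norm (X \<omega>))\<^sup>2)"
      by (intro L2_Cauchy_Schwarz Ysum_sq_integrable d X)
    also have "\<dots> \<le> B * (LINT \<omega>|M. (norm (X \<omega>))\<^sup>2)"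
      by (intro mult_right_mono B v Bochner_Integration.integral_nonneg) auto
    finally show "norm (\<Sum>k\<le>L. \<Sum>j=-int k..int k. sph_Y k j v * e k j) \<le> sqrt (B * (LINT \<omega>|M. (norm (X \<omega>))\<^sup>2))"
      unfolding E by (rule real_le_rsqrt)
  qed
  then show ?thesis by (simp add: e_def)
qed

lemma Ysum_cnj:
  "Ysum I (\<lambda>l m \<omega>. (-1) powi m * cnj (a l (- m) \<omega>)) v \<omega> = cnj (Ysum I a v \<omega>)"
proof -
  have "(\<Sum>m=-int l..int l. sph_Y l m v * ((-1) powi m * cnj (a l (- m) \<omega>))) = (\<Sum>m=-int l..int l. cnj (sph_Y l m v * a l m \<omega>))" for l
  proof (rule sum.reindex_bij_witness[of _ uminus uminus])
    fix m
    have ym: "cnj (sph_Y l (-m) v) = (-1) powi m * sph_Y l m v"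
      using cnj_sph_Y[of l "-m" v] by (simp add: power_int_minus_one_minus)
    show "cnj (sph_Y l (-m) v * a l (-m) \<omega>) = sph_Y l m v * ((-1) powi m * cnj (a l (- m) \<omega>))"
      unfolding complex_cnj_mult ym by (simp only: mult_ac)
  qed auto
  then show ?thesis by (simp only: Ysum_def cnj_sum)
qed

locale spectral_field = prob_space M for M :: "'w measure" +
  fixes \<eta> :: "real^3 \<Rightarrow> 'w \<Rightarrow> real" and G :: "real measure"
    and Z :: "nat \<Rightarrow> int \<Rightarrow> real set \<Rightarrow> 'w \<Rightarrow> complex"
  assumes G: "finite_measure G" "sets G = sets (restrict_space borel {0..})"
    and Z: "orthogonal_random_measures M G Z"
    and \<eta>_mean: "\<And>x. (LINT \<omega>|M. \<eta> x \<omega>) = 0"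
    and \<eta>_series: "\<And>r \<theta> \<phi>. r \<ge> 0 \<Longrightarrow> \<theta> \<in> {0..pi} \<Longrightarrow> \<phi> \<in> {0..<2 * pi} \<Longrightarrow>
           ms_tendsto M (laplace_partial_sum (spectral_coeff M G Z (\<lambda>_. 1) r) \<theta> \<phi>)
             (\<lambda>\<omega>. of_real (\<eta> (r *\<^sub>R sph_point \<theta> \<phi>) \<omega>))"
begin

interpretation G: finite_measure G by (rule G)

lemma space_G: "space G = {0..}"
  using sets_eq_imp_space_eq[OF G(2)] by simp

lemma cov:
  assumes "\<bar>m\<bar> \<le> int l" "\<bar>m'\<bar> \<le> int l'"
  shows "random_measures_cov M G (if l = l' \<and> m = m' then 1 else 0) (Z l m) (Z l' m')"
  using Z assms G(1) finite_measure_axioms unfolding orthogonal_random_measures_def random_measures_cov_def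
  by (auto split: if_splits)

lemma cov1: "\<bar>m\<bar> \<le> int l \<Longrightarrow> random_measures_cov M G 1 (Z l m) (Z l m)"
  using cov[of m l m l] by simp

definition I :: "nat \<Rightarrow> int \<Rightarrow> (real \<Rightarrow> real) \<Rightarrow> 'w \<Rightarrow> complex" where
  "I l m f = stoch_integral M G (Z l m) (\<lambda>\<mu>. of_real (f \<mu>))"

abbreviation L2G :: "(real \<Rightarrow> real) \<Rightarrow> bool" where
  "L2G f \<equiv> sq_integrable G (\<lambda>\<mu>. complex_of_real (f \<mu>))"

lemma measurable_G:
  assumes "continuous_on {0..} f"
  shows "f \<in> borel_measurable G"
  unfolding measurable_cong_sets[OF G(2) refl] by (rule borel_measurable_continuous_on_restrict[OF assms])

lemma sq_integrable_G_bounded: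
  fixes f :: "real \<Rightarrow> complex"
  assumes "f \<in> borel_measurable G" "\<And>x. x \<ge> 0 \<Longrightarrow> norm (f x) \<le> K"
  shows "sq_integrable G f"
  by (rule sq_integrable_bounded_by[where Y="\<lambda>_. K\<^sup>2"])
    (use assms in \<open>auto simp: space_G intro!: AE_I2 power_mono\<close>)

lemma L2G_continuous:
  assumes "continuous_on {0..} f" "\<And>x. x \<ge> 0 \<Longrightarrow> \<bar>f x\<bar> \<le> K"
  shows "L2G f"
  by (rule sq_integrable_G_bounded[where K=K]) (use measurable_G[OF assms(1)] assms(2) in auto)

lemma ms_tendsto_G:
  assumes f: "\<And>n::nat. L2G (f n)" "\<And>n x. x \<ge> 0 \<Longrightarrow> \<bar>f n x\<bar> \<le> K" "\<And>x. x \<ge> 0 \<Longrightarrow> (\<lambda>n. f n x) \<longlonglongrightarrow> g x"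
  shows "ms_tendsto G (\<lambda>n \<mu>. complex_of_real (f n \<mu>)) (\<lambda>\<mu>. of_real (g \<mu>))"
proof -
  have fm: "f n \<in> borel_measurable G" for n
    using sq_integrable_measurable[OF f(1)[of n]] by (simp add: borel_measurable_complex_iff)
  have gm: "g \<in> borel_measurable G"
    by (rule borel_measurable_LIMSEQ_real[of G f]) (use fm f(3) space_G in auto)
  have gK: "\<bar>g x\<bar> \<le> K" if "x \<ge> 0" for x
    by (rule Lim_bounded[OF tendsto_rabs[OF f(3)[OF that]], of 0]) (use f(2) that in auto)
  have "(\<lambda>n. LINT \<mu>|G. (norm (complex_of_real (f n \<mu>) - of_real (g \<mu>)))\<^sup>2) \<longlonglongrightarrow> (LINT \<mu>|G. 0)"
  proof (rule integral_dominated_convergence[where w="\<lambda>_. (2 * K)\<^sup>2"])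
    show "AE \<mu> in G. (\<lambda>n. (norm (complex_of_real (f n \<mu>) - of_real (g \<mu>)))\<^sup>2) \<longlonglongrightarrow> 0"
    proof (rule AE_I2)
      fix \<mu> assume "\<mu> \<in> space G"
      then have "(\<lambda>n. (norm (complex_of_real (f n \<mu>) - of_real (g \<mu>)))\<^sup>2) \<longlonglongrightarrow> (norm (complex_of_real (g \<mu>) - of_real (g \<mu>)))\<^sup>2"
        by (intro tendsto_intros f(3)) (simp add: space_G)
      then show "(\<lambda>n. (norm (complex_of_real (f n \<mu>) - of_real (g \<mu>)))\<^sup>2) \<longlonglongrightarrow> 0" by simp
    qed
    show "AE \<mu> in G. norm ((norm (complex_of_real (f n \<mu>) - of_real (g \<mu>)))\<^sup>2) \<le> (2 * K)\<^sup>2" for n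
    proof (rule AE_I2)
      fix \<mu> assume "\<mu> \<in> space G"
      then have "\<bar>f n \<mu> - g \<mu>\<bar> \<le> 2 * K" using f(2)[of \<mu> n] gK[of \<mu>] by (simp add: space_G)
      then have "\<bar>f n \<mu> - g \<mu>\<bar>\<^sup>2 \<le> (2 * K)\<^sup>2" by (intro power_mono) auto
      then show "norm ((norm (complex_of_real (f n \<mu>) - of_real (g \<mu>)))\<^sup>2) \<le> (2 * K)\<^sup>2"
        by (simp flip: of_real_diff)
    qed
  qed (use fm gm in \<open>auto\<close>)
  moreover have "L2G g" by (rule sq_integrable_G_bounded[where K=K]) (use gm gK in auto)
  ultimately show ?thesis using f(1) by (simp add: ms_tendsto_def)
qed

lemma I_sq: "\<bar>m\<bar> \<le> int l \<Longrightarrow> L2G f \<Longrightarrow> sq_integrable M (I l m f)"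
  unfolding I_def by (rule stoch_integral_sq_integrable[OF cov1])

lemma I_lin:
  assumes "\<bar>m\<bar> \<le> int l" "L2G f" "L2G g"
  shows "AE \<omega> in M. I l m (\<lambda>x. a * f x + b * g x) \<omega> = of_real a * I l m f \<omega> + of_real b * I l m g \<omega>"
  using stoch_integral_lincomb_AE[OF cov1 assms(2,3), OF assms(1), of "of_real a" "of_real b"] by (simp add: I_def)

lemma L2G_lin: "L2G f \<Longrightarrow> L2G g \<Longrightarrow> L2G (\<lambda>x. a * f x + b * g x)"
  unfolding of_real_add of_real_mult by (intro sq_integrable_add sq_integrable_mult_left)

lemma I_lim:
  assumes "\<bar>m\<bar> \<le> int l" "\<And>n::nat. L2G (f n)" "\<And>n x. x \<ge> 0 \<Longrightarrow> \<bar>f n x\<bar> \<le> K" "\<And>x. x \<ge> 0 \<Longrightarrow> (\<lambda>n. f n x) \<longlonglongrightarrow> g x"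
  shows "ms_tendsto M (\<lambda>n. I l m (f n)) (I l m g)" "L2G g"
  unfolding I_def using stoch_integral_ms_tendsto[OF cov1[OF assms(1)] ms_tendsto_G[OF assms(2-4)]]
    ms_tendstoD(2)[OF ms_tendsto_G[OF assms(2-4)]] by auto

section \<open>Coefficients for a bounded continuous multiplier\<close>

context
  fixes g :: "real \<Rightarrow> complex" and k :: "real \<Rightarrow> real" and K r :: real
  assumes g: "\<And>\<mu>. \<mu> \<ge> 0 \<Longrightarrow> g \<mu> = of_real (k \<mu>)" and k: "continuous_on {0..} k" "\<And>\<mu>. \<mu> \<ge> 0 \<Longrightarrow> \<bar>k \<mu>\<bar> \<le> K"
    and r: "r \<ge> 0"
begin

lemma density_eq: "\<mu> \<ge> 0 \<Longrightarrow> of_real (bessel_quot l (\<mu> * r)) * g \<mu> = of_real (bq l (\<mu> * r) * k \<mu>)"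
  using g r by (simp add: bessel_quot_eq)

lemma density_L2G: "L2G (\<lambda>\<mu>. bq l (\<mu> * r) * k \<mu>)"
proof -
  obtain C where C: "\<And>z. z \<ge> 0 \<Longrightarrow> \<bar>bq l z\<bar> \<le> C" using bq_bounded by blast
  show ?thesis
  proof (rule L2G_continuous)
    show "continuous_on {0..} (\<lambda>\<mu>. bq l (\<mu> * r) * k \<mu>)"
      by (intro continuous_intros k continuous_on_compose2[OF continuous_on_bq[of UNIV]]) auto
    show "\<bar>bq l (\<mu> * r) * k \<mu>\<bar> \<le> C * K" if "\<mu> \<ge> 0" for \<mu>
      unfolding abs_mult using that r C[of 0] by (intro mult_mono C k) auto
  qed
qed

lemma density_sq: "sq_integrable G (\<lambda>\<mu>. of_real (bessel_quot l (\<mu> * r)) * g \<mu>)"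
proof -
  have "sq_integrable G (\<lambda>\<mu>. of_real (bessel_quot l (\<mu> * r)) * g \<mu>) \<longleftrightarrow> L2G (\<lambda>\<mu>. bq l (\<mu> * r) * k \<mu>)"
    unfolding sq_integrable_def
    by (intro conj_cong measurable_cong Bochner_Integration.integrable_cong refl) (auto simp: density_eq space_G)
  with density_L2G show ?thesis by simp
qed

lemma coeff_sq:
  assumes "\<bar>m\<bar> \<le> int l"
  shows "sq_integrable M (spectral_coeff M G Z g r l m)"
  unfolding spectral_coeff_def[abs_def]
  by (intro sq_integrable_mult_left stoch_integral_sq_integrable[OF cov1] assms density_sq)

lemma coeff_I:
  assumes "\<bar>m\<bar> \<le> int l"
  shows "AE \<omega> in M. spectral_coeff M G Z g r l m \<omega> = of_real (pi * sqrt 2) * I l m (\<lambda>\<mu>. bq l (\<mu> * r) * k \<mu>) \<omega>"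
proof -
  have "AE \<omega> in M. stoch_integral M G (Z l m) (\<lambda>\<mu>. of_real (bessel_quot l (\<mu> * r)) * g \<mu>) \<omega> = I l m (\<lambda>\<mu>. bq l (\<mu> * r) * k \<mu>) \<omega>"
    unfolding I_def
    by (rule stoch_integral_cong_AE[OF cov1[OF assms] density_sq density_L2G]) (auto simp: density_eq space_G)
  then show ?thesis by eventually_elim (simp add: spectral_coeff_def)
qed

end

lemma coeff_inner:
  assumes g: "\<And>\<mu>. \<mu> \<ge> 0 \<Longrightarrow> g \<mu> = of_real (k \<mu>)" "continuous_on {0..} k" "\<And>\<mu>. \<mu> \<ge> 0 \<Longrightarrow> \<bar>k \<mu>\<bar> \<le> K"
    and g': "\<And>\<mu>. \<mu> \<ge> 0 \<Longrightarrow> g' \<mu> = of_real (k' \<mu>)" "continuous_on {0..} k'" "\<And>\<mu>. \<mu> \<ge> 0 \<Longrightarrow> \<bar>k' \<mu>\<bar> \<le> K'"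
    and r: "r \<ge> 0" and m: "\<bar>m\<bar> \<le> int l" "\<bar>m'\<bar> \<le> int l'"
  shows "(LINT \<omega>|M. spectral_coeff M G Z g r l m \<omega> * cnj (spectral_coeff M G Z g' r l' m' \<omega>)) =
    (if l = l' \<and> m = m' then of_real (2 * pi\<^sup>2) * (LINT \<mu>|G. of_real ((bessel_quot l (\<mu> * r))\<^sup>2) * g \<mu> * g' \<mu>) else 0)"
proof -
  let ?d = "\<lambda>l g \<mu>. of_real (bessel_quot l (\<mu> * r)) * g \<mu> :: complex"
  have pp: "complex_of_real (pi * sqrt 2) * of_real (pi * sqrt 2) = of_real (2 * pi\<^sup>2)"
  proof -
    have "pi * sqrt 2 * (pi * sqrt 2) = 2 * pi\<^sup>2" by (simp add: power2_eq_square)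
    then show ?thesis by (simp only: of_real_mult[symmetric])
  qed
  have "(LINT \<omega>|M. spectral_coeff M G Z g r l m \<omega> * cnj (spectral_coeff M G Z g' r l' m' \<omega>)) =
    (LINT \<omega>|M. of_real (2 * pi\<^sup>2) * (stoch_integral M G (Z l m) (?d l g) \<omega> * cnj (stoch_integral M G (Z l' m') (?d l' g') \<omega>)))"
    unfolding spectral_coeff_def complex_cnj_mult complex_cnj_complex_of_real pp[symmetric] by (simp only: mult_ac)
  also have "\<dots> = of_real (2 * pi\<^sup>2) * (LINT \<omega>|M. stoch_integral M G (Z l m) (?d l g) \<omega> * cnj (stoch_integral M G (Z l' m') (?d l' g') \<omega>))"
    by (rule integral_mult_right_zero)
  also have "(LINT \<omega>|M. stoch_integral M G (Z l m) (?d l g) \<omega> * cnj (stoch_integral M G (Z l' m') (?d l' g') \<omega>)) =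
     (if l = l' \<and> m = m' then 1 else 0) * (LINT \<mu>|G. ?d l g \<mu> * cnj (?d l' g' \<mu>))"
    by (intro stoch_integral_inner cov1 cov m density_sq[OF g r] density_sq[OF g' r])
  also have "\<dots> = (if l = l' \<and> m = m' then (LINT \<mu>|G. of_real ((bessel_quot l (\<mu> * r))\<^sup>2) * g \<mu> * g' \<mu>) else 0)"
  proof (cases "l = l' \<and> m = m'")
    case True
    have "(LINT \<mu>|G. ?d l g \<mu> * cnj (?d l' g' \<mu>)) = (LINT \<mu>|G. of_real ((bessel_quot l (\<mu> * r))\<^sup>2) * g \<mu> * g' \<mu>)"
      by (intro Bochner_Integration.integral_cong refl) (use True g g' in \<open>auto simp: space_G power2_eq_square\<close>)
    then show ?thesis using True by simp
  qed auto
  finally show ?thesis by (simp split: if_splits)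
qed

abbreviation b :: "real \<Rightarrow> nat \<Rightarrow> int \<Rightarrow> 'w \<Rightarrow> complex" where
  "b \<equiv> spectral_coeff M G Z (\<lambda>_. 1)"

text \<open>The angular power spectrum of \<eta> on the sphere of radius r. At r = 1 it serves as
  the time-independent bound for the spectrum of the solution.\<close>

definition sph_var :: "real \<Rightarrow> nat \<Rightarrow> real" where
  "sph_var r l = 2 * pi\<^sup>2 * (LINT \<mu>|G. (bessel_quot l (\<mu> * r))\<^sup>2)"

lemma b_props:
  assumes r: "r \<ge> 0" and m: "\<bar>m\<bar> \<le> int l"
  shows "sq_integrable M (b r l m)"
    and "AE \<omega> in M. b r l m \<omega> = of_real (pi * sqrt 2) * I l m (\<lambda>\<mu>. bq l (\<mu> * r)) \<omega>"
    and "\<bar>m'\<bar> \<le> int l' \<Longrightarrow> (LINT \<omega>|M. b r l m \<omega> * cnj (b r l' m' \<omega>)) = (if l = l' \<and> m = m' then of_real (sph_var r l) else 0)"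
proof -
  have k: "(1::complex) = of_real ((\<lambda>_. 1) \<mu>)" "continuous_on {0..} (\<lambda>_::real. 1::real)" "\<bar>(\<lambda>_. 1) \<mu>\<bar> \<le> (1::real)" for \<mu> :: real
    by auto
  show "sq_integrable M (b r l m)" by (rule coeff_sq[OF k r m])
  show "AE \<omega> in M. b r l m \<omega> = of_real (pi * sqrt 2) * I l m (\<lambda>\<mu>. bq l (\<mu> * r)) \<omega>"
    using coeff_I[OF k r m] by simp
  assume "\<bar>m'\<bar> \<le> int l'"
  from coeff_inner[OF k k r m this]
  show "(LINT \<omega>|M. b r l m \<omega> * cnj (b r l' m' \<omega>)) = (if l = l' \<and> m = m' then of_real (sph_var r l) else 0)"
    by (simp add: sph_var_def flip: integral_complex_of_real)
qed

lemma b_ms: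
  assumes r: "r \<ge> 0" and v: "norm v = 1"
  shows "ms_tendsto M (\<lambda>L. Ysum {..L} (b r) v) (\<lambda>\<omega>. of_real (\<eta> (r *\<^sub>R v) \<omega>))"
proof -
  obtain \<theta> \<phi> where "\<theta> \<in> {0..pi}" "\<phi> \<in> {0..<2*pi}" "v = sph_point \<theta> \<phi>" using sph_point_surj[OF v] .
  with \<eta>_series[OF r this(1,2)] show ?thesis by (simp add: laplace_partial_sum_Ysum)
qed

lemma b_norm:
  assumes r: "r \<ge> 0" and v: "norm v = 1"
  shows "(LINT \<omega>|M. (norm (Ysum {..L} (b r) v \<omega>))\<^sup>2) = (\<Sum>l\<le>L. sph_dim l * sph_var r l)"
proof -
  have "complex_of_real (LINT \<omega>|M. (norm (Ysum {..L} (b r) v \<omega>))\<^sup>2) = (\<Sum>l\<le>L. Yker l v v * of_real (sph_var r l))"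
    unfolding integral_norm_sq using b_props(1,3)[OF r] by (intro Ysum_inner) auto
  also have "\<dots> = of_real (\<Sum>l\<le>L. sph_dim l * sph_var r l)"
    by (simp add: Yker_diag v)
  finally show ?thesis by (simp only: of_real_eq_iff)
qed

text \<open>The partial sums are the second moments of the partial Laplace sums at one point, and
  these converge because \<eta> is their mean square limit. This takes the place of estimates of
  Bessel functions in the order.\<close>

lemma sph_var_summable:
  assumes r: "r \<ge> 0"
  shows "summable (\<lambda>l. sph_dim l * sph_var r l)"
proof -
  obtain v :: "real^3" where v: "norm v = 1" using norm_sph_point by blast
  from ms_tendsto_norm_sq[OF b_ms[OF r v]] show ?thesis
    unfolding b_norm[OF r v] summable_iff_convergent' by (rule convergentI)
qed

lemma b_norm_le:
  assumes r: "r \<ge> 0" and v: "norm v = 1"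
  shows "(LINT \<omega>|M. (norm (Ysum {..L} (b r) v \<omega>))\<^sup>2) \<le> (\<Sum>l. sph_dim l * sph_var r l)"
  unfolding b_norm[OF assms]
proof (rule sum_le_suminf[OF sph_var_summable[OF r]])
  show "0 \<le> sph_dim l * sph_var r l" for l
    unfolding sph_var_def by (intro mult_nonneg_nonneg less_imp_le[OF sph_dim_pos] Bochner_Integration.integral_nonneg) auto
qed auto

lemma b_mean_zero:
  assumes r: "r \<ge> 0" and m: "\<bar>m\<bar> \<le> int l"
  shows "(LINT \<omega>|M. b r l m \<omega>) = 0"
proof -
  have "(LINT \<omega>|M. b r l m \<omega> * cnj 1) = 0"
    by (rule laplace_coefficients_orthogonal[OF b_props(1)[OF r] b_ms[OF r] b_norm_le[OF r] sq_integrable_const _ m])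
      (auto simp: \<eta>_mean finite_measure_axioms)
  then show ?thesis by simp
qed

text \<open>The defects d l m of the symmetry are the coefficients of a Laplace series with sum
  \<eta> minus its conjugate, that is 0. Hence each defect is orthogonal to every square integrable
  variable, in particular to itself.\<close>

lemma b_conj:
  assumes r: "r \<ge> 0" and m: "\<bar>m\<bar> \<le> int l"
  shows "AE \<omega> in M. b r l m \<omega> = (-1) powi m * cnj (b r l (- m) \<omega>)"
proof -
  define d where "d l m \<omega> = b r l m \<omega> - (-1) powi m * cnj (b r l (- m) \<omega>)" for l m \<omega>
  have d: "sq_integrable M (d l m)" if "\<bar>m\<bar> \<le> int l" for l m
    unfolding d_def[abs_def] using that by (intro sq_integrable_diff sq_integrable_mult_left sq_integrable_cnj b_props(1) r) auto
  have Y: "Ysum {..L} d v \<omega> = Ysum {..L} (b r) v \<omega> - cnj (Ysum {..L} (b r) v \<omega>)" for L v \<omega>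
    unfolding Ysum_cnj[symmetric] by (simp add: Ysum_def d_def sum_subtractf right_diff_distrib)
  have W: "ms_tendsto M (\<lambda>L. Ysum {..L} d v) (\<lambda>_. 0)" if "norm v = 1" for v
    using ms_tendsto_diff[OF b_ms[OF r that] ms_tendsto_cnj[OF b_ms[OF r that]]] by (simp add: Y[abs_def])
  have B: "(LINT \<omega>|M. (norm (Ysum {..L} d v \<omega>))\<^sup>2) \<le> 4 * (\<Sum>l. sph_dim l * sph_var r l)" if v: "norm v = 1" for v L
  proof -
    have s: "sq_integrable M (Ysum {..L} (b r) v)" by (intro Ysum_sq_integrable b_props(1) r)
    have "(LINT \<omega>|M. (norm (Ysum {..L} d v \<omega>))\<^sup>2) \<le> 2 * (LINT \<omega>|M. (norm (Ysum {..L} (b r) v \<omega>))\<^sup>2) + 2 * (LINT \<omega>|M. (norm (- cnj (Ysum {..L} (b r) v \<omega>)))\<^sup>2)"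
      using L2_norm_add_le[OF s sq_integrable_uminus[OF sq_integrable_cnj[OF s]]] by (simp add: Y)
    then show ?thesis using b_norm_le[OF r v, of L] by simp
  qed
  have "(LINT \<omega>|M. d l m \<omega> * cnj (d l m \<omega>)) = 0"
    by (rule laplace_coefficients_orthogonal[OF d W B d[OF m] _ m]) auto
  then have "complex_of_real (LINT \<omega>|M. (norm (d l m \<omega>))\<^sup>2) = 0" by (simp only: integral_norm_sq)
  then have "(LINT \<omega>|M. (norm (d l m \<omega>))\<^sup>2) = 0" by (simp only: of_real_eq_0_iff)
  from L2_norm_zero_AE[OF d[OF m] this] show ?thesis by eventually_elim (simp add: d_def)
qed

lemma pi_sqrt2_nonzero: "complex_of_real (pi * sqrt 2) \<noteq> 0" by simp

lemma bq_L2G: "r \<ge> 0 \<Longrightarrow> L2G (\<lambda>\<mu>. bq l (\<mu> * r))"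
  using density_L2G[of "\<lambda>_. 1" "\<lambda>_. 1" 1 r l] by simp

lemma integrable_sq: "sq_integrable M (X :: 'w \<Rightarrow> complex) \<Longrightarrow> integrable M X"
  using sq_integrable_inner[OF _ sq_integrable_const[OF finite_measure_axioms, of 1]] by simp

text \<open>The mean and the reality condition are known only for the densities \<open>\<mu> \<mapsto> bq l (\<mu> r)\<close>, but they
  are stable under linear combinations and bounded pointwise limits.\<close>

lemma mean_class:
  assumes m: "\<bar>m\<bar> \<le> int l"
  shows "bounded_limit_class (\<lambda>f. L2G f \<and> (LINT \<omega>|M. I l m f \<omega>) = 0) l"
proof
  fix f g a c assume P: "L2G f \<and> (LINT \<omega>|M. I l m f \<omega>) = 0" "L2G g \<and> (LINT \<omega>|M. I l m g \<omega>) = 0"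
  have L: "L2G (\<lambda>x. a * f x + c * g x)" using P by (intro L2G_lin) auto
  have "(LINT \<omega>|M. I l m (\<lambda>x. a * f x + c * g x) \<omega>) = (LINT \<omega>|M. of_real a * I l m f \<omega> + of_real c * I l m g \<omega>)"
    using I_sq[OF m L] I_sq[OF m, of f] I_sq[OF m, of g] P
    by (intro integral_cong_AE I_lin m borel_measurable_add borel_measurable_times borel_measurable_const sq_integrable_measurable) auto
  also have "\<dots> = 0" using P integrable_sq[OF I_sq[OF m]] by simp
  finally show "L2G (\<lambda>x. a * f x + c * g x) \<and> (LINT \<omega>|M. I l m (\<lambda>x. a * f x + c * g x) \<omega>) = 0" using L by blast
next
  fix f :: "nat \<Rightarrow> real \<Rightarrow> real" and g K
  assume P: "\<And>n. L2G (f n) \<and> (LINT \<omega>|M. I l m (f n) \<omega>) = 0" and "\<And>n x. x \<ge> 0 \<Longrightarrow> \<bar>f n x\<bar> \<le> K" "\<And>x. x \<ge> 0 \<Longrightarrow> (\<lambda>n. f n x) \<longlonglongrightarrow> g x"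
  note lim = I_lim[OF m P[THEN conjunct1] this(2,3)]
  have "(\<lambda>n. LINT \<omega>|M. I l m (f n) \<omega> * cnj 1) \<longlonglongrightarrow> (LINT \<omega>|M. I l m g \<omega> * cnj 1)"
    by (intro ms_tendsto_inner lim ms_tendsto_const sq_integrable_const finite_measure_axioms)
  then show "L2G g \<and> (LINT \<omega>|M. I l m g \<omega>) = 0" using lim(2) P by (simp add: LIMSEQ_const_iff)
next
  fix r :: real assume r: "r \<ge> 0"
  have "(LINT \<omega>|M. b r l m \<omega>) = (LINT \<omega>|M. of_real (pi * sqrt 2) * I l m (\<lambda>\<mu>. bq l (\<mu> * r)) \<omega>)"
    using b_props(1)[OF r m] I_sq[OF m bq_L2G[OF r]]
    by (intro integral_cong_AE b_props(2) r m borel_measurable_times borel_measurable_const sq_integrable_measurable)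
  then have "of_real (pi * sqrt 2) * (LINT \<omega>|M. I l m (\<lambda>\<mu>. bq l (\<mu> * r)) \<omega>) = 0"
    unfolding integral_mult_right_zero b_mean_zero[OF r m] by (rule sym)
  then show "L2G (\<lambda>x. bq l (x * r)) \<and> (LINT \<omega>|M. I l m (\<lambda>x. bq l (x * r)) \<omega>) = 0"
    using bq_L2G[OF r] pi_sqrt2_nonzero by (simp only: mult_eq_0_iff) simp
qed

text \<open>The class consists of real densities, for which conjugating the integral leaves the
  density alone and changes only the random measure.\<close>

lemma conj_class:
  assumes m: "\<bar>m\<bar> \<le> int l"
  shows "bounded_limit_class (\<lambda>f. L2G f \<and> (AE \<omega> in M. I l m f \<omega> = (-1) powi m * cnj (I l (- m) f \<omega>))) l"
proof
  have m': "\<bar>- m\<bar> \<le> int l" using m by simp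
  {
    fix f g a c
    assume P: "L2G f \<and> (AE \<omega> in M. I l m f \<omega> = (-1) powi m * cnj (I l (- m) f \<omega>))"
      "L2G g \<and> (AE \<omega> in M. I l m g \<omega> = (-1) powi m * cnj (I l (- m) g \<omega>))"
    have L: "L2G f" "L2G g" using P by auto
    have "AE \<omega> in M. I l m (\<lambda>x. a * f x + c * g x) \<omega> = (-1) powi m * cnj (I l (- m) (\<lambda>x. a * f x + c * g x) \<omega>)"
      using P[THEN conjunct2] I_lin[OF m L, of a c] I_lin[OF m' L, of a c]
      by eventually_elim (simp add: algebra_simps)
    then show "L2G (\<lambda>x. a * f x + c * g x) \<and> (AE \<omega> in M. I l m (\<lambda>x. a * f x + c * g x) \<omega> = (-1) powi m * cnj (I l (- m) (\<lambda>x. a * f x + c * g x) \<omega>))"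
      using L2G_lin[OF L] by blast
  next
    fix f :: "nat \<Rightarrow> real \<Rightarrow> real" and g K
    assume P: "\<And>n. L2G (f n) \<and> (AE \<omega> in M. I l m (f n) \<omega> = (-1) powi m * cnj (I l (- m) (f n) \<omega>))"
      and "\<And>n x. x \<ge> 0 \<Longrightarrow> \<bar>f n x\<bar> \<le> K" "\<And>x. x \<ge> 0 \<Longrightarrow> (\<lambda>n. f n x) \<longlonglongrightarrow> g x"
    note lim = I_lim[OF m P[THEN conjunct1] this(2,3)] and lim' = I_lim[OF m' P[THEN conjunct1] this(2,3)]
    \<comment> \<open>For each n the two sides agree almost surely, so one sequence has both
      candidates as mean square limits.\<close>
    have "ms_tendsto M (\<lambda>n \<omega>. (-1) powi m * cnj (I l (- m) (f n) \<omega>)) (I l m g)"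
      by (rule ms_tendsto_cong_AE[OF lim(1)])
        (use P in \<open>auto intro!: sq_integrable_mult_left sq_integrable_cnj I_sq m'\<close>)
    from ms_tendsto_unique_AE[OF this ms_tendsto_mult_left[OF ms_tendsto_cnj[OF lim'(1)]]] lim(2)
    show "L2G g \<and> (AE \<omega> in M. I l m g \<omega> = (-1) powi m * cnj (I l (- m) g \<omega>))" by blast
  next
    fix r :: real assume r: "r \<ge> 0"
    have "AE \<omega> in M. I l m (\<lambda>x. bq l (x * r)) \<omega> = (-1) powi m * cnj (I l (- m) (\<lambda>x. bq l (x * r)) \<omega>)"
      using b_conj[OF r m] b_props(2)[OF r m] b_props(2)[OF r m']
    proof eventually_elim
      case (elim \<omega>)
      then have "of_real (pi * sqrt 2) * I l m (\<lambda>x. bq l (x * r)) \<omega> = of_real (pi * sqrt 2) * ((-1) powi m * cnj (I l (- m) (\<lambda>x. bq l (x * r)) \<omega>))"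
        by (simp only: complex_cnj_mult complex_cnj_complex_of_real mult_ac)
      then show ?case using pi_sqrt2_nonzero by (simp only: mult_cancel_left) simp
    qed
    then show "L2G (\<lambda>x. bq l (x * r)) \<and> (AE \<omega> in M. I l m (\<lambda>x. bq l (x * r)) \<omega> = (-1) powi m * cnj (I l (- m) (\<lambda>x. bq l (x * r)) \<omega>))"
      using bq_L2G[OF r] by blast
  }
qed

section \<open>The coefficients of the solution field\<close>

context
  fixes H :: "real \<Rightarrow> real \<Rightarrow> complex" and h :: "real \<Rightarrow> real \<Rightarrow> real"
  assumes H: "\<And>\<mu> t. \<mu> \<ge> 0 \<Longrightarrow> t \<ge> 0 \<Longrightarrow> H \<mu> t = of_real (h \<mu> t)"
    and h_bound: "\<And>\<mu> t. \<mu> \<ge> 0 \<Longrightarrow> t \<ge> 0 \<Longrightarrow> \<bar>h \<mu> t\<bar> \<le> 1"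
    and h_time: "\<And>\<mu>. \<mu> \<ge> 0 \<Longrightarrow> continuous_on {0..} (h \<mu>)"
    and h_freq: "\<And>t. t \<ge> 0 \<Longrightarrow> continuous_on {0..} (\<lambda>\<mu>. h \<mu> t)"
begin

abbreviation a :: "nat \<Rightarrow> int \<Rightarrow> real \<Rightarrow> 'w \<Rightarrow> complex" where
  "a l m t \<equiv> spectral_coeff M G Z (\<lambda>\<mu>. H \<mu> t) 1 l m"

abbreviation C :: "nat \<Rightarrow> real \<Rightarrow> real \<Rightarrow> complex" where
  "C l t t' \<equiv> of_real (2 * pi\<^sup>2) * (LINT \<mu>|G. of_real ((bessel_quot l \<mu>)\<^sup>2) * H \<mu> t * H \<mu> t')"

lemma spectral_density_eq:
  assumes "t \<ge> 0" "t' \<ge> 0" "\<mu> \<in> space G"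
  shows "of_real ((bessel_quot l \<mu>)\<^sup>2) * H \<mu> t * H \<mu> t' = of_real ((bq l \<mu>)\<^sup>2 * h \<mu> t * h \<mu> t')"
  using assms by (simp add: space_G H bessel_quot_eq)

lemma spectral_density_measurable:
  assumes "t \<ge> 0" "t' \<ge> 0"
  shows "(\<lambda>\<mu>. of_real ((bessel_quot l \<mu>)\<^sup>2) * H \<mu> t * H \<mu> t') \<in> borel_measurable G"
proof -
  have "(\<lambda>\<mu>. (bq l \<mu>)\<^sup>2 * h \<mu> t * h \<mu> t') \<in> borel_measurable G"
    by (intro measurable_G continuous_intros h_freq assms continuous_on_bq)
  then have "(\<lambda>\<mu>. complex_of_real ((bq l \<mu>)\<^sup>2 * h \<mu> t * h \<mu> t')) \<in> borel_measurable G" by measurable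
  then show ?thesis
    by (rule measurable_cong[THEN iffD1, rotated]) (simp only: spectral_density_eq assms)
qed

lemma spectral_density_le:
  assumes "t \<ge> 0" "t' \<ge> 0" "\<mu> \<in> space G"
  shows "norm (of_real ((bessel_quot l \<mu>)\<^sup>2) * H \<mu> t * H \<mu> t') \<le> (bessel_quot l (\<mu> * 1))\<^sup>2"
proof -
  have "(bq l \<mu>)\<^sup>2 * \<bar>h \<mu> t\<bar> * \<bar>h \<mu> t'\<bar> \<le> (bq l \<mu>)\<^sup>2 * 1 * 1"
    using assms by (intro mult_mono h_bound) (auto simp: space_G)
  then show ?thesis unfolding spectral_density_eq[OF assms] norm_of_real
    using assms by (simp add: space_G bessel_quot_eq abs_mult)
qed

lemma bessel_integrable: "integrable G (\<lambda>\<mu>. (bessel_quot l (\<mu> * 1))\<^sup>2)"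
proof -
  have "sq_integrable G (\<lambda>\<mu>. of_real (bessel_quot l (\<mu> * 1)) * (\<lambda>_. 1 :: complex) \<mu>)"
    by (rule density_sq[of _ "\<lambda>_. 1" 1]) auto
  then show ?thesis by (simp add: sq_integrable_def)
qed

lemma spectral_density_integrable:
  assumes "t \<ge> 0" "t' \<ge> 0"
  shows "integrable G (\<lambda>\<mu>. of_real ((bessel_quot l \<mu>)\<^sup>2) * H \<mu> t * H \<mu> t')"
  by (rule Bochner_Integration.integrable_bound[OF bessel_integrable[of l] spectral_density_measurable[OF assms]])
    (use spectral_density_le[OF assms] in auto)

text \<open>At fixed t the function h is bounded and continuous in the frequency, so its product
  with \<open>bq l\<close> lies in every class closed under bounded limits that contains the Bessel
  densities.\<close>

lemma coeff_product:
  "t \<ge> 0 \<Longrightarrow> \<bar>m\<bar> \<le> int l \<Longrightarrow> L2G (\<lambda>\<mu>. bq l \<mu> * h \<mu> t) \<and> (LINT \<omega>|M. I l m (\<lambda>\<mu>. bq l \<mu> * h \<mu> t) \<omega>) = 0"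
  "t \<ge> 0 \<Longrightarrow> \<bar>m\<bar> \<le> int l \<Longrightarrow> AE \<omega> in M. I l m (\<lambda>\<mu>. bq l \<mu> * h \<mu> t) \<omega> = (-1) powi m * cnj (I l (- m) (\<lambda>\<mu>. bq l \<mu> * h \<mu> t) \<omega>)"
  using bounded_limit_class.product[OF mean_class h_freq h_bound]
    bounded_limit_class.product[OF conj_class h_freq h_bound] by blast+

lemma a_props:
  assumes t: "t \<ge> 0" and m: "\<bar>m\<bar> \<le> int l"
  shows "sq_integrable M (a l m t)"
    and "AE \<omega> in M. a l m t \<omega> = of_real (pi * sqrt 2) * I l m (\<lambda>\<mu>. bq l \<mu> * h \<mu> t) \<omega>"
  using coeff_sq[of "\<lambda>\<mu>. H \<mu> t" "\<lambda>\<mu>. h \<mu> t" 1 1, OF H h_freq h_bound _ m] coeff_I[of "\<lambda>\<mu>. H \<mu> t" "\<lambda>\<mu>. h \<mu> t" 1 1, OF H h_freq h_bound _ m] t by auto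

lemma a_inner:
  assumes "t \<ge> 0" "t' \<ge> 0" "\<bar>m\<bar> \<le> int l" "\<bar>m'\<bar> \<le> int l'"
  shows "(LINT \<omega>|M. a l m t \<omega> * cnj (a l' m' t' \<omega>)) = (if l = l' \<and> m = m' then C l t t' else 0)"
  using coeff_inner[of "\<lambda>\<mu>. H \<mu> t" "\<lambda>\<mu>. h \<mu> t" 1 "\<lambda>\<mu>. H \<mu> t'" "\<lambda>\<mu>. h \<mu> t'" 1 1, OF H h_freq h_bound H h_freq h_bound _ assms(3,4)] assms(1,2) by simp

text \<open>The bound |H| \<le> 1 gives domination of the spectrum by that of \<eta> on the unit
  sphere at all times; together with continuity of H in time, dominated convergence over the
  frequencies makes C continuous in both times jointly.\<close>

lemma laplace_series: "laplace_series M a C (sph_var 1)"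
proof
  fix l m t assume m: "\<bar>m\<bar> \<le> int l" and t: "(t::real) \<ge> 0"
  show "sq_integrable M (a l m t)" by (rule a_props[OF t m])
  have "(LINT \<omega>|M. a l m t \<omega>) = (LINT \<omega>|M. of_real (pi * sqrt 2) * I l m (\<lambda>\<mu>. bq l \<mu> * h \<mu> t) \<omega>)"
    using a_props(1)[OF t m] I_sq[OF m coeff_product(1)[OF t m, THEN conjunct1]]
    by (intro integral_cong_AE a_props(2) t m borel_measurable_times borel_measurable_const sq_integrable_measurable)
  then show "(LINT \<omega>|M. a l m t \<omega>) = 0" using coeff_product(1)[OF t m] by simp
  have m': "\<bar>- m\<bar> \<le> int l" using m by simp
  show "AE \<omega> in M. a l m t \<omega> = (-1) powi m * cnj (a l (- m) t \<omega>)"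
    using coeff_product(2)[OF t m] a_props(2)[OF t m] a_props(2)[OF t m']
    by eventually_elim (simp only: complex_cnj_mult complex_cnj_complex_of_real mult_ac)
next
  fix l m l' m' and t t' :: real assume "\<bar>m\<bar> \<le> int l" "\<bar>m'\<bar> \<le> int l'" "t \<ge> 0" "t' \<ge> 0"
  then show "(LINT \<omega>|M. a l m t \<omega> * cnj (a l' m' t' \<omega>)) = (if l = l' \<and> m = m' then C l t t' else 0)" by (intro a_inner)
next
  fix l and t t' :: real assume t: "t \<ge> 0" "t' \<ge> 0"
  have "norm (LINT \<mu>|G. of_real ((bessel_quot l \<mu>)\<^sup>2) * H \<mu> t * H \<mu> t') \<le> (LINT \<mu>|G. norm (of_real ((bessel_quot l \<mu>)\<^sup>2) * H \<mu> t * H \<mu> t'))"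
    by (rule integral_norm_bound)
  also have "\<dots> \<le> (LINT \<mu>|G. (bessel_quot l (\<mu> * 1))\<^sup>2)"
    by (intro integral_mono integrable_norm spectral_density_integrable t bessel_integrable spectral_density_le)
  finally show "norm (C l t t') \<le> sph_var 1 l"
    unfolding sph_var_def norm_mult norm_of_real by (intro mult_mono) auto
next
  show "summable (\<lambda>l. sph_dim l * sph_var 1 l)" by (rule sph_var_summable) simp
next
  fix l and s s' :: "nat \<Rightarrow> real" and t t' :: real
  assume s: "\<And>n. s n \<ge> 0" "\<And>n. s' n \<ge> 0" and t: "t \<ge> 0" "t' \<ge> 0" and lim: "s \<longlonglongrightarrow> t" "s' \<longlonglongrightarrow> t'"
  have "(\<lambda>n. LINT \<mu>|G. of_real ((bessel_quot l \<mu>)\<^sup>2) * H \<mu> (s n) * H \<mu> (s' n)) \<longlonglongrightarrow> (LINT \<mu>|G. of_real ((bessel_quot l \<mu>)\<^sup>2) * H \<mu> t * H \<mu> t')"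
  proof (rule integral_dominated_convergence[where w="\<lambda>\<mu>. (bessel_quot l (\<mu> * 1))\<^sup>2"])
    show "AE \<mu> in G. (\<lambda>n. of_real ((bessel_quot l \<mu>)\<^sup>2) * H \<mu> (s n) * H \<mu> (s' n)) \<longlonglongrightarrow> of_real ((bessel_quot l \<mu>)\<^sup>2) * H \<mu> t * H \<mu> t'"
    proof (rule AE_I2)
      fix \<mu> assume \<mu>: "\<mu> \<in> space G"
      then have \<mu>0: "\<mu> \<ge> 0" by (simp add: space_G)
      have "(\<lambda>n. h \<mu> (s n)) \<longlonglongrightarrow> h \<mu> t" "(\<lambda>n. h \<mu> (s' n)) \<longlonglongrightarrow> h \<mu> t'"
        using s t lim by (auto intro!: continuous_on_tendsto_compose[OF h_time[OF \<mu>0]])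
      then show "(\<lambda>n. of_real ((bessel_quot l \<mu>)\<^sup>2) * H \<mu> (s n) * H \<mu> (s' n)) \<longlonglongrightarrow> of_real ((bessel_quot l \<mu>)\<^sup>2) * H \<mu> t * H \<mu> t'"
        unfolding spectral_density_eq[OF s \<mu>] spectral_density_eq[OF t \<mu>] by (intro tendsto_intros)
    qed
  qed (rule spectral_density_measurable s t bessel_integrable AE_I2 spectral_density_le | assumption)+
  then show "(\<lambda>n. C l (s n) (s' n)) \<longlonglongrightarrow> C l t t'" by (intro tendsto_mult tendsto_const)
qed

end

end

text \<open>Versions of the Laplace series are not unique, so isotropy and spectrum are asserted for
  every version, and existence of a version is asserted alongside so that this is not vacuous. The
  outer series for H are stated with \<open>sums\<close>, which includes their convergence; likewise
  integrability accompanies the formula for C.\<close>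

theorem theorem4:
  fixes \<alpha> \<beta> c D :: real
    and M :: "'w measure"
    and \<eta> :: "real^3 \<Rightarrow> 'w \<Rightarrow> real" and B :: "real \<Rightarrow> real"
    and F :: "(real^3) measure" and G :: "real measure"
    and Z :: "nat \<Rightarrow> int \<Rightarrow> real set \<Rightarrow> 'w \<Rightarrow> complex"
    and Q :: "real \<Rightarrow> (real^3 \<Rightarrow> complex) \<Rightarrow> complex"
    and H :: "real \<Rightarrow> real \<Rightarrow> complex"
  assumes "0 < \<alpha>" "\<alpha> \<le> 1" "1 < \<alpha> + \<beta>" "\<alpha> + \<beta> \<le> 2" "c > 0" "D > 0"
    and "prob_space M" "complete_measure M"
    and "fundamental_solution \<alpha> \<beta> c D Q"
    and "\<forall>\<kappa>. \<forall>t\<ge>0. H (norm \<kappa>) t = fourier_distribution (Q t) \<kappa>"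
    and "homogeneous_isotropic_field M \<eta> B"
    and "finite_measure F" "sets F = sets borel"
    and "finite_measure G" "sets G = sets (restrict_space borel {0..})"
    and "\<forall>\<mu>>0. measure G {0..<\<mu>} = measure F {k. norm k < \<mu>}"
    and "\<forall>x y. B (norm (x - y)) = (LINT k|F. cos (k \<bullet> (x - y)))"
    and "\<forall>x y :: real^3. B (norm (x - y)) = (LINT \<mu>|G. sinc (\<mu> * norm (x - y)))"
    and "orthogonal_random_measures M G Z"
    and "\<forall>r\<ge>0. \<forall>\<theta>\<in>{0..pi}. \<forall>\<phi>\<in>{0..<2 * pi}.
           ms_tendsto M (laplace_partial_sum (spectral_coeff M G Z (\<lambda>_. 1) r) \<theta> \<phi>)
             (\<lambda>\<omega>. of_real (\<eta> (r *\<^sub>R sph_point \<theta> \<phi>) \<omega>))"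
    and "\<forall>t\<ge>0. integrable G (\<lambda>\<mu>. \<mu>\<^sup>2 * (norm (H \<mu> t))\<^sup>2)"
  shows "let a = (\<lambda>l m t. spectral_coeff M G Z (\<lambda>\<mu>. H \<mu> t) 1 l m);
             C = (\<lambda>l t t'. of_real (2 * pi\<^sup>2) *
                    (LINT \<mu>|G. of_real ((bessel_quot l \<mu>)\<^sup>2) * H \<mu> t * H \<mu> t'))
         in (\<exists>T. laplace_series_field M a T) \<and>
            (\<forall>T. laplace_series_field M a T \<longrightarrow>
                 isotropic_sphere_field M T \<and> angular_power_spectrum M T C) \<and>
            (\<forall>l m t t'. \<bar>m\<bar> \<le> int l \<longrightarrow> t \<ge> 0 \<longrightarrow> t' \<ge> 0 \<longrightarrow>
               integrable M (\<lambda>\<omega>. a l m t \<omega> * cnj (a l m t' \<omega>)) \<and>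
               integrable G (\<lambda>\<mu>. of_real ((bessel_quot l \<mu>)\<^sup>2) * H \<mu> t * H \<mu> t') \<and>
               (LINT \<omega>|M. a l m t \<omega> * cnj (a l m t' \<omega>)) = C l t t') \<and>
            (\<forall>\<mu>\<ge>0. \<forall>t\<ge>0. \<exists>S1 S2 :: real.
               (\<lambda>n. (- (\<mu>\<^sup>2 * c\<^sup>2 * t powr (\<alpha> + \<beta>))) ^ (n + 1) *
                     mittag_leffler3 (real (n + 1)) \<beta> ((\<alpha> + \<beta>) * real (n + 1) + 1)
                       (- (c\<^sup>2 / D * t powr \<beta>))) sums S1 \<and>
               (\<lambda>m. \<Sum>n\<le>m. real (m choose n) * (- (c\<^sup>2 / D * t powr \<beta>)) ^ m *
                     (\<mu>\<^sup>2 * D * t powr \<alpha>) ^ n /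
                     Gamma (\<beta> * real m + \<alpha> * real n + \<alpha> + \<beta> + 1)) sums S2 \<and>
               H \<mu> t = of_real (1 + S1) \<and>
               H \<mu> t = of_real (1 - \<mu>\<^sup>2 * c\<^sup>2 * t powr (\<alpha> + \<beta>) * S2))"
proof -
  interpret prob_space M by fact
  have H': "H (norm \<kappa>) t = fourier_distribution (Q t) \<kappa>" if "t \<ge> 0" for \<kappa> t
    using assms(10) that by blast
  interpret F: fundamental \<alpha> \<beta> c D Q H
    by (rule fundamental.intro) (fact | rule H')+
  have mean: "(LINT \<omega>|M. \<eta> x \<omega>) = 0" for x
    using assms(11) unfolding homogeneous_isotropic_field_def by blast
  have series: "ms_tendsto M (laplace_partial_sum (spectral_coeff M G Z (\<lambda>_. 1) r) \<theta> \<phi>)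
             (\<lambda>\<omega>. of_real (\<eta> (r *\<^sub>R sph_point \<theta> \<phi>) \<omega>))"
    if "r \<ge> 0" "\<theta> \<in> {0..pi}" "\<phi> \<in> {0..<2 * pi}" for r \<theta> \<phi>
    using assms(20) that by blast
  interpret spectral_field M \<eta> G Z
    by (rule spectral_field.intro[OF prob_space_axioms], rule spectral_field_axioms.intro)
      (fact | rule mean series)+
  note H = F.H_real F.h_bound F.h_continuous_time F.h_continuous
  let ?a = "\<lambda>l m t. spectral_coeff M G Z (\<lambda>\<mu>. H \<mu> t) 1 l m"
  let ?C = "\<lambda>l t t'. of_real (2 * pi\<^sup>2) * (LINT \<mu>|G. of_real ((bessel_quot l \<mu>)\<^sup>2) * H \<mu> t * H \<mu> t')"
  interpret L: laplace_series M ?a ?C "sph_var 1" by (rule laplace_series[OF H])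
  show ?thesis
    unfolding Let_def
  proof (intro conjI allI impI)
    show "\<exists>T. laplace_series_field M ?a T" by (rule L.ex_field)
    show "isotropic_sphere_field M T" "angular_power_spectrum M T ?C" if "laplace_series_field M ?a T" for T
      using L.isotropic[OF that] L.angular[OF that] by blast+
  next
    fix l m and t t' :: real assume *: "\<bar>m\<bar> \<le> int l" "t \<ge> 0" "t' \<ge> 0"
    show "integrable M (\<lambda>\<omega>. ?a l m t \<omega> * cnj (?a l m t' \<omega>))"
      using * by (intro sq_integrable_inner L.sq)
    show "integrable G (\<lambda>\<mu>. of_real ((bessel_quot l \<mu>)\<^sup>2) * H \<mu> t * H \<mu> t')"
      using * by (intro spectral_density_integrable[OF H])
    show "(LINT \<omega>|M. ?a l m t \<omega> * cnj (?a l m t' \<omega>)) = ?C l t t'"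
      using L.orth[of m l m l t t'] * by simp
  qed (rule F.H_series)
qed

end
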